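(* Let $(\Omega,\sigma)$ be minimal, let $a_2:\Omega\to\mathbb{R}$ be continuous, and let $[-\xi_+,-\xi_-]$ be the Sacker and Sell spectrum of $a_2$, with $\xi_-\le\xi_+$. Let $\hat\tau_\lambda$ be the local skewproduct flow on $\Omega\times\mathbb{R}$ given by $$x'=-x^3+a_2(\omega\cdot t)x^2+\lambda x,\qquad\omega\in\Omega,$$ let $\hat{\mathcal{A}}_\lambda=\bigcup_{\omega\in\Omega}(\{\omega\}\times[\hat\alpha_\lambda(\omega),\hat\beta_\lambda(\omega)])$ be its global attractor, and let $\hat{\mathcal{M}}_0=\Omega\times\{0\}$. (i) If $0\in[\xi_-,\xi_+]$, then the family exhibits a global pitchfork bifurcation diagram of minimal sets: for $\lambda>0$, $\hat\tau_\lambda$ admits three different hyperbolic minimal sets $\hat{\mathcal{M}}^l_\lambda<\hat{\mathcal{M}}_0<\hat{\mathcal{M}}^u_\lambda$, where $\hat{\mathcal{M}}^l_\lambda$ and $\hat{\mathcal{M}}^u_\lambda$ are the graphs of $\hat\alpha_\lambda$ and $\hat\beta_\lambda$; both $\hat\alpha_\lambda$ and $\hat\beta_\lambda$ collide with $0$ on a residual $\sigma$-invariant set as $\lambda\downarrow0$; $\hat{\mathcal{M}}_0$ is the unique $\hat\tau_\lambda$-minimal set if $\lambda\le0$; and $\hat{\mathcal{A}}_\lambda=\hat{\mathcal{M}}_0$ if $\lambda<0$. (ii) If $0\notin[\xi_-,\xi_+]$, then the family exhibits a transcritical and saddle-node bifurcation diagram of minimal sets: there exists $\mu<0$ such that one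 of the following two (mirror) situations holds. (A) For $\lambda>0$ there are exactly three minimal sets $\hat{\mathcal{M}}^l_\lambda<\hat{\mathcal{M}}_0<\hat{\mathcal{M}}^u_\lambda$, with $\hat{\mathcal{M}}^u_\lambda$ the graph of $\hat\beta_\lambda$, and $\hat\beta_\lambda$ collides with $0$ on a residual $\sigma$-invariant set as $\lambda\downarrow0$; for all $\lambda>\mu$ the graph of $\hat\alpha_\lambda$ is a hyperbolic minimal set $\hat{\mathcal{M}}^l_\lambda<\hat{\mathcal{M}}_0$; $\hat\tau_0$ admits exactly two minimal sets $\hat{\mathcal{M}}^l_0<\hat{\mathcal{M}}_0$ (here $\hat{\mathcal{M}}_0=\Omega\times\{0\}$ and $\hat{\mathcal{M}}^l_0$ is the graph of $\hat\alpha_0$); for $\lambda\in(\mu,0)$ there are three hyperbolic minimal sets $\hat{\mathcal{M}}^l_\lambda<\hat{\mathcal{N}}_\lambda<\hat{\mathcal{M}}_0$, with $\hat{\mathcal{N}}_\lambda$ repulsive and given by the graph of a continuous map $\hat\kappa_\lambda:\Omega\to\mathbb{R}$ which increases strictly as $\lambda$ increases in $(\mu,0)$ and collides with $\hat\alpha_\lambda$ (resp. with $0$) on a residual set as $\lambda\downarrow\mu$ (resp. $\lambda\uparrow0$); $\hat\tau_\mu$ admits exactly two minimal sets $\hat{\mathcal{M}}^l_\mu<\hat{\mathcal{M}}_0$, with $\hat{\mathcal{M}}^l_\mu$ nonhyperbolic; and $\hat{\mathcal{A}}_\lambda=\hat{\mathcal{M}}_0$ for $\lambda<\mu$. In particular,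 $\mu$ and $0$ are the unique bifurcation points: a local saddle-node bifurcation of minimal sets occurs around $\hat{\mathcal{M}}^l_\mu$ at $\mu$, as well as a discontinuous bifurcation of attractors, and a (classic) local transcritical bifurcation of minimal sets occurs around $\hat{\mathcal{M}}_0$ at $0$. (B) The situation symmetric to (A) with respect to the horizontal axis, i.e., the statement (A) for the flow transformed by $(\omega,x)\mapsto(\omega,-x)$, in which the roles of the pairs $(\hat\alpha_\lambda,\hat{\mathcal{M}}^l_\lambda)$ and $(\hat\beta_\lambda,\hat{\mathcal{M}}^u_\lambda)$ are interchanged, all order relations are reversed, and $\hat\kappa_\lambda>0$ decreases strictly as $\lambda$ increases in $(\mu,0)$.
   Context: $\Omega$ is a compact metric space with a continuous flow $\sigma:\mathbb{R}\times\Omega\to\Omega$, $\sigma(t,\omega)=\omega\cdot t$; minimal means every $\sigma$-orbit is dense. $t\mapsto\hat u_\lambda(t,\omega,x_0)$ is the maximal solution of the displayed equation with $\hat u_\lambda(0,\omega,x_0)=x_0$; $\hat\tau_\lambda(t,\omega,x_0)=(\omega\cdot t,\hat u_\lambda(t,\omega,x_0))$. The global attractor (a compact invariant set attracting every bounded set in the Hausdorff semidistance) exists and has the displayed form, with $\hat\alpha_\lambda,\hat\beta_\lambda$ lower and upper semicontinuous equilibria; an equilibrium is a map $\beta:\Omega\to\mathbb{R}$ with $\beta(\omega\cdot t)=\hat u_\lambda(t,\omega,\beta(\omega))$ for all $\omega,t$, and a copy of the base is the graph of a continuous equilibrium. A minimal set is a nonempty compact invariant set containing properly no other such set. $\mathcal{M}_1<\mathcal{M}_2$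 means $x<y$ whenever $(\omega,x)\in\mathcal{M}_1,(\omega,y)\in\mathcal{M}_2$. A minimal set is hyperbolic attractive (resp. repulsive) if there are $\delta>0,k\ge1,\gamma>0$ such that if $(\omega,x)$ is in the set and $|y-x|<\delta$ then $|\hat u_\lambda(t,\omega,y)-\hat u_\lambda(t,\omega,x)|\le ke^{-\gamma|t|}|y-x|$ for all $t\ge0$ (resp. $t\le0$); hyperbolic if it is one of the two, nonhyperbolic otherwise. The Sacker and Sell spectrum of a continuous $a:\Omega\to\mathbb{R}$ is the set of $\lambda\in\mathbb{R}$ such that $x'=(a(\omega\cdot t)-\lambda)x$ does not have exponential dichotomy over $\Omega$; here $x'=c(\omega\cdot t)x$ has exponential dichotomy over $\Omega$ if there are $k\ge1,\delta>0$ such that either $\exp\int_0^tc(\omega\cdot s)ds\le ke^{-\delta t}$ for all $\omega\in\Omega,t\ge0$ or $\exp\int_0^tc(\omega\cdot s)ds\le ke^{\delta t}$ for all $\omega\in\Omega,t\le0$. Two families of equilibria (one of which may be $0$) collide on a residual set as $\lambda\to\lambda_1$ if their pointwise limits exist, are semicontinuous $\hat\tau_{\lambda_1}$-equilibria, and coincide on a residual ($\sigma$-invariant) set of common continuity points; the closure of the orbit of a point of the common graph over this set is the minimal set arising from the collision. At $\mu$, $\hat{\mathcal{M}}^l_\mu$ is the minimal set arising in this way from the limits of $\hat\alpha_\lambda$ and $\hat\kappa_\lambda$. A bifurcation point is a value of $\lambda$ around which the number or the hyperbolicity type of the minimal sets is not locally constant. A local saddle-node bifurcation of minimal sets at $\lambda_1$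 around $\mathcal{M}$: two hyperbolic copies of the base, one attractive and one repulsive, existing for $\lambda$ close to $\lambda_1$ on one side, collide as $\lambda\to\lambda_1$ giving rise to the nonhyperbolic minimal set $\mathcal{M}$, and there is an open set containing the region between the graphs of the limit equilibria (these included) in which there are no minimal sets for $\lambda$ close to $\lambda_1$ on the other side. A discontinuous bifurcation of attractors at $\lambda_1$: $\lambda\mapsto\hat{\mathcal{A}}_\lambda$ is not continuous at $\lambda_1$ in the Hausdorff distance. A local transcritical bifurcation around $\hat{\mathcal{M}}_0$ at $0$: $\hat{\mathcal{M}}_0$ collides with another hyperbolic minimal set as $\lambda\uparrow0$ and with another hyperbolic minimal set as $\lambda\downarrow0$, $\hat{\mathcal{M}}_0$ being locally the unique minimal set, and nonhyperbolic, at $\lambda=0$. *)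

theory Defs
  imports "HOL-Analysis.Analysis"
begin

section \<open>The flow on the base and scalar linear equations over it\<close>

definition continuous_flow :: "(real \<Rightarrow> 'w::metric_space \<Rightarrow> 'w) \<Rightarrow> bool" where
  "continuous_flow \<sigma> \<longleftrightarrow>
     continuous_on UNIV (\<lambda>(t, \<omega>). \<sigma> t \<omega>) \<and>
     (\<forall>\<omega>. \<sigma> 0 \<omega> = \<omega>) \<and>
     (\<forall>s t \<omega>. \<sigma> (s + t) \<omega> = \<sigma> s (\<sigma> t \<omega>))"

definition minimal_flow :: "(real \<Rightarrow> 'w::metric_space \<Rightarrow> 'w) \<Rightarrow> bool" where
  "minimal_flow \<sigma> \<longleftrightarrow> (\<forall>\<omega>. closure (range (\<lambda>t. \<sigma> t \<omega>)) = UNIV)"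

text \<open>The interval integral is oriented: for \<open>t < 0\<close> it is minus the integral from \<open>t\<close> to \<open>0\<close>.\<close>

definition exponential_dichotomy ::
    "(real \<Rightarrow> 'w \<Rightarrow> 'w) \<Rightarrow> ('w \<Rightarrow> real) \<Rightarrow> bool" where
  "exponential_dichotomy \<sigma> c \<longleftrightarrow>
     (\<exists>k\<ge>1. \<exists>\<delta>>0.
        (\<forall>\<omega>. \<forall>t\<ge>0. exp (LBINT s=0..t. c (\<sigma> s \<omega>)) \<le> k * exp (- \<delta> * t)) \<or>
        (\<forall>\<omega>. \<forall>t\<le>0. exp (LBINT s=0..t. c (\<sigma> s \<omega>)) \<le> k * exp (\<delta> * t)))"

definition sacker_sell_spectrum ::
    "(real \<Rightarrow> 'w \<Rightarrow> 'w) \<Rightarrow> ('w \<Rightarrow> real) \<Rightarrow> real set" where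
  "sacker_sell_spectrum \<sigma> a = {l. \<not> exponential_dichotomy \<sigma> (\<lambda>\<omega>. a \<omega> - l)}"

section \<open>The local skewproduct flow\<close>

text \<open>
  Throughout, \<open>f \<omega> x\<close> is the right-hand side of the family of scalar equations
  \<open>x' = f (\<omega>\<cdot>t) x\<close>, with \<open>\<omega>\<cdot>t = \<sigma> t \<omega>\<close>, and \<open>h l\<close> is such a right-hand side for each value
  \<open>l\<close> of the bifurcation parameter.
\<close>

definition solves ::
    "(real \<Rightarrow> 'w \<Rightarrow> 'w) \<Rightarrow> ('w \<Rightarrow> real \<Rightarrow> real) \<Rightarrow> 'w \<Rightarrow> real \<Rightarrow> real set \<Rightarrow> (real \<Rightarrow> real) \<Rightarrow> bool"
  where
  "solves \<sigma> f \<omega> x0 I u \<longleftrightarrow>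
     open I \<and> is_interval I \<and> 0 \<in> I \<and> u 0 = x0 \<and>
     (\<forall>t\<in>I. (u has_real_derivative f (\<sigma> t \<omega>) (u t)) (at t))"

text \<open>
  \<open>sol_dom\<close> is the interval of definition of the maximal solution and \<open>sol\<close> is its value. The
  description operator is meaningful whenever solutions are unique (e.g. \<open>f\<close> continuous and
  continuously differentiable in \<open>x\<close>) and \<open>t \<in> sol_dom \<sigma> f \<omega> x0\<close>; every definition below that
  evaluates \<open>sol\<close> also requires the latter, except for orbits and time-\<open>t\<close> images of sets for
  which it has been required already.
\<close>

definition sol_dom ::
    "(real \<Rightarrow> 'w \<Rightarrow> 'w) \<Rightarrow> ('w \<Rightarrow> real \<Rightarrow> real) \<Rightarrow> 'w \<Rightarrow> real \<Rightarrow> real set" where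
  "sol_dom \<sigma> f \<omega> x0 = \<Union>{I. \<exists>u. solves \<sigma> f \<omega> x0 I u}"

definition sol ::
    "(real \<Rightarrow> 'w \<Rightarrow> 'w) \<Rightarrow> ('w \<Rightarrow> real \<Rightarrow> real) \<Rightarrow> real \<Rightarrow> 'w \<Rightarrow> real \<Rightarrow> real" where
  "sol \<sigma> f t \<omega> x0 = (THE y. \<exists>I u. solves \<sigma> f \<omega> x0 I u \<and> t \<in> I \<and> y = u t)"

definition skew ::
    "(real \<Rightarrow> 'w \<Rightarrow> 'w) \<Rightarrow> ('w \<Rightarrow> real \<Rightarrow> real) \<Rightarrow> real \<Rightarrow> 'w \<times> real \<Rightarrow> 'w \<times> real" where
  "skew \<sigma> f t = (\<lambda>(\<omega>, x). (\<sigma> t \<omega>, sol \<sigma> f t \<omega> x))"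

text \<open>The inclusion for all \<open>t\<close>, positive and negative, gives equality of \<open>K\<close> and its images.\<close>

definition invariant_set ::
    "(real \<Rightarrow> 'w \<Rightarrow> 'w) \<Rightarrow> ('w \<Rightarrow> real \<Rightarrow> real) \<Rightarrow> ('w \<times> real) set \<Rightarrow> bool" where
  "invariant_set \<sigma> f K \<longleftrightarrow>
     (\<forall>(\<omega>, x)\<in>K. \<forall>t. t \<in> sol_dom \<sigma> f \<omega> x \<and> skew \<sigma> f t (\<omega>, x) \<in> K)"

definition equilibrium ::
    "(real \<Rightarrow> 'w \<Rightarrow> 'w) \<Rightarrow> ('w \<Rightarrow> real \<Rightarrow> real) \<Rightarrow> ('w \<Rightarrow> real) \<Rightarrow> bool" where
  "equilibrium \<sigma> f b \<longleftrightarrow>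
     (\<forall>\<omega> t. t \<in> sol_dom \<sigma> f \<omega> (b \<omega>) \<and> b (\<sigma> t \<omega>) = sol \<sigma> f t \<omega> (b \<omega>))"

definition graph_of :: "('w \<Rightarrow> real) \<Rightarrow> ('w \<times> real) set" where
  "graph_of b = range (\<lambda>\<omega>. (\<omega>, b \<omega>))"

definition minimal_set ::
    "(real \<Rightarrow> 'w::metric_space \<Rightarrow> 'w) \<Rightarrow> ('w \<Rightarrow> real \<Rightarrow> real) \<Rightarrow> ('w \<times> real) set \<Rightarrow> bool" where
  "minimal_set \<sigma> f M \<longleftrightarrow>
     M \<noteq> {} \<and> compact M \<and> invariant_set \<sigma> f M \<and>
     (\<forall>K. K \<noteq> {} \<and> compact K \<and> invariant_set \<sigma> f K \<longrightarrow> \<not> K \<subset> M)"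

definition set_below :: "('w \<times> real) set \<Rightarrow> ('w \<times> real) set \<Rightarrow> bool" where
  "set_below M1 M2 \<longleftrightarrow> (\<forall>\<omega> x y. (\<omega>, x) \<in> M1 \<and> (\<omega>, y) \<in> M2 \<longrightarrow> x < y)"

definition hyp_attractive ::
    "(real \<Rightarrow> 'w \<Rightarrow> 'w) \<Rightarrow> ('w \<Rightarrow> real \<Rightarrow> real) \<Rightarrow> ('w \<times> real) set \<Rightarrow> bool" where
  "hyp_attractive \<sigma> f M \<longleftrightarrow>
     (\<exists>\<delta>>0. \<exists>k\<ge>1. \<exists>\<gamma>>0. \<forall>\<omega> x y. (\<omega>, x) \<in> M \<and> \<bar>y - x\<bar> < \<delta> \<longrightarrow>
        (\<forall>t\<ge>0. t \<in> sol_dom \<sigma> f \<omega> y \<and>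
           \<bar>sol \<sigma> f t \<omega> y - sol \<sigma> f t \<omega> x\<bar> \<le> k * exp (- \<gamma> * \<bar>t\<bar>) * \<bar>y - x\<bar>))"

definition hyp_repulsive ::
    "(real \<Rightarrow> 'w \<Rightarrow> 'w) \<Rightarrow> ('w \<Rightarrow> real \<Rightarrow> real) \<Rightarrow> ('w \<times> real) set \<Rightarrow> bool" where
  "hyp_repulsive \<sigma> f M \<longleftrightarrow>
     (\<exists>\<delta>>0. \<exists>k\<ge>1. \<exists>\<gamma>>0. \<forall>\<omega> x y. (\<omega>, x) \<in> M \<and> \<bar>y - x\<bar> < \<delta> \<longrightarrow>
        (\<forall>t\<le>0. t \<in> sol_dom \<sigma> f \<omega> y \<and>
           \<bar>sol \<sigma> f t \<omega> y - sol \<sigma> f t \<omega> x\<bar> \<le> k * exp (- \<gamma> * \<bar>t\<bar>) * \<bar>y - x\<bar>))"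

definition hyperbolic ::
    "(real \<Rightarrow> 'w \<Rightarrow> 'w) \<Rightarrow> ('w \<Rightarrow> real \<Rightarrow> real) \<Rightarrow> ('w \<times> real) set \<Rightarrow> bool" where
  "hyperbolic \<sigma> f M \<longleftrightarrow> hyp_attractive \<sigma> f M \<or> hyp_repulsive \<sigma> f M"

section \<open>The global attractor\<close>

definition hausdorff_semidist :: "'a::metric_space set \<Rightarrow> 'a set \<Rightarrow> ennreal" where
  "hausdorff_semidist A B = (SUP p\<in>A. INF q\<in>B. ennreal (dist p q))"

definition hausdorff_dist :: "'a::metric_space set \<Rightarrow> 'a set \<Rightarrow> ennreal" where
  "hausdorff_dist A B = max (hausdorff_semidist A B) (hausdorff_semidist B A)"

definition is_global_attractor ::
    "(real \<Rightarrow> 'w::metric_space \<Rightarrow> 'w) \<Rightarrow> ('w \<Rightarrow> real \<Rightarrow> real) \<Rightarrow> ('w \<times> real) set \<Rightarrow> bool" where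
  "is_global_attractor \<sigma> f A \<longleftrightarrow>
     compact A \<and> invariant_set \<sigma> f A \<and>
     (\<forall>C. bounded C \<longrightarrow>
        (\<forall>(\<omega>, x)\<in>C. \<forall>t\<ge>0. t \<in> sol_dom \<sigma> f \<omega> x) \<and>
        ((\<lambda>t. hausdorff_semidist (skew \<sigma> f t ` C) A) \<longlongrightarrow> 0) at_top)"

definition band :: "('w \<Rightarrow> real) \<Rightarrow> ('w \<Rightarrow> real) \<Rightarrow> ('w \<times> real) set" where
  "band a b = (\<Union>\<omega>. {\<omega>} \<times> {a \<omega>..b \<omega>})"

section \<open>Collision of families of equilibria\<close>

definition semicontinuous :: "('w::metric_space \<Rightarrow> real) \<Rightarrow> bool" where
  "semicontinuous g \<longleftrightarrow>
     (\<forall>\<omega> y. y < g \<omega> \<longrightarrow> (\<forall>\<^sub>F \<eta> in nhds \<omega>. y < g \<eta>)) \<or>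
     (\<forall>\<omega> y. g \<omega> < y \<longrightarrow> (\<forall>\<^sub>F \<eta> in nhds \<omega>. g \<eta> < y))"

definition residual :: "'w::metric_space set \<Rightarrow> bool" where
  "residual R \<longleftrightarrow>
     (\<exists>\<U>. countable \<U> \<and> (\<forall>U\<in>\<U>. open U \<and> closure U = UNIV) \<and> \<Inter>\<U> \<subseteq> R)"

text \<open>
  \<open>F\<close> is \<open>at_left l1\<close> or \<open>at_right l1\<close>, for the one-sided limit of the parameter; the pointwise
  limits are \<open>g1\<close> and \<open>g2\<close>, and they coincide and are continuous at the points of \<open>R\<close>.
\<close>

definition collision ::
    "(real \<Rightarrow> 'w::metric_space \<Rightarrow> 'w) \<Rightarrow> (real \<Rightarrow> 'w \<Rightarrow> real \<Rightarrow> real) \<Rightarrow> real \<Rightarrow> real filter \<Rightarrow>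
     (real \<Rightarrow> 'w \<Rightarrow> real) \<Rightarrow> (real \<Rightarrow> 'w \<Rightarrow> real) \<Rightarrow> ('w \<Rightarrow> real) \<Rightarrow> ('w \<Rightarrow> real) \<Rightarrow> 'w set \<Rightarrow> bool"
  where
  "collision \<sigma> h l1 F b1 b2 g1 g2 R \<longleftrightarrow>
     (\<forall>\<omega>. ((\<lambda>l. b1 l \<omega>) \<longlongrightarrow> g1 \<omega>) F) \<and> (\<forall>\<omega>. ((\<lambda>l. b2 l \<omega>) \<longlongrightarrow> g2 \<omega>) F) \<and>
     semicontinuous g1 \<and> semicontinuous g2 \<and>
     equilibrium \<sigma> (h l1) g1 \<and> equilibrium \<sigma> (h l1) g2 \<and>
     residual R \<and> (\<forall>\<omega>\<in>R. \<forall>t. \<sigma> t \<omega> \<in> R) \<and>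
     (\<forall>\<omega>\<in>R. g1 \<omega> = g2 \<omega> \<and> isCont g1 \<omega> \<and> isCont g2 \<omega>)"

definition collide ::
    "(real \<Rightarrow> 'w::metric_space \<Rightarrow> 'w) \<Rightarrow> (real \<Rightarrow> 'w \<Rightarrow> real \<Rightarrow> real) \<Rightarrow> real \<Rightarrow> real filter \<Rightarrow>
     (real \<Rightarrow> 'w \<Rightarrow> real) \<Rightarrow> (real \<Rightarrow> 'w \<Rightarrow> real) \<Rightarrow> bool"
  where
  "collide \<sigma> h l1 F b1 b2 \<longleftrightarrow> (\<exists>g1 g2 R. collision \<sigma> h l1 F b1 b2 g1 g2 R)"

text \<open>
  \<open>M\<close> is the minimal set arising from the collision: the closure of the orbit of any point of the
  common graph over \<open>R\<close>.
\<close>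

definition collision_minimal_set ::
    "(real \<Rightarrow> 'w::metric_space \<Rightarrow> 'w) \<Rightarrow> ('w \<Rightarrow> real \<Rightarrow> real) \<Rightarrow>
     ('w \<Rightarrow> real) \<Rightarrow> 'w set \<Rightarrow> ('w \<times> real) set \<Rightarrow> bool"
  where
  "collision_minimal_set \<sigma> f g R M \<longleftrightarrow>
     minimal_set \<sigma> f M \<and> (\<forall>\<omega>\<in>R. M = closure (range (\<lambda>t. skew \<sigma> f t (\<omega>, g \<omega>))))"

section \<open>Bifurcations\<close>

text \<open>
  The number and the hyperbolicity type of the minimal sets agree for two values of the parameter
  if there is a type-preserving bijection between the two collections of minimal sets; this
  formulation does not presuppose that the collections are finite.
\<close>

definition same_minimal_structure ::
    "(real \<Rightarrow> 'w::metric_space \<Rightarrow> 'w) \<Rightarrow> ('w \<Rightarrow> real \<Rightarrow> real) \<Rightarrow> ('w \<Rightarrow> real \<Rightarrow> real) \<Rightarrow> bool"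
  where
  "same_minimal_structure \<sigma> f1 f2 \<longleftrightarrow>
     (\<exists>\<phi>. bij_betw \<phi> {M. minimal_set \<sigma> f1 M} {M. minimal_set \<sigma> f2 M} \<and>
        (\<forall>M. minimal_set \<sigma> f1 M \<longrightarrow>
           (hyp_attractive \<sigma> f1 M \<longleftrightarrow> hyp_attractive \<sigma> f2 (\<phi> M)) \<and>
           (hyp_repulsive \<sigma> f1 M \<longleftrightarrow> hyp_repulsive \<sigma> f2 (\<phi> M))))"

definition bifurcation_point ::
    "(real \<Rightarrow> 'w::metric_space \<Rightarrow> 'w) \<Rightarrow> (real \<Rightarrow> 'w \<Rightarrow> real \<Rightarrow> real) \<Rightarrow> real \<Rightarrow> bool" where
  "bifurcation_point \<sigma> h l1 \<longleftrightarrow>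
     \<not> (\<forall>\<^sub>F l in nhds l1. same_minimal_structure \<sigma> (h l1) (h l))"

text \<open>
  \<open>F\<close> is the side of \<open>l1\<close> on which the attractive copy of the base (the graph of \<open>b l\<close>) and the
  repulsive one (the graph of \<open>r l\<close>) exist, and \<open>G\<close> is the other side.
\<close>

definition local_saddle_node ::
    "(real \<Rightarrow> 'w::metric_space \<Rightarrow> 'w) \<Rightarrow> (real \<Rightarrow> 'w \<Rightarrow> real \<Rightarrow> real) \<Rightarrow> real \<Rightarrow>
     ('w \<times> real) set \<Rightarrow> bool"
  where
  "local_saddle_node \<sigma> h l1 M \<longleftrightarrow>
     (\<exists>(F, G) \<in> {(at_right l1, at_left l1), (at_left l1, at_right l1)}. \<exists>b r gb gr R U.
        (\<forall>\<^sub>F l in F.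
           continuous_on UNIV (b l) \<and> minimal_set \<sigma> (h l) (graph_of (b l)) \<and>
           hyp_attractive \<sigma> (h l) (graph_of (b l)) \<and>
           continuous_on UNIV (r l) \<and> minimal_set \<sigma> (h l) (graph_of (r l)) \<and>
           hyp_repulsive \<sigma> (h l) (graph_of (r l))) \<and>
        collision \<sigma> h l1 F b r gb gr R \<and>
        collision_minimal_set \<sigma> (h l1) gb R M \<and>
        \<not> hyperbolic \<sigma> (h l1) M \<and>
        open U \<and> band (\<lambda>\<omega>. min (gb \<omega>) (gr \<omega>)) (\<lambda>\<omega>. max (gb \<omega>) (gr \<omega>)) \<subseteq> U \<and>
        (\<forall>\<^sub>F l in G. \<forall>N. minimal_set \<sigma> (h l) N \<longrightarrow> N \<inter> U = {}))"

text \<open>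
  The set which persists through the bifurcation is the graph of a fixed function \<open>e\<close> (below,
  \<open>e = 0\<close>); the other hyperbolic sets are the graphs of \<open>b l\<close> for \<open>l < l1\<close> and for \<open>l > l1\<close>.
\<close>

definition local_transcritical ::
    "(real \<Rightarrow> 'w::metric_space \<Rightarrow> 'w) \<Rightarrow> (real \<Rightarrow> 'w \<Rightarrow> real \<Rightarrow> real) \<Rightarrow> real \<Rightarrow>
     ('w \<Rightarrow> real) \<Rightarrow> bool"
  where
  "local_transcritical \<sigma> h l1 e \<longleftrightarrow>
     (\<forall>F \<in> {at_left l1, at_right l1}. \<exists>b.
        (\<forall>\<^sub>F l in F.
           minimal_set \<sigma> (h l) (graph_of e) \<and> hyperbolic \<sigma> (h l) (graph_of e) \<and>
           continuous_on UNIV (b l) \<and> minimal_set \<sigma> (h l) (graph_of (b l)) \<and>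
           hyperbolic \<sigma> (h l) (graph_of (b l)) \<and> graph_of (b l) \<noteq> graph_of e) \<and>
        collide \<sigma> h l1 F b (\<lambda>_. e)) \<and>
     minimal_set \<sigma> (h l1) (graph_of e) \<and> \<not> hyperbolic \<sigma> (h l1) (graph_of e) \<and>
     (\<exists>U. open U \<and> graph_of e \<subseteq> U \<and>
        (\<forall>N. minimal_set \<sigma> (h l1) N \<and> N \<inter> U \<noteq> {} \<longrightarrow> N = graph_of e))"

definition discontinuous_at :: "(real \<Rightarrow> 'a::metric_space set) \<Rightarrow> real \<Rightarrow> bool" where
  "discontinuous_at A l1 \<longleftrightarrow> \<not> ((\<lambda>l. hausdorff_dist (A l) (A l1)) \<longlongrightarrow> 0) (at l1)"

section \<open>The two bifurcation diagrams\<close>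

text \<open>
  In both diagrams \<open>\<alpha> l\<close> and \<open>\<beta> l\<close> delimit the global attractor for the parameter \<open>l\<close>.
\<close>

abbreviation M0 :: "('w \<times> real) set" where
  "M0 \<equiv> graph_of (\<lambda>_. 0)"

definition global_pitchfork_diagram ::
    "(real \<Rightarrow> 'w::metric_space \<Rightarrow> 'w) \<Rightarrow> (real \<Rightarrow> 'w \<Rightarrow> real \<Rightarrow> real) \<Rightarrow>
     (real \<Rightarrow> 'w \<Rightarrow> real) \<Rightarrow> (real \<Rightarrow> 'w \<Rightarrow> real) \<Rightarrow> bool"
  where
  "global_pitchfork_diagram \<sigma> h \<alpha> \<beta> \<longleftrightarrow>
     (\<forall>l>0.
        {M. minimal_set \<sigma> (h l) M} = {graph_of (\<alpha> l), M0, graph_of (\<beta> l)} \<and>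
        set_below (graph_of (\<alpha> l)) M0 \<and> set_below M0 (graph_of (\<beta> l)) \<and>
        hyperbolic \<sigma> (h l) (graph_of (\<alpha> l)) \<and> hyperbolic \<sigma> (h l) M0 \<and>
        hyperbolic \<sigma> (h l) (graph_of (\<beta> l))) \<and>
     collide \<sigma> h 0 (at_right 0) \<alpha> (\<lambda>_ _. 0) \<and>
     collide \<sigma> h 0 (at_right 0) \<beta> (\<lambda>_ _. 0) \<and>
     (\<forall>l\<le>0. {M. minimal_set \<sigma> (h l) M} = {M0}) \<and>
     (\<forall>l<0. band (\<alpha> l) (\<beta> l) = M0)"

definition transcritical_saddle_node_diagram ::
    "(real \<Rightarrow> 'w::metric_space \<Rightarrow> 'w) \<Rightarrow> (real \<Rightarrow> 'w \<Rightarrow> real \<Rightarrow> real) \<Rightarrow>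
     (real \<Rightarrow> 'w \<Rightarrow> real) \<Rightarrow> (real \<Rightarrow> 'w \<Rightarrow> real) \<Rightarrow> real \<Rightarrow> bool"
  where
  "transcritical_saddle_node_diagram \<sigma> h \<alpha> \<beta> \<mu> \<longleftrightarrow>
     (\<forall>l>0.
        {M. minimal_set \<sigma> (h l) M} = {graph_of (\<alpha> l), M0, graph_of (\<beta> l)} \<and>
        set_below (graph_of (\<alpha> l)) M0 \<and> set_below M0 (graph_of (\<beta> l))) \<and>
     collide \<sigma> h 0 (at_right 0) \<beta> (\<lambda>_ _. 0) \<and>
     (\<forall>l>\<mu>.
        minimal_set \<sigma> (h l) (graph_of (\<alpha> l)) \<and> hyperbolic \<sigma> (h l) (graph_of (\<alpha> l)) \<and>
        set_below (graph_of (\<alpha> l)) M0) \<and>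
     {M. minimal_set \<sigma> (h 0) M} = {graph_of (\<alpha> 0), M0} \<and>
     (\<exists>\<kappa> Ml g1 g2 R.
        (\<forall>l\<in>{\<mu><..<0}.
           continuous_on UNIV (\<kappa> l) \<and>
           {M. minimal_set \<sigma> (h l) M} = {graph_of (\<alpha> l), graph_of (\<kappa> l), M0} \<and>
           set_below (graph_of (\<alpha> l)) (graph_of (\<kappa> l)) \<and> set_below (graph_of (\<kappa> l)) M0 \<and>
           hyperbolic \<sigma> (h l) (graph_of (\<alpha> l)) \<and> hyp_repulsive \<sigma> (h l) (graph_of (\<kappa> l)) \<and>
           hyperbolic \<sigma> (h l) M0) \<and>
        (\<forall>l\<in>{\<mu><..<0}. \<forall>l'\<in>{\<mu><..<0}. l < l' \<longrightarrow> (\<forall>\<omega>. \<kappa> l \<omega> < \<kappa> l' \<omega>)) \<and>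
        collide \<sigma> h 0 (at_left 0) \<kappa> (\<lambda>_ _. 0) \<and>
        collision \<sigma> h \<mu> (at_right \<mu>) \<alpha> \<kappa> g1 g2 R \<and>
        collision_minimal_set \<sigma> (h \<mu>) g1 R Ml \<and>
        {M. minimal_set \<sigma> (h \<mu>) M} = {Ml, M0} \<and> set_below Ml M0 \<and>
        \<not> hyperbolic \<sigma> (h \<mu>) Ml \<and>
        local_saddle_node \<sigma> h \<mu> Ml) \<and>
     (\<forall>l<\<mu>. band (\<alpha> l) (\<beta> l) = M0) \<and>
     {l. bifurcation_point \<sigma> h l} = {\<mu>, 0} \<and>
     discontinuous_at (\<lambda>l. band (\<alpha> l) (\<beta> l)) \<mu> \<and>
     local_transcritical \<sigma> h 0 (\<lambda>_. 0)"

text \<open>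
  The right-hand side after the change of variables \<open>(\<omega>, x) \<mapsto> (\<omega>, -x)\<close>, which maps the
  attractor between \<open>\<alpha>\<close> and \<open>\<beta>\<close> to the one between \<open>-\<beta>\<close> and \<open>-\<alpha>\<close>.
\<close>

definition reflect :: "('w \<Rightarrow> real \<Rightarrow> real) \<Rightarrow> 'w \<Rightarrow> real \<Rightarrow> real" where
  "reflect f \<omega> x = - f \<omega> (- x)"

definition cubic :: "('w \<Rightarrow> real) \<Rightarrow> real \<Rightarrow> 'w \<Rightarrow> real \<Rightarrow> real" where
  "cubic a\<^sub>2 l \<omega> x = - (x ^ 3) + a\<^sub>2 \<omega> * x ^ 2 + l * x"

end

theory Submission
  imports Defs
begin

text \<open>The line \<open>x = 0\<close> consists of solutions, so no solution changes sign, and the change of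
  variables \<open>x \<mapsto> -x\<close> turns the family for \<open>a\<close> into the family for \<open>-a\<close>. Hence it is enough to
  understand the upper half \<open>x > 0\<close> for an arbitrary coefficient \<open>a\<close>, and then to combine the
  results for \<open>a\<close> and \<open>-a\<close> (locales \<open>cubic_family\<close> and \<open>cubic_pair\<close>).

  The assumption on the global attractor provides all the solutions that are needed: every
  solution is defined in forward time, those starting in the attractor are defined on the whole
  line, and every bounded solution on the whole line lies in the attractor
  (\<open>bounded_entire_in_attr\<close>). So \<open>\<beta> l\<close> is the largest bounded equilibrium, and lower bounds for
  it follow from following solutions that start far in the past (\<open>pullback_le\<close>). All comparison
  arguments use that the difference of two solutions satisfies a linear equation whose coefficient
  is a secant slope of the cubic.

  The upper half is governed by one identity. If \<open>\<kappa> < b\<close> are equilibria and \<open>u\<close> is a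
  third solution, then \<open>w (b - u) / (b (u - \<kappa>))\<close> has logarithmic derivative \<open>-m - u (b - \<kappa>)\<close>, where
  \<open>w\<close> is a bounded weight: \<open>w = \<kappa>\<close> and \<open>m = 0\<close> if \<open>\<kappa>\<close> is positive, \<open>w = 1\<close> and \<open>m = l\<close> if
  \<open>\<kappa> = 0\<close> and \<open>l \<ge> 0\<close> (\<open>ratio_rates\<close> in the locale \<open>separated_pair\<close>). As soon as the gap
  \<open>b - \<kappa>\<close> is bounded away from zero, this ratio decays exponentially. Then \<open>b\<close> is continuous and
  hyperbolic attractive, a positive \<open>\<kappa>\<close> is continuous and hyperbolic repulsive, and there is no
  minimal set strictly between them.

  Call \<open>l\<close> persistent if \<open>\<beta> l\<close> is bounded away from zero, which means that there is a compact
  invariant set in the open upper half. Every \<open>l > 0\<close> is persistent, and increasing \<open>l\<close> pushes \<open>\<beta> l\<close>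
  up by a uniform amount, so the persistent parameters form an up-set. For negative \<open>l\<close>, solutions
  near \<open>0\<close> decay, and the lower boundary \<open>kappa l\<close> of the set of points that do not decay is a
  second equilibrium; increasing \<open>l\<close> pushes it down by a uniform amount. So at every negative
  parameter above a persistent one there is a gap between \<open>kappa l\<close> and \<open>\<beta> l\<close>, and the identity
  applies.

  If \<open>0\<close> is persistent, then the set of persistent parameters is \<open>{\<mu>..}\<close> with \<open>\<mu> < 0\<close>
  (\<open>threshold\<close>): hyperbolic attractivity survives a small decrease of \<open>l\<close> (\<open>att_near_persists\<close>),
  and a limit of equilibria is an equilibrium. By the same perturbation argument there is no
  uniform gap between \<open>kappa \<mu>\<close> and \<open>\<beta> \<mu>\<close>. As the base is minimal, a gap at one common
  continuity point would spread to a uniform gap (\<open>eqm_gap_dichotomy\<close>), so the two equilibria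
  coincide at all of their common continuity points, and these form a residual set. The orbit
  closure over this set is the only minimal set in the upper half at \<open>\<mu>\<close>. It is neither attractive,
  since it contains points of the lower boundary \<open>kappa \<mu>\<close>, nor repulsive, since it contains points
  of the top of the attractor.

  Finally, at \<open>l = 0\<close> the variable \<open>y = 1 / x\<close> satisfies \<open>y' = 1 / y - a\<close>, and it stays bounded if
  and only if the time averages of \<open>a\<close> are uniformly positive. Thus \<open>0\<close> is persistent for \<open>a\<close> or for
  \<open>-a\<close> exactly if the linear equation with coefficient \<open>a\<close> has exponential dichotomy, that is, if
  \<open>0\<close> is outside the Sacker and Sell spectrum (\<open>dichotomy_iff\<close>). If it is persistent for neither,
  the diagram is the pitchfork; if it is persistent for one of them, the saddle-node bifurcation at
  \<open>\<mu>\<close> takes place in the corresponding half, and the two halves meet in the transcritical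
  bifurcation at \<open>0\<close>.\<close>

section \<open>Differential inequalities on the line\<close>

lemma deriv_nonpos_imp_le:
  fixes u :: "real \<Rightarrow> real"
  assumes "s \<le> t" and "\<And>\<tau>. s \<le> \<tau> \<Longrightarrow> \<tau> \<le> t \<Longrightarrow> (u has_real_derivative u' \<tau>) (at \<tau>)"
    and "\<And>\<tau>. s \<le> \<tau> \<Longrightarrow> \<tau> \<le> t \<Longrightarrow> u' \<tau> \<le> 0"
  shows "u t \<le> u s"
  using DERIV_nonpos_imp_nonincreasing[of s t u] assms by blast

lemma last_exit:
  fixes u :: "real \<Rightarrow> real"
  assumes "s \<le> t" "continuous_on {s..t} u" "u s \<le> K" "K < u t"
  obtains r where "s \<le> r" "r \<le> t" "u r \<le> K" "\<And>\<tau>. r < \<tau> \<Longrightarrow> \<tau> \<le> t \<Longrightarrow> K < u \<tau>"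
proof -
  define Z where "Z = {s..t} \<inter> u -` {..K}"
  have "closed Z" unfolding Z_def by (intro continuous_closed_preimage assms closed_atLeastAtMost closed_atMost)
  moreover have "s \<in> Z" using assms by (auto simp: Z_def)
  moreover have bdd: "bdd_above Z" by (auto simp: Z_def)
  ultimately have SZ: "Sup Z \<in> Z" using closed_contains_Sup[of Z] by auto
  have "K < u \<tau>" if "Sup Z < \<tau>" "\<tau> \<le> t" for \<tau>
    using that SZ cSup_upper[OF _ bdd, of \<tau>] by (force simp: Z_def)
  then show ?thesis using SZ by (intro that[of "Sup Z"]) (auto simp: Z_def)
qed

text \<open>The sign of the derivative matters only where \<open>u\<close> exceeds \<open>K\<close>: after the last time at which
  \<open>u \<le> K\<close> the function does not increase.\<close>

lemma barrier_le:
  fixes u :: "real \<Rightarrow> real"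
  assumes st: "s \<le> t" and der: "\<And>\<tau>. s \<le> \<tau> \<Longrightarrow> \<tau> \<le> t \<Longrightarrow> (u has_real_derivative u' \<tau>) (at \<tau>)"
    and us: "u s \<le> K" and neg: "\<And>\<tau>. s \<le> \<tau> \<Longrightarrow> \<tau> \<le> t \<Longrightarrow> K < u \<tau> \<Longrightarrow> u' \<tau> \<le> 0"
  shows "u t \<le> K"
proof (rule ccontr)
  assume "\<not> u t \<le> K"
  then have ut: "K < u t" by simp
  have cont: "continuous_on {s..t} u"
    using der by (intro continuous_at_imp_continuous_on) (auto intro!: DERIV_isCont)
  obtain r where r: "s \<le> r" "r \<le> t" "u r \<le> K" "\<And>\<tau>. r < \<tau> \<Longrightarrow> \<tau> \<le> t \<Longrightarrow> K < u \<tau>"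
    using last_exit[OF st cont us ut] by blast
  have rt: "r < t" using r(2,3) ut by (auto simp: order.order_iff_strict)
  have "\<exists>z>r. z < t \<and> u t - u r = (t - r) * u' z"
    by (rule MVT2[OF rt]) (use r(1) der in auto)
  then obtain z where z: "r < z" "z < t" "u t - u r = (t - r) * u' z" by blast
  have "u' z \<le> 0" using z r(1) r(4)[of z] by (intro neg) auto
  then have "u t - u r \<le> 0" using z by (simp add: mult_nonneg_nonpos)
  then show False using r(3) ut by simp
qed

lemma barrier_ge:
  fixes u :: "real \<Rightarrow> real"
  assumes st: "s \<le> t" and der: "\<And>\<tau>. s \<le> \<tau> \<Longrightarrow> \<tau> \<le> t \<Longrightarrow> (u has_real_derivative u' \<tau>) (at \<tau>)"
    and "K \<le> u s" and pos: "\<And>\<tau>. s \<le> \<tau> \<Longrightarrow> \<tau> \<le> t \<Longrightarrow> u \<tau> < K \<Longrightarrow> 0 \<le> u' \<tau>"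
  shows "K \<le> u t"
  using barrier_le[of s t "\<lambda>\<tau>. - u \<tau>" "\<lambda>\<tau>. - u' \<tau>" "- K"] assms
  by (auto intro!: derivative_eq_intros)

text \<open>Formulated with \<open>d d'\<close> because \<open>\<bar>d\<bar>\<close> may fail to be differentiable at the zeros of \<open>d\<close>:
  \<open>d\<^sup>2 exp (-2 h t)\<close> does not increase.\<close>

lemma growth_upper:
  fixes d :: "real \<Rightarrow> real"
  assumes st: "s \<le> t" and der: "\<And>\<tau>. s \<le> \<tau> \<Longrightarrow> \<tau> \<le> t \<Longrightarrow> (d has_real_derivative d' \<tau>) (at \<tau>)"
    and h: "\<And>\<tau>. s \<le> \<tau> \<Longrightarrow> \<tau> \<le> t \<Longrightarrow> d \<tau> * d' \<tau> \<le> h * (d \<tau>)\<^sup>2"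
  shows "\<bar>d t\<bar> \<le> \<bar>d s\<bar> * exp (h * (t - s))"
proof -
  have "(d t)\<^sup>2 * exp (- 2 * h * t) \<le> (d s)\<^sup>2 * exp (- 2 * h * s)"
  proof (rule deriv_nonpos_imp_le[OF st, where u = "\<lambda>\<tau>. (d \<tau>)\<^sup>2 * exp (- 2 * h * \<tau>)"
        and u' = "\<lambda>\<tau>. 2 * (d \<tau> * d' \<tau> - h * (d \<tau>)\<^sup>2) * exp (- 2 * h * \<tau>)"])
    fix \<tau> assume "s \<le> \<tau>" "\<tau> \<le> t"
    then show "((\<lambda>\<tau>. (d \<tau>)\<^sup>2 * exp (- 2 * h * \<tau>)) has_real_derivative
        2 * (d \<tau> * d' \<tau> - h * (d \<tau>)\<^sup>2) * exp (- 2 * h * \<tau>)) (at \<tau>)"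
      by (auto intro!: derivative_eq_intros der simp: algebra_simps power2_eq_square)
    show "2 * (d \<tau> * d' \<tau> - h * (d \<tau>)\<^sup>2) * exp (- 2 * h * \<tau>) \<le> 0"
      using h[OF \<open>s \<le> \<tau>\<close> \<open>\<tau> \<le> t\<close>] by (simp add: mult_nonpos_nonneg)
  qed
  then have "(d t)\<^sup>2 * exp (- 2 * h * t) * exp (2 * h * t) \<le> (d s)\<^sup>2 * exp (- 2 * h * s) * exp (2 * h * t)"
    by (intro mult_right_mono) auto
  then have "(d t)\<^sup>2 \<le> (d s)\<^sup>2 * exp (2 * (h * (t - s)))"
    by (simp add: mult.assoc exp_add[symmetric] algebra_simps)
  also have "\<dots> = (\<bar>d s\<bar> * exp (h * (t - s)))\<^sup>2"
    by (simp only: power_mult_distrib power2_abs exp_double)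
  finally have "\<bar>d t\<bar>\<^sup>2 \<le> (\<bar>d s\<bar> * exp (h * (t - s)))\<^sup>2" by simp
  then show ?thesis by (rule power2_le_imp_le) auto
qed

lemma growth_lower:
  fixes d :: "real \<Rightarrow> real"
  assumes st: "s \<le> t" and der: "\<And>\<tau>. s \<le> \<tau> \<Longrightarrow> \<tau> \<le> t \<Longrightarrow> (d has_real_derivative d' \<tau>) (at \<tau>)"
    and h: "\<And>\<tau>. s \<le> \<tau> \<Longrightarrow> \<tau> \<le> t \<Longrightarrow> h * (d \<tau>)\<^sup>2 \<le> d \<tau> * d' \<tau>"
  shows "\<bar>d s\<bar> * exp (h * (t - s)) \<le> \<bar>d t\<bar>"
proof -
  have "\<bar>d (- (- s))\<bar> \<le> \<bar>d (- (- t))\<bar> * exp ((- h) * (- s - - t))"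
  proof (rule growth_upper[where d = "\<lambda>\<tau>. d (- \<tau>)" and d' = "\<lambda>\<tau>. - d' (- \<tau>)"])
    fix \<tau> assume \<tau>: "- t \<le> \<tau>" "\<tau> \<le> - s"
    show "((\<lambda>\<tau>. d (- \<tau>)) has_real_derivative - d' (- \<tau>)) (at \<tau>)"
      using DERIV_mirror[of d "d' (- \<tau>)" \<tau>] der[of "- \<tau>"] \<tau> by auto
    show "d (- \<tau>) * - d' (- \<tau>) \<le> - h * (d (- \<tau>))\<^sup>2"
      using h[of "- \<tau>"] \<tau> by auto
  qed (use st in auto)
  then have "\<bar>d s\<bar> * exp (h * (t - s)) \<le> \<bar>d t\<bar> * exp ((- h) * (- s - - t)) * exp (h * (t - s))"
    by (intro mult_right_mono) auto
  then show ?thesis by (simp add: mult.assoc exp_add[symmetric] algebra_simps)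
qed

text \<open>Gronwall's inequality for the square of \<open>d\<close>, which is differentiable; the mixed term is absorbed by
  \<open>2 \<eta> \<bar>d\<bar> \<le> d\<^sup>2 + \<eta>\<^sup>2\<close>, which accounts for the additional \<open>1\<close> in the exponent.\<close>

lemma gronwall_square:
  fixes d :: "real \<Rightarrow> real"
  assumes st: "s \<le> t" and der: "\<And>\<tau>. s \<le> \<tau> \<Longrightarrow> \<tau> \<le> t \<Longrightarrow> (d has_real_derivative d' \<tau>) (at \<tau>)"
    and L: "0 \<le> L" and h: "\<And>\<tau>. s \<le> \<tau> \<Longrightarrow> \<tau> \<le> t \<Longrightarrow> \<bar>d' \<tau>\<bar> \<le> L * \<bar>d \<tau>\<bar> + \<eta>"
  shows "(d t)\<^sup>2 \<le> exp ((2 * L + 1) * (t - s)) * ((d s)\<^sup>2 + \<eta>\<^sup>2 * (t - s))"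
proof -
  let ?K = "2 * L + 1"
  let ?u = "\<lambda>\<tau>. (d \<tau>)\<^sup>2 * exp (- ?K * (\<tau> - s)) - \<eta>\<^sup>2 * (\<tau> - s)"
  let ?u' = "\<lambda>\<tau>. (2 * d \<tau> * d' \<tau> - ?K * (d \<tau>)\<^sup>2) * exp (- ?K * (\<tau> - s)) - \<eta>\<^sup>2"
  have "?u t \<le> ?u s"
  proof (rule deriv_nonpos_imp_le[OF st, of ?u ?u'])
    fix \<tau> assume \<tau>: "s \<le> \<tau>" "\<tau> \<le> t"
    then show "(?u has_real_derivative ?u' \<tau>) (at \<tau>)"
      by (auto intro!: derivative_eq_intros der simp: algebra_simps power2_eq_square)
    have "2 * d \<tau> * d' \<tau> \<le> 2 * (\<bar>d \<tau>\<bar> * \<bar>d' \<tau>\<bar>)"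
      using abs_ge_self[of "d \<tau> * d' \<tau>"] by (simp add: abs_mult)
    also have "\<dots> \<le> 2 * (\<bar>d \<tau>\<bar> * (L * \<bar>d \<tau>\<bar> + \<eta>))"
      using h[OF \<tau>] by (intro mult_left_mono) auto
    also have "\<dots> = 2 * L * (d \<tau>)\<^sup>2 + 2 * \<eta> * \<bar>d \<tau>\<bar>"
      by (simp add: algebra_simps power2_eq_square)
    also have "\<dots> \<le> 2 * L * (d \<tau>)\<^sup>2 + ((d \<tau>)\<^sup>2 + \<eta>\<^sup>2)"
      using zero_le_power2[of "\<bar>d \<tau>\<bar> - \<eta>"] by (simp add: power2_eq_square algebra_simps)
    finally have "2 * d \<tau> * d' \<tau> - ?K * (d \<tau>)\<^sup>2 \<le> \<eta>\<^sup>2" by (simp add: algebra_simps)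
    then have "(2 * d \<tau> * d' \<tau> - ?K * (d \<tau>)\<^sup>2) * exp (- ?K * (\<tau> - s)) \<le> \<eta>\<^sup>2 * exp (- ?K * (\<tau> - s))"
      by (intro mult_right_mono) auto
    also have "\<dots> \<le> \<eta>\<^sup>2 * 1"
    proof (intro mult_left_mono)
      have "0 \<le> ?K * (\<tau> - s)" using L \<tau> by (intro mult_nonneg_nonneg) auto
      then show "exp (- ?K * (\<tau> - s)) \<le> 1" by (simp only: mult_minus_left exp_le_one_iff neg_le_0_iff_le)
    qed auto
    finally show "?u' \<tau> \<le> 0" by simp
  qed
  then have "(d t)\<^sup>2 * exp (- ?K * (t - s)) \<le> (d s)\<^sup>2 + \<eta>\<^sup>2 * (t - s)" by simp
  then have "(d t)\<^sup>2 * exp (- ?K * (t - s)) * exp (?K * (t - s)) \<le> ((d s)\<^sup>2 + \<eta>\<^sup>2 * (t - s)) * exp (?K * (t - s))"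
    by (intro mult_right_mono) auto
  then show ?thesis by (simp add: mult.assoc exp_add[symmetric] algebra_simps)
qed

text \<open>A positive source term creates a quantitative gain. This is what makes the equilibria
  strictly monotone in the parameter, uniformly over the base. The multiplier \<open>exp (- L t)\<close> shows
  that \<open>d\<close> stays nonnegative, and then \<open>exp (L t)\<close> gives the gain.\<close>

lemma gronwall_lower:
  fixes d :: "real \<Rightarrow> real"
  assumes st: "s \<le> t" and der: "\<And>\<tau>. s \<le> \<tau> \<Longrightarrow> \<tau> \<le> t \<Longrightarrow> (d has_real_derivative c \<tau> * d \<tau> + e \<tau>) (at \<tau>)"
    and L: "0 \<le> L" "\<And>\<tau>. s \<le> \<tau> \<Longrightarrow> \<tau> \<le> t \<Longrightarrow> \<bar>c \<tau>\<bar> \<le> L"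
    and e: "\<And>\<tau>. s \<le> \<tau> \<Longrightarrow> \<tau> \<le> t \<Longrightarrow> \<eta> \<le> e \<tau>" and "0 \<le> \<eta>" "0 \<le> d s"
  shows "\<eta> * (t - s) * exp (- L * (t - s)) \<le> d t"
proof -
  have nn: "0 \<le> d r" if r: "s \<le> r" "r \<le> t" for r
  proof -
    have "0 \<le> d r * exp (- L * r)"
    proof (rule barrier_ge[of s r "\<lambda>\<tau>. d \<tau> * exp (- L * \<tau>)" "\<lambda>\<tau>. ((c \<tau> - L) * d \<tau> + e \<tau>) * exp (- L * \<tau>)"])
      fix \<tau> assume \<tau>: "s \<le> \<tau>" "\<tau> \<le> r"
      then show "((\<lambda>\<tau>. d \<tau> * exp (- L * \<tau>)) has_real_derivative ((c \<tau> - L) * d \<tau> + e \<tau>) * exp (- L * \<tau>)) (at \<tau>)"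
        using r by (auto intro!: derivative_eq_intros der simp: algebra_simps)
      assume "d \<tau> * exp (- L * \<tau>) < 0"
      then have "d \<tau> < 0" by (simp add: mult_less_0_iff)
      moreover have "c \<tau> - L \<le> 0" "0 \<le> e \<tau>" using L(2)[of \<tau>] e[of \<tau>] \<tau> r \<open>0 \<le> \<eta>\<close> by auto
      ultimately show "0 \<le> ((c \<tau> - L) * d \<tau> + e \<tau>) * exp (- L * \<tau>)"
        by (intro mult_nonneg_nonneg add_nonneg_nonneg mult_nonpos_nonpos) auto
    qed (use r \<open>0 \<le> d s\<close> in auto)
    then show ?thesis by (simp add: zero_le_mult_iff)
  qed
  have "\<eta> * (t - s) - d t * exp (L * (t - s)) \<le> \<eta> * (s - s) - d s * exp (L * (s - s))"
  proof (rule deriv_nonpos_imp_le[OF st, where u = "\<lambda>\<tau>. \<eta> * (\<tau> - s) - d \<tau> * exp (L * (\<tau> - s))"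
        and u' = "\<lambda>\<tau>. \<eta> - ((c \<tau> + L) * d \<tau> + e \<tau>) * exp (L * (\<tau> - s))"])
    fix \<tau> assume \<tau>: "s \<le> \<tau>" "\<tau> \<le> t"
    then show "((\<lambda>\<tau>. \<eta> * (\<tau> - s) - d \<tau> * exp (L * (\<tau> - s))) has_real_derivative
        \<eta> - ((c \<tau> + L) * d \<tau> + e \<tau>) * exp (L * (\<tau> - s))) (at \<tau>)"
      by (auto intro!: derivative_eq_intros der simp: algebra_simps)
    have "0 \<le> (c \<tau> + L) * d \<tau>" using L(2)[OF \<tau>] nn[OF \<tau>] by (intro mult_nonneg_nonneg) auto
    then have "\<eta> * 1 \<le> ((c \<tau> + L) * d \<tau> + e \<tau>) * exp (L * (\<tau> - s))"
      using e[OF \<tau>] \<open>0 \<le> \<eta>\<close> L(1) \<tau> by (intro mult_mono) auto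
    then show "\<eta> - ((c \<tau> + L) * d \<tau> + e \<tau>) * exp (L * (\<tau> - s)) \<le> 0" by simp
  qed
  then have "\<eta> * (t - s) \<le> d t * exp (L * (t - s))" using \<open>0 \<le> d s\<close> by simp
  then have "\<eta> * (t - s) * exp (- L * (t - s)) \<le> d t * exp (L * (t - s)) * exp (- L * (t - s))"
    by (intro mult_right_mono) auto
  then show ?thesis by (simp add: mult.assoc exp_add[symmetric])
qed

section \<open>Solutions of the cubic equation\<close>

locale base_flow =
  fixes \<sigma> :: "real \<Rightarrow> 'w::metric_space \<Rightarrow> 'w" and a :: "'w \<Rightarrow> real"
  assumes compact_base: "compact (UNIV :: 'w set)"
    and flow: "continuous_flow \<sigma>"
    and minimal: "minimal_flow \<sigma>"
    and cont_a: "continuous_on UNIV a"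
begin

lemma flow_0 [simp]: "\<sigma> 0 \<omega> = \<omega>"
  and flow_add: "\<sigma> (s + t) \<omega> = \<sigma> s (\<sigma> t \<omega>)"
  and flow_continuous: "continuous_on UNIV (\<lambda>(t, \<omega>). \<sigma> t \<omega>)"
  using flow by (auto simp: continuous_flow_def)

lemma flow_comp [simp]: "\<sigma> s (\<sigma> t \<omega>) = \<sigma> (s + t) \<omega>" by (simp add: flow_add)

lemma flow_continuous_compose [continuous_intros]:
  assumes "continuous_on S f" "continuous_on S g"
  shows "continuous_on S (\<lambda>x. \<sigma> (f x) (g x))"
  using continuous_on_compose2[OF flow_continuous continuous_on_Pair[OF assms]] by simp

lemma a_continuous_compose [continuous_intros]:
  assumes "continuous_on S f" shows "continuous_on S (\<lambda>x. a (f x))"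
  using continuous_on_compose2[OF cont_a assms] by simp

definition a_bound :: real where "a_bound = 1 + (SUP \<omega>. \<bar>a \<omega>\<bar>)"

lemma abs_a_le: "\<bar>a \<omega>\<bar> \<le> a_bound" and a_bound_ge_1: "1 \<le> a_bound"
proof -
  have "compact (range (\<lambda>\<omega>. \<bar>a \<omega>\<bar>))"
    by (intro compact_continuous_image compact_base continuous_intros)
  then have bdd: "bdd_above (range (\<lambda>\<omega>. \<bar>a \<omega>\<bar>))" by (intro bounded_imp_bdd_above compact_imp_bounded)
  show *: "\<bar>a \<omega>\<bar> \<le> a_bound" for \<omega> using cSUP_upper[OF _ bdd, of \<omega>] by (simp add: a_bound_def)
  have "0 \<le> (SUP \<omega>. \<bar>a \<omega>\<bar>)" using cSUP_upper[OF _ bdd, of undefined] by (smt (verit) UNIV_I abs_ge_zero)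
  then show "1 \<le> a_bound" by (simp add: a_bound_def)
qed

text \<open>The per capita growth rate: a positive solution \<open>x\<close> has logarithmic derivative \<open>growth\<close>.\<close>

definition growth :: "real \<Rightarrow> 'w \<Rightarrow> real \<Rightarrow> real" where
  "growth l \<omega> x = - x\<^sup>2 + a \<omega> * x + l"

lemma cubic_growth: "cubic a l \<omega> x = growth l \<omega> x * x"
  by (simp add: cubic_def growth_def power2_eq_square power3_eq_cube algebra_simps)

text \<open>The secant slope of the cubic between \<open>x\<close> and \<open>y\<close>. The difference of two solutions of the same
  equation satisfies a linear equation with this coefficient, which yields uniqueness, preservation
  of order and continuous dependence at once.\<close>

definition secant :: "real \<Rightarrow> 'w \<Rightarrow> real \<Rightarrow> real \<Rightarrow> real" where
  "secant l \<omega> x y = - (x\<^sup>2 + x * y + y\<^sup>2) + a \<omega> * (x + y) + l"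

lemma cubic_diff:
  "cubic a l \<omega> x - cubic a l' \<omega>' y = secant l \<omega> x y * (x - y) + ((a \<omega> - a \<omega>') * y\<^sup>2 + (l - l') * y)"
  by (simp add: cubic_def secant_def power2_eq_square power3_eq_cube algebra_simps)

definition secant_bound :: "real \<Rightarrow> real \<Rightarrow> real" where
  "secant_bound l R = 3 * R\<^sup>2 + 2 * a_bound * R + \<bar>l\<bar>"

lemma secant_bound_nonneg: "0 \<le> R \<Longrightarrow> 0 \<le> secant_bound l R"
  using a_bound_ge_1 by (simp add: secant_bound_def)

lemma abs_secant_le: 
  assumes "\<bar>x\<bar> \<le> R" "\<bar>y\<bar> \<le> R" shows "\<bar>secant l \<omega> x y\<bar> \<le> secant_bound l R"
proof -
  have R: "0 \<le> R" using assms by simp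
  have m: "\<bar>p * q\<bar> \<le> R\<^sup>2" if "\<bar>p\<bar> \<le> R" "\<bar>q\<bar> \<le> R" for p q
    using mult_mono[OF that] R by (simp add: abs_mult power2_eq_square)
  have "\<bar>a \<omega> * (x + y)\<bar> \<le> a_bound * (2 * R)"
    unfolding abs_mult using abs_a_le[of \<omega>] assms by (intro mult_mono) auto
  moreover have "\<bar>x\<^sup>2\<bar> \<le> R\<^sup>2" "\<bar>x * y\<bar> \<le> R\<^sup>2" "\<bar>y\<^sup>2\<bar> \<le> R\<^sup>2"
    using m[of x x] m[of x y] m[of y y] assms by (auto simp: power2_eq_square)
  ultimately show ?thesis unfolding secant_def secant_bound_def by linarith
qed

text \<open>In contrast to \<open>solves\<close>, the set of times need not be an open interval around \<open>0\<close>: comparison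
  arguments use compact time intervals.\<close>

definition sol_on :: "real \<Rightarrow> 'w \<Rightarrow> real set \<Rightarrow> (real \<Rightarrow> real) \<Rightarrow> bool" where
  "sol_on l \<omega> J u \<longleftrightarrow> (\<forall>t\<in>J. (u has_real_derivative cubic a l (\<sigma> t \<omega>) (u t)) (at t))"

lemma sol_onD: "sol_on l \<omega> J u \<Longrightarrow> t \<in> J \<Longrightarrow> (u has_real_derivative cubic a l (\<sigma> t \<omega>) (u t)) (at t)"
  by (simp add: sol_on_def)

lemma sol_on_subset: "sol_on l \<omega> J u \<Longrightarrow> I \<subseteq> J \<Longrightarrow> sol_on l \<omega> I u" by (auto simp: sol_on_def)

lemma sol_on_zero: "sol_on l \<omega> J (\<lambda>_. 0)" by (simp add: sol_on_def cubic_def)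

lemma sol_on_continuous: "sol_on l \<omega> J u \<Longrightarrow> continuous_on J u"
  by (intro continuous_at_imp_continuous_on) (auto simp: sol_on_def intro!: DERIV_isCont)

lemma sol_on_shift: "sol_on l \<omega> J u \<Longrightarrow> (\<And>t. t \<in> I \<Longrightarrow> t + s \<in> J) \<Longrightarrow> sol_on l (\<sigma> s \<omega>) I (\<lambda>t. u (t + s))"
  unfolding sol_on_def
  by (auto simp: DERIV_shift[of u _ _ s, symmetric])

lemma sol_on_diff_deriv:
  assumes "sol_on l \<omega> J u" "sol_on l' \<omega>' J v" "t \<in> J"
  shows "((\<lambda>t. u t - v t) has_real_derivative 
    secant l (\<sigma> t \<omega>) (u t) (v t) * (u t - v t) + ((a (\<sigma> t \<omega>) - a (\<sigma> t \<omega>')) * (v t)\<^sup>2 + (l - l') * v t)) (at t)"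
  using DERIV_diff[OF sol_onD[OF assms(1,3)] sol_onD[OF assms(2,3)]] by (simp add: cubic_diff)

lemma sol_on_diff_growth:
  assumes "s \<le> t" "sol_on l \<omega> {s..t} u" "sol_on l \<omega> {s..t} v"
    and R: "\<And>\<tau>. \<tau> \<in> {s..t} \<Longrightarrow> \<bar>u \<tau>\<bar> \<le> R" "\<And>\<tau>. \<tau> \<in> {s..t} \<Longrightarrow> \<bar>v \<tau>\<bar> \<le> R"
  shows "\<bar>u t - v t\<bar> \<le> \<bar>u s - v s\<bar> * exp (secant_bound l R * (t - s))"
    and "\<bar>u s - v s\<bar> * exp (- secant_bound l R * (t - s)) \<le> \<bar>u t - v t\<bar>"
proof -
  let ?d' = "\<lambda>t. secant l (\<sigma> t \<omega>) (u t) (v t) * (u t - v t)"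
  have der: "((\<lambda>t. u t - v t) has_real_derivative ?d' \<tau>) (at \<tau>)" if "s \<le> \<tau>" "\<tau> \<le> t" for \<tau>
    using sol_on_diff_deriv[OF assms(2,3), of \<tau>] that by simp
  have b: "\<bar>secant l (\<sigma> \<tau> \<omega>) (u \<tau>) (v \<tau>)\<bar> \<le> secant_bound l R" if "s \<le> \<tau>" "\<tau> \<le> t" for \<tau>
    using R that by (intro abs_secant_le) auto
  show "\<bar>u t - v t\<bar> \<le> \<bar>u s - v s\<bar> * exp (secant_bound l R * (t - s))"
  proof (rule growth_upper[OF assms(1) der])
    fix \<tau> assume \<tau>: "s \<le> \<tau>" "\<tau> \<le> t"
    have "secant l (\<sigma> \<tau> \<omega>) (u \<tau>) (v \<tau>) * (u \<tau> - v \<tau>)\<^sup>2 \<le> secant_bound l R * (u \<tau> - v \<tau>)\<^sup>2"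
      using b[OF \<tau>] by (intro mult_right_mono) auto
    then show "(u \<tau> - v \<tau>) * ?d' \<tau> \<le> secant_bound l R * (u \<tau> - v \<tau>)\<^sup>2" by (simp add: power2_eq_square mult_ac)
  qed
  show "\<bar>u s - v s\<bar> * exp (- secant_bound l R * (t - s)) \<le> \<bar>u t - v t\<bar>"
  proof (rule growth_lower[OF assms(1) der])
    fix \<tau> assume \<tau>: "s \<le> \<tau>" "\<tau> \<le> t"
    have "- secant_bound l R * (u \<tau> - v \<tau>)\<^sup>2 \<le> secant l (\<sigma> \<tau> \<omega>) (u \<tau>) (v \<tau>) * (u \<tau> - v \<tau>)\<^sup>2"
      using b[OF \<tau>] by (intro mult_right_mono) auto
    then show "- secant_bound l R * (u \<tau> - v \<tau>)\<^sup>2 \<le> (u \<tau> - v \<tau>) * ?d' \<tau>" by (simp add: power2_eq_square mult_ac)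
  qed
qed

lemma sol_on_bounded_on:
  assumes "sol_on l \<omega> {s..t} u" 
  obtains R where "\<And>\<tau>. \<tau> \<in> {s..t} \<Longrightarrow> \<bar>u \<tau>\<bar> \<le> R"
proof -
  have "compact (u ` {s..t})" by (intro compact_continuous_image sol_on_continuous[OF assms]) auto
  then obtain b where "\<forall>x\<in>u ` {s..t}. \<bar>x\<bar> \<le> b" by (auto dest!: compact_imp_bounded simp: bounded_real)
  then show ?thesis using that[of b] by blast
qed

lemma sol_on_unique_ends:
  assumes "s \<le> t" "sol_on l \<omega> {s..t} u" "sol_on l \<omega> {s..t} v"
  shows "u s = v s \<longleftrightarrow> u t = v t"
proof -
  obtain R1 where R1: "\<And>\<tau>. \<tau> \<in> {s..t} \<Longrightarrow> \<bar>u \<tau>\<bar> \<le> R1" using sol_on_bounded_on[OF assms(2)] by blast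
  obtain R2 where R2: "\<And>\<tau>. \<tau> \<in> {s..t} \<Longrightarrow> \<bar>v \<tau>\<bar> \<le> R2" using sol_on_bounded_on[OF assms(3)] by blast
  note * = sol_on_diff_growth[OF assms, of "max R1 R2"]
  show ?thesis
    using * R1 R2 by (auto simp: le_max_iff_disj mult_le_0_iff)
qed

lemma sol_on_less_ends:
  assumes "s \<le> t" "sol_on l \<omega> {s..t} u" "sol_on l \<omega> {s..t} v"
  shows "u s < v s \<longleftrightarrow> u t < v t"
proof -
  have *: "u t < v t" if uv: "sol_on l \<omega> {s..t} u" "sol_on l \<omega> {s..t} v" "u s < v s" for u v
  proof (rule ccontr)
    assume "\<not> u t < v t"
    then have "\<exists>x\<ge>s. x \<le> t \<and> u x - v x = 0"
      using uv assms(1) by (intro IVT') (auto intro!: continuous_on_diff intro: sol_on_continuous)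
    then obtain x where x: "s \<le> x" "x \<le> t" "u x = v x" by auto
    then have "u s = v s"
      using sol_on_unique_ends[OF x(1), of l \<omega> u v] sol_on_subset[OF uv(1), of "{s..x}"] sol_on_subset[OF uv(2), of "{s..x}"] by auto
    then show False using uv(3) by simp
  qed
  show ?thesis
    using *[OF assms(2,3)] *[OF assms(3,2)] sol_on_unique_ends[OF assms]
    by (cases "u s = v s"; cases "u s < v s") auto
qed

lemma sol_on_le_ends:
  assumes "s \<le> t" "sol_on l \<omega> {s..t} u" "sol_on l \<omega> {s..t} v"
  shows "u s \<le> v s \<longleftrightarrow> u t \<le> v t"
  using sol_on_less_ends[OF assms(1,3,2)] by (simp add: not_less[symmetric])

subsection \<open>The maximal solution\<close>

lemma solves_sol_on: "solves \<sigma> (cubic a l) \<omega> x I u \<longleftrightarrow> open I \<and> is_interval I \<and> 0 \<in> I \<and> u 0 = x \<and> sol_on l \<omega> I u"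
  by (simp add: solves_def sol_on_def)

lemma solves_unique:
  assumes "solves \<sigma> (cubic a l) \<omega> x I u" "solves \<sigma> (cubic a l) \<omega> x J v" "t \<in> I" "t \<in> J"
  shows "u t = v t"
proof -
  have sub: "{s..r} \<subseteq> K" if "is_interval K" "s \<in> K" "r \<in> K" for s r and K :: "real set"
    using that by (meson atLeastAtMost_iff mem_is_interval_1_I subsetI)
  note A = assms[unfolded solves_sol_on]
  show ?thesis
  proof (cases "0 \<le> t")
    case True
    then show ?thesis using sol_on_unique_ends[of 0 t l \<omega> u v] A sub[of I 0 t] sub[of J 0 t]
      by (auto intro: sol_on_subset)
  next
    case False
    then show ?thesis using sol_on_unique_ends[of t 0 l \<omega> u v] A sub[of I t 0] sub[of J t 0]
      by (auto intro: sol_on_subset)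
  qed
qed

lemma sol_eq:
  assumes "solves \<sigma> (cubic a l) \<omega> x I u" "t \<in> I"
  shows "t \<in> sol_dom \<sigma> (cubic a l) \<omega> x" "sol \<sigma> (cubic a l) t \<omega> x = u t"
proof -
  show "t \<in> sol_dom \<sigma> (cubic a l) \<omega> x" using assms by (auto simp: sol_dom_def)
  show "sol \<sigma> (cubic a l) t \<omega> x = u t"
    unfolding sol_def
  proof (rule the_equality)
    show "\<exists>I ua. solves \<sigma> (cubic a l) \<omega> x I ua \<and> t \<in> I \<and> u t = ua t" using assms by blast
    show "y = u t" if "\<exists>I u. solves \<sigma> (cubic a l) \<omega> x I u \<and> t \<in> I \<and> y = u t" for y
      using that solves_unique[OF assms(1)] assms(2) by metis
  qed
qed

lemma sol_on_sol: "sol_on l \<omega> (sol_dom \<sigma> (cubic a l) \<omega> x) (\<lambda>t. sol \<sigma> (cubic a l) t \<omega> x)"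
  unfolding sol_on_def
proof
  fix t assume "t \<in> sol_dom \<sigma> (cubic a l) \<omega> x"
  then obtain I u where I: "solves \<sigma> (cubic a l) \<omega> x I u" "t \<in> I" by (auto simp: sol_dom_def)
  have "(u has_real_derivative cubic a l (\<sigma> t \<omega>) (u t)) (at t)" "open I" using I by (auto simp: solves_sol_on sol_on_def)
  then have "((\<lambda>t. sol \<sigma> (cubic a l) t \<omega> x) has_real_derivative cubic a l (\<sigma> t \<omega>) (u t)) (at t)"
    by (rule has_field_derivative_transform_within_open) (use I in \<open>auto simp: sol_eq(2)\<close>)
  then show "((\<lambda>t. sol \<sigma> (cubic a l) t \<omega> x) has_real_derivative
          cubic a l (\<sigma> t \<omega>) (sol \<sigma> (cubic a l) t \<omega> x)) (at t)"
    by (simp add: sol_eq(2)[OF I])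
qed

lemma sol_dom_interval:
  "open (sol_dom \<sigma> (cubic a l) \<omega> x)" "is_interval (sol_dom \<sigma> (cubic a l) \<omega> x)"
proof -
  show "open (sol_dom \<sigma> (cubic a l) \<omega> x)" by (auto simp: sol_dom_def solves_def intro!: open_Union)
  have "connected (\<Union>{I. \<exists>u. solves \<sigma> (cubic a l) \<omega> x I u})"
    by (rule connected_Union) (auto simp: solves_def is_interval_connected_1)
  then show "is_interval (sol_dom \<sigma> (cubic a l) \<omega> x)"
    by (simp add: sol_dom_def is_interval_connected_1)
qed

lemma sol_entire:
  assumes "sol_on l \<omega> UNIV u"
  shows "t \<in> sol_dom \<sigma> (cubic a l) \<omega> (u 0)" "sol \<sigma> (cubic a l) t \<omega> (u 0) = u t"
  using sol_eq[of l \<omega> "u 0" UNIV u t] assms by (auto simp: solves_sol_on)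

lemma sol_0: "0 \<in> sol_dom \<sigma> (cubic a l) \<omega> x \<Longrightarrow> sol \<sigma> (cubic a l) 0 \<omega> x = x"
proof -
  assume "0 \<in> sol_dom \<sigma> (cubic a l) \<omega> x"
  then obtain I u where I: "solves \<sigma> (cubic a l) \<omega> x I u" "0 \<in> I" by (auto simp: sol_dom_def)
  then show ?thesis using sol_eq(2)[OF I] by (simp add: solves_def)
qed

lemma sol_zero: "t \<in> sol_dom \<sigma> (cubic a l) \<omega> 0" "sol \<sigma> (cubic a l) t \<omega> 0 = 0"
  using sol_entire[where u = "\<lambda>_. 0", OF sol_on_zero] by auto

lemma sol_flow:
  assumes "s \<in> sol_dom \<sigma> (cubic a l) \<omega> x" "s + t \<in> sol_dom \<sigma> (cubic a l) \<omega> x"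
  shows "t \<in> sol_dom \<sigma> (cubic a l) (\<sigma> s \<omega>) (sol \<sigma> (cubic a l) s \<omega> x)"
    "sol \<sigma> (cubic a l) t (\<sigma> s \<omega>) (sol \<sigma> (cubic a l) s \<omega> x) = sol \<sigma> (cubic a l) (s + t) \<omega> x"
proof -
  let ?D = "sol_dom \<sigma> (cubic a l) \<omega> x"
  have "solves \<sigma> (cubic a l) (\<sigma> s \<omega>) (sol \<sigma> (cubic a l) s \<omega> x) {t. t + s \<in> ?D} (\<lambda>t. sol \<sigma> (cubic a l) (t + s) \<omega> x)"
    unfolding solves_sol_on
  proof (intro conjI)
    have "{t. t + s \<in> ?D} = (\<lambda>t. t + s) -` ?D" by auto
    then show "open {t. t + s \<in> ?D}" by (auto intro!: open_vimage sol_dom_interval continuous_intros)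
    show "is_interval {t. t + s \<in> ?D}"
      unfolding is_interval_1
    proof (intro ballI allI impI)
      fix p q r assume "p \<in> {t. t + s \<in> ?D}" "q \<in> {t. t + s \<in> ?D}" "p \<le> r \<and> r \<le> q"
      then show "r \<in> {t. t + s \<in> ?D}"
        using mem_is_interval_1_I[OF sol_dom_interval(2)[of l \<omega> x], of "p + s" "q + s" "r + s"] by simp
    qed
    show "sol_on l (\<sigma> s \<omega>) {t. t + s \<in> ?D} (\<lambda>t. sol \<sigma> (cubic a l) (t + s) \<omega> x)"
      by (rule sol_on_shift[OF sol_on_sol]) auto
  qed (use assms in auto)
  from sol_eq[OF this, of t] assms
  show "t \<in> sol_dom \<sigma> (cubic a l) (\<sigma> s \<omega>) (sol \<sigma> (cubic a l) s \<omega> x)"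
    "sol \<sigma> (cubic a l) t (\<sigma> s \<omega>) (sol \<sigma> (cubic a l) s \<omega> x) = sol \<sigma> (cubic a l) (s + t) \<omega> x"
    by (auto simp: add.commute)
qed

end

section \<open>The attractor\<close>

lemma mem_band: "(\<omega>, x) \<in> band p q \<longleftrightarrow> p \<omega> \<le> x \<and> x \<le> q \<omega>"
  by (auto simp: band_def)

lemma hausdorff_semidist_lessD:
  assumes "hausdorff_semidist A B < ennreal e" "p \<in> A"
  obtains q where "q \<in> B" "dist p q < e"
proof -
  have "(INF q\<in>B. ennreal (dist p q)) \<le> hausdorff_semidist A B"
    unfolding hausdorff_semidist_def using assms(2) by (intro SUP_upper)
  also note assms(1)
  finally obtain q where "q \<in> B" "ennreal (dist p q) < ennreal e" by (auto simp: INF_less_iff)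
  then show ?thesis using that by (auto simp: ennreal_less_iff)
qed

text \<open>The attractor is the only source of solutions on long time intervals: all solutions exist in
  forward time, and those in the attractor exist for all times.\<close>

locale cubic_family = base_flow \<sigma> a
  for \<sigma> :: "real \<Rightarrow> 'w::metric_space \<Rightarrow> 'w" and a :: "'w \<Rightarrow> real" +
  fixes \<alpha> \<beta> :: "real \<Rightarrow> 'w \<Rightarrow> real"
  assumes attractor: "\<And>l. is_global_attractor \<sigma> (cubic a l) (band (\<alpha> l) (\<beta> l))"
begin

abbreviation S :: "real \<Rightarrow> real \<Rightarrow> 'w \<Rightarrow> real \<Rightarrow> real" where
  "S l t \<omega> x \<equiv> sol \<sigma> (cubic a l) t \<omega> x"

abbreviation dom :: "real \<Rightarrow> 'w \<Rightarrow> real \<Rightarrow> real set" where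
  "dom l \<omega> x \<equiv> sol_dom \<sigma> (cubic a l) \<omega> x"

abbreviation attr :: "real \<Rightarrow> ('w \<times> real) set" where
  "attr l \<equiv> band (\<alpha> l) (\<beta> l)"

lemma fwd_dom: "0 \<le> t \<Longrightarrow> t \<in> dom l \<omega> x"
  using attractor[of l] unfolding is_global_attractor_def by (auto dest: spec[of _ "{(\<omega>, x)}"])

lemma fwd_sol_on: "sol_on l \<omega> {0..} (\<lambda>t. S l t \<omega> x)"
  by (rule sol_on_subset[OF sol_on_sol]) (auto intro: fwd_dom)

lemma fwd_sol_on': "sol_on l \<omega> {0..t} (\<lambda>t. S l t \<omega> x)"
  by (rule sol_on_subset[OF fwd_sol_on]) auto

lemma S_0 [simp]: "S l 0 \<omega> x = x" by (rule sol_0[OF fwd_dom]) simp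

lemma S_zero [simp]: "S l t \<omega> 0 = 0" by (rule sol_zero)

lemma S_add: "0 \<le> s \<Longrightarrow> 0 \<le> t \<Longrightarrow> S l t (\<sigma> s \<omega>) (S l s \<omega> x) = S l (s + t) \<omega> x"
  by (intro sol_flow fwd_dom) auto

lemma S_eq: "0 \<le> t \<Longrightarrow> sol_on l \<omega> {0..t} u \<Longrightarrow> u 0 = x \<Longrightarrow> S l t \<omega> x = u t"
  using sol_on_unique_ends[OF _ fwd_sol_on', of t l \<omega> u x] by auto

lemma S_mono: "0 \<le> t \<Longrightarrow> S l t \<omega> x \<le> S l t \<omega> y \<longleftrightarrow> x \<le> y"
  using sol_on_le_ends[OF _ fwd_sol_on' fwd_sol_on', of t l \<omega> x y] by simp

lemma S_strict_mono: "0 \<le> t \<Longrightarrow> S l t \<omega> x < S l t \<omega> y \<longleftrightarrow> x < y"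
  using S_mono[of t l \<omega> y x] by linarith

lemma S_nonneg: "0 \<le> t \<Longrightarrow> 0 \<le> S l t \<omega> x \<longleftrightarrow> 0 \<le> x"
  using S_mono[of t l \<omega> 0 x] by simp

lemma S_pos: "0 \<le> t \<Longrightarrow> 0 < S l t \<omega> x \<longleftrightarrow> 0 < x"
  using S_strict_mono[of t l \<omega> 0 x] by simp

lemma S_deriv: "0 \<le> t \<Longrightarrow> ((\<lambda>t. S l t \<omega> x) has_real_derivative growth l (\<sigma> t \<omega>) (S l t \<omega> x) * S l t \<omega> x) (at t)"
  using sol_onD[OF fwd_sol_on, of t l \<omega> x] by (simp add: cubic_growth)

text \<open>Solutions above this level do not increase.\<close>

definition absorbing_level :: "real \<Rightarrow> real" where "absorbing_level l = a_bound + \<bar>l\<bar>"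

lemma absorbing_level_pos: "1 \<le> absorbing_level l" using a_bound_ge_1 by (simp add: absorbing_level_def)

lemma growth_nonpos_above_level: 
  assumes "absorbing_level l \<le> x" shows "growth l \<omega> x \<le> 0"
proof -
  have x: "1 \<le> x" using assms absorbing_level_pos[of l] by linarith
  have "a \<omega> * x \<le> a_bound * x" using abs_a_le[of \<omega>] x by (intro mult_right_mono) auto
  moreover have "\<bar>l\<bar> * 1 \<le> (x - a_bound) * x" using assms x by (intro mult_mono) (auto simp: absorbing_level_def)
  ultimately show ?thesis unfolding growth_def by (simp add: power2_eq_square algebra_simps)
qed

lemma S_le_absorbing_level:
  assumes "0 \<le> t" "x \<le> X" "absorbing_level l \<le> X" shows "S l t \<omega> x \<le> X"
proof (rule barrier_le[OF assms(1), where u = "\<lambda>t. S l t \<omega> x"])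
  show "((\<lambda>t. S l t \<omega> x) has_real_derivative growth l (\<sigma> \<tau> \<omega>) (S l \<tau> \<omega> x) * S l \<tau> \<omega> x) (at \<tau>)" if "0 \<le> \<tau>" for \<tau>
    using S_deriv that by blast
  show "growth l (\<sigma> \<tau> \<omega>) (S l \<tau> \<omega> x) * S l \<tau> \<omega> x \<le> 0" if "X < S l \<tau> \<omega> x" for \<tau>
    using that assms absorbing_level_pos[of l] by (intro mult_nonpos_nonneg growth_nonpos_above_level) auto
qed (use assms in auto)

lemma S_abs_le:
  assumes "0 \<le> t" "0 \<le> x" "x \<le> X" "absorbing_level l \<le> X" shows "\<bar>S l t \<omega> x\<bar> \<le> X"
  using S_le_absorbing_level[OF assms(1,3,4), of \<omega>] S_nonneg[OF assms(1), of l \<omega> x] assms(2) by auto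

subsection \<open>Elementary properties of the attractor\<close>

lemma attr_compact: "compact (attr l)"
  and attr_invariant: "invariant_set \<sigma> (cubic a l) (attr l)"
  using attractor[of l] by (auto simp: is_global_attractor_def)

lemma attr_dom: "(\<omega>, x) \<in> attr l \<Longrightarrow> dom l \<omega> x = UNIV"
  using attr_invariant[of l] by (auto simp: invariant_set_def)

lemma attr_sol_on: "(\<omega>, x) \<in> attr l \<Longrightarrow> sol_on l \<omega> UNIV (\<lambda>t. S l t \<omega> x)"
  using sol_on_sol[of l \<omega> x] by (simp add: attr_dom)

lemma attr_S: "(\<omega>, x) \<in> attr l \<Longrightarrow> (\<sigma> t \<omega>, S l t \<omega> x) \<in> attr l"
  using attr_invariant[of l] by (auto simp: invariant_set_def skew_def)

lemma attr_S_add: "(\<omega>, x) \<in> attr l \<Longrightarrow> S l t (\<sigma> s \<omega>) (S l s \<omega> x) = S l (s + t) \<omega> x"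
  by (intro sol_flow) (auto simp: attr_dom)

lemma attracts:
  assumes "bounded C" "0 < e"
  shows "\<forall>\<^sub>F t in at_top. \<forall>(\<omega>, x)\<in>C. \<exists>q\<in>attr l. dist (\<sigma> t \<omega>, S l t \<omega> x) q < e"
proof -
  have "((\<lambda>t. hausdorff_semidist (skew \<sigma> (cubic a l) t ` C) (attr l)) \<longlongrightarrow> 0) at_top"
    using attractor[of l] assms(1) by (auto simp: is_global_attractor_def)
  then have "\<forall>\<^sub>F t in at_top. hausdorff_semidist (skew \<sigma> (cubic a l) t ` C) (attr l) < ennreal e"
    by (rule order_tendstoD) (use assms(2) in simp)
  then show ?thesis
  proof eventually_elim
    case (elim t)
    show ?case
    proof clarify
      fix \<omega> x assume "(\<omega>, x) \<in> C"
      then have "(\<sigma> t \<omega>, S l t \<omega> x) \<in> skew \<sigma> (cubic a l) t ` C" by (force simp: skew_def)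
      from hausdorff_semidist_lessD[OF elim this] show "\<exists>q\<in>attr l. dist (\<sigma> t \<omega>, S l t \<omega> x) q < e" by blast
    qed
  qed
qed

text \<open>A point of a bounded orbit at time \<open>0\<close> was in a fixed bounded set at time \<open>-t\<close>, for every \<open>t\<close>;
  hence it is arbitrarily close to the attractor.\<close>

lemma bounded_entire_in_attr:
  assumes u: "sol_on l \<omega> UNIV u" and R: "\<And>t. \<bar>u t\<bar> \<le> R"
  shows "(\<omega>, u 0) \<in> attr l"
proof -
  define C where "C = (UNIV :: 'w set) \<times> {- R..R}"
  have C: "bounded C" unfolding C_def by (intro compact_imp_bounded compact_Times compact_base compact_Icc)
  have "(\<omega>, u 0) \<in> closure (attr l)"
    unfolding closure_approachable
  proof (intro allI impI)
    fix e :: real assume "0 < e"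
    from attracts[OF C this, of l] obtain t where
      t: "0 \<le> t" "\<forall>(\<omega>, x)\<in>C. \<exists>q\<in>attr l. dist (\<sigma> t \<omega>, S l t \<omega> x) q < e"
      by (metis (mono_tags, lifting) eventually_at_top_linorder linorder_linear)
    have "(\<sigma> (- t) \<omega>, u (- t)) \<in> C" using R[of "- t"] by (auto simp: C_def abs_le_iff)
    then obtain q where q: "q \<in> attr l" "dist (\<sigma> t (\<sigma> (- t) \<omega>), S l t (\<sigma> (- t) \<omega>) (u (- t))) q < e"
      using t(2) by blast
    have "S l t (\<sigma> (- t) \<omega>) (u (- t)) = u (t + (- t))"
      by (rule S_eq[OF t(1) sol_on_shift[OF u]]) auto
    then show "\<exists>y\<in>attr l. dist y (\<omega>, u 0) < e" using q by (auto simp: dist_commute)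
  qed
  then show ?thesis using attr_compact[of l] by (simp add: compact_imp_closed closure_closed)
qed

lemma alpha_le_0: "\<alpha> l \<omega> \<le> 0" and beta_ge_0: "0 \<le> \<beta> l \<omega>"
  using bounded_entire_in_attr[OF sol_on_zero, of 0] by (auto simp: mem_band)

lemma beta_in_attr: "(\<omega>, \<beta> l \<omega>) \<in> attr l"
  using alpha_le_0[of l \<omega>] beta_ge_0[of l \<omega>] by (simp add: mem_band)

lemma in_attrI: "0 \<le> x \<Longrightarrow> x \<le> \<beta> l \<omega> \<Longrightarrow> (\<omega>, x) \<in> attr l"
  using alpha_le_0[of l \<omega>] by (simp add: mem_band)

text \<open>Invariance of the attractor gives \<open>\<le>\<close> at all times, positive and negative; the other inequality is the
  former one for the inverse time, since solutions preserve the order.\<close>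

lemma beta_flow: "S l t \<omega> (\<beta> l \<omega>) = \<beta> l (\<sigma> t \<omega>)"
proof (rule antisym)
  show *: "S l t \<omega> (\<beta> l \<omega>) \<le> \<beta> l (\<sigma> t \<omega>)" for t \<omega>
    using attr_S[OF beta_in_attr[of \<omega> l], of t] by (simp add: mem_band)
  show "\<beta> l (\<sigma> t \<omega>) \<le> S l t \<omega> (\<beta> l \<omega>)"
  proof -
    let ?v = "\<lambda>r. S l (r + - t) (\<sigma> t \<omega>) (\<beta> l (\<sigma> t \<omega>))"
    have v: "sol_on l \<omega> UNIV ?v" using sol_on_shift[OF attr_sol_on[OF beta_in_attr[of "\<sigma> t \<omega>" l]], of UNIV "- t"] by simp
    have u: "sol_on l \<omega> UNIV (\<lambda>t. S l t \<omega> (\<beta> l \<omega>))" by (rule attr_sol_on[OF beta_in_attr])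
    have le: "?v 0 \<le> S l 0 \<omega> (\<beta> l \<omega>)" using *[of "- t" "\<sigma> t \<omega>"] by simp
    have "?v t \<le> S l t \<omega> (\<beta> l \<omega>)"
    proof (cases "0 \<le> t")
      case True
      then show ?thesis using sol_on_le_ends[OF _ sol_on_subset[OF v] sol_on_subset[OF u], of 0 t] le by simp
    next
      case False
      then show ?thesis using sol_on_le_ends[OF _ sol_on_subset[OF v] sol_on_subset[OF u], of t 0] le by simp
    qed
    then show ?thesis by simp
  qed
qed

lemma compact_snd_bound:
  fixes K :: "('w \<times> real) set"
  assumes "compact K" obtains R where "0 < R" "\<And>\<omega> x. (\<omega>, x) \<in> K \<Longrightarrow> \<bar>x\<bar> \<le> R"
proof -
  have "compact (snd ` K)" by (intro compact_continuous_image assms continuous_intros)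
  then obtain R where "0 < R" "\<And>x. x \<in> snd ` K \<Longrightarrow> norm x \<le> R"
    using compact_imp_bounded[THEN bounded_pos[THEN iffD1]] by metis
  then show ?thesis using that[of R] by force
qed

lemma beta_bounded: obtains R where "0 < R" "\<And>\<omega>. \<beta> l \<omega> \<le> R"
  using compact_snd_bound[OF attr_compact[of l]] beta_in_attr by (metis abs_le_D1)

lemma closed_superlevel:
  fixes K :: "('w \<times> real) set"
  assumes "compact K" "\<And>\<omega>. (\<omega>, b \<omega>) \<in> K" "\<And>\<omega> x. (\<omega>, x) \<in> K \<Longrightarrow> x \<le> b \<omega>"
  shows "closed {\<omega>. y \<le> (b \<omega> :: real)}"
proof -
  have "closed (UNIV \<times> {y..} :: ('w \<times> real) set)" by (intro closed_Times) auto
  then have "compact (fst ` (K \<inter> UNIV \<times> {y..}))"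
    by (intro compact_continuous_image compact_Int_closed assms continuous_intros)
  moreover have "fst ` (K \<inter> UNIV \<times> {y..}) = {\<omega>. y \<le> b \<omega>}"
    using assms(2,3) by force
  ultimately show ?thesis by (simp add: compact_imp_closed)
qed

lemma beta_superlevel: "closed {\<omega>. y \<le> \<beta> l \<omega>}"
  by (rule closed_superlevel[OF attr_compact beta_in_attr]) (simp add: mem_band)

text \<open>The tool for bounding \<open>\<beta>\<close> from below: if solutions that start at bounded values further and further
  in the past arrive over \<open>\<omega>\<close> above \<open>w\<close>, then by attraction some point of the attractor over \<open>\<omega>\<close> is
  above \<open>w\<close>.\<close>

lemma pullback_le:
  assumes t: "filterlim t at_top sequentially" and x: "\<And>n. \<bar>x n\<bar> \<le> R"
    and w: "\<And>n. w \<le> S l (t n) (\<sigma> (- t n) \<omega>) (x n)"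
  shows "w \<le> \<beta> l \<omega>"
proof -
  define C where "C = (UNIV :: 'w set) \<times> {- R..R}"
  have C: "bounded C" unfolding C_def by (intro compact_imp_bounded compact_Times compact_base compact_Icc)
  have "\<exists>q\<in>attr l. dist \<omega> (fst q) < inverse (Suc n) \<and> w - inverse (Suc n) < snd q" for n
  proof -
    have "\<forall>\<^sub>F k in sequentially. \<forall>(\<omega>, x)\<in>C. \<exists>q\<in>attr l. dist (\<sigma> (t k) \<omega>, S l (t k) \<omega> x) q < inverse (Suc n)"
      using attracts[OF C, of "inverse (Suc n)" l] t by (auto elim: eventually_compose_filterlim)
    then obtain k where k: "\<forall>(\<omega>, x)\<in>C. \<exists>q\<in>attr l. dist (\<sigma> (t k) \<omega>, S l (t k) \<omega> x) q < inverse (Suc n)"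
      by (auto simp: eventually_sequentially)
    have "(\<sigma> (- t k) \<omega>, x k) \<in> C" using x[of k] by (auto simp: C_def abs_le_iff)
    then obtain q where q: "q \<in> attr l" "dist (\<sigma> (t k) (\<sigma> (- t k) \<omega>), S l (t k) (\<sigma> (- t k) \<omega>) (x k)) q < inverse (Suc n)"
      using k by blast
    have "dist \<omega> (fst q) < inverse (Suc n)" 
      using q(2) dist_fst_le[of "(\<sigma> (t k) (\<sigma> (- t k) \<omega>), S l (t k) (\<sigma> (- t k) \<omega>) (x k))" q] by simp
    moreover have "w - inverse (Suc n) < snd q"
      using q(2) dist_snd_le[of "(\<sigma> (t k) (\<sigma> (- t k) \<omega>), S l (t k) (\<sigma> (- t k) \<omega>) (x k))" q] w[of k]
      by (auto simp: dist_real_def)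
    ultimately show ?thesis using q(1) by blast
  qed
  then obtain q where q: "\<And>n. q n \<in> attr l" "\<And>n. dist \<omega> (fst (q n)) < inverse (Suc n)" "\<And>n. w - inverse (Suc n) < snd (q n)"
    by metis
  obtain p r where p: "p \<in> attr l" "strict_mono r" "(q \<circ> r) \<longlonglongrightarrow> p"
    using attr_compact[of l] q(1) unfolding compact_def by metis
  have inv: "(\<lambda>n. inverse (real (Suc (r n)))) \<longlonglongrightarrow> 0"
    using LIMSEQ_subseq_LIMSEQ[OF LIMSEQ_inverse_real_of_nat p(2)] by (simp add: o_def)
  have "(\<lambda>n. dist \<omega> (fst (q (r n)))) \<longlonglongrightarrow> 0"
    by (rule tendsto_sandwich[OF _ _ tendsto_const inv]) (use q(2) in \<open>auto intro!: always_eventually less_imp_le\<close>)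
  then have "(\<lambda>n. fst (q (r n))) \<longlonglongrightarrow> \<omega>" by (simp add: tendsto_dist_iff[of _ \<omega>] dist_commute)
  moreover have "(\<lambda>n. fst (q (r n))) \<longlonglongrightarrow> fst p" using tendsto_fst[OF p(3)] by (simp add: o_def)
  ultimately have "fst p = \<omega>" using LIMSEQ_unique by blast
  have lim_snd: "(\<lambda>n. snd (q (r n))) \<longlonglongrightarrow> snd p" using tendsto_snd[OF p(3)] by (simp add: o_def)
  have "(\<lambda>n. w - inverse (real (Suc (r n)))) \<longlonglongrightarrow> w" using tendsto_diff[OF tendsto_const inv, of w] by simp
  from LIMSEQ_le[OF this lim_snd] have "w \<le> snd p" using q(3) by (auto intro: less_imp_le)
  also have "\<dots> \<le> \<beta> l \<omega>" using p(1) \<open>fst p = \<omega>\<close> by (metis mem_band prod.collapse)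
  finally show ?thesis .
qed

subsection \<open>Continuous dependence\<close>

text \<open>Continuity of the flow on \<open>{0..t}\<close> times the compact base is uniform, so a small change of the
  base point changes the coefficient little during the whole time interval.\<close>

lemma a_flow_uniform:
  assumes "0 < e"
  shows "\<forall>\<^sub>F \<eta> in nhds \<omega>. \<forall>\<tau>\<in>{0..t}. \<bar>a (\<sigma> \<tau> \<eta>) - a (\<sigma> \<tau> \<omega>)\<bar> < e"
proof -
  have "uniformly_continuous_on ({0..t} \<times> UNIV) (\<lambda>(\<tau>, \<eta>). a (\<sigma> \<tau> \<eta>))"
    by (intro compact_uniformly_continuous compact_Times compact_base compact_Icc)
      (auto simp: case_prod_unfold intro!: continuous_intros)
  then obtain d where d: "0 < d" "\<And>p q. p \<in> {0..t} \<times> UNIV \<Longrightarrow> q \<in> {0..t} \<times> UNIV \<Longrightarrow> dist q p < d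
      \<Longrightarrow> dist ((\<lambda>(\<tau>, \<eta>). a (\<sigma> \<tau> \<eta>)) q) ((\<lambda>(\<tau>, \<eta>). a (\<sigma> \<tau> \<eta>)) p) < e"
    using assms unfolding uniformly_continuous_on_def by metis
  show ?thesis
    unfolding eventually_nhds_metric
  proof (intro exI conjI allI impI ballI)
    fix \<eta> \<tau> assume "dist \<eta> \<omega> < d" "\<tau> \<in> {0..t}"
    then show "\<bar>a (\<sigma> \<tau> \<eta>) - a (\<sigma> \<tau> \<omega>)\<bar> < e"
      using d(2)[of "(\<tau>, \<omega>)" "(\<tau>, \<eta>)"] by (simp add: dist_Pair_Pair dist_real_def)
  qed (fact d(1))
qed

lemma sol_on_dependence:
  assumes t: "0 \<le> t" and u: "sol_on l \<omega> {0..t} u" and v: "sol_on l' \<omega>' {0..t} v"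
    and R: "\<And>\<tau>. \<tau> \<in> {0..t} \<Longrightarrow> \<bar>u \<tau>\<bar> \<le> R" "\<And>\<tau>. \<tau> \<in> {0..t} \<Longrightarrow> \<bar>v \<tau>\<bar> \<le> R"
    and e: "\<And>\<tau>. \<tau> \<in> {0..t} \<Longrightarrow> \<bar>a (\<sigma> \<tau> \<omega>) - a (\<sigma> \<tau> \<omega>')\<bar> \<le> e"
  shows "(u t - v t)\<^sup>2 \<le> exp ((2 * secant_bound l R + 1) * t) * ((u 0 - v 0)\<^sup>2 + (e * R\<^sup>2 + \<bar>l - l'\<bar> * R)\<^sup>2 * t)"
proof -
  have R0: "0 \<le> R" using R(1)[of 0] t by (auto intro: order_trans[OF abs_ge_zero])
  have e0: "0 \<le> e" using e[of 0] t by (auto intro: order_trans[OF abs_ge_zero])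
  have "(u t - v t)\<^sup>2 \<le> exp ((2 * secant_bound l R + 1) * (t - 0)) * ((u 0 - v 0)\<^sup>2 + (e * R\<^sup>2 + \<bar>l - l'\<bar> * R)\<^sup>2 * (t - 0))"
  proof (rule gronwall_square[OF t, where d = "\<lambda>t. u t - v t"])
    fix \<tau> assume \<tau>: "0 \<le> \<tau>" "\<tau> \<le> t"
    then show "((\<lambda>t. u t - v t) has_real_derivative secant l (\<sigma> \<tau> \<omega>) (u \<tau>) (v \<tau>) * (u \<tau> - v \<tau>)
        + ((a (\<sigma> \<tau> \<omega>) - a (\<sigma> \<tau> \<omega>')) * (v \<tau>)\<^sup>2 + (l - l') * v \<tau>)) (at \<tau>)"
      by (intro sol_on_diff_deriv[OF u v]) auto
    have "\<bar>secant l (\<sigma> \<tau> \<omega>) (u \<tau>) (v \<tau>) * (u \<tau> - v \<tau>)\<bar> \<le> secant_bound l R * \<bar>u \<tau> - v \<tau>\<bar>"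
      unfolding abs_mult using R \<tau> by (intro mult_right_mono abs_secant_le) auto
    moreover have "\<bar>(a (\<sigma> \<tau> \<omega>) - a (\<sigma> \<tau> \<omega>')) * (v \<tau>)\<^sup>2\<bar> \<le> e * R\<^sup>2"
      unfolding abs_mult using R(2)[of \<tau>] R0 \<tau> e[of \<tau>] e0
      by (intro mult_mono) (auto simp: abs_le_square_iff[symmetric])
    moreover have "\<bar>(l - l') * v \<tau>\<bar> \<le> \<bar>l - l'\<bar> * R"
      unfolding abs_mult using R \<tau> by (intro mult_left_mono) auto
    ultimately show "\<bar>secant l (\<sigma> \<tau> \<omega>) (u \<tau>) (v \<tau>) * (u \<tau> - v \<tau>)
        + ((a (\<sigma> \<tau> \<omega>) - a (\<sigma> \<tau> \<omega>')) * (v \<tau>)\<^sup>2 + (l - l') * v \<tau>)\<bar> \<le> secant_bound l R * \<bar>u \<tau> - v \<tau>\<bar> + (e * R\<^sup>2 + \<bar>l - l'\<bar> * R)"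
      by linarith
  qed (use R0 in \<open>auto intro: secant_bound_nonneg\<close>)
  then show ?thesis by simp
qed

lemma S_tendsto:
  assumes t: "0 \<le> t" and lim: "(p \<longlongrightarrow> l) F" "(f \<longlongrightarrow> \<omega>) F" "(x \<longlongrightarrow> x0) F"
    and x: "\<forall>\<^sub>F n in F. 0 \<le> x n" "0 \<le> x0"
  shows "((\<lambda>n. S (p n) t (f n) (x n)) \<longlongrightarrow> S l t \<omega> x0) F"
proof -
  define R where "R = max (x0 + 1) (absorbing_level l + 1)"
  define K where "K = exp ((2 * secant_bound l R + 1) * t)"
  have R: "0 < R" using absorbing_level_pos[of l] by (auto simp: R_def)
  have K: "0 < K" by (simp add: K_def)
  have "((\<lambda>n. S (p n) t (f n) (x n) - S l t \<omega> x0) \<longlongrightarrow> 0) F"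
  proof (rule tendstoI)
    fix \<epsilon> :: real assume \<epsilon>: "0 < \<epsilon>"
    have tn: "((\<lambda>n. K * ((x0 - x n)\<^sup>2 + (e * R\<^sup>2 + \<bar>l - p n\<bar> * R)\<^sup>2 * t)) \<longlongrightarrow> K * ((x0 - x0)\<^sup>2 + (e * R\<^sup>2 + \<bar>l - l\<bar> * R)\<^sup>2 * t)) F" for e
      by (intro tendsto_intros lim)
    have "((\<lambda>e. K * ((x0 - x0)\<^sup>2 + (e * R\<^sup>2 + \<bar>l - l\<bar> * R)\<^sup>2 * t)) \<longlongrightarrow> K * ((x0 - x0)\<^sup>2 + (0 * R\<^sup>2 + \<bar>l - l\<bar> * R)\<^sup>2 * t)) (at_right 0)"
      by (intro tendsto_intros)
    then have "\<forall>\<^sub>F e in at_right 0. K * ((x0 - x0)\<^sup>2 + (e * R\<^sup>2 + \<bar>l - l\<bar> * R)\<^sup>2 * t) < \<epsilon>\<^sup>2"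
      by (rule order_tendstoD) (use \<epsilon> in simp)
    then obtain e where e: "0 < e" "K * ((x0 - x0)\<^sup>2 + (e * R\<^sup>2 + \<bar>l - l\<bar> * R)\<^sup>2 * t) < \<epsilon>\<^sup>2"
      by (metis (mono_tags, lifting) eventually_at_right_field dense)
    have ev1: "\<forall>\<^sub>F n in F. K * ((x0 - x n)\<^sup>2 + (e * R\<^sup>2 + \<bar>l - p n\<bar> * R)\<^sup>2 * t) < \<epsilon>\<^sup>2"
      by (rule order_tendstoD(2)[OF tn e(2)])
    have ev2: "\<forall>\<^sub>F n in F. x n < x0 + 1" by (rule order_tendstoD(2)[OF lim(3)]) simp
    have "((\<lambda>n. absorbing_level (p n)) \<longlongrightarrow> absorbing_level l) F" unfolding absorbing_level_def by (intro tendsto_intros lim)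
    then have ev3: "\<forall>\<^sub>F n in F. absorbing_level (p n) < absorbing_level l + 1" by (rule order_tendstoD) simp
    have ev4: "\<forall>\<^sub>F n in F. \<forall>\<tau>\<in>{0..t}. \<bar>a (\<sigma> \<tau> (f n)) - a (\<sigma> \<tau> \<omega>)\<bar> < e"
      using filterlim_iff[THEN iffD1, OF lim(2)] a_flow_uniform[OF e(1)] by blast
    show "\<forall>\<^sub>F n in F. dist (S (p n) t (f n) (x n) - S l t \<omega> x0) 0 < \<epsilon>"
      using ev1 ev2 ev3 ev4 x(1)
    proof eventually_elim
      case (elim n)
      have "(S l t \<omega> x0 - S (p n) t (f n) (x n))\<^sup>2 \<le> K * ((S l 0 \<omega> x0 - S (p n) 0 (f n) (x n))\<^sup>2 + (e * R\<^sup>2 + \<bar>l - p n\<bar> * R)\<^sup>2 * t)"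
        unfolding K_def
      proof (rule sol_on_dependence[OF t fwd_sol_on' fwd_sol_on'])
        fix \<tau> assume \<tau>: "\<tau> \<in> {0..t}"
        show "\<bar>S l \<tau> \<omega> x0\<bar> \<le> R" using \<tau> x(2) by (intro S_abs_le) (auto simp: R_def)
        show "\<bar>S (p n) \<tau> (f n) (x n)\<bar> \<le> R" using \<tau> elim by (intro S_abs_le) (auto simp: R_def)
        show "\<bar>a (\<sigma> \<tau> \<omega>) - a (\<sigma> \<tau> (f n))\<bar> \<le> e" using elim(4) \<tau> by (auto simp: abs_minus_commute intro: less_imp_le)
      qed
      also have "\<dots> < \<epsilon>\<^sup>2" using elim(1) by simp
      finally have "\<bar>S l t \<omega> x0 - S (p n) t (f n) (x n)\<bar>\<^sup>2 < \<epsilon>\<^sup>2" by simp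
      then have "\<bar>S l t \<omega> x0 - S (p n) t (f n) (x n)\<bar> < \<epsilon>" by (rule power2_less_imp_less) (use \<epsilon> in simp)
      then show ?case by (simp add: dist_real_def abs_minus_commute)
    qed
  qed
  then show ?thesis by (simp add: LIM_zero_iff)
qed

text \<open>The forward equation suffices: it holds over every base point, and near time \<open>t\<close> the orbit of
  \<open>\<omega>\<close> is the forward orbit of the point one time unit earlier.\<close>

lemma forward_equilibrium:
  assumes b: "\<And>\<omega> t. 0 \<le> t \<Longrightarrow> S l t \<omega> (b \<omega>) = b (\<sigma> t \<omega>)"
  shows "sol_on l \<omega> UNIV (\<lambda>t. b (\<sigma> t \<omega>))"
  unfolding sol_on_def
proof
  fix t
  define \<eta> where "\<eta> = \<sigma> (t - 1) \<omega>"
  have "((\<lambda>r. S l r \<eta> (b \<eta>)) has_real_derivative cubic a l (\<sigma> 1 \<eta>) (S l 1 \<eta> (b \<eta>))) (at 1)"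
    using sol_onD[OF fwd_sol_on, of 1 l \<eta> "b \<eta>"] by simp
  moreover have "\<forall>\<^sub>F r in nhds 1. S l r \<eta> (b \<eta>) = b (\<sigma> (r + (t - 1)) \<omega>)"
  proof -
    have "\<forall>\<^sub>F r in nhds (1::real). 0 < r" by (rule order_tendstoD[OF filterlim_ident]) simp
    then show ?thesis by eventually_elim (simp add: b \<eta>_def)
  qed
  ultimately have "((\<lambda>r. b (\<sigma> (r + (t - 1)) \<omega>)) has_real_derivative cubic a l (\<sigma> 1 \<eta>) (S l 1 \<eta> (b \<eta>))) (at 1)"
    by (subst (asm) DERIV_cong_ev[OF refl _ refl]) auto
  then show "((\<lambda>t. b (\<sigma> t \<omega>)) has_real_derivative cubic a l (\<sigma> t \<omega>) (b (\<sigma> t \<omega>))) (at t)"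
    using DERIV_shift[of "\<lambda>t. b (\<sigma> t \<omega>)" _ 1 "t - 1"] by (simp add: b \<eta>_def)
qed

end

section \<open>Recurrence in the base\<close>

context base_flow
begin

text \<open>Minimality concerns full orbits. A limit point of the backward orbit has a dense full orbit, which the
  backward orbit shadows.\<close>

lemma backward_orbit_dense:
  assumes "0 < e"
  shows "\<exists>t\<ge>T. dist (\<sigma> (- t) \<omega>) \<eta> < e"
proof -
  obtain p r where p: "strict_mono r" "((\<lambda>n. \<sigma> (- real n) \<omega>) \<circ> r) \<longlonglongrightarrow> p"
    using compact_base unfolding compact_def by (metis UNIV_I)
  have "\<eta> \<in> closure (range (\<lambda>t. \<sigma> t p))" using minimal by (auto simp: minimal_flow_def)
  then obtain s where s: "dist (\<sigma> s p) \<eta> < e" using assms by (auto simp: closure_approachable)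
  have "continuous_on UNIV (\<lambda>\<omega>. \<sigma> s \<omega>)" by (intro continuous_intros)
  then have "isCont (\<lambda>\<omega>. \<sigma> s \<omega>) p" by (simp add: continuous_on_eq_continuous_at)
  then have "(\<lambda>n. \<sigma> s (\<sigma> (- real (r n)) \<omega>)) \<longlonglongrightarrow> \<sigma> s p"
    using isCont_tendsto_compose[OF _ p(2)] by (fastforce simp: o_def)
  then have "(\<lambda>n. dist (\<sigma> s (\<sigma> (- real (r n)) \<omega>)) \<eta>) \<longlonglongrightarrow> dist (\<sigma> s p) \<eta>"
    by (intro tendsto_intros)
  then have "\<forall>\<^sub>F n in sequentially. dist (\<sigma> s (\<sigma> (- real (r n)) \<omega>)) \<eta> < e"
    by (rule order_tendstoD) (use s in simp)
  moreover have "\<forall>\<^sub>F n in sequentially. T + s \<le> real n"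
    using filterlim_real_sequentially by (simp add: filterlim_at_top)
  ultimately have "\<forall>\<^sub>F n in sequentially. dist (\<sigma> s (\<sigma> (- real (r n)) \<omega>)) \<eta> < e \<and> T + s \<le> real n"
    by eventually_elim auto
  then obtain n where n: "dist (\<sigma> s (\<sigma> (- real (r n)) \<omega>)) \<eta> < e" "T + s \<le> real n"
    by (auto simp: eventually_sequentially)
  moreover have "n \<le> r n" using p(1) by (rule seq_suble)
  ultimately show ?thesis
    by (intro exI[of _ "real (r n) - s"]) auto
qed

lemma visits_open_uniformly:
  assumes "open U" "U \<noteq> {}"
  obtains T where "0 \<le> T" "\<And>\<omega>. \<exists>t. \<bar>t\<bar> \<le> T \<and> \<sigma> t \<omega> \<in> U"
proof -
  let ?V = "\<lambda>t. (\<lambda>\<omega>. \<sigma> t \<omega>) -` U"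
  have op: "open (?V t)" for t
    by (intro open_vimage assms continuous_intros)
  have "UNIV \<subseteq> (\<Union>t. ?V t)"
  proof
    fix \<omega> :: 'w
    obtain y where y: "y \<in> U" using assms by auto
    have "y \<in> closure (range (\<lambda>t. \<sigma> t \<omega>))" using minimal by (auto simp: minimal_flow_def)
    then have "range (\<lambda>t. \<sigma> t \<omega>) \<inter> U \<noteq> {}"
      using assms(1) y by (metis closure_iff_nhds_not_empty disjoint_iff subset_refl inf_commute)
    then show "\<omega> \<in> (\<Union>t. ?V t)" by auto
  qed
  then obtain D where D: "finite D" "UNIV \<subseteq> (\<Union>t\<in>D. ?V t)"
    using compactE_image[OF compact_base, of UNIV ?V] op by metis
  define T where "T = Max (insert 0 (abs ` D))"
  have T: "0 \<le> T" "\<And>t. t \<in> D \<Longrightarrow> \<bar>t\<bar> \<le> T" using D(1) by (auto simp: T_def)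
  show ?thesis
  proof (rule that[OF T(1)])
    fix \<omega>
    obtain t where "t \<in> D" "\<sigma> t \<omega> \<in> U" using D(2) by auto
    then show "\<exists>t. \<bar>t\<bar> \<le> T \<and> \<sigma> t \<omega> \<in> U" using T(2) by blast
  qed
qed

text \<open>A positive lower bound on an open set spreads over the whole base, because every orbit meets the
  open set within a bounded time, and \<open>\<phi>\<close> changes at most by a bounded factor in that time.\<close>

lemma transport_lower_bound:
  fixes \<phi> :: "'w \<Rightarrow> real"
  assumes L: "0 \<le> L" "\<And>\<omega> t. 0 \<le> t \<Longrightarrow> \<phi> \<omega> * exp (- L * t) \<le> \<phi> (\<sigma> t \<omega>)"
      "\<And>\<omega> t. 0 \<le> t \<Longrightarrow> \<phi> (\<sigma> t \<omega>) \<le> \<phi> \<omega> * exp (L * t)"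
    and U: "open U" "U \<noteq> {}" "0 < d" "\<And>\<omega>. \<omega> \<in> U \<Longrightarrow> d \<le> \<phi> \<omega>"
  shows "\<exists>d'>0. \<forall>\<omega>. d' \<le> \<phi> \<omega>"
proof -
  obtain T where T: "0 \<le> T" "\<And>\<omega>. \<exists>t. \<bar>t\<bar> \<le> T \<and> \<sigma> t \<omega> \<in> U" using visits_open_uniformly[OF U(1,2)] by blast
  have "d * exp (- L * T) \<le> \<phi> \<omega>" for \<omega>
  proof -
    obtain t where t: "\<bar>t\<bar> \<le> T" "\<sigma> t \<omega> \<in> U" using T(2) by blast
    have "d * exp (- L * T) \<le> \<phi> (\<sigma> t \<omega>) * exp (- L * \<bar>t\<bar>)"
      using U(3) U(4)[OF t(2)] t(1) L(1) by (intro mult_mono) (auto intro: mult_left_mono)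
    also have "\<dots> \<le> \<phi> \<omega>"
    proof (cases "0 \<le> t")
      case True
      have "\<phi> (\<sigma> t \<omega>) * exp (- L * \<bar>t\<bar>) \<le> \<phi> \<omega> * exp (L * t) * exp (- L * \<bar>t\<bar>)"
        using L(3)[OF True, of \<omega>] by (intro mult_right_mono) auto
      then show ?thesis using True by (simp add: mult.assoc exp_add[symmetric])
    next
      case False
      then show ?thesis using L(2)[of "- t" "\<sigma> t \<omega>"] by simp
    qed
    finally show ?thesis .
  qed
  then show ?thesis using U(3) by (intro exI[of _ "d * exp (- L * T)"]) auto
qed

end

section \<open>The parameters for which the upper half carries a compact invariant set\<close>

lemma exp_decay_at_top:
  fixes h :: real
  assumes "h < 0" shows "((\<lambda>t. c * exp (h * (t - s))) \<longlongrightarrow> 0) at_top"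
proof -
  have "filterlim (\<lambda>t. h * (- s + t)) at_bot at_top"
    by (intro filterlim_tendsto_neg_mult_at_bot[OF tendsto_const assms]
        filterlim_tendsto_add_at_top[OF tendsto_const] filterlim_ident)
  then have "((\<lambda>t. c * exp (h * (- s + t))) \<longlongrightarrow> 0) at_top"
    by (intro tendsto_mult_right_zero filterlim_compose[OF exp_at_bot])
  then show ?thesis by simp
qed

lemma exp_decay_sequentially:
  fixes h :: real
  assumes "h < 0" shows "(\<lambda>n. c * exp (h * real n)) \<longlonglongrightarrow> 0"
  using filterlim_compose[OF exp_decay_at_top[OF assms, of c 0] filterlim_real_sequentially] by simp

text \<open>As in \<open>barrier_le\<close>, with the sign condition only in a strip above \<open>K\<close>: the strip cannot be crossed.\<close>

lemma barrier_le_local: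
  fixes u :: "real \<Rightarrow> real"
  assumes st: "s \<le> t" and der: "\<And>\<tau>. s \<le> \<tau> \<Longrightarrow> \<tau> \<le> t \<Longrightarrow> (u has_real_derivative u' \<tau>) (at \<tau>)"
    and us: "u s \<le> K" and KK: "K < K'"
    and neg: "\<And>\<tau>. s \<le> \<tau> \<Longrightarrow> \<tau> \<le> t \<Longrightarrow> K < u \<tau> \<Longrightarrow> u \<tau> \<le> K' \<Longrightarrow> u' \<tau> \<le> 0"
  shows "u t \<le> K"
proof (rule ccontr)
  assume "\<not> u t \<le> K"
  define M where "M = min (u t) K'"
  have M: "K < M" "M \<le> u t" "M \<le> K'" using \<open>\<not> u t \<le> K\<close> KK by (auto simp: M_def)
  have cont: "continuous_on {s..t} u"
    using der by (intro continuous_at_imp_continuous_on) (auto intro!: DERIV_isCont)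
  define Z where "Z = {s..t} \<inter> u -` {M..}"
  have "closed Z" unfolding Z_def by (intro continuous_closed_preimage cont closed_atLeastAtMost closed_atLeast)
  moreover have "t \<in> Z" using st M by (auto simp: Z_def)
  moreover have bdd: "bdd_below Z" by (auto simp: Z_def)
  ultimately have IZ: "Inf Z \<in> Z" using closed_contains_Inf[of Z] by auto
  define r where "r = Inf Z"
  have r: "s \<le> r" "r \<le> t" "M \<le> u r" using IZ by (auto simp: Z_def r_def)
  have below: "u \<tau> < M" if "s \<le> \<tau>" "\<tau> < r" for \<tau>
    using that r cInf_lower[OF _ bdd, of \<tau>] by (force simp: r_def Z_def)
  have "u r \<le> M"
  proof (rule ccontr)
    assume "\<not> u r \<le> M"
    moreover have "continuous_on {s..r} u" using r by (intro continuous_on_subset[OF cont]) auto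
    ultimately obtain x where "s \<le> x" "x \<le> r" "u x = M" using IVT'[of u s M r] us M r by auto
    moreover have "x < r" using \<open>\<not> u r \<le> M\<close> calculation by (auto simp: order.order_iff_strict)
    ultimately show False using below[of x] by simp
  qed
  have "u r \<le> K"
    by (rule barrier_le[OF r(1) der us neg]) (use r M below \<open>u r \<le> M\<close> in \<open>force simp: order.order_iff_strict\<close>)+
  then show False using r M by simp
qed

context cubic_family
begin

text \<open>For negative \<open>l\<close> the growth rate is at most \<open>l / 2\<close> on \<open>{0..decay_radius l}\<close>, so solutions that
  enter this interval decay to \<open>0\<close>. On twice the interval the rate is still nonpositive, which keeps
  them from leaving it.\<close>

definition decay_radius :: "real \<Rightarrow> real" where "decay_radius l = - l / (2 * a_bound)"

lemma decay_radius_pos: "l < 0 \<Longrightarrow> 0 < decay_radius l"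
  using a_bound_ge_1 by (simp add: decay_radius_def divide_neg_pos)

lemma decay_radius_antimono: "l \<le> l' \<Longrightarrow> decay_radius l' \<le> decay_radius l"
  using a_bound_ge_1 by (simp add: decay_radius_def divide_right_mono)

lemma growth_le: "0 \<le> x \<Longrightarrow> growth l \<omega> x \<le> a_bound * x + l"
  using mult_right_mono[OF abs_le_D1[OF abs_a_le[of \<omega>]], of x] zero_le_power2[of x] unfolding growth_def by linarith

lemma growth_le_rad: "0 \<le> x \<Longrightarrow> x \<le> decay_radius l \<Longrightarrow> growth l \<omega> x \<le> l / 2"
  using growth_le[of x l \<omega>] a_bound_ge_1 by (simp add: decay_radius_def field_simps)

lemma growth_le_2_rad: "0 \<le> x \<Longrightarrow> x \<le> 2 * decay_radius l \<Longrightarrow> growth l \<omega> x \<le> 0"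
  using growth_le[of x l \<omega>] a_bound_ge_1 by (simp add: decay_radius_def field_simps)

lemma S_le_rad:
  assumes "l < 0" "0 \<le> t" "0 \<le> x" "x \<le> \<rho>" "\<rho> \<le> decay_radius l"
  shows "S l t \<omega> x \<le> \<rho>"
proof (rule barrier_le_local[OF assms(2), where u = "\<lambda>t. S l t \<omega> x" and K' = "2 * decay_radius l"])
  show "((\<lambda>t. S l t \<omega> x) has_real_derivative growth l (\<sigma> \<tau> \<omega>) (S l \<tau> \<omega> x) * S l \<tau> \<omega> x) (at \<tau>)" if "0 \<le> \<tau>" for \<tau>
    using S_deriv that by blast
  show "growth l (\<sigma> \<tau> \<omega>) (S l \<tau> \<omega> x) * S l \<tau> \<omega> x \<le> 0" if "0 \<le> \<tau>" "S l \<tau> \<omega> x \<le> 2 * decay_radius l" for \<tau>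
    using that assms(3) by (intro mult_nonpos_nonneg growth_le_2_rad) (auto simp: S_nonneg)
qed (use assms decay_radius_pos[of l] in auto)

lemma S_decay:
  assumes "l < 0" "0 \<le> t" "0 \<le> x" "x \<le> decay_radius l"
  shows "S l t \<omega> x \<le> x * exp (l / 2 * t)"
proof -
  have "\<bar>S l t \<omega> x\<bar> \<le> \<bar>S l 0 \<omega> x\<bar> * exp (l / 2 * (t - 0))"
  proof (rule growth_upper[OF assms(2) S_deriv])
    fix \<tau> :: real assume \<tau>: "0 \<le> \<tau>" "\<tau> \<le> t"
    have "growth l (\<sigma> \<tau> \<omega>) (S l \<tau> \<omega> x) * (S l \<tau> \<omega> x)\<^sup>2 \<le> l / 2 * (S l \<tau> \<omega> x)\<^sup>2"
      using \<tau> assms S_le_rad[OF assms(1) \<tau>(1) assms(3,4) order_refl, of \<omega>]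
      by (intro mult_right_mono growth_le_rad) (auto simp: S_nonneg)
    then show "S l \<tau> \<omega> x * (growth l (\<sigma> \<tau> \<omega>) (S l \<tau> \<omega> x) * S l \<tau> \<omega> x) \<le> l / 2 * (S l \<tau> \<omega> x)\<^sup>2"
      by (simp add: power2_eq_square mult_ac)
  qed auto
  then show ?thesis using assms S_nonneg[OF assms(2), of l \<omega> x] by simp
qed

lemma S_ge_rad_before:
  assumes "l < 0" "0 \<le> s" "s \<le> t" "0 \<le> x" "decay_radius l \<le> S l t \<omega> x"
  shows "decay_radius l \<le> S l s \<omega> x"
proof (rule ccontr)
  assume "\<not> decay_radius l \<le> S l s \<omega> x"
  then have "S l (t - s) (\<sigma> s \<omega>) (S l s \<omega> x) \<le> S l s \<omega> x"
    using assms by (intro S_le_rad[of l "t - s" "S l s \<omega> x" "S l s \<omega> x"]) (auto simp: S_nonneg)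
  then show False using assms S_add[of s "t - s" l \<omega> x] \<open>\<not> decay_radius l \<le> S l s \<omega> x\<close> by simp
qed

lemma S_below_rad_tendsto_0:
  assumes "l < 0" "0 \<le> s" "0 \<le> x" "S l s \<omega> x \<le> decay_radius l"
  shows "((\<lambda>t. S l t \<omega> x) \<longlongrightarrow> 0) at_top"
proof (rule tendsto_sandwich[OF _ _ tendsto_const])
  show "\<forall>\<^sub>F t in at_top. 0 \<le> S l t \<omega> x"
    using eventually_ge_at_top[of 0] by eventually_elim (simp add: S_nonneg assms)
  show "\<forall>\<^sub>F t in at_top. S l t \<omega> x \<le> S l s \<omega> x * exp (l / 2 * (t - s))"
    using eventually_ge_at_top[of s]
  proof eventually_elim
    case (elim t)
    then show ?case using S_decay[of l "t - s" "S l s \<omega> x" "\<sigma> s \<omega>"] assms S_add[of s "t - s" l \<omega> x]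
      by (simp add: S_nonneg)
  qed
  show "((\<lambda>t. S l s \<omega> x * exp (l / 2 * (t - s))) \<longlongrightarrow> 0) at_top"
    using assms(1) by (intro exp_decay_at_top) simp
qed

text \<open>A solution below \<open>decay_radius l\<close> decays to \<open>0\<close> and hence violates any positive lower bound.
  So for negative \<open>l\<close> the compact invariant sets in the upper half are bounded away from \<open>0\<close> by a
  number that depends on \<open>l\<close> and the coefficient only.\<close>

lemma entire_ge_rad:
  assumes "l < 0" "sol_on l \<omega> UNIV u" "0 < r" "\<And>t. r \<le> u t"
  shows "decay_radius l \<le> u t"
proof (rule ccontr)
  assume less: "\<not> decay_radius l \<le> u t"
  have eq: "S l s (\<sigma> t \<omega>) (u t) = u (s + t)" if "0 \<le> s" for s
    using that by (intro S_eq sol_on_shift[OF assms(2)]) auto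
  have "((\<lambda>s. S l s (\<sigma> t \<omega>) (u t)) \<longlongrightarrow> 0) at_top"
    using less assms(1,3) assms(4)[of t] by (intro S_below_rad_tendsto_0[of l 0]) auto
  then have "\<forall>\<^sub>F s in at_top. S l s (\<sigma> t \<omega>) (u t) < r" by (rule order_tendstoD) (rule assms(3))
  then have "\<forall>\<^sub>F s in at_top. S l s (\<sigma> t \<omega>) (u t) < r \<and> 0 \<le> s" using eventually_ge_at_top[of 0] by eventually_elim simp
  then obtain s where "S l s (\<sigma> t \<omega>) (u t) < r" "0 \<le> s" by (auto simp: eventually_at_top_linorder)
  then show False using eq[of s] assms(4)[of "s + t"] by simp
qed

subsection \<open>Comparison of different parameters\<close>

lemma param_diff_deriv:
  assumes "sol_on l \<omega> J v" "sol_on l' \<omega> J u" "\<tau> \<in> J"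
  shows "((\<lambda>t. u t - v t) has_real_derivative
    secant l' (\<sigma> \<tau> \<omega>) (u \<tau>) (v \<tau>) * (u \<tau> - v \<tau>) + (l' - l) * v \<tau>) (at \<tau>)"
  using sol_on_diff_deriv[OF assms(2,1,3)] by simp

text \<open>Raising the parameter from \<open>l\<close> to \<open>l'\<close> adds the source term \<open>(l' - l) v\<close> to the equation of
  the difference. The second claim is the first one with time reversed.\<close>

lemma param_gain:
  assumes "s \<le> t" "l \<le> l'" and v: "sol_on l \<omega> {s..t} v" and u: "sol_on l' \<omega> {s..t} u"
    and R: "\<And>\<tau>. \<tau> \<in> {s..t} \<Longrightarrow> \<bar>u \<tau>\<bar> \<le> R" "\<And>\<tau>. \<tau> \<in> {s..t} \<Longrightarrow> \<bar>v \<tau>\<bar> \<le> R"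
    and r: "0 \<le> r" "\<And>\<tau>. \<tau> \<in> {s..t} \<Longrightarrow> r \<le> v \<tau>"
  shows "v s \<le> u s \<Longrightarrow> v t + (l' - l) * r * (t - s) * exp (- secant_bound l' R * (t - s)) \<le> u t"
    and "u t \<le> v t \<Longrightarrow> u s + (l' - l) * r * (t - s) * exp (- secant_bound l' R * (t - s)) \<le> v s"
proof -
  have R0: "0 \<le> R" using R(1)[of s] assms(1) by (auto intro: order_trans[OF abs_ge_zero])
  have secant_bound: "\<bar>secant l' (\<sigma> \<tau> \<omega>) (u \<tau>) (v \<tau>)\<bar> \<le> secant_bound l' R" if "s \<le> \<tau>" "\<tau> \<le> t" for \<tau>
    using R that by (intro abs_secant_le) auto
  have e: "(l' - l) * r \<le> (l' - l) * v \<tau>" if "s \<le> \<tau>" "\<tau> \<le> t" for \<tau>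
    using r(2)[of \<tau>] that assms(2) by (intro mult_left_mono) auto
  show "v t + (l' - l) * r * (t - s) * exp (- secant_bound l' R * (t - s)) \<le> u t" if "v s \<le> u s"
  proof -
    have "(l' - l) * r * (t - s) * exp (- secant_bound l' R * (t - s)) \<le> u t - v t"
      by (rule gronwall_lower[OF assms(1), where d = "\<lambda>t. u t - v t" and c = "\<lambda>\<tau>. secant l' (\<sigma> \<tau> \<omega>) (u \<tau>) (v \<tau>)" and e = "\<lambda>\<tau>. (l' - l) * v \<tau>"])
        (use param_diff_deriv[OF v u] secant_bound e secant_bound_nonneg[OF R0] that assms(2) r(1) in auto)
    then show ?thesis by simp
  qed
  show "u s + (l' - l) * r * (t - s) * exp (- secant_bound l' R * (t - s)) \<le> v s" if "u t \<le> v t"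
  proof -
    have "(l' - l) * r * (- s - - t) * exp (- secant_bound l' R * (- s - - t)) \<le> v (- (- s)) - u (- (- s))"
    proof (rule gronwall_lower[where d = "\<lambda>\<tau>. v (- \<tau>) - u (- \<tau>)" and c = "\<lambda>\<tau>. - secant l' (\<sigma> (- \<tau>) \<omega>) (u (- \<tau>)) (v (- \<tau>))" and e = "\<lambda>\<tau>. (l' - l) * v (- \<tau>)"])
      fix \<tau> assume \<tau>: "- t \<le> \<tau>" "\<tau> \<le> - s"
      have "((\<lambda>t. u t - v t) has_real_derivative
        secant l' (\<sigma> (- \<tau>) \<omega>) (u (- \<tau>)) (v (- \<tau>)) * (u (- \<tau>) - v (- \<tau>)) + (l' - l) * v (- \<tau>)) (at (- \<tau>))"
        using \<tau> by (intro param_diff_deriv[OF v u]) auto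
      from DERIV_minus[OF this[unfolded DERIV_mirror]]
      show "((\<lambda>\<tau>. v (- \<tau>) - u (- \<tau>)) has_real_derivative
          - secant l' (\<sigma> (- \<tau>) \<omega>) (u (- \<tau>)) (v (- \<tau>)) * (v (- \<tau>) - u (- \<tau>)) + (l' - l) * v (- \<tau>)) (at \<tau>)"
        by (simp add: algebra_simps)
    qed (use secant_bound e secant_bound_nonneg[OF R0] that assms(1,2) r(1) in auto)
    then show ?thesis by simp
  qed
qed

text \<open>Equilibria, expressed by the differential equation along the orbits of the base; this form passes to limits
  and combines directly with the comparison lemmas.\<close>

definition eqm :: "real \<Rightarrow> ('w \<Rightarrow> real) \<Rightarrow> bool" where
  "eqm l b \<longleftrightarrow> (\<forall>\<omega>. sol_on l \<omega> UNIV (\<lambda>t. b (\<sigma> t \<omega>)))"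

lemma eqm_sol_on: "eqm l b \<Longrightarrow> sol_on l \<omega> J (\<lambda>t. b (\<sigma> t \<omega>))"
  by (auto simp: eqm_def intro: sol_on_subset)

lemma eqm_S: "eqm l b \<Longrightarrow> S l t \<omega> (b \<omega>) = b (\<sigma> t \<omega>)"
  using sol_entire(2)[where u = "\<lambda>t. b (\<sigma> t \<omega>)", OF eqm_sol_on] by simp

lemma eqm_equilibrium: "eqm l b \<Longrightarrow> equilibrium \<sigma> (cubic a l) b"
  using sol_entire(1)[where u = "\<lambda>t. b (\<sigma> t \<omega>)" for \<omega>, OF eqm_sol_on] by (auto simp: equilibrium_def eqm_S)

lemma eqm_forwardI: "(\<And>\<omega> t. 0 \<le> t \<Longrightarrow> S l t \<omega> (b \<omega>) = b (\<sigma> t \<omega>)) \<Longrightarrow> eqm l b"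
  unfolding eqm_def using forward_equilibrium by blast

lemma eqm_beta: "eqm l (\<beta> l)"
  by (rule eqm_forwardI) (rule beta_flow)

lemma eqm_zero: "eqm l (\<lambda>_. 0)"
  by (rule eqm_forwardI) simp

lemma entire_le_beta:
  assumes "sol_on l \<omega> UNIV u" "\<And>t. \<bar>u t\<bar> \<le> R" shows "u t \<le> \<beta> l (\<sigma> t \<omega>)"
  using bounded_entire_in_attr[OF sol_on_shift[OF assms(1)], of t R] assms(2) by (simp add: mem_band)

lemma eqm_le_beta:
  assumes "eqm l b" "\<And>\<omega>. \<bar>b \<omega>\<bar> \<le> R" shows "b \<omega> \<le> \<beta> l \<omega>"
  using entire_le_beta[OF eqm_sol_on[OF assms(1), of \<omega> UNIV], of R 0] assms(2) by simp

text \<open>The equilibrium for \<open>l\<close> is a strict subsolution for \<open>l'\<close>. Starting from it in the past, the solution for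
  \<open>l'\<close> first stays above it and in the last unit of time gains an amount proportional to \<open>r\<close>.\<close>

lemma eqm_gain:
  assumes b: "eqm l b" and r: "0 \<le> r" "\<And>\<omega>. r \<le> b \<omega>" and R: "\<And>\<omega>. b \<omega> \<le> R" and l: "l \<le> l'"
  shows "b \<omega> + (l' - l) * r * exp (- secant_bound l' (max R (absorbing_level l'))) \<le> \<beta> l' \<omega>"
proof (rule pullback_le[where t = "\<lambda>n. 1 + real n" and x = "\<lambda>n. b (\<sigma> (- (1 + real n)) \<omega>)" and R = "max R 0"])
  show "filterlim (\<lambda>n. 1 + real n) at_top sequentially"
    by (rule filterlim_tendsto_add_at_top[OF tendsto_const filterlim_real_sequentially])
  show "\<bar>b (\<sigma> (- (1 + real n)) \<omega>)\<bar> \<le> max R 0" for n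
    using r(2)[of "\<sigma> (- (1 + real n)) \<omega>"] R[of "\<sigma> (- (1 + real n)) \<omega>"] r(1) by auto
  fix n :: nat
  define \<eta> where "\<eta> = \<sigma> (- (1 + real n)) \<omega>"
  let ?R = "max R (absorbing_level l')"
  let ?u = "\<lambda>\<tau>. S l' \<tau> \<eta> (b \<eta>)" and ?v = "\<lambda>\<tau>. b (\<sigma> \<tau> \<eta>)"
  have b0: "0 \<le> b \<omega>" for \<omega> using r(1) r(2)[of \<omega>] by linarith
  have u: "sol_on l' \<eta> {s..t} ?u" if "0 \<le> s" for s t using that by (intro sol_on_subset[OF fwd_sol_on]) auto
  have v: "sol_on l \<eta> {s..t} ?v" for s t by (rule eqm_sol_on[OF b])
  have Ru: "\<bar>?u \<tau>\<bar> \<le> ?R" if "0 \<le> \<tau>" for \<tau> using that b0 R by (intro S_abs_le) (auto simp: le_max_iff_disj)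
  have Rv: "\<bar>?v \<tau>\<bar> \<le> ?R" for \<tau> using b0[of "\<sigma> \<tau> \<eta>"] R[of "\<sigma> \<tau> \<eta>"] by auto
  have "?v n + (l' - l) * r * (real n - 0) * exp (- secant_bound l' ?R * (real n - 0)) \<le> ?u n"
    by (rule param_gain(1)[OF _ l v u]) (use Ru Rv r in auto)
  moreover have "0 \<le> (l' - l) * r * (real n - 0) * exp (- secant_bound l' ?R * (real n - 0))" using l r by auto
  ultimately have "?v n \<le> ?u n" by simp
  then have "?v (1 + real n) + (l' - l) * r * (1 + real n - real n) * exp (- secant_bound l' ?R * (1 + real n - real n)) \<le> ?u (1 + real n)"
    by (intro param_gain(1)[OF _ l v u]) (use Ru Rv r in auto)
  then show "b \<omega> + (l' - l) * r * exp (- secant_bound l' (max R (absorbing_level l')))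
     \<le> S l' (1 + real n) (\<sigma> (- (1 + real n)) \<omega>) (b (\<sigma> (- (1 + real n)) \<omega>))"
    by (simp add: \<eta>_def)
qed

lemma beta_mono: "l \<le> l' \<Longrightarrow> \<beta> l \<omega> \<le> \<beta> l' \<omega>"
proof -
  assume l: "l \<le> l'"
  obtain R where "\<And>\<omega>. \<beta> l \<omega> \<le> R" using beta_bounded by metis
  from eqm_gain[OF eqm_beta order_refl beta_ge_0 this l] show ?thesis by simp
qed

text \<open>Equivalently, there is a compact invariant set in the open upper half.\<close>

definition persistent :: "real set" where "persistent = {l. \<exists>d>0. \<forall>\<omega>. d \<le> \<beta> l \<omega>}"

lemma eqm_gain_strict:
  assumes b: "eqm l b" and r: "0 < r" "\<And>\<omega>. r \<le> b \<omega>" and R: "\<And>\<omega>. b \<omega> \<le> R" and l: "l < l'"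
  obtains e where "0 < e" "\<And>\<omega>. b \<omega> + e \<le> \<beta> l' \<omega>"
  using that[of "(l' - l) * r * exp (- secant_bound l' (max R (absorbing_level l')))"] eqm_gain[OF b _ r(2) R, of l'] r l
  by auto

lemma persistent_gain:
  assumes "l \<in> persistent" "l < l'" obtains e where "0 < e" "\<And>\<omega>. \<beta> l \<omega> + e \<le> \<beta> l' \<omega>"
proof -
  obtain R where R: "\<And>\<omega>. \<beta> l \<omega> \<le> R" using beta_bounded by metis
  obtain d where d: "0 < d" "\<And>\<omega>. d \<le> \<beta> l \<omega>" using assms(1) by (auto simp: persistent_def)
  show ?thesis using eqm_gain_strict[OF eqm_beta d R assms(2)] that by metis
qed

lemma persistent_upward: "l \<in> persistent \<Longrightarrow> l \<le> l' \<Longrightarrow> l' \<in> persistent"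
  unfolding persistent_def using beta_mono[of l l'] by (auto intro: order_trans)

lemma persistent_pos: 
  assumes "0 < l" shows "l \<in> persistent"
proof -
  define \<epsilon> where "\<epsilon> = min 1 (l / (a_bound + 1))"
  have "\<epsilon> \<le> l / (a_bound + 1)" by (simp add: \<epsilon>_def)
  then have \<epsilon>: "0 < \<epsilon>" "\<epsilon> \<le> 1" "\<epsilon> * (a_bound + 1) \<le> l"
    using assms a_bound_ge_1 pos_le_divide_eq[of "a_bound + 1" \<epsilon> l] by (auto simp: \<epsilon>_def)
  have growth: "0 \<le> growth l \<omega> x" if "0 \<le> x" "x \<le> \<epsilon>" for \<omega> x
  proof -
    have "x\<^sup>2 \<le> \<epsilon>" using mult_mono[of x \<epsilon> x 1] that \<epsilon> by (simp add: power2_eq_square)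
    moreover have "\<bar>a \<omega> * x\<bar> \<le> a_bound * \<epsilon>" unfolding abs_mult using abs_a_le[of \<omega>] that by (intro mult_mono) auto
    ultimately show ?thesis using \<epsilon>(3) unfolding growth_def by (simp add: algebra_simps) 
  qed
  have ge: "\<epsilon> \<le> S l t \<omega> \<epsilon>" if "0 \<le> t" for t \<omega>
  proof (rule barrier_ge[OF that S_deriv])
    show "0 \<le> growth l (\<sigma> \<tau> \<omega>) (S l \<tau> \<omega> \<epsilon>) * S l \<tau> \<omega> \<epsilon>" if "0 \<le> \<tau>" "S l \<tau> \<omega> \<epsilon> < \<epsilon>" for \<tau>
      using that \<epsilon> by (intro mult_nonneg_nonneg growth) (auto simp: S_nonneg)
  qed auto
  have "\<epsilon> \<le> \<beta> l \<omega>" for \<omega>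
    by (rule pullback_le[OF filterlim_real_sequentially, where x = "\<lambda>_. \<epsilon>" and R = \<epsilon>]) (use \<epsilon> ge in auto)
  then show ?thesis using \<epsilon>(1) by (auto simp: persistent_def)
qed

text \<open>If \<open>\<beta> l\<close> is positive at one point \<open>\<omega>0\<close>, it is at least \<open>decay_radius l\<close> at all sufficiently early
  times along the orbit of \<open>\<omega>0\<close>, as otherwise decay would force \<open>\<beta> l \<omega>0 = 0\<close>. The points
  reached at those times are dense in the base, and \<open>\<beta> l\<close> is upper semicontinuous.\<close>

lemma beta_ge_rad:
  assumes "l < 0" "0 < \<beta> l \<omega>0"
  shows "decay_radius l \<le> \<beta> l \<omega>"
proof -
  obtain R where R: "0 < R" "\<And>\<omega>. \<beta> l \<omega> \<le> R" using beta_bounded by metis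
  have ex: "\<exists>T\<ge>0. \<forall>t\<ge>T. decay_radius l \<le> \<beta> l (\<sigma> (- t) \<omega>0)"
  proof (rule ccontr)
    assume "\<not> ?thesis"
    then have "\<exists>t\<ge>T. \<beta> l (\<sigma> (- t) \<omega>0) < decay_radius l" if "0 \<le> T" for T using that by (meson not_le)
    have "\<beta> l \<omega>0 \<le> decay_radius l * exp (l / 2 * n)" for n :: nat
    proof -
      obtain t where t: "real n \<le> t" "\<beta> l (\<sigma> (- t) \<omega>0) < decay_radius l"
        using \<open>\<And>T. 0 \<le> T \<Longrightarrow> \<exists>t\<ge>T. \<beta> l (\<sigma> (- t) \<omega>0) < decay_radius l\<close>[of n] by auto
      have "\<beta> l \<omega>0 = S l t (\<sigma> (- t) \<omega>0) (\<beta> l (\<sigma> (- t) \<omega>0))" by (simp add: beta_flow)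
      also have "\<dots> \<le> \<beta> l (\<sigma> (- t) \<omega>0) * exp (l / 2 * t)"
        using t assms beta_ge_0 by (intro S_decay) auto
      also have "\<dots> \<le> decay_radius l * exp (l / 2 * n)"
        using t assms beta_ge_0 decay_radius_pos[OF assms(1)] by (intro mult_mono) (auto simp: mult_left_mono_neg)
      finally show ?thesis .
    qed
    moreover have "(\<lambda>n. decay_radius l * exp (l / 2 * real n)) \<longlonglongrightarrow> 0"
      using assms(1) by (intro exp_decay_sequentially) simp
    ultimately have "\<beta> l \<omega>0 \<le> 0" by (intro LIMSEQ_le_const) auto
    then show False using assms by simp
  qed
  then obtain T where T: "\<And>t. T \<le> t \<Longrightarrow> decay_radius l \<le> \<beta> l (\<sigma> (- t) \<omega>0)" by blast
  have "\<omega> \<in> closure {\<omega>. decay_radius l \<le> \<beta> l \<omega>}"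
    unfolding closure_approachable
  proof (intro allI impI)
    fix e :: real assume "0 < e"
    from backward_orbit_dense[OF this, of T \<omega>0 \<omega>] T show "\<exists>y\<in>{\<omega>. decay_radius l \<le> \<beta> l \<omega>}. dist y \<omega> < e" by blast
  qed
  then show ?thesis using beta_superlevel[of "decay_radius l" l] by (simp add: closure_closed)
qed

lemma beta_zero: "l < 0 \<Longrightarrow> l \<notin> persistent \<Longrightarrow> \<beta> l \<omega> = 0"
  using beta_ge_rad[of l \<omega>] decay_radius_pos[of l] beta_ge_0[of l \<omega>]
  by (cases "0 < \<beta> l \<omega>") (auto simp: persistent_def)

lemma persistent_rad:
  assumes "l < 0" "l \<in> persistent" shows "decay_radius l \<le> \<beta> l \<omega>"
proof -
  obtain d where "0 < d" "d \<le> \<beta> l \<omega>" using assms(2) by (auto simp: persistent_def)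
  then show ?thesis using beta_ge_rad[OF assms(1), of \<omega> \<omega>] by simp
qed

text \<open>For very negative parameters the growth rate is negative everywhere in the upper half.\<close>

lemma persistent_bounded_below: "l \<in> persistent \<Longrightarrow> - a_bound\<^sup>2 \<le> l"
proof (rule ccontr)
  assume l: "l \<in> persistent" "\<not> - a_bound\<^sup>2 \<le> l"
  obtain d where d: "0 < d" "\<And>\<omega>. d \<le> \<beta> l \<omega>" using l by (auto simp: persistent_def)
  obtain R where R: "0 < R" "\<And>\<omega>. \<beta> l \<omega> \<le> R" using beta_bounded by metis
  define h where "h = - (l + a_bound\<^sup>2)"
  have h: "0 < h" using l by (simp add: h_def)
  have growth: "growth l \<omega> x \<le> - h" if "0 \<le> x" for \<omega> x
  proof -
    have "0 \<le> a_bound * x" using that a_bound_ge_1 by simp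
    then have "a_bound * x \<le> x\<^sup>2 + a_bound\<^sup>2" using sum_squares_bound[of a_bound x] by simp
    then show ?thesis using mult_right_mono[OF abs_le_D1[OF abs_a_le[of \<omega>]] that] unfolding growth_def h_def by linarith
  qed
  have "d \<le> R * exp (- h * n)" for n :: nat
  proof -
    obtain \<omega> :: 'w where True by blast
    have "d \<le> \<bar>\<beta> l (\<sigma> n \<omega>)\<bar>" using d(2)[of "\<sigma> n \<omega>"] by simp
    also have "\<dots> \<le> \<bar>\<beta> l (\<sigma> 0 \<omega>)\<bar> * exp (- h * (real n - 0))"
    proof (rule growth_upper[where d = "\<lambda>t. \<beta> l (\<sigma> t \<omega>)"])
      fix \<tau> :: real assume "0 \<le> \<tau>"
      show "((\<lambda>t. \<beta> l (\<sigma> t \<omega>)) has_real_derivative growth l (\<sigma> \<tau> \<omega>) (\<beta> l (\<sigma> \<tau> \<omega>)) * \<beta> l (\<sigma> \<tau> \<omega>)) (at \<tau>)"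
        using sol_onD[OF eqm_sol_on[OF eqm_beta[of l], of \<omega> UNIV], of \<tau>] by (simp add: cubic_growth)
      have "growth l (\<sigma> \<tau> \<omega>) (\<beta> l (\<sigma> \<tau> \<omega>)) * (\<beta> l (\<sigma> \<tau> \<omega>))\<^sup>2 \<le> - h * (\<beta> l (\<sigma> \<tau> \<omega>))\<^sup>2"
        by (intro mult_right_mono growth beta_ge_0) auto
      then show "\<beta> l (\<sigma> \<tau> \<omega>) * (growth l (\<sigma> \<tau> \<omega>) (\<beta> l (\<sigma> \<tau> \<omega>)) * \<beta> l (\<sigma> \<tau> \<omega>)) \<le> - h * (\<beta> l (\<sigma> \<tau> \<omega>))\<^sup>2"
        by (simp add: power2_eq_square mult_ac)
    qed auto
    also have "\<dots> \<le> R * exp (- h * n)" using R(2)[of \<omega>] beta_ge_0[of l \<omega>] by simp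
    finally show ?thesis .
  qed
  moreover have "(\<lambda>n. R * exp (- h * real n)) \<longlonglongrightarrow> 0"
    using h by (intro exp_decay_sequentially) simp
  ultimately have "d \<le> 0" by (intro LIMSEQ_le_const) auto
  then show False using d by simp
qed

subsection \<open>Limits of equilibria in the parameter\<close>

text \<open>Forward equations over all base points determine an equilibrium, and they pass to the limit by
  continuous dependence.\<close>

lemma eqm_limit:
  assumes "\<forall>\<^sub>F p in F. eqm p (b p)" "\<And>\<omega>. ((\<lambda>p. b p \<omega>) \<longlongrightarrow> g \<omega>) F" "(id \<longlongrightarrow> l) F"
    "\<forall>\<^sub>F p in F. \<forall>\<omega>. 0 \<le> b p \<omega>" "F \<noteq> bot"
  shows "eqm l g"
proof (rule eqm_forwardI)
  fix \<omega> and t :: real assume t: "0 \<le> t"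
  have "0 \<le> g \<omega>" by (rule tendsto_lowerbound[OF assms(2) _ assms(5)]) (use assms(4) in \<open>auto elim: eventually_mono\<close>)
  then have "((\<lambda>p. S (id p) t \<omega> (b p \<omega>)) \<longlongrightarrow> S l t \<omega> (g \<omega>)) F"
    using assms(4) by (intro S_tendsto[OF t assms(3) tendsto_const assms(2)]) (auto elim: eventually_mono)
  moreover have "\<forall>\<^sub>F p in F. S (id p) t \<omega> (b p \<omega>) = b p (\<sigma> t \<omega>)"
    using assms(1) by eventually_elim (simp add: eqm_S)
  ultimately have "((\<lambda>p. b p (\<sigma> t \<omega>)) \<longlongrightarrow> S l t \<omega> (g \<omega>)) F"
    by (rule Lim_transform_eventually)
  then show "S l t \<omega> (g \<omega>) = g (\<sigma> t \<omega>)" using tendsto_unique[OF assms(5) _ assms(2)] by blast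
qed

text \<open>The decreasing limit is a bounded equilibrium for \<open>m\<close> that is not below \<open>\<beta> m\<close>, and \<open>\<beta> m\<close> is the
  largest bounded equilibrium.\<close>

lemma beta_right_continuous: "((\<lambda>l. \<beta> l \<omega>) \<longlongrightarrow> \<beta> m \<omega>) (at_right m)"
proof -
  define g where "g \<omega> = (INF l\<in>{m<..}. \<beta> l \<omega>)" for \<omega>
  have bdd: "bdd_below ((\<lambda>l. \<beta> l \<omega>) ` {m<..})" for \<omega> using beta_ge_0 by (intro bdd_belowI[of _ 0]) auto
  have lim: "((\<lambda>l. \<beta> l \<omega>) \<longlongrightarrow> g \<omega>) (at_right m)" for \<omega>
  proof (rule order_tendstoI)
    fix y assume "y < g \<omega>"
    show "\<forall>\<^sub>F l in at_right m. y < \<beta> l \<omega>"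
      using eventually_at_right_less[of m]
      by eventually_elim (use \<open>y < g \<omega>\<close> bdd in \<open>auto simp: g_def intro: less_le_trans cINF_lower\<close>)
  next
    fix y assume "g \<omega> < y"
    then obtain l where l: "m < l" "\<beta> l \<omega> < y" unfolding g_def using cINF_less_iff[OF _ bdd] by auto
    show "\<forall>\<^sub>F l in at_right m. \<beta> l \<omega> < y"
      using eventually_at_right_real[OF l(1)]
    proof eventually_elim
      case (elim p)
      then have "\<beta> p \<omega> \<le> \<beta> l \<omega>" by (intro beta_mono) simp
      then show ?case using l(2) by simp
    qed
  qed
  have g0: "0 \<le> g \<omega>" for \<omega> unfolding g_def using beta_ge_0 by (intro cINF_greatest) auto
  obtain R where R: "\<And>\<omega>. \<beta> (m + 1) \<omega> \<le> R" using beta_bounded by metis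
  have gR: "g \<omega> \<le> R" for \<omega>
    using cINF_lower[OF bdd, of "m + 1" \<omega>] R[of \<omega>] by (simp add: g_def)
  have "eqm m g"
  proof (rule eqm_limit[OF always_eventually[OF allI[OF eqm_beta]] lim])
    show "(id \<longlongrightarrow> m) (at_right m)" unfolding id_def by (rule tendsto_ident_at)
  qed (auto intro!: always_eventually beta_ge_0)
  then have "g \<omega> \<le> \<beta> m \<omega>" by (rule eqm_le_beta[of _ _ R]) (use g0 gR in auto)
  moreover have "\<beta> m \<omega> \<le> g \<omega>" unfolding g_def by (intro cINF_greatest) (auto intro: beta_mono)
  ultimately have "g \<omega> = \<beta> m \<omega>" by (rule antisym)
  then show ?thesis using lim[of \<omega>] by simp
qed

lemma persistent_closed:
  assumes "m < 0" "\<And>l. m < l \<Longrightarrow> l \<in> persistent" shows "m \<in> persistent"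
proof -
  have "decay_radius (m / 2) \<le> \<beta> m \<omega>" for \<omega>
  proof (rule tendsto_lowerbound[OF beta_right_continuous])
    show "\<forall>\<^sub>F l in at_right m. decay_radius (m / 2) \<le> \<beta> l \<omega>"
      using eventually_at_right_real[of m "m / 2"] assms(1)
      by (auto elim!: eventually_mono intro!: order_trans[OF decay_radius_antimono persistent_rad] assms(2))
  qed simp
  moreover have "0 < decay_radius (m / 2)" using assms(1) by (intro decay_radius_pos) simp
  ultimately show ?thesis by (auto simp: persistent_def)
qed

end

section \<open>Uniformly separated pairs of equilibria\<close>

lemma quotient_log_deriv:
  fixes w b p q :: "real \<Rightarrow> real"
  assumes "(w has_real_derivative A * w t) (at t)" "(b has_real_derivative B * b t) (at t)"
    "(p has_real_derivative C * p t) (at t)" "(q has_real_derivative D * q t) (at t)"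
    and "b t \<noteq> 0" "q t \<noteq> 0"
  shows "((\<lambda>t. w t * p t / (b t * q t)) has_real_derivative (A + C - B - D) * (w t * p t / (b t * q t))) (at t)"
proof -
  have "((\<lambda>t. w t * p t / (b t * q t)) has_real_derivative
      ((A * w t * p t + C * p t * w t) * (b t * q t) - w t * p t * (B * b t * q t + D * q t * b t)) / ((b t * q t) * (b t * q t))) (at t)"
    using assms by (intro DERIV_divide DERIV_mult) auto
  also have "((A * w t * p t + C * p t * w t) * (b t * q t) - w t * p t * (B * b t * q t + D * q t * b t)) / ((b t * q t) * (b t * q t))
    = (A + C - B - D) * (w t * p t / (b t * q t))"
    using assms(5,6) by (simp add: divide_simps) (simp add: algebra_simps)
  finally show ?thesis .
qed

context cubic_family
begin

text \<open>The part of the attractor in the closed upper half.\<close>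

definition attr_upper :: "real \<Rightarrow> ('w \<times> real) set" where
  "attr_upper l = {(\<omega>, x). 0 \<le> x \<and> x \<le> \<beta> l \<omega>}"

lemma mem_attr_upper: "(\<omega>, x) \<in> attr_upper l \<longleftrightarrow> 0 \<le> x \<and> x \<le> \<beta> l \<omega>"
  by (simp add: attr_upper_def)

lemma attr_upper_attr: "p \<in> attr_upper l \<Longrightarrow> p \<in> attr l"
  by (cases p) (auto simp: mem_attr_upper intro: in_attrI)

lemma attr_upper_S: "(\<omega>, x) \<in> attr_upper l \<Longrightarrow> (\<sigma> t \<omega>, S l t \<omega> x) \<in> attr_upper l"
proof -
  assume *: "(\<omega>, x) \<in> attr_upper l"
  note A = attr_upper_attr[OF *]
  have "0 \<le> S l t \<omega> x"
  proof (cases "0 \<le> t")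
    case True
    then show ?thesis using * by (simp add: S_nonneg mem_attr_upper)
  next
    case False
    then show ?thesis
      using attr_S_add[OF A, of "- t" t] S_nonneg[of "- t" l "\<sigma> t \<omega>" "S l t \<omega> x"] * by (simp add: mem_attr_upper)
  qed
  then show ?thesis using attr_S[OF A, of t] by (simp add: mem_attr_upper mem_band)
qed

lemma attr_upper_compact: "compact (attr_upper l)"
proof -
  have "compact (attr l \<inter> UNIV \<times> {0..})"
    by (intro compact_Int_closed attr_compact closed_Times closed_UNIV closed_atLeast)
  also have "attr l \<inter> UNIV \<times> {0..} = attr_upper l"
  proof -
    have "p \<in> attr l \<inter> UNIV \<times> {0..} \<longleftrightarrow> p \<in> attr_upper l" for p
      using alpha_le_0[of l "fst p"] by (cases p) (auto simp: mem_attr_upper mem_band)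
    then show ?thesis by blast
  qed
  finally show ?thesis .
qed

lemma S_continuous_on_forward:
  assumes "0 \<le> t" "\<And>p. p \<in> K \<Longrightarrow> 0 \<le> snd p"
  shows "continuous_on K (\<lambda>p. S l t (fst p) (snd p))"
  unfolding continuous_on_def
proof
  fix p assume "p \<in> K"
  then show "((\<lambda>p. S l t (fst p) (snd p)) \<longlongrightarrow> S l t (fst p) (snd p)) (at p within K)"
    by (intro S_tendsto[OF assms(1) tendsto_const] tendsto_intros)
      (use assms(2) in \<open>auto simp: eventually_at_filter intro!: always_eventually\<close>)
qed

text \<open>Continuous dependence in backward time is available on the attractor only; there the flow map is
  the inverse of a continuous bijection of a compact space.\<close>

lemma S_continuous_on_attr_upper: "continuous_on (attr_upper l) (\<lambda>p. S l t (fst p) (snd p))"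
proof (cases "0 \<le> t")
  case True
  then show ?thesis by (intro S_continuous_on_forward) (auto simp: attr_upper_def)
next
  case False
  let ?F = "\<lambda>t p. (\<sigma> t (fst p), S l t (fst p) (snd p))"
  have F: "?F r p \<in> attr_upper l" "?F (- r) (?F r p) = p" if "p \<in> attr_upper l" for r p
    using that attr_upper_S[of "fst p" "snd p" l r] attr_S_add[of "fst p" "snd p" l "- r" r] attr_upper_attr[OF that] by auto
  have cont: "continuous_on (attr_upper l) (?F (- t))"
    using False by (intro continuous_intros S_continuous_on_forward) (auto simp: attr_upper_def)
  have im: "?F (- t) ` attr_upper l = attr_upper l"
  proof (intro subset_antisym subsetI)
    fix p assume "p \<in> attr_upper l"
    show "p \<in> ?F (- t) ` attr_upper l"
    proof (rule image_eqI)
      show "p = ?F (- t) (?F t p)" by (rule F(2)[OF \<open>p \<in> attr_upper l\<close>, symmetric])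
      show "?F t p \<in> attr_upper l" by (rule F(1)[OF \<open>p \<in> attr_upper l\<close>])
    qed
  next
    fix p assume "p \<in> ?F (- t) ` attr_upper l"
    then obtain q where "q \<in> attr_upper l" "p = ?F (- t) q" by (rule imageE)
    then show "p \<in> attr_upper l" using F(1)[of q "- t"] by (simp only:)
  qed
  have "continuous_on (?F (- t) ` attr_upper l) (?F t)"
    by (rule continuous_on_inv[OF cont attr_upper_compact]) (use F(2)[of _ "- t"] in simp)
  then have "continuous_on (attr_upper l) (\<lambda>p. snd (?F t p))"
    unfolding im by (rule continuous_on_snd)
  then show ?thesis by simp
qed

text \<open>Hyperbolicity of the graph of an equilibrium \<open>b\<close>, with the solutions on the graph written as values of
  \<open>b\<close>; in the repulsive case the existence of the nearby backward solutions is part of the claim.\<close>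

definition att_near :: "real \<Rightarrow> ('w \<Rightarrow> real) \<Rightarrow> bool" where
  "att_near l b \<longleftrightarrow> (\<exists>\<delta>>0. \<exists>k\<ge>1. \<exists>\<gamma>>0. \<forall>\<omega> y t. \<bar>y - b \<omega>\<bar> < \<delta> \<longrightarrow> 0 \<le> t \<longrightarrow>
     \<bar>S l t \<omega> y - b (\<sigma> t \<omega>)\<bar> \<le> k * exp (- \<gamma> * t) * \<bar>y - b \<omega>\<bar>)"

definition rep_near :: "real \<Rightarrow> ('w \<Rightarrow> real) \<Rightarrow> bool" where
  "rep_near l b \<longleftrightarrow> (\<exists>\<delta>>0. \<exists>k\<ge>1. \<exists>\<gamma>>0. \<forall>\<omega> y t. \<bar>y - b \<omega>\<bar> < \<delta> \<longrightarrow> t \<le> 0 \<longrightarrow>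
     t \<in> dom l \<omega> y \<and> \<bar>S l t \<omega> y - b (\<sigma> t \<omega>)\<bar> \<le> k * exp (\<gamma> * t) * \<bar>y - b \<omega>\<bar>)"

lemma att_near_hyp: "eqm l b \<Longrightarrow> att_near l b \<Longrightarrow> hyp_attractive \<sigma> (cubic a l) (graph_of b)"
  unfolding att_near_def hyp_attractive_def
  by (elim ex_forward conj_forward) (auto simp: graph_of_def eqm_S fwd_dom)

lemma rep_near_hyp: "eqm l b \<Longrightarrow> rep_near l b \<Longrightarrow> hyp_repulsive \<sigma> (cubic a l) (graph_of b)"
  unfolding rep_near_def hyp_repulsive_def
  by (elim ex_forward conj_forward) (auto simp: graph_of_def eqm_S)

end

text \<open>Two equilibria \<open>\<kappa> < b\<close> with a uniform gap. The weight \<open>w\<close> and the number \<open>m\<close> unify two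
  situations: \<open>w = \<kappa>\<close>, \<open>m = 0\<close> for a positive lower equilibrium, and \<open>w = 1\<close>, \<open>m = l\<close> for
  \<open>\<kappa> = 0\<close> and \<open>l \<ge> 0\<close>.\<close>

locale separated_pair = cubic_family \<sigma> a \<alpha> \<beta>
  for \<sigma> :: "real \<Rightarrow> 'w::metric_space \<Rightarrow> 'w" and a :: "'w \<Rightarrow> real" and \<alpha> \<beta> :: "real \<Rightarrow> 'w \<Rightarrow> real" +
  fixes l :: real and \<kappa> b w :: "'w \<Rightarrow> real" and m \<epsilon> R w1 w2 :: real
  assumes kappa: "eqm l \<kappa>" and b: "eqm l b" and kappa_nonneg: "\<And>\<omega>. 0 \<le> \<kappa> \<omega>"
    and gap: "\<And>\<omega>. \<kappa> \<omega> + \<epsilon> \<le> b \<omega>" and eps: "0 < \<epsilon>" and b_le: "\<And>\<omega>. b \<omega> \<le> R"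
    and w: "\<And>\<omega> t. ((\<lambda>t. w (\<sigma> t \<omega>)) has_real_derivative
        (growth l (\<sigma> t \<omega>) (\<kappa> (\<sigma> t \<omega>)) - m) * w (\<sigma> t \<omega>)) (at t)"
    and m: "0 \<le> m" and w1: "0 < w1" "\<And>\<omega>. w1 \<le> w \<omega>" and w2: "\<And>\<omega>. w \<omega> \<le> w2"
begin

text \<open>For \<open>w = \<kappa>\<close> this is the ratio of \<open>1 / x - 1 / b\<close> and \<open>1 / \<kappa> - 1 / x\<close>; for \<open>\<kappa> = 0\<close> and
  \<open>w = 1\<close> it is \<open>1 / x - 1 / b\<close>.\<close>

definition ratio :: "'w \<Rightarrow> real \<Rightarrow> real" where
  "ratio \<omega> x = w \<omega> * (b \<omega> - x) / (b \<omega> * (x - \<kappa> \<omega>))"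

definition coratio :: "'w \<Rightarrow> real \<Rightarrow> real" where
  "coratio \<omega> x = b \<omega> * (x - \<kappa> \<omega>) / (w \<omega> * (b \<omega> - x))"

lemma b_ge: "\<epsilon> \<le> b \<omega>" and b_pos: "0 < b \<omega>" and w_pos: "0 < w \<omega>" and w2_pos: "0 < w2" and R_pos: "0 < R"
proof -
  fix \<omega>
  show "\<epsilon> \<le> b \<omega>" using gap[of \<omega>] kappa_nonneg[of \<omega>] by linarith
  then show "0 < b \<omega>" using eps by linarith
  then show "0 < R" using b_le[of \<omega>] by linarith
  show "0 < w \<omega>" using w1 w1(2)[of \<omega>] by linarith
  then show "0 < w2" using w2[of \<omega>] by linarith
qed

lemma ratio_rates:
  assumes u: "sol_on l \<omega> J u" and t: "t \<in> J"
  shows "u t \<noteq> \<kappa> (\<sigma> t \<omega>) \<Longrightarrow> ((\<lambda>t. ratio (\<sigma> t \<omega>) (u t)) has_real_derivative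
      - (m + u t * (b (\<sigma> t \<omega>) - \<kappa> (\<sigma> t \<omega>))) * ratio (\<sigma> t \<omega>) (u t)) (at t)"
    and "u t \<noteq> b (\<sigma> t \<omega>) \<Longrightarrow> ((\<lambda>t. coratio (\<sigma> t \<omega>) (u t)) has_real_derivative
      (m + u t * (b (\<sigma> t \<omega>) - \<kappa> (\<sigma> t \<omega>))) * coratio (\<sigma> t \<omega>) (u t)) (at t)"
proof -
  let ?w = "\<lambda>t. w (\<sigma> t \<omega>)" and ?b = "\<lambda>t. b (\<sigma> t \<omega>)" and ?k = "\<lambda>t. \<kappa> (\<sigma> t \<omega>)"
  have b': "(?b has_real_derivative growth l (\<sigma> t \<omega>) (?b t) * ?b t) (at t)"
    using sol_onD[OF eqm_sol_on[OF b, of \<omega> UNIV], of t] by (simp add: cubic_growth)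
  have p: "((\<lambda>t. ?b t - u t) has_real_derivative secant l (\<sigma> t \<omega>) (?b t) (u t) * (?b t - u t)) (at t)"
    using sol_on_diff_deriv[OF eqm_sol_on[OF b, of \<omega> J] u t] by simp
  have q: "((\<lambda>t. u t - ?k t) has_real_derivative secant l (\<sigma> t \<omega>) (u t) (?k t) * (u t - ?k t)) (at t)"
    using sol_on_diff_deriv[OF u eqm_sol_on[OF kappa, of \<omega> J] t] by simp
  \<comment> \<open>the cancellation behind the whole construction: only \<open>m\<close> and the product of \<open>u\<close> with the gap survive\<close>
  have rate: "growth l (\<sigma> t \<omega>) (?k t) - m + secant l (\<sigma> t \<omega>) (?b t) (u t) - growth l (\<sigma> t \<omega>) (?b t) - secant l (\<sigma> t \<omega>) (u t) (?k t)
     = - (m + u t * (?b t - ?k t))"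
    by (simp add: growth_def secant_def power2_eq_square algebra_simps)
  show "((\<lambda>t. ratio (\<sigma> t \<omega>) (u t)) has_real_derivative - (m + u t * (?b t - ?k t)) * ratio (\<sigma> t \<omega>) (u t)) (at t)"
    if "u t \<noteq> ?k t"
    using quotient_log_deriv[OF w[of \<omega> t] b' p q] that b_pos[of "\<sigma> t \<omega>"] unfolding ratio_def rate by simp
  have rate': "growth l (\<sigma> t \<omega>) (?b t) + secant l (\<sigma> t \<omega>) (u t) (?k t) - (growth l (\<sigma> t \<omega>) (?k t) - m) - secant l (\<sigma> t \<omega>) (?b t) (u t)
     = m + u t * (?b t - ?k t)"
    using rate by linarith
  show "((\<lambda>t. coratio (\<sigma> t \<omega>) (u t)) has_real_derivative (m + u t * (?b t - ?k t)) * coratio (\<sigma> t \<omega>) (u t)) (at t)"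
    if "u t \<noteq> ?b t"
    using quotient_log_deriv[OF b' w[of \<omega> t] q p] that w_pos[of "\<sigma> t \<omega>"] unfolding coratio_def rate' by simp
qed

lemma rate_ge: "0 \<le> q \<Longrightarrow> q \<le> x \<Longrightarrow> q * \<epsilon> \<le> m + x * (b \<omega> - \<kappa> \<omega>)"
  using mult_mono[of q x \<epsilon> "b \<omega> - \<kappa> \<omega>"] gap[of \<omega>] eps m by simp

lemma ratio_forward:
  assumes t: "0 \<le> t" and x: "\<kappa> \<omega> < x" and q: "0 \<le> q" "\<And>\<tau>. 0 \<le> \<tau> \<Longrightarrow> \<tau> \<le> t \<Longrightarrow> q \<le> S l \<tau> \<omega> x"
  shows "\<bar>ratio (\<sigma> t \<omega>) (S l t \<omega> x)\<bar> \<le> \<bar>ratio \<omega> x\<bar> * exp (- (q * \<epsilon>) * t)"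
proof -
  let ?u = "\<lambda>t. S l t \<omega> x"
  let ?r = "\<lambda>\<tau>. m + ?u \<tau> * (b (\<sigma> \<tau> \<omega>) - \<kappa> (\<sigma> \<tau> \<omega>))"
  have gt: "\<kappa> (\<sigma> \<tau> \<omega>) < ?u \<tau>" if "0 \<le> \<tau>" for \<tau>
    using S_strict_mono[OF that, of l \<omega> "\<kappa> \<omega>" x] x by (simp add: eqm_S[OF kappa])
  have "\<bar>ratio (\<sigma> t \<omega>) (?u t)\<bar> \<le> \<bar>ratio (\<sigma> 0 \<omega>) (?u 0)\<bar> * exp (- (q * \<epsilon>) * (t - 0))"
  proof (rule growth_upper[OF t, where d = "\<lambda>\<tau>. ratio (\<sigma> \<tau> \<omega>) (?u \<tau>)"])
    fix \<tau> :: real assume \<tau>: "0 \<le> \<tau>" "\<tau> \<le> t"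
    show "((\<lambda>\<tau>. ratio (\<sigma> \<tau> \<omega>) (?u \<tau>)) has_real_derivative - ?r \<tau> * ratio (\<sigma> \<tau> \<omega>) (?u \<tau>)) (at \<tau>)"
      using \<tau> gt[OF \<tau>(1)] by (intro ratio_rates(1)[OF fwd_sol_on]) auto
    have "- ?r \<tau> * (ratio (\<sigma> \<tau> \<omega>) (?u \<tau>))\<^sup>2 \<le> - (q * \<epsilon>) * (ratio (\<sigma> \<tau> \<omega>) (?u \<tau>))\<^sup>2"
      using rate_ge[OF q(1) q(2)[OF \<tau>], of "\<sigma> \<tau> \<omega>"] by (intro mult_right_mono) auto
    then show "ratio (\<sigma> \<tau> \<omega>) (?u \<tau>) * (- ?r \<tau> * ratio (\<sigma> \<tau> \<omega>) (?u \<tau>)) \<le> - (q * \<epsilon>) * (ratio (\<sigma> \<tau> \<omega>) (?u \<tau>))\<^sup>2"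
      by (simp add: power2_eq_square algebra_simps)
  qed
  then show ?thesis by simp
qed

lemma ratio_le: 
  assumes "0 < c" "c \<le> x - \<kappa> \<omega>" shows "\<bar>ratio \<omega> x\<bar> \<le> w2 * \<bar>b \<omega> - x\<bar> / (\<epsilon> * c)"
proof -
  have "\<bar>ratio \<omega> x\<bar> = w \<omega> * \<bar>b \<omega> - x\<bar> / (b \<omega> * (x - \<kappa> \<omega>))"
    using assms b_pos[of \<omega>] w_pos[of \<omega>] by (simp add: ratio_def abs_mult)
  also have "\<dots> \<le> w2 * \<bar>b \<omega> - x\<bar> / (\<epsilon> * c)"
    using assms b_ge[of \<omega>] w2[of \<omega>] w2_pos eps by (intro frac_le mult_mono mult_right_mono) auto
  finally show ?thesis .
qed

lemma dist_b_le: 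
  assumes "\<kappa> \<omega> < x" shows "\<bar>x - b \<omega>\<bar> \<le> \<bar>ratio \<omega> x\<bar> * (R * (x - \<kappa> \<omega>) / w1)"
proof -
  have "\<bar>x - b \<omega>\<bar> = \<bar>ratio \<omega> x\<bar> * (b \<omega> * (x - \<kappa> \<omega>) / w \<omega>)"
    using assms b_pos[of \<omega>] w_pos[of \<omega>] by (simp add: ratio_def abs_mult abs_minus_commute)
  also have "\<dots> \<le> \<bar>ratio \<omega> x\<bar> * (R * (x - \<kappa> \<omega>) / w1)"
    using assms b_pos[of \<omega>] b_le[of \<omega>] w1(1) w1(2)[of \<omega>] R_pos by (intro mult_left_mono frac_le mult_right_mono) auto
  finally show ?thesis .
qed

text \<open>Every solution that starts above \<open>\<kappa>\<close> and stays above some \<open>q > 0\<close> is exponentially attracted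
  by \<open>b\<close>: \<open>ratio\<close> decays at the rate \<open>q \<epsilon>\<close> and is comparable to the distance from \<open>b\<close>.\<close>

lemma forward_convergence:
  assumes t: "0 \<le> t" and c: "0 < c" "c \<le> x - \<kappa> \<omega>" and X: "x \<le> X" "absorbing_level l \<le> X"
    and q: "0 \<le> q" "\<And>\<tau>. 0 \<le> \<tau> \<Longrightarrow> \<tau> \<le> t \<Longrightarrow> q \<le> S l \<tau> \<omega> x"
  shows "\<bar>S l t \<omega> x - b (\<sigma> t \<omega>)\<bar> \<le> (w2 * R * X / (\<epsilon> * c * w1)) * \<bar>x - b \<omega>\<bar> * exp (- (q * \<epsilon>) * t)"
proof -
  have gt: "\<kappa> (\<sigma> t \<omega>) < S l t \<omega> x"
    using S_strict_mono[OF t, of l \<omega> "\<kappa> \<omega>" x] c by (simp add: eqm_S[OF kappa])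
  have XX: "S l t \<omega> x - \<kappa> (\<sigma> t \<omega>) \<le> X"
    using S_le_absorbing_level[OF t X, of \<omega>] kappa_nonneg[of "\<sigma> t \<omega>"] by linarith
  have "\<bar>S l t \<omega> x - b (\<sigma> t \<omega>)\<bar> \<le> \<bar>ratio (\<sigma> t \<omega>) (S l t \<omega> x)\<bar> * (R * (S l t \<omega> x - \<kappa> (\<sigma> t \<omega>)) / w1)"
    by (rule dist_b_le[OF gt])
  also have "\<dots> \<le> (w2 * \<bar>b \<omega> - x\<bar> / (\<epsilon> * c) * exp (- (q * \<epsilon>) * t)) * (R * X / w1)"
  proof (rule mult_mono)
    show "\<bar>ratio (\<sigma> t \<omega>) (S l t \<omega> x)\<bar> \<le> w2 * \<bar>b \<omega> - x\<bar> / (\<epsilon> * c) * exp (- (q * \<epsilon>) * t)"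
    proof -
      have "\<bar>ratio (\<sigma> t \<omega>) (S l t \<omega> x)\<bar> \<le> \<bar>ratio \<omega> x\<bar> * exp (- (q * \<epsilon>) * t)"
        by (rule ratio_forward[OF t _ q]) (use c in auto)
      also have "\<dots> \<le> w2 * \<bar>b \<omega> - x\<bar> / (\<epsilon> * c) * exp (- (q * \<epsilon>) * t)" by (intro mult_right_mono ratio_le[OF c]) simp
      finally show ?thesis .
    qed
    show "R * (S l t \<omega> x - \<kappa> (\<sigma> t \<omega>)) / w1 \<le> R * X / w1"
      using XX R_pos w1 by (intro divide_right_mono mult_left_mono) auto
    show "0 \<le> w2 * \<bar>b \<omega> - x\<bar> / (\<epsilon> * c) * exp (- (q * \<epsilon>) * t)" using w2_pos eps c by simp
    show "0 \<le> R * (S l t \<omega> x - \<kappa> (\<sigma> t \<omega>)) / w1" using R_pos w1 gt by simp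
  qed
  also have "\<dots> = (w2 * R * X / (\<epsilon> * c * w1)) * \<bar>x - b \<omega>\<bar> * exp (- (q * \<epsilon>) * t)"
    by (simp add: abs_minus_commute)
  finally show ?thesis .
qed

text \<open>Applying \<open>forward_convergence\<close> requires a lower bound for nearby solutions. It comes from the ratio itself,
  which at least does not increase, so that a solution starting close to \<open>b\<close> stays close enough to \<open>b\<close> to
  be above \<open>\<epsilon> / 2\<close>.\<close>

lemma b_attractive: "att_near l b"
proof -
  define X where "X = max (R + \<epsilon>) (absorbing_level l)"
  \<comment> \<open>the second bound makes the initial ratio small enough for the distance to \<open>b\<close> to stay below a quarter of that to \<open>\<kappa>\<close>\<close>
  define \<delta> where "\<delta> = min (\<epsilon> / 2) (w1 * \<epsilon>\<^sup>2 / (8 * w2 * R))"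
  define k where "k = max 1 (w2 * R * X / (\<epsilon> * (\<epsilon> / 2) * w1))"
  define \<gamma> where "\<gamma> = (\<epsilon> / 2) * \<epsilon>"
  have \<delta>: "0 < \<delta>" "\<delta> \<le> \<epsilon> / 2" using eps w1 w2_pos R_pos by (auto simp: \<delta>_def)
  have "\<delta> \<le> w1 * \<epsilon>\<^sup>2 / (8 * w2 * R)" by (simp add: \<delta>_def)
  then have "\<delta> * (8 * w2 * R) \<le> w1 * \<epsilon>\<^sup>2" using w2_pos R_pos by (simp add: pos_le_divide_eq)
  then have \<delta>': "w2 * \<delta> / (\<epsilon> * (\<epsilon> / 2)) * (R / w1) \<le> 1 / 4"
    using eps w1 by (simp add: divide_simps power2_eq_square mult_ac)
  have main: "\<bar>S l t \<omega> y - b (\<sigma> t \<omega>)\<bar> \<le> k * exp (- \<gamma> * t) * \<bar>y - b \<omega>\<bar>"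
    if y: "\<bar>y - b \<omega>\<bar> < \<delta>" and t: "0 \<le> t" for \<omega> y t
  proof -
    have c: "\<epsilon> / 2 \<le> y - \<kappa> \<omega>" using y \<delta> gap[of \<omega>] by linarith
    have y0: "0 \<le> y" using c kappa_nonneg[of \<omega>] eps by linarith
    have lower: "\<epsilon> / 2 \<le> S l \<tau> \<omega> y" if \<tau>: "0 \<le> \<tau>" for \<tau>
    proof -
      let ?z = "S l \<tau> \<omega> y"
      have gt: "\<kappa> (\<sigma> \<tau> \<omega>) < ?z"
        using S_strict_mono[OF \<tau>, of l \<omega> "\<kappa> \<omega>" y] c eps by (simp add: eqm_S[OF kappa])
      have "\<bar>ratio (\<sigma> \<tau> \<omega>) ?z\<bar> \<le> \<bar>ratio \<omega> y\<bar>"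
        using ratio_forward[OF \<tau>, of \<omega> y 0] c eps y0 by (simp add: S_nonneg)
      also have "\<dots> \<le> w2 * \<bar>b \<omega> - y\<bar> / (\<epsilon> * (\<epsilon> / 2))" using ratio_le[OF _ c] eps by simp
      also have "\<dots> \<le> w2 * \<delta> / (\<epsilon> * (\<epsilon> / 2))"
        using y eps w2_pos by (intro divide_right_mono mult_left_mono) auto
      finally have PP: "\<bar>ratio (\<sigma> \<tau> \<omega>) ?z\<bar> \<le> w2 * \<delta> / (\<epsilon> * (\<epsilon> / 2))" .
      have "\<bar>?z - b (\<sigma> \<tau> \<omega>)\<bar> \<le> \<bar>ratio (\<sigma> \<tau> \<omega>) ?z\<bar> * (R / w1 * (?z - \<kappa> (\<sigma> \<tau> \<omega>)))"
        using dist_b_le[OF gt] by simp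
      also have "\<dots> \<le> w2 * \<delta> / (\<epsilon> * (\<epsilon> / 2)) * (R / w1 * (?z - \<kappa> (\<sigma> \<tau> \<omega>)))"
        using PP gt R_pos w1 by (intro mult_right_mono) auto
      also have "\<dots> \<le> 1 / 4 * (?z - \<kappa> (\<sigma> \<tau> \<omega>))"
        unfolding mult.assoc[symmetric] using \<delta>' gt by (intro mult_right_mono) auto
      finally show ?thesis using gap[of "\<sigma> \<tau> \<omega>"] kappa_nonneg[of "\<sigma> \<tau> \<omega>"] eps by (simp add: abs_if split: if_splits)
    qed
    have "\<bar>S l t \<omega> y - b (\<sigma> t \<omega>)\<bar> \<le> (w2 * R * X / (\<epsilon> * (\<epsilon> / 2) * w1)) * \<bar>y - b \<omega>\<bar> * exp (- (\<epsilon> / 2 * \<epsilon>) * t)"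
      by (rule forward_convergence[OF t _ c]) (use eps y \<delta> b_le[of \<omega>] lower in \<open>auto simp: X_def\<close>)
    also have "\<dots> \<le> k * \<bar>y - b \<omega>\<bar> * exp (- (\<epsilon> / 2 * \<epsilon>) * t)"
      by (intro mult_right_mono) (auto simp: k_def)
    finally show ?thesis by (simp add: \<gamma>_def mult_ac)
  qed
  show ?thesis
    unfolding att_near_def
    by (rule exI[of _ \<delta>], intro conjI \<delta> exI[of _ k] exI[of _ \<gamma>]) (use main eps in \<open>auto simp: k_def \<gamma>_def\<close>)
qed

text \<open>\<open>b\<close> is the uniform limit of the values reached from a constant level above \<open>b\<close> that was left
  \<open>n\<close> time units ago.\<close>

lemma b_continuous: "continuous_on UNIV b"
proof (rule uniform_limit_theorem)
  define X where "X = max R (absorbing_level l)"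
  define C where "C = (w2 * R * X / (\<epsilon> * \<epsilon> * w1)) * X"
  show "uniform_limit UNIV (\<lambda>n \<omega>. S l (real n) (\<sigma> (- real n) \<omega>) X) b sequentially"
    unfolding uniform_limit_iff
  proof (intro allI impI)
    fix e :: real assume e: "0 < e"
    have "(\<lambda>n. C * exp (- (\<epsilon> * \<epsilon>) * real n)) \<longlonglongrightarrow> 0"
      by (rule exp_decay_sequentially) (use eps in simp)
    then have "\<forall>\<^sub>F n in sequentially. C * exp (- (\<epsilon> * \<epsilon>) * real n) < e" by (rule order_tendstoD) (rule e)
    then show "\<forall>\<^sub>F n in sequentially. \<forall>\<omega>\<in>UNIV. dist (S l (real n) (\<sigma> (- real n) \<omega>) X) (b \<omega>) < e"
    proof eventually_elim
      case (elim n)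
      show ?case
      proof
        fix \<omega>
        define \<eta> where "\<eta> = \<sigma> (- real n) \<omega>"
        have X: "b \<eta> \<le> X" for \<eta> using b_le[of \<eta>] by (auto simp: X_def)
        have X0: "0 < X" using R_pos by (auto simp: X_def)
        have "\<bar>S l n \<eta> X - b (\<sigma> n \<eta>)\<bar> \<le> (w2 * R * X / (\<epsilon> * \<epsilon> * w1)) * \<bar>X - b \<eta>\<bar> * exp (- (\<epsilon> * \<epsilon>) * n)"
        proof (rule forward_convergence)
          show "\<epsilon> \<le> X - \<kappa> \<eta>" using gap[of \<eta>] X[of \<eta>] by linarith
          fix \<tau> :: real assume "0 \<le> \<tau>"
          then have "b (\<sigma> \<tau> \<eta>) \<le> S l \<tau> \<eta> X" using S_mono[of \<tau> l \<eta> "b \<eta>" X] X by (simp add: eqm_S[OF b])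
          then show "\<epsilon> \<le> S l \<tau> \<eta> X" using b_ge[of "\<sigma> \<tau> \<eta>"] by linarith
        qed (use eps in \<open>auto simp: X_def\<close>)
        also have "\<dots> \<le> C * exp (- (\<epsilon> * \<epsilon>) * n)"
          unfolding C_def using X0 X[of \<eta>] b_pos[of \<eta>] w2_pos R_pos eps w1(1)
          by (intro mult_right_mono mult_left_mono) auto
        finally show "dist (S l (real n) (\<sigma> (- real n) \<omega>) X) (b \<omega>) < e"
          using elim by (simp add: \<eta>_def dist_real_def)
      qed
    qed
  qed
  have "0 \<le> X" using R_pos by (simp add: X_def)
  then have "continuous_on UNIV (\<lambda>\<omega>. (\<lambda>p. S l (real n) (fst p) (snd p)) (\<sigma> (- real n) \<omega>, X))" for n
    by (intro continuous_on_compose2[OF S_continuous_on_forward[of "real n" "UNIV \<times> {0..}" l]] continuous_intros) auto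
  then show "\<forall>\<^sub>F n in sequentially. continuous_on UNIV (\<lambda>\<omega>. S l (real n) (\<sigma> (- real n) \<omega>) X)" by simp
qed simp

text \<open>A bounded ratio on the whole line that decays exponentially in forward time must vanish.\<close>

lemma entire_eq_b:
  assumes u: "sol_on l \<omega> UNIV u" and c: "0 < c" "\<And>t. \<kappa> (\<sigma> t \<omega>) + c \<le> u t" and X: "\<And>t. u t \<le> X"
  shows "u 0 = b \<omega>"
proof -
  define X' where "X' = max (max X R) (absorbing_level l)"
  have X': "0 < X'" "absorbing_level l \<le> X'" "X \<le> X'" "R \<le> X'" using R_pos by (auto simp: X'_def)
  have bound: "\<bar>u 0 - b \<omega>\<bar> \<le> (w2 * R * X' / (\<epsilon> * c * w1)) * X' * exp (- (c * \<epsilon>) * n)" for n :: nat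
  proof -
    let ?\<eta> = "\<sigma> (- n) \<omega>"
    have S: "S l \<tau> ?\<eta> (u (- n)) = u (\<tau> + - n)" if "0 \<le> \<tau>" for \<tau> :: real
      using that by (intro S_eq sol_on_shift[OF u]) auto
    have cu: "c \<le> u t" for t using c(2)[of t] kappa_nonneg[of "\<sigma> t \<omega>"] by linarith
    have "\<bar>S l n ?\<eta> (u (- n)) - b (\<sigma> n ?\<eta>)\<bar> \<le> (w2 * R * X' / (\<epsilon> * c * w1)) * \<bar>u (- n) - b ?\<eta>\<bar> * exp (- (c * \<epsilon>) * n)"
      using c(2)[of "- n"] X[of "- n"] X' S cu c(1) by (intro forward_convergence) auto
    also have "\<dots> \<le> (w2 * R * X' / (\<epsilon> * c * w1)) * X' * exp (- (c * \<epsilon>) * n)"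
    proof (intro mult_right_mono mult_left_mono)
      show "\<bar>u (- n) - b ?\<eta>\<bar> \<le> X'"
        using cu[of "- n"] c(1) X[of "- n"] X' b_le[of ?\<eta>] b_pos[of ?\<eta>] by (auto simp: abs_if)
    qed (use X' w2_pos R_pos eps c(1) w1(1) in auto)
    finally show ?thesis using S[of n] by simp
  qed
  have "(\<lambda>n. (w2 * R * X' / (\<epsilon> * c * w1)) * X' * exp (- (c * \<epsilon>) * real n)) \<longlonglongrightarrow> 0"
    by (rule exp_decay_sequentially) (use eps c in simp)
  then have "\<bar>u 0 - b \<omega>\<bar> \<le> 0" by (rule LIMSEQ_le_const) (use bound in auto)
  then show ?thesis by simp
qed

end

text \<open>If \<open>\<kappa>\<close> is bounded away from \<open>0\<close>, it is repulsive: the reciprocal \<open>coratio\<close> of \<open>ratio\<close>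
  decays in backward time. That \<open>b\<close> is the top of the attractor guarantees that the solutions between
  \<open>0\<close> and \<open>b\<close> exist in backward time.\<close>

locale separated_pair_pos = separated_pair +
  fixes \<kappa>0 :: real
  assumes b_eq_beta: "b = \<beta> l" and kappa0: "0 < \<kappa>0" "\<And>\<omega>. \<kappa>0 \<le> \<kappa> \<omega>"
begin

lemma coratio_backward:
  assumes t: "t \<le> 0" and y: "0 < y" "y < b \<omega>" and q: "0 \<le> q" "\<And>\<tau>. t \<le> \<tau> \<Longrightarrow> \<tau> \<le> 0 \<Longrightarrow> q \<le> S l \<tau> \<omega> y"
  shows "\<bar>coratio (\<sigma> t \<omega>) (S l t \<omega> y)\<bar> \<le> \<bar>coratio \<omega> y\<bar> * exp (q * \<epsilon> * t)"
proof -
  let ?u = "\<lambda>t. S l t \<omega> y"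
  let ?r = "\<lambda>\<tau>. m + ?u \<tau> * (b (\<sigma> \<tau> \<omega>) - \<kappa> (\<sigma> \<tau> \<omega>))"
  have u: "sol_on l \<omega> J ?u" for J using sol_on_subset[OF attr_sol_on[OF in_attrI]] y by (simp add: b_eq_beta)
  have lt: "?u \<tau> < b (\<sigma> \<tau> \<omega>)" if "\<tau> \<le> 0" for \<tau>
    using sol_on_less_ends[OF that u eqm_sol_on[OF b]] y by simp
  have "\<bar>coratio (\<sigma> t \<omega>) (?u t)\<bar> * exp (q * \<epsilon> * (0 - t)) \<le> \<bar>coratio (\<sigma> 0 \<omega>) (?u 0)\<bar>"
  proof (rule growth_lower[OF t, where d = "\<lambda>\<tau>. coratio (\<sigma> \<tau> \<omega>) (?u \<tau>)"])
    fix \<tau> :: real assume \<tau>: "t \<le> \<tau>" "\<tau> \<le> 0"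
    show "((\<lambda>\<tau>. coratio (\<sigma> \<tau> \<omega>) (?u \<tau>)) has_real_derivative ?r \<tau> * coratio (\<sigma> \<tau> \<omega>) (?u \<tau>)) (at \<tau>)"
      using lt[OF \<tau>(2)] by (intro ratio_rates(2)[OF u[of UNIV]]) auto
    have "q * \<epsilon> * (coratio (\<sigma> \<tau> \<omega>) (?u \<tau>))\<^sup>2 \<le> ?r \<tau> * (coratio (\<sigma> \<tau> \<omega>) (?u \<tau>))\<^sup>2"
      using rate_ge[OF q(1) q(2)[OF \<tau>], of "\<sigma> \<tau> \<omega>"] by (intro mult_right_mono) auto
    then show "q * \<epsilon> * (coratio (\<sigma> \<tau> \<omega>) (?u \<tau>))\<^sup>2 \<le> coratio (\<sigma> \<tau> \<omega>) (?u \<tau>) * (?r \<tau> * coratio (\<sigma> \<tau> \<omega>) (?u \<tau>))"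
      by (simp add: power2_eq_square algebra_simps)
  qed
  then have "\<bar>coratio (\<sigma> t \<omega>) (?u t)\<bar> * exp (q * \<epsilon> * (0 - t)) * exp (q * \<epsilon> * t) \<le> \<bar>coratio (\<sigma> 0 \<omega>) (?u 0)\<bar> * exp (q * \<epsilon> * t)"
    by (intro mult_right_mono) auto
  then show ?thesis by (simp add: mult.assoc exp_add[symmetric])
qed

lemma coratio_le:
  assumes "0 < c" "c \<le> b \<omega> - y" shows "\<bar>coratio \<omega> y\<bar> \<le> R / (w1 * c) * \<bar>y - \<kappa> \<omega>\<bar>"
proof -
  have "\<bar>coratio \<omega> y\<bar> = b \<omega> * \<bar>y - \<kappa> \<omega>\<bar> / (w \<omega> * (b \<omega> - y))"
    using assms b_pos[of \<omega>] w_pos[of \<omega>] by (simp add: coratio_def abs_mult)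
  also have "\<dots> \<le> R * \<bar>y - \<kappa> \<omega>\<bar> / (w1 * c)"
    using assms b_le[of \<omega>] w1(1) w1(2)[of \<omega>] R_pos by (intro frac_le mult_mono mult_right_mono) auto
  finally show ?thesis by simp
qed

lemma dist_kappa_le:
  assumes "0 \<le> y" "y < b \<omega>" shows "\<bar>y - \<kappa> \<omega>\<bar> \<le> \<bar>coratio \<omega> y\<bar> * (w2 * R / \<epsilon>)"
proof -
  have "\<bar>y - \<kappa> \<omega>\<bar> = \<bar>coratio \<omega> y\<bar> * (w \<omega> * (b \<omega> - y) / b \<omega>)"
    using assms b_pos[of \<omega>] w_pos[of \<omega>] by (simp add: coratio_def abs_mult)
  also have "\<dots> \<le> \<bar>coratio \<omega> y\<bar> * (w2 * R / \<epsilon>)"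
    using assms b_ge[of \<omega>] b_le[of \<omega>] w_pos[of \<omega>] w2[of \<omega>] eps w2_pos R_pos by (intro mult_left_mono frac_le mult_mono) auto
  finally show ?thesis .
qed

lemma backward_convergence:
  assumes t: "t \<le> 0" and y: "0 < y" and c: "0 < c" "c \<le> b \<omega> - y"
    and q: "0 \<le> q" "\<And>\<tau>. t \<le> \<tau> \<Longrightarrow> \<tau> \<le> 0 \<Longrightarrow> q \<le> S l \<tau> \<omega> y"
  shows "\<bar>S l t \<omega> y - \<kappa> (\<sigma> t \<omega>)\<bar> \<le> R / (w1 * c) * (w2 * R / \<epsilon>) * \<bar>y - \<kappa> \<omega>\<bar> * exp (q * \<epsilon> * t)"
proof -
  have yb: "y < b \<omega>" using c by simp
  have u: "sol_on l \<omega> J (\<lambda>t. S l t \<omega> y)" for J using sol_on_subset[OF attr_sol_on[OF in_attrI]] y yb by (simp add: b_eq_beta)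
  have lt: "S l t \<omega> y < b (\<sigma> t \<omega>)" 
    using sol_on_less_ends[OF t u eqm_sol_on[OF b]] yb by simp
  have "\<bar>S l t \<omega> y - \<kappa> (\<sigma> t \<omega>)\<bar> \<le> \<bar>coratio (\<sigma> t \<omega>) (S l t \<omega> y)\<bar> * (w2 * R / \<epsilon>)"
    using q(2)[of t] q(1) t by (intro dist_kappa_le lt) auto
  also have "\<dots> \<le> (R / (w1 * c) * \<bar>y - \<kappa> \<omega>\<bar> * exp (q * \<epsilon> * t)) * (w2 * R / \<epsilon>)"
  proof (intro mult_right_mono)
    have "\<bar>coratio (\<sigma> t \<omega>) (S l t \<omega> y)\<bar> \<le> \<bar>coratio \<omega> y\<bar> * exp (q * \<epsilon> * t)" by (rule coratio_backward[OF t y yb q])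
    also have "\<dots> \<le> R / (w1 * c) * \<bar>y - \<kappa> \<omega>\<bar> * exp (q * \<epsilon> * t)" by (intro mult_right_mono coratio_le[OF c]) simp
    finally show "\<bar>coratio (\<sigma> t \<omega>) (S l t \<omega> y)\<bar> \<le> R / (w1 * c) * \<bar>y - \<kappa> \<omega>\<bar> * exp (q * \<epsilon> * t)" .
  qed (use w2_pos R_pos eps in auto)
  finally show ?thesis by (simp add: mult_ac)
qed

lemma kappa_repulsive: "rep_near l \<kappa>"
proof -
  define C where "C = R / (w1 * (\<epsilon> / 2)) * (w2 * R / \<epsilon>)"
  have C: "0 < C" using R_pos w1 eps w2_pos by (simp add: C_def)
  define \<delta> where "\<delta> = min (min (\<epsilon> / 2) (\<kappa>0 / 2)) (\<kappa>0 / (2 * C))"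
  have \<delta>: "0 < \<delta>" "\<delta> \<le> \<epsilon> / 2" "\<delta> \<le> \<kappa>0 / 2" using eps kappa0 C by (auto simp: \<delta>_def)
  have "\<delta> \<le> \<kappa>0 / (2 * C)" by (simp add: \<delta>_def)
  then have \<delta>': "C * \<delta> \<le> \<kappa>0 / 2" using C by (simp add: field_simps)
  define k where "k = max 1 C"
  have main: "t \<in> dom l \<omega> y \<and> \<bar>S l t \<omega> y - \<kappa> (\<sigma> t \<omega>)\<bar> \<le> k * exp (\<kappa>0 / 2 * \<epsilon> * t) * \<bar>y - \<kappa> \<omega>\<bar>"
    if y: "\<bar>y - \<kappa> \<omega>\<bar> < \<delta>" and t: "t \<le> 0" for \<omega> y t
  proof
    have c: "\<epsilon> / 2 \<le> b \<omega> - y" "0 < y" using y \<delta> gap[of \<omega>] kappa0(1) kappa0(2)[of \<omega>] by linarith+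
    have A: "(\<omega>, y) \<in> attr l" using c eps by (intro in_attrI) (auto simp: b_eq_beta)
    then show "t \<in> dom l \<omega> y" by (simp add: attr_dom)
    have ge0: "0 \<le> S l \<tau> \<omega> y" for \<tau>
      using attr_upper_S[of \<omega> y l \<tau>] c eps by (simp add: mem_attr_upper b_eq_beta)
    have lower: "\<kappa>0 / 2 \<le> S l \<tau> \<omega> y" if \<tau>: "\<tau> \<le> 0" for \<tau>
    proof -
      have "\<bar>S l \<tau> \<omega> y - \<kappa> (\<sigma> \<tau> \<omega>)\<bar> \<le> C * \<bar>y - \<kappa> \<omega>\<bar>"
        using backward_convergence[OF \<tau> c(2) _ c(1), of 0] eps ge0 by (simp add: C_def)
      also have "\<dots> \<le> C * \<delta>" using y C by (intro mult_left_mono) auto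
      finally show ?thesis using \<delta>' kappa0(2)[of "\<sigma> \<tau> \<omega>"] by linarith
    qed
    have "\<bar>S l t \<omega> y - \<kappa> (\<sigma> t \<omega>)\<bar> \<le> C * \<bar>y - \<kappa> \<omega>\<bar> * exp (\<kappa>0 / 2 * \<epsilon> * t)"
      unfolding C_def by (rule backward_convergence[OF t c(2) _ c(1)]) (use eps kappa0 lower in auto)
    also have "\<dots> \<le> k * \<bar>y - \<kappa> \<omega>\<bar> * exp (\<kappa>0 / 2 * \<epsilon> * t)"
      by (intro mult_right_mono) (auto simp: k_def)
    finally show "\<bar>S l t \<omega> y - \<kappa> (\<sigma> t \<omega>)\<bar> \<le> k * exp (\<kappa>0 / 2 * \<epsilon> * t) * \<bar>y - \<kappa> \<omega>\<bar>" by (simp add: mult_ac)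
  qed
  show ?thesis
    unfolding rep_near_def
    by (rule exI[of _ \<delta>], intro conjI \<delta> exI[of _ k] exI[of _ "\<kappa>0 / 2 * \<epsilon>"]) (use main eps kappa0 in \<open>auto simp: k_def\<close>)
qed

text \<open>\<open>\<kappa>\<close> is the uniform limit of solutions followed backwards for time \<open>n\<close> from the continuous curve
  \<open>b - \<epsilon> / 2\<close>, which lies strictly between the two equilibria.\<close>

lemma kappa_continuous: "continuous_on UNIV \<kappa>"
proof (rule uniform_limit_theorem)
  define C where "C = R / (w1 * (\<epsilon> / 2)) * (w2 * R / \<epsilon>) * R"
  let ?f = "\<lambda>n \<omega>. S l (- real n) (\<sigma> (real n) \<omega>) (b (\<sigma> (real n) \<omega>) - \<epsilon> / 2)"
  show "uniform_limit UNIV ?f \<kappa> sequentially"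
    unfolding uniform_limit_iff
  proof (intro allI impI)
    fix e :: real assume e: "0 < e"
    have "(\<lambda>n. C * exp (- (\<kappa>0 * \<epsilon>) * real n)) \<longlonglongrightarrow> 0"
      by (rule exp_decay_sequentially) (use eps kappa0 in simp)
    then have "\<forall>\<^sub>F n in sequentially. C * exp (- (\<kappa>0 * \<epsilon>) * real n) < e" by (rule order_tendstoD) (rule e)
    then show "\<forall>\<^sub>F n in sequentially. \<forall>\<omega>\<in>UNIV. dist (?f n \<omega>) (\<kappa> \<omega>) < e"
    proof eventually_elim
      case (elim n)
      show ?case
      proof
        fix \<omega>
        define \<eta> where "\<eta> = \<sigma> (real n) \<omega>"
        let ?y = "b \<eta> - \<epsilon> / 2"
        have y: "\<kappa> \<eta> \<le> ?y" "0 < ?y" "\<bar>?y - \<kappa> \<eta>\<bar> \<le> R"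
          using gap[of \<eta>] kappa0(1) kappa0(2)[of \<eta>] eps b_le[of \<eta>] by linarith+
        have A: "(\<eta>, ?y) \<in> attr l" using y(2) eps by (intro in_attrI) (auto simp: b_eq_beta)
        have "\<bar>S l (- real n) \<eta> ?y - \<kappa> (\<sigma> (- real n) \<eta>)\<bar> \<le> R / (w1 * (\<epsilon> / 2)) * (w2 * R / \<epsilon>) * \<bar>?y - \<kappa> \<eta>\<bar> * exp (\<kappa>0 * \<epsilon> * (- real n))"
        proof (rule backward_convergence)
          fix \<tau> :: real assume "\<tau> \<le> 0"
          then have "\<kappa> (\<sigma> \<tau> \<eta>) \<le> S l \<tau> \<eta> ?y"
            using sol_on_le_ends[OF _ eqm_sol_on[OF kappa, of \<eta> "{\<tau>..0}"] sol_on_subset[OF attr_sol_on[OF A]]] y by simp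
          then show "\<kappa>0 \<le> S l \<tau> \<eta> ?y" using kappa0(2)[of "\<sigma> \<tau> \<eta>"] by linarith
        qed (use y eps kappa0 in auto)
        also have "\<dots> \<le> C * exp (- (\<kappa>0 * \<epsilon>) * real n)"
        proof -
          have "R / (w1 * (\<epsilon> / 2)) * (w2 * R / \<epsilon>) * \<bar>?y - \<kappa> \<eta>\<bar> \<le> C"
            unfolding C_def using y(3) R_pos w1(1) eps w2_pos by (intro mult_left_mono) auto
          then have "R / (w1 * (\<epsilon> / 2)) * (w2 * R / \<epsilon>) * \<bar>?y - \<kappa> \<eta>\<bar> * exp (\<kappa>0 * \<epsilon> * (- real n))
              \<le> C * exp (\<kappa>0 * \<epsilon> * (- real n))" by (intro mult_right_mono) auto
          then show ?thesis by simp
        qed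
        finally show "dist (?f n \<omega>) (\<kappa> \<omega>) < e"
          using elim by (simp add: \<eta>_def dist_real_def)
      qed
    qed
  qed
  have bc: "continuous_on UNIV (\<lambda>\<omega>. b (\<sigma> t \<omega>))" for t
    by (rule continuous_on_compose2[OF b_continuous]) (auto intro!: continuous_intros)
  have in_attr_upper: "(\<omega>, b \<omega> - \<epsilon> / 2) \<in> attr_upper l" for \<omega>
    using b_ge[of \<omega>] eps by (simp add: mem_attr_upper b_eq_beta)
  have "continuous_on UNIV (\<lambda>\<omega>. (\<lambda>p. S l (- real n) (fst p) (snd p)) (\<sigma> (real n) \<omega>, b (\<sigma> (real n) \<omega>) - \<epsilon> / 2))" for n
    by (intro continuous_on_compose2[OF S_continuous_on_attr_upper] continuous_intros bc) (use in_attr_upper in auto)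
  then show "\<forall>\<^sub>F n in sequentially. continuous_on UNIV (?f n)" by simp
qed simp

end

section \<open>Continuity points of semicontinuous functions\<close>

lemma interior_frontier_closed:
  assumes "closed S" shows "interior (frontier S) = {}"
proof -
  have "interior (frontier S) \<subseteq> interior S" 
    using assms frontier_subset_closed[of S] by (intro interior_mono) auto
  moreover have "interior (frontier S) \<subseteq> frontier S" by (rule interior_subset)
  ultimately show ?thesis by (auto simp: frontier_def)
qed

text \<open>A discontinuity of an upper semicontinuous function lies on the boundary of a superlevel set \<open>{\<omega>. q \<le> g \<omega>}\<close>
  with rational \<open>q\<close>; these sets are closed, so that their boundaries are nowhere dense.\<close>

lemma residual_continuity_points:
  fixes g :: "'a::metric_space \<Rightarrow> real"
  assumes "\<And>y. closed {\<omega>. y \<le> g \<omega>}"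
  shows "residual {\<omega>. isCont g \<omega>}"
  unfolding residual_def
proof (intro exI conjI ballI)
  let ?U = "\<lambda>q :: rat. - frontier {\<omega>. real_of_rat q \<le> g \<omega>}"
  show "countable (range ?U)" by simp
  fix U assume "U \<in> range ?U"
  then obtain q :: rat where U: "U = ?U q" by blast
  show "open U" unfolding U by (intro open_Compl frontier_closed)
  show "closure U = UNIV" 
    unfolding U closure_complement using interior_frontier_closed[OF assms] by simp
next
  let ?U = "\<lambda>q :: rat. - frontier {\<omega>. real_of_rat q \<le> g \<omega>}"
  show "\<Inter> (range ?U) \<subseteq> {\<omega>. isCont g \<omega>}"
  proof clarify
    fix \<omega> assume \<omega>: "\<omega> \<in> \<Inter> (range ?U)"
    show "isCont g \<omega>"
      unfolding isCont_def
    proof (rule order_tendstoI)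
      fix y assume "y < g \<omega>"
      then obtain q where q: "y < real_of_rat q" "real_of_rat q < g \<omega>" using of_rat_dense by blast
      have "\<omega> \<in> closure {\<omega>. real_of_rat q \<le> g \<omega>}" using q closure_subset by fastforce
      moreover have "\<omega> \<notin> frontier {\<omega>. real_of_rat q \<le> g \<omega>}" using \<omega> by blast
      ultimately have "\<omega> \<in> interior {\<omega>. real_of_rat q \<le> g \<omega>}" unfolding frontier_def by blast
      then have "\<forall>\<^sub>F \<eta> in at \<omega>. \<eta> \<in> interior {\<omega>. real_of_rat q \<le> g \<omega>}"
        by (auto simp: eventually_at_topological)
      then show "\<forall>\<^sub>F \<eta> in at \<omega>. y < g \<eta>"
        by eventually_elim (use q(1) interior_subset[of "{\<omega>. real_of_rat q \<le> g \<omega>}"] in auto)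
    next
      fix y assume y: "g \<omega> < y"
      have "open (- {\<omega>. y \<le> g \<omega>})" using assms by (rule open_Compl)
      then show "\<forall>\<^sub>F \<eta> in at \<omega>. g \<eta> < y"
        unfolding eventually_at_topological using y by (intro exI[of _ "- {\<omega>. y \<le> g \<omega>}"]) auto
    qed
  qed
qed

lemma residual_Int: "residual A \<Longrightarrow> residual B \<Longrightarrow> residual (A \<inter> B)"
  unfolding residual_def
proof (elim exE conjE)
  fix U V assume *: "countable U" "\<forall>u\<in>U. open u \<and> closure u = UNIV" "\<Inter> U \<subseteq> A" 
    "countable V" "\<forall>u\<in>V. open u \<and> closure u = UNIV" "\<Inter> V \<subseteq> B"
  show "\<exists>\<U>. countable \<U> \<and> (\<forall>U\<in>\<U>. open U \<and> closure U = UNIV) \<and> \<Inter> \<U> \<subseteq> A \<inter> B"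
  proof (intro exI conjI)
    show "countable (U \<union> V)" using *(1,4) by (rule countable_Un)
    show "\<forall>u\<in>U \<union> V. open u \<and> closure u = UNIV" using *(2,5) by blast
    show "\<Inter> (U \<union> V) \<subseteq> A \<inter> B" unfolding Inter_Un_distrib using *(3,6) by blast
  qed
qed

lemma residual_nonempty:
  assumes "compact (UNIV :: 'a::metric_space set)" "residual (R :: 'a set)"
  shows "R \<noteq> {}"
proof -
  obtain \<U> where U: "countable \<U>" "\<And>U. U \<in> \<U> \<Longrightarrow> open U \<and> closure U = UNIV" "\<Inter> \<U> \<subseteq> R"
    using assms(2) by (auto simp: residual_def)
  have "Met_TC.mtopology closure_of \<Inter> \<U> = (UNIV :: 'a set)"
  proof (rule Met_TC.metric_Baire_category)
    show "Met_TC.mcomplete TYPE('a)" using compact_imp_complete[OF assms(1)] by simp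
  qed (use U in auto)
  then have "closure (\<Inter> \<U>) = UNIV" by simp
  then have "\<Inter> \<U> \<noteq> {}" by auto
  then show ?thesis using U(3) by blast
qed

lemma semicontinuous_superlevel:
  assumes "\<And>y. closed {\<omega>. y \<le> g \<omega>}" shows "semicontinuous g"
  unfolding semicontinuous_def
proof (intro disjI2 allI impI)
  fix \<omega> y assume "g \<omega> < y"
  moreover have "open (- {\<omega>. y \<le> g \<omega>})" using assms by (rule open_Compl)
  ultimately show "\<forall>\<^sub>F \<eta> in nhds \<omega>. g \<eta> < y"
    unfolding eventually_nhds by (intro exI[of _ "- {\<omega>. y \<le> g \<omega>}"]) auto
qed

lemma semicontinuous_uminus: "semicontinuous g \<Longrightarrow> semicontinuous (\<lambda>\<omega>. - g \<omega>)"
  unfolding semicontinuous_def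
proof (elim disjE)
  assume *: "\<forall>\<omega> y. y < g \<omega> \<longrightarrow> (\<forall>\<^sub>F \<eta> in nhds \<omega>. y < g \<eta>)"
  show "(\<forall>\<omega> y. y < - g \<omega> \<longrightarrow> (\<forall>\<^sub>F \<eta> in nhds \<omega>. y < - g \<eta>)) \<or>
    (\<forall>\<omega> y. - g \<omega> < y \<longrightarrow> (\<forall>\<^sub>F \<eta> in nhds \<omega>. - g \<eta> < y))"
  proof (intro disjI2 allI impI)
    fix \<omega> y assume "- g \<omega> < y"
    then have "\<forall>\<^sub>F \<eta> in nhds \<omega>. - y < g \<eta>" using *[rule_format, of "- y" \<omega>] by simp
    then show "\<forall>\<^sub>F \<eta> in nhds \<omega>. - g \<eta> < y" by eventually_elim simp
  qed
next
  assume *: "\<forall>\<omega> y. g \<omega> < y \<longrightarrow> (\<forall>\<^sub>F \<eta> in nhds \<omega>. g \<eta> < y)"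
  show "(\<forall>\<omega> y. y < - g \<omega> \<longrightarrow> (\<forall>\<^sub>F \<eta> in nhds \<omega>. y < - g \<eta>)) \<or>
    (\<forall>\<omega> y. - g \<omega> < y \<longrightarrow> (\<forall>\<^sub>F \<eta> in nhds \<omega>. - g \<eta> < y))"
  proof (intro disjI1 allI impI)
    fix \<omega> y assume "y < - g \<omega>"
    then have "\<forall>\<^sub>F \<eta> in nhds \<omega>. g \<eta> < - y" using *[rule_format, of \<omega> "- y"] by simp
    then show "\<forall>\<^sub>F \<eta> in nhds \<omega>. y < - g \<eta>" by eventually_elim simp
  qed
qed

context cubic_family
begin

section \<open>Hyperbolic attractivity persists for nearby parameters\<close>

text \<open>Choose \<open>T\<close> such that the flow for \<open>l0\<close> halves small distances to \<open>b\<close> within time \<open>T\<close>. For \<open>l\<close>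
  close to \<open>l0\<close> the time \<open>T\<close> map still maps a fixed neighbourhood of \<open>b\<close> into itself, over all
  base points. Solutions for \<open>l\<close> that start on \<open>b\<close> in the past are therefore close to \<open>b\<close> at all
  multiples of \<open>T\<close>.\<close>

lemma att_near_persists:
  assumes b: "eqm l0 b" and att: "att_near l0 b" and r: "0 < r" "\<And>\<omega>. r \<le> b \<omega>" and R: "\<And>\<omega>. b \<omega> \<le> R"
  shows "\<exists>l<l0. l \<in> persistent"
proof -
  obtain \<delta> k \<gamma> where d: "0 < \<delta>" "1 \<le> k" "0 < \<gamma>" and
    dd: "\<And>\<omega> y t. \<bar>y - b \<omega>\<bar> < \<delta> \<Longrightarrow> 0 \<le> t \<Longrightarrow> \<bar>S l0 t \<omega> y - b (\<sigma> t \<omega>)\<bar> \<le> k * exp (- \<gamma> * t) * \<bar>y - b \<omega>\<bar>"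
    using att unfolding att_near_def by blast
  have "(\<lambda>n. k * exp (- \<gamma> * real n)) \<longlonglongrightarrow> 0" by (rule exp_decay_sequentially) (use d in simp)
  then have "\<forall>\<^sub>F n in sequentially. k * exp (- \<gamma> * real n) < 1 / 2" by (rule order_tendstoD) simp
  then have "\<forall>\<^sub>F n in sequentially. k * exp (- \<gamma> * real n) < 1 / 2 \<and> 1 \<le> n" using eventually_ge_at_top[of 1] by eventually_elim simp
  then obtain T :: nat where T: "k * exp (- \<gamma> * real T) < 1 / 2" "1 \<le> T" by (auto simp: eventually_sequentially)
  define \<eta> where "\<eta> = min (\<delta> / 2) (r / 2)"
  have \<eta>: "0 < \<eta>" "\<eta> < \<delta>" "\<eta> \<le> r / 2" using d r by (auto simp: \<eta>_def)
  define R' where "R' = max (R + \<eta>) (absorbing_level l0 + 1)"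
  define K where "K = exp ((2 * secant_bound l0 R' + 1) * T)"
  have R': "0 < R'" using absorbing_level_pos[of l0] by (auto simp: R'_def)
  have "((\<lambda>l. K * ((0::real)\<^sup>2 + (0 * R'\<^sup>2 + \<bar>l0 - l\<bar> * R')\<^sup>2 * T)) \<longlongrightarrow> K * (0\<^sup>2 + (0 * R'\<^sup>2 + \<bar>l0 - l0\<bar> * R')\<^sup>2 * T)) (at_left l0)"
    by (intro tendsto_intros)
  then have "\<forall>\<^sub>F l in at_left l0. K * ((0::real)\<^sup>2 + (0 * R'\<^sup>2 + \<bar>l0 - l\<bar> * R')\<^sup>2 * T) < (\<eta> / 2)\<^sup>2"
    by (rule order_tendstoD) (use \<eta> in simp)
  moreover have "\<forall>\<^sub>F l in at_left l0. l \<in> {l0 - 1<..<l0}" by (rule eventually_at_left_real) simp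
  ultimately have "\<forall>\<^sub>F l in at_left l0. K * ((0::real)\<^sup>2 + (0 * R'\<^sup>2 + \<bar>l0 - l\<bar> * R')\<^sup>2 * T) < (\<eta> / 2)\<^sup>2 \<and> l \<in> {l0 - 1<..<l0}"
    by eventually_elim simp
  from eventually_happens'[OF _ this] obtain l where l: "K * ((0::real)\<^sup>2 + (0 * R'\<^sup>2 + \<bar>l0 - l\<bar> * R')\<^sup>2 * T) < (\<eta> / 2)\<^sup>2" "l0 - 1 < l" "l < l0"
    by (auto simp: trivial_limit_at_left_real)
  have top_l: "absorbing_level l \<le> R'" "absorbing_level l0 \<le> R'" using l by (auto simp: absorbing_level_def R'_def)
  have step: "\<bar>S l T \<omega> y - b (\<sigma> T \<omega>)\<bar> \<le> \<eta>" if y: "\<bar>y - b \<omega>\<bar> \<le> \<eta>" for \<omega> y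
  proof -
    have y0: "0 \<le> y" "y \<le> R'" using y r(2)[of \<omega>] R[of \<omega>] \<eta> r(1) by (auto simp: R'_def)
    have "(S l0 T \<omega> y - S l T \<omega> y)\<^sup>2 \<le> K * ((S l0 0 \<omega> y - S l 0 \<omega> y)\<^sup>2 + (0 * R'\<^sup>2 + \<bar>l0 - l\<bar> * R')\<^sup>2 * T)"
      unfolding K_def by (rule sol_on_dependence[OF _ fwd_sol_on' fwd_sol_on']) (use y0 top_l in \<open>auto intro: S_abs_le\<close>)
    also have "\<dots> < (\<eta> / 2)\<^sup>2" using l by simp
    finally have "\<bar>S l0 T \<omega> y - S l T \<omega> y\<bar>\<^sup>2 < (\<eta> / 2)\<^sup>2" by simp
    then have 1: "\<bar>S l0 T \<omega> y - S l T \<omega> y\<bar> < \<eta> / 2" by (rule power2_less_imp_less) (use \<eta> in simp)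
    have "\<bar>S l0 T \<omega> y - b (\<sigma> T \<omega>)\<bar> \<le> k * exp (- \<gamma> * T) * \<bar>y - b \<omega>\<bar>" by (rule dd) (use y \<eta> in auto)
    also have "\<dots> \<le> 1 / 2 * \<eta>" using T y \<eta> by (intro mult_mono) auto
    finally show ?thesis using 1 by linarith
  qed
  have iter: "\<bar>S l (real n * real T) \<omega> (b \<omega>) - b (\<sigma> (real n * real T) \<omega>)\<bar> \<le> \<eta>" for n :: nat and \<omega>
  proof (induction n)
    case 0
    then show ?case using \<eta> by simp
  next
    case (Suc n)
    have "S l (real (Suc n) * real T) \<omega> (b \<omega>) = S l T (\<sigma> (real n * real T) \<omega>) (S l (real n * real T) \<omega> (b \<omega>))"
      by (subst S_add) (auto simp: algebra_simps)
    then show ?case using step[OF Suc.IH] by (simp add: algebra_simps)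
  qed
  have "r / 2 \<le> \<beta> l \<omega>" for \<omega>
  proof (rule pullback_le[where t = "\<lambda>n. real n * real T" and R = "max R 0"])
    show "filterlim (\<lambda>n. real n * real T) at_top sequentially"
      using T(2) by (intro filterlim_at_top_mult_tendsto_pos[OF tendsto_const _ filterlim_real_sequentially]) auto
    show "\<bar>b (\<sigma> (- (real n * real T)) \<omega>)\<bar> \<le> max R 0" for n
      using r(2)[of "\<sigma> (- (real n * real T)) \<omega>"] R[of "\<sigma> (- (real n * real T)) \<omega>"] r(1) by auto
    show "r / 2 \<le> S l (real n * real T) (\<sigma> (- (real n * real T)) \<omega>) (b (\<sigma> (- (real n * real T)) \<omega>))" for n
      using iter[of n "\<sigma> (- (real n * real T)) \<omega>"] r(2)[of \<omega>] \<eta>(3) by (simp add: abs_le_iff)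
  qed
  then have "l \<in> persistent" unfolding persistent_def using r(1) by (intro CollectI exI[of _ "r / 2"]) auto
  then show ?thesis using l by blast
qed

section \<open>The lower equilibrium for negative parameters\<close>

text \<open>The points whose solutions never enter the region of decay. For negative parameters they form the largest
  compact invariant set in the open upper half (if there is one), and \<open>kappa\<close> is its lower boundary.\<close>

definition survivors :: "real \<Rightarrow> ('w \<times> real) set" where
  "survivors l = {(\<omega>, x). 0 \<le> x \<and> x \<le> \<beta> l \<omega> \<and> (\<forall>t\<ge>0. decay_radius l \<le> S l t \<omega> x)}"

definition kappa :: "real \<Rightarrow> 'w \<Rightarrow> real" where
  "kappa l \<omega> = Inf {x. (\<omega>, x) \<in> survivors l}"

lemma mem_survivors: "(\<omega>, x) \<in> survivors l \<longleftrightarrow> 0 \<le> x \<and> x \<le> \<beta> l \<omega> \<and> (\<forall>t\<ge>0. decay_radius l \<le> S l t \<omega> x)"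
  by (simp add: survivors_def)

lemma survivors_compact: "compact (survivors l)"
proof -
  have "closed (survivors l)"
    unfolding closed_sequential_limits
  proof (intro allI impI, elim conjE)
    fix p q assume p: "\<forall>n. p n \<in> survivors l" "p \<longlonglongrightarrow> q"
    have "closed (attr_upper l)" using attr_upper_compact by (rule compact_imp_closed)
    moreover have pA: "p n \<in> attr_upper l" for n using p(1)[rule_format, of n] by (cases "p n") (auto simp: mem_survivors mem_attr_upper)
    ultimately have q: "q \<in> attr_upper l" using p(2) unfolding closed_sequential_limits by blast
    have "decay_radius l \<le> S l t (fst q) (snd q)" if t: "0 \<le> t" for t
    proof (rule LIMSEQ_le_const)
      show "(\<lambda>n. S l t (fst (p n)) (snd (p n))) \<longlonglongrightarrow> S l t (fst q) (snd q)"
        using continuous_on_tendsto_compose[OF S_continuous_on_attr_upper p(2) q] pA by simp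
      have "decay_radius l \<le> S l t (fst (p n)) (snd (p n))" for n
        using p(1)[rule_format, of n] t by (cases "p n") (auto simp: mem_survivors)
      then show "\<exists>N. \<forall>n\<ge>N. decay_radius l \<le> S l t (fst (p n)) (snd (p n))" by blast
    qed
    then show "q \<in> survivors l" using q by (cases q) (auto simp: mem_survivors mem_attr_upper)
  qed
  then have "compact (attr_upper l \<inter> survivors l)" by (intro compact_Int_closed attr_upper_compact)
  moreover have "attr_upper l \<inter> survivors l = survivors l" by (auto simp: mem_survivors mem_attr_upper)
  ultimately show ?thesis by simp
qed

context
  fixes l assumes neg: "l < 0" and persistent: "l \<in> persistent"
begin

lemma beta_survivors: "(\<omega>, \<beta> l \<omega>) \<in> survivors l"
  using persistent_rad[OF neg persistent] beta_ge_0 by (auto simp: mem_survivors beta_flow)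

lemma kappa_survivors: "(\<omega>, kappa l \<omega>) \<in> survivors l"
proof -
  have "closed (Pair \<omega> -` survivors l)"
    by (intro closed_vimage compact_imp_closed survivors_compact continuous_intros)
  then have "closed {x. (\<omega>, x) \<in> survivors l}" by (simp add: vimage_def)
  moreover have "bdd_below {x. (\<omega>, x) \<in> survivors l}" by (intro bdd_belowI[of _ 0]) (auto simp: mem_survivors)
  ultimately have "Inf {x. (\<omega>, x) \<in> survivors l} \<in> {x. (\<omega>, x) \<in> survivors l}"
    using beta_survivors by (intro closed_contains_Inf) auto
  then show ?thesis by (simp add: kappa_def)
qed

lemma kappa_le: "(\<omega>, x) \<in> survivors l \<Longrightarrow> kappa l \<omega> \<le> x"
  unfolding kappa_def by (intro cInf_lower bdd_belowI[of _ 0]) (auto simp: mem_survivors)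

lemma kappa_le_beta: "kappa l \<omega> \<le> \<beta> l \<omega>"
  by (rule kappa_le[OF beta_survivors])

lemma decay_radius_le_kappa: "decay_radius l \<le> kappa l \<omega>"
  using kappa_survivors[of \<omega>] by (auto simp: mem_survivors dest: spec[of _ 0])

lemma survivors_entire: 
  assumes "sol_on l \<omega> UNIV u" "0 < r" "\<And>t. r \<le> u t" "\<And>t. u t \<le> R"
  shows "(\<omega>, u 0) \<in> survivors l"
  unfolding mem_survivors
proof (intro conjI allI impI)
  show "0 \<le> u 0" using assms(2) assms(3)[of 0] by linarith
  have "\<bar>u t\<bar> \<le> R" for t using assms(2) assms(3)[of t] assms(4)[of t] by linarith
  from entire_le_beta[OF assms(1) this, of 0] show "u 0 \<le> \<beta> l \<omega>" by simp
  show "decay_radius l \<le> S l t \<omega> (u 0)" for t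
    using entire_ge_rad[OF neg assms(1-3), of t] sol_entire(2)[OF assms(1), of t] by simp
qed

text \<open>Survivors flow to survivors, which gives one inequality. For the other one, the lowest survivor at time \<open>s\<close> is
  followed backwards: it was a survivor, because a decaying solution cannot recover.\<close>

lemma kappa_eqm: "eqm l (kappa l)"
proof (rule eqm_forwardI, rule antisym)
  fix \<omega> and s :: real assume s: "0 \<le> s"
  have "(\<sigma> s \<omega>, S l s \<omega> (kappa l \<omega>)) \<in> survivors l"
    unfolding mem_survivors
  proof (intro conjI allI impI)
    show "0 \<le> S l s \<omega> (kappa l \<omega>)" using kappa_survivors[of \<omega>] s by (simp add: S_nonneg mem_survivors)
    show "S l s \<omega> (kappa l \<omega>) \<le> \<beta> l (\<sigma> s \<omega>)"
      using S_mono[OF s, of l \<omega> "kappa l \<omega>" "\<beta> l \<omega>"] kappa_le_beta by (simp add: beta_flow)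
    show "decay_radius l \<le> S l t (\<sigma> s \<omega>) (S l s \<omega> (kappa l \<omega>))" if "0 \<le> t" for t
      using kappa_survivors[of \<omega>] s that by (simp add: S_add mem_survivors)
  qed
  then show "kappa l (\<sigma> s \<omega>) \<le> S l s \<omega> (kappa l \<omega>)" by (rule kappa_le)
  define z where "z = kappa l (\<sigma> s \<omega>)"
  have z: "(\<sigma> s \<omega>, z) \<in> survivors l" unfolding z_def by (rule kappa_survivors)
  then have A: "(\<sigma> s \<omega>, z) \<in> attr_upper l" by (simp add: mem_survivors mem_attr_upper)
  define x where "x = S l (- s) (\<sigma> s \<omega>) z"
  have xA: "(\<omega>, x) \<in> attr_upper l" using attr_upper_S[OF A, of "- s"] by (simp add: x_def)
  have xz: "S l s \<omega> x = z" using attr_S_add[OF attr_upper_attr[OF A], of s "- s"] by (simp add: x_def)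
  have "(\<omega>, x) \<in> survivors l"
    unfolding mem_survivors
  proof (intro conjI allI impI)
    fix t :: real assume t: "0 \<le> t"
    show "decay_radius l \<le> S l t \<omega> x"
    proof (cases "s \<le> t")
      case True
      then have "S l t \<omega> x = S l (t - s) (\<sigma> s \<omega>) z" using S_add[OF s, of "t - s" l \<omega> x] xz by simp
      then show ?thesis using z True by (simp add: mem_survivors)
    next
      case False
      have "decay_radius l \<le> z" using z by (auto simp: mem_survivors dest: spec[of _ 0])
      then show ?thesis using False t xA xz by (intro S_ge_rad_before[OF neg t, of s]) (auto simp: mem_attr_upper)
    qed
  qed (use xA in \<open>auto simp: mem_attr_upper\<close>)
  then have "S l s \<omega> (kappa l \<omega>) \<le> S l s \<omega> x" using kappa_le[of \<omega> x] S_mono[OF s] by blast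
  then show "S l s \<omega> (kappa l \<omega>) \<le> kappa l (\<sigma> s \<omega>)" by (simp add: xz z_def)
qed

lemma kappa_sublevel: "closed {\<omega>. kappa l \<omega> \<le> y}"
proof -
  have "closed (UNIV \<times> {..y} :: ('w \<times> real) set)" by (intro closed_Times) auto
  then have "compact (fst ` (survivors l \<inter> UNIV \<times> {..y}))"
    by (intro compact_continuous_image compact_Int_closed survivors_compact continuous_intros)
  moreover have "fst ` (survivors l \<inter> UNIV \<times> {..y}) = {\<omega>. kappa l \<omega> \<le> y}"
    using kappa_survivors kappa_le by (force intro: order_trans)
  ultimately show ?thesis by (simp add: compact_imp_closed)
qed

text \<open>Raising the parameter turns the point slightly below \<open>kappa l\<close> into a survivor. To see that its solution is above the
  decay radius at time \<open>t\<close>, compare it with the solution for \<open>l'\<close> that passes through the graph of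
  \<open>kappa l\<close> at the later time \<open>t + 1\<close>; backwards in time the latter falls below \<open>kappa l\<close> by a
  uniform amount.\<close>

lemma kappa_drop:
  assumes l': "l < l'" "l' < 0"
  obtains e where "0 < e" "\<And>\<omega>. kappa l' \<omega> + e \<le> kappa l \<omega>"
proof -
  have persistent': "l' \<in> persistent" using persistent_upward[OF persistent] l' by simp
  obtain R where R: "0 < R" "\<And>\<omega>. \<beta> l' \<omega> \<le> R" using beta_bounded by metis
  define e where "e = min (decay_radius l) ((l' - l) * decay_radius l * exp (- secant_bound l' R))"
  have e: "0 < e" "e \<le> decay_radius l" using l' decay_radius_pos[OF neg] by (auto simp: e_def)
  have "(\<omega>, kappa l \<omega> - e) \<in> survivors l'" for \<omega>
  proof -
    let ?x = "kappa l \<omega> - e"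
    have bb: "kappa l \<eta> \<le> \<beta> l' \<eta>" for \<eta>
      using kappa_le_beta[of \<eta>] beta_mono[of l l' \<eta>] l' by simp
    have x0: "0 \<le> ?x" "?x \<le> \<beta> l' \<omega>"
      using e decay_radius_le_kappa[of \<omega>] bb[of \<omega>] by linarith+
    have "decay_radius l' \<le> S l' t \<omega> ?x" if t: "0 \<le> t" for t
    proof -
      \<comment> \<open>follow the solution for the larger parameter backwards from a late point of the lower equilibrium\<close>
      define n where "n = t + 1"
      have n: "1 \<le> n" "t \<le> n" using t by (auto simp: n_def)
      define z where "z = kappa l (\<sigma> n \<omega>)"
      have z: "(\<sigma> n \<omega>, z) \<in> attr_upper l'" 
        using bb[of "\<sigma> n \<omega>"] decay_radius_le_kappa[of "\<sigma> n \<omega>"] decay_radius_pos[OF neg] by (simp add: mem_attr_upper z_def)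
      define u where "u \<tau> = S l' (\<tau> + - n) (\<sigma> n \<omega>) z" for \<tau>
      have u: "sol_on l' \<omega> J u" for J
        unfolding u_def using sol_on_subset[OF sol_on_shift[OF attr_sol_on[OF attr_upper_attr[OF z]], of UNIV "- n"]] by simp
      have uA: "(\<sigma> \<tau> \<omega>, u \<tau>) \<in> attr_upper l'" for \<tau>
        using attr_upper_S[OF z, of "\<tau> + - n"] by (simp add: u_def)
      have S_u: "S l' \<tau> \<omega> (u 0) = u \<tau>" if "0 \<le> \<tau>" for \<tau> by (rule S_eq[OF that u refl])
      have un: "u n = z" using z attr_upper_attr[OF z] by (simp add: u_def)
      let ?v = "\<lambda>\<tau>. kappa l (\<sigma> \<tau> \<omega>)"
      have v: "sol_on l \<omega> J ?v" for J by (rule eqm_sol_on[OF kappa_eqm])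
      have Ru: "\<bar>u \<tau>\<bar> \<le> R" for \<tau> using uA[of \<tau>] R(2)[of "\<sigma> \<tau> \<omega>"] by (simp add: mem_attr_upper)
      have Rv: "\<bar>?v \<tau>\<bar> \<le> R" for \<tau> using bb[of "\<sigma> \<tau> \<omega>"] R(2)[of "\<sigma> \<tau> \<omega>"] decay_radius_le_kappa[of "\<sigma> \<tau> \<omega>"] decay_radius_pos[OF neg] by simp
      have rv: "decay_radius l \<le> ?v \<tau>" for \<tau> by (rule decay_radius_le_kappa)
      have "u 1 + (l' - l) * decay_radius l * (n - 1) * exp (- secant_bound l' R * (n - 1)) \<le> ?v 1"
        by (rule param_gain(2)[OF n(1) _ v u]) (use Ru Rv rv l' decay_radius_pos[OF neg] un in \<open>auto simp: z_def\<close>)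
      moreover have "0 \<le> (l' - l) * decay_radius l * (n - 1) * exp (- secant_bound l' R * (n - 1))"
        using l' decay_radius_pos[OF neg] n by simp
      ultimately have "u 1 \<le> ?v 1" by linarith
      then have "u 0 + (l' - l) * decay_radius l * (1 - 0) * exp (- secant_bound l' R * (1 - 0)) \<le> ?v 0"
        by (intro param_gain(2)[OF _ _ v u]) (use Ru Rv rv l' decay_radius_pos[OF neg] in auto)
      then have "u 0 \<le> ?x" by (simp add: e_def)
      then have "u t \<le> S l' t \<omega> ?x" using S_mono[OF t, of l' \<omega> "u 0" ?x] S_u[OF t] by simp
      moreover have "decay_radius l' \<le> u t"
      proof -
        have "decay_radius l' \<le> z" using decay_radius_antimono[of l l'] decay_radius_le_kappa[of "\<sigma> n \<omega>"] l' by (simp add: z_def)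
        then have "decay_radius l' \<le> S l' t \<omega> (u 0)"
          using un S_u[of n] n t uA[of 0] by (intro S_ge_rad_before[OF l'(2) t n(2)]) (auto simp: mem_attr_upper)
        then show ?thesis using S_u[OF t] by simp
      qed
      ultimately show ?thesis by linarith
    qed
    then show ?thesis using x0 by (simp add: mem_survivors)
  qed
  moreover have "kappa l' \<omega> \<le> x" if "(\<omega>, x) \<in> survivors l'" for \<omega> x
    using that unfolding kappa_def by (intro cInf_lower bdd_belowI[of _ 0]) (auto simp: mem_survivors)
  ultimately have "kappa l' \<omega> + e \<le> kappa l \<omega>" for \<omega> by (smt (verit))
  then show ?thesis using that e(1) by blast
qed

end

section \<open>Existence of separated pairs\<close>

lemma pair_nonneg:
  assumes "0 \<le> l" "l \<in> persistent"
  obtains \<epsilon> R where "separated_pair \<sigma> a \<alpha> \<beta> l (\<lambda>_. 0) (\<beta> l) (\<lambda>_. 1) l \<epsilon> R 1 1"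
proof -
  obtain R where R: "\<And>\<omega>. \<beta> l \<omega> \<le> R" using beta_bounded by metis
  obtain d where d: "0 < d" "\<And>\<omega>. d \<le> \<beta> l \<omega>" using assms by (auto simp: persistent_def)
  have "separated_pair \<sigma> a \<alpha> \<beta> l (\<lambda>_. 0) (\<beta> l) (\<lambda>_. 1) l d R 1 1"
    by unfold_locales (use R d assms eqm_beta eqm_zero in \<open>auto simp: growth_def\<close>)
  then show ?thesis by (rule that)
qed

lemma pair_neg_of_gap:
  assumes l: "l < 0" "l \<in> persistent" and e: "0 < e" "\<And>\<omega>. kappa l \<omega> + e \<le> \<beta> l \<omega>"
  obtains R where "separated_pair_pos \<sigma> a \<alpha> \<beta> l (kappa l) (\<beta> l) (kappa l) 0 e R (decay_radius l) R (decay_radius l)"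
proof -
  obtain R where R: "\<And>\<omega>. \<beta> l \<omega> \<le> R" using beta_bounded by metis
  have kappa0: "0 \<le> kappa l \<omega>" for \<omega> using decay_radius_le_kappa[OF l, of \<omega>] decay_radius_pos[OF l(1)] by linarith
  have kR: "kappa l \<omega> \<le> R" for \<omega> using kappa_le_beta[OF l, of \<omega>] R[of \<omega>] by linarith
  have "((\<lambda>t. kappa l (\<sigma> t \<omega>)) has_real_derivative (growth l (\<sigma> t \<omega>) (kappa l (\<sigma> t \<omega>)) - 0) * kappa l (\<sigma> t \<omega>)) (at t)" for \<omega> t
    using sol_onD[OF eqm_sol_on[OF kappa_eqm[OF l], of \<omega> UNIV], of t] by (simp add: cubic_growth)
  then have "separated_pair_pos \<sigma> a \<alpha> \<beta> l (kappa l) (\<beta> l) (kappa l) 0 e R (decay_radius l) R (decay_radius l)"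
    by unfold_locales (use R e eqm_beta kappa_eqm[OF l] kappa0 kR decay_radius_le_kappa[OF l] decay_radius_pos[OF l(1)] in auto)
  then show ?thesis by (rule that)
qed

text \<open>The gap at \<open>l\<close> is produced by the persistent parameter \<open>p < l\<close>: \<open>kappa l\<close> is below
  \<open>kappa p \<le> \<beta> p\<close>, and \<open>\<beta> l\<close> is above \<open>\<beta> p\<close> by a uniform amount.\<close>

lemma pair_neg:
  assumes p: "p \<in> persistent" "p < l" "l < 0"
  obtains e R where "separated_pair_pos \<sigma> a \<alpha> \<beta> l (kappa l) (\<beta> l) (kappa l) 0 e R (decay_radius l) R (decay_radius l)"
proof -
  have l: "l \<in> persistent" using persistent_upward p by (meson less_imp_le)
  have p0: "p < 0" using p by simp
  obtain e1 where e1: "0 < e1" "\<And>\<omega>. \<beta> p \<omega> + e1 \<le> \<beta> l \<omega>" using persistent_gain[OF p(1,2)] by blast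
  obtain e2 where e2: "0 < e2" "\<And>\<omega>. kappa l \<omega> + e2 \<le> kappa p \<omega>" using kappa_drop[OF p0 p(1,2,3)] by blast
  have "kappa l \<omega> + e1 \<le> \<beta> l \<omega>" for \<omega>
    using e1(2)[of \<omega>] e2(1) e2(2)[of \<omega>] kappa_le_beta[OF p0 p(1), of \<omega>] by linarith
  then show ?thesis using pair_neg_of_gap[OF p(3) l e1(1)] that by metis
qed

subsection \<open>The threshold\<close>

lemma threshold:
  assumes "0 \<in> persistent"
  obtains \<mu> where "\<mu> < 0" "\<And>l. l \<in> persistent \<longleftrightarrow> \<mu> \<le> l"
proof -
  obtain \<epsilon> R where "separated_pair \<sigma> a \<alpha> \<beta> 0 (\<lambda>_. 0) (\<beta> 0) (\<lambda>_. 1) 0 \<epsilon> R 1 1"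
    using pair_nonneg[OF order_refl assms] by blast
  then interpret sp: separated_pair \<sigma> a \<alpha> \<beta> 0 "\<lambda>_. 0" "\<beta> 0" "\<lambda>_. 1" 0 \<epsilon> R 1 1 .
  obtain l0 where l0: "l0 < 0" "l0 \<in> persistent"
    using att_near_persists[OF eqm_beta sp.b_attractive sp.eps sp.b_ge sp.b_le] by blast
  define \<mu> where "\<mu> = Inf persistent"
  have bdd: "bdd_below persistent" using persistent_bounded_below by (intro bdd_belowI[of _ "- a_bound\<^sup>2"]) auto
  have lower: "\<mu> \<le> l" if "l \<in> persistent" for l unfolding \<mu>_def using that bdd by (rule cInf_lower)
  have \<mu>: "\<mu> < 0" using lower[OF l0(2)] l0(1) by simp
  have above: "l \<in> persistent" if "\<mu> < l" for l
  proof -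
    have "persistent \<noteq> {}" using assms by auto
    then have "\<exists>p\<in>persistent. p < l" using that cInf_less_iff[OF _ bdd, of l] by (simp add: \<mu>_def)
    then obtain p where "p \<in> persistent" "p < l" by blast
    then show ?thesis using persistent_upward by (meson less_imp_le)
  qed
  have "\<mu> \<in> persistent" by (rule persistent_closed[OF \<mu> above])
  then show ?thesis using that[OF \<mu>] lower above by (metis order_le_less)
qed

text \<open>A gap would make \<open>\<beta> \<mu>\<close> attractive, and then a parameter below \<open>\<mu>\<close> would be persistent.\<close>

lemma no_gap_at_threshold:
  assumes "\<mu> < 0" "\<And>l. l \<in> persistent \<longleftrightarrow> \<mu> \<le> l" "0 < e" shows "\<exists>\<omega>. \<beta> \<mu> \<omega> < kappa \<mu> \<omega> + e"
proof (rule ccontr)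
  assume "\<not> ?thesis"
  then have gap: "kappa \<mu> \<omega> + e \<le> \<beta> \<mu> \<omega>" for \<omega> by (simp add: not_less)
  have p: "\<mu> \<in> persistent" using assms by simp
  obtain R where "separated_pair_pos \<sigma> a \<alpha> \<beta> \<mu> (kappa \<mu>) (\<beta> \<mu>) (kappa \<mu>) 0 e R (decay_radius \<mu>) R (decay_radius \<mu>)"
    using pair_neg_of_gap[OF assms(1) p assms(3) gap] by blast
  then interpret sp: separated_pair_pos \<sigma> a \<alpha> \<beta> \<mu> "kappa \<mu>" "\<beta> \<mu>" "kappa \<mu>" 0 e R "decay_radius \<mu>" R "decay_radius \<mu>" .
  obtain l where "l < \<mu>" "l \<in> persistent"
    using att_near_persists[OF eqm_beta sp.b_attractive sp.eps sp.b_ge sp.b_le] by blast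
  then show False using assms(2)[of l] by simp
qed

section \<open>Coincidence of equilibria on a residual set\<close>

text \<open>The gap is continuous at \<open>\<omega>0\<close>, so it is positive on an open set; along orbits it satisfies
  a linear equation with bounded coefficient, and \<open>transport_lower_bound\<close> applies.\<close>

lemma eqm_gap_dichotomy:
  assumes g: "eqm l g1" "eqm l g2" and le: "\<And>\<omega>. 0 \<le> g1 \<omega>" "\<And>\<omega>. g1 \<omega> \<le> g2 \<omega>" "\<And>\<omega>. g2 \<omega> \<le> R"
    and cont: "isCont g1 \<omega>0" "isCont g2 \<omega>0" and less: "g1 \<omega>0 < g2 \<omega>0"
  shows "\<exists>d>0. \<forall>\<omega>. g1 \<omega> + d \<le> g2 \<omega>"
proof -
  define d where "d = (g2 \<omega>0 - g1 \<omega>0) / 2"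
  have d: "0 < d" "d < g2 \<omega>0 - g1 \<omega>0" using less by (auto simp: d_def)
  have "isCont (\<lambda>\<omega>. g2 \<omega> - g1 \<omega>) \<omega>0" using cont by (intro continuous_intros)
  then have "\<forall>\<^sub>F \<omega> in nhds \<omega>0. d < g2 \<omega> - g1 \<omega>"
    using tendsto_at_iff_tendsto_nhds[of "\<lambda>\<omega>. g2 \<omega> - g1 \<omega>" \<omega>0] d(2)
    by (auto simp: isCont_def intro: order_tendstoD(1))
  then obtain U where U: "open U" "\<omega>0 \<in> U" "\<And>\<omega>. \<omega> \<in> U \<Longrightarrow> d < g2 \<omega> - g1 \<omega>"
    unfolding eventually_nhds by blast
  have abs_le: "\<bar>g1 \<omega>\<bar> \<le> R" "\<bar>g2 \<omega>\<bar> \<le> R" for \<omega> using le(1)[of \<omega>] le(2)[of \<omega>] le(3)[of \<omega>] by auto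
  have R0: "0 \<le> R" using abs_le(1)[of \<omega>0] by linarith
  have "\<exists>d'>0. \<forall>\<omega>. d' \<le> g2 \<omega> - g1 \<omega>"
  proof (rule transport_lower_bound[OF secant_bound_nonneg[OF R0]])
    fix \<omega> and t :: real assume t: "0 \<le> t"
    note G = sol_on_diff_growth[OF t eqm_sol_on[OF g(2)] eqm_sol_on[OF g(1)], of \<omega> R, OF abs_le(2) abs_le(1)]
    show "(g2 \<omega> - g1 \<omega>) * exp (- secant_bound l R * t) \<le> g2 (\<sigma> t \<omega>) - g1 (\<sigma> t \<omega>)"
      using G(2) le(2)[of \<omega>] le(2)[of "\<sigma> t \<omega>"] by simp
    show "g2 (\<sigma> t \<omega>) - g1 (\<sigma> t \<omega>) \<le> (g2 \<omega> - g1 \<omega>) * exp (secant_bound l R * t)"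
      using G(1) le(2)[of \<omega>] le(2)[of "\<sigma> t \<omega>"] by simp
  qed (use U d in \<open>auto intro: less_imp_le\<close>)
  then show ?thesis by (metis add.commute le_diff_eq)
qed

lemma eqm_isCont_flow:
  assumes g: "eqm l g" "\<And>\<omega>. 0 \<le> g \<omega>" "\<And>\<omega>. g \<omega> \<le> \<beta> l \<omega>" and c: "isCont g \<omega>"
  shows "isCont g (\<sigma> t \<omega>)"
proof -
  have lim: "((\<lambda>\<eta>. \<sigma> (- t) \<eta>) \<longlongrightarrow> \<omega>) (at (\<sigma> t \<omega>))"
  proof -
    have "continuous_on UNIV (\<lambda>\<eta>. \<sigma> (- t) \<eta>)" by (intro continuous_intros)
    then have "isCont (\<lambda>\<eta>. \<sigma> (- t) \<eta>) (\<sigma> t \<omega>)" by (simp add: continuous_on_eq_continuous_at)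
    then show ?thesis by (simp add: isCont_def)
  qed
  have "((\<lambda>\<eta>. (\<sigma> (- t) \<eta>, g (\<sigma> (- t) \<eta>))) \<longlongrightarrow> (\<omega>, g \<omega>)) (at (\<sigma> t \<omega>))"
    by (intro tendsto_Pair lim isCont_tendsto_compose[OF c])
  from continuous_on_tendsto_compose[OF S_continuous_on_attr_upper[of l t] this]
  have "((\<lambda>\<eta>. S l t (\<sigma> (- t) \<eta>) (g (\<sigma> (- t) \<eta>))) \<longlongrightarrow> S l t \<omega> (g \<omega>)) (at (\<sigma> t \<omega>))"
    using g(2,3) by (simp add: mem_attr_upper)
  then show ?thesis by (simp add: isCont_def eqm_S[OF g(1)])
qed

end

section \<open>Minimal sets in the upper half\<close>

lemma antimono_tendsto_at_right:
  fixes f :: "real \<Rightarrow> real"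
  assumes "m < c" and mono: "\<And>x y. m < x \<Longrightarrow> x \<le> y \<Longrightarrow> y < c \<Longrightarrow> f y \<le> f x"
    and bdd: "\<And>x. m < x \<Longrightarrow> x < c \<Longrightarrow> f x \<le> B"
  shows "(f \<longlongrightarrow> (SUP x\<in>{m<..<c}. f x)) (at_right m)"
proof (rule order_tendstoI)
  have bdd': "bdd_above (f ` {m<..<c})" using bdd by (intro bdd_aboveI[of _ B]) auto
  fix y assume "y < (SUP x\<in>{m<..<c}. f x)"
  then obtain p where p: "m < p" "p < c" "y < f p" using less_cSUP_iff[OF _ bdd'] assms(1) by fastforce
  show "\<forall>\<^sub>F x in at_right m. y < f x"
    using eventually_at_right_real[OF p(1)]
  proof eventually_elim
    case (elim x)
    then show ?case using mono[of x p] p by simp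
  qed
next
  have bdd': "bdd_above (f ` {m<..<c})" using bdd by (intro bdd_aboveI[of _ B]) auto
  fix y assume y: "(SUP x\<in>{m<..<c}. f x) < y"
  show "\<forall>\<^sub>F x in at_right m. f x < y"
    using eventually_at_right_real[OF assms(1)]
  proof eventually_elim
    case (elim x)
    then show ?case using cSUP_upper[OF elim bdd'] y by simp
  qed
qed

lemma antimono_tendsto_at_left:
  fixes f :: "real \<Rightarrow> real"
  assumes "c < m" and mono: "\<And>x y. c < x \<Longrightarrow> x \<le> y \<Longrightarrow> y < m \<Longrightarrow> f y \<le> f x"
    and bdd: "\<And>x. c < x \<Longrightarrow> x < m \<Longrightarrow> B \<le> f x"
  shows "(f \<longlongrightarrow> (INF x\<in>{c<..<m}. f x)) (at_left m)"
proof (rule order_tendstoI)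
  have bdd': "bdd_below (f ` {c<..<m})" using bdd by (intro bdd_belowI[of _ B]) auto
  fix y assume "(INF x\<in>{c<..<m}. f x) < y"
  then obtain p where p: "c < p" "p < m" "f p < y" using cINF_less_iff[OF _ bdd'] assms(1) by fastforce
  show "\<forall>\<^sub>F x in at_left m. f x < y"
    using eventually_at_left_real[OF p(2)]
  proof eventually_elim
    case (elim x)
    then show ?case using mono[of p x] p by simp
  qed
next
  have bdd': "bdd_below (f ` {c<..<m})" using bdd by (intro bdd_belowI[of _ B]) auto
  fix y assume y: "y < (INF x\<in>{c<..<m}. f x)"
  show "\<forall>\<^sub>F x in at_left m. y < f x"
    using eventually_at_left_real[OF assms(1)]
  proof eventually_elim
    case (elim x)
    then show ?case using cINF_lower[OF bdd' elim] y by simp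
  qed
qed

context cubic_family
begin

lemma inv_dom: "invariant_set \<sigma> (cubic a l) K \<Longrightarrow> (\<omega>, x) \<in> K \<Longrightarrow> dom l \<omega> x = UNIV"
  and inv_S: "invariant_set \<sigma> (cubic a l) K \<Longrightarrow> (\<omega>, x) \<in> K \<Longrightarrow> (\<sigma> t \<omega>, S l t \<omega> x) \<in> K"
  by (auto simp: invariant_set_def skew_def)

lemma inv_sol_on: "invariant_set \<sigma> (cubic a l) K \<Longrightarrow> (\<omega>, x) \<in> K \<Longrightarrow> sol_on l \<omega> UNIV (\<lambda>t. S l t \<omega> x)"
  using sol_on_sol[of l \<omega> x] by (simp add: inv_dom)

lemma inv_fst_UNIV:
  assumes "K \<noteq> {}" "compact K" "invariant_set \<sigma> (cubic a l) K"
  shows "fst ` K = UNIV"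
proof -
  obtain \<omega> x where p: "(\<omega>, x) \<in> K" using assms(1) by auto
  have "closed (fst ` K)" by (intro compact_imp_closed compact_continuous_image assms continuous_intros)
  moreover have "range (\<lambda>t. \<sigma> t \<omega>) \<subseteq> fst ` K" using inv_S[OF assms(3) p] by force
  ultimately have "closure (range (\<lambda>t. \<sigma> t \<omega>)) \<subseteq> fst ` K" by (rule closure_minimal[rotated])
  then show ?thesis using minimal by (auto simp: minimal_flow_def)
qed

lemma inv_subset_attr:
  assumes "compact K" "invariant_set \<sigma> (cubic a l) K" "(\<omega>, x) \<in> K"
  shows "(\<omega>, x) \<in> attr l"
proof -
  obtain R where R: "0 < R" "\<And>\<omega> x. (\<omega>, x) \<in> K \<Longrightarrow> \<bar>x\<bar> \<le> R" using compact_snd_bound[OF assms(1)] by blast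
  have "(\<omega>, S l 0 \<omega> x) \<in> attr l"
    by (rule bounded_entire_in_attr[OF inv_sol_on[OF assms(2,3)]]) (use R(2) inv_S[OF assms(2,3)] in blast)
  then show ?thesis by simp
qed

text \<open>A compact invariant subset projects onto the whole base, hence is the whole graph.\<close>

lemma graph_minimal:
  assumes b: "eqm l b" "continuous_on UNIV b" shows "minimal_set \<sigma> (cubic a l) (graph_of b)"
  unfolding minimal_set_def
proof (intro conjI allI impI notI)
  show "compact (graph_of b)"
    unfolding graph_of_def by (intro compact_continuous_image compact_base continuous_intros b)
  show "invariant_set \<sigma> (cubic a l) (graph_of b)"
    using eqm_equilibrium[OF b(1)] by (auto simp: invariant_set_def graph_of_def equilibrium_def skew_def eqm_S[OF b(1)])
  fix K assume K: "K \<noteq> {} \<and> compact K \<and> invariant_set \<sigma> (cubic a l) K" "K \<subset> graph_of b"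
  have "graph_of b \<subseteq> K"
  proof
    fix p assume "p \<in> graph_of b"
    then obtain \<omega> where p: "p = (\<omega>, b \<omega>)" by (auto simp: graph_of_def)
    have "\<omega> \<in> fst ` K" using inv_fst_UNIV[of K l] K(1) by simp
    then obtain x where "(\<omega>, x) \<in> K" by force
    moreover then have "x = b \<omega>" using K(2) by (auto simp: graph_of_def)
    ultimately show "p \<in> K" using p by simp
  qed
  then show False using K(2) by blast
qed (simp add: graph_of_def)

lemma M0_minimal: "minimal_set \<sigma> (cubic a l) M0"
  by (intro graph_minimal eqm_zero continuous_on_const)

lemma minimal_subset_eq:
  assumes "minimal_set \<sigma> (cubic a l) M" "K \<noteq> {}" "compact K" "invariant_set \<sigma> (cubic a l) K" "K \<subseteq> M"
  shows "K = M"
  using assms unfolding minimal_set_def by blast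

lemma minimal_meet_eq:
  assumes M: "minimal_set \<sigma> (cubic a l) M" and N: "minimal_set \<sigma> (cubic a l) N" and "M \<inter> N \<noteq> {}"
  shows "M = N"
proof -
  have c: "compact (M \<inter> N)" using M N by (auto simp: minimal_set_def intro: compact_Int)
  have i: "invariant_set \<sigma> (cubic a l) (M \<inter> N)" using M N by (auto simp: minimal_set_def invariant_set_def)
  show ?thesis using minimal_subset_eq[OF M assms(3) c i] minimal_subset_eq[OF N assms(3) c i] by auto
qed

text \<open>For compact sets this says that the set lies in the open upper half.\<close>

definition pos_set :: "('w \<times> real) set \<Rightarrow> bool" where
  "pos_set M \<longleftrightarrow> (\<exists>d>0. \<forall>p\<in>M. d \<le> snd p)"

text \<open>A minimal set other than \<open>M0\<close> is disjoint from \<open>M0\<close>. Solutions do not change sign, so its part in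
  the closed upper half is invariant, and is therefore empty or everything.\<close>

lemma minimal_trichotomy:
  assumes M: "minimal_set \<sigma> (cubic a l) M" and "M \<noteq> M0"
  shows "pos_set M \<or> (\<exists>d>0. \<forall>p\<in>M. d \<le> - snd p)"
proof -
  have cM: "compact M" and iM: "invariant_set \<sigma> (cubic a l) M" and nM: "M \<noteq> {}"
    using M by (auto simp: minimal_set_def)
  have nz: "x \<noteq> 0" if "(\<omega>, x) \<in> M" for \<omega> x
    using that minimal_meet_eq[OF M M0_minimal] assms(2) by (auto simp: graph_of_def)
  let ?K = "M \<inter> UNIV \<times> {0..}"
  have cK: "compact ?K" by (intro compact_Int_closed cM closed_Times closed_UNIV closed_atLeast)
  have iK: "invariant_set \<sigma> (cubic a l) ?K"
    unfolding invariant_set_def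
  proof clarify
    fix \<omega> x t assume p: "(\<omega>, x) \<in> M" "(0::real) \<le> x"
    have x: "0 < x" using nz[OF p(1)] p(2) by simp
    have "0 < S l t \<omega> x"
    proof (cases "0 \<le> t")
      case True
      then show ?thesis using x by (simp add: S_pos)
    next
      case False
      then show ?thesis using sol_on_less_ends[OF _ sol_on_zero sol_on_subset[OF inv_sol_on[OF iM p(1)]], of t 0] x by simp
    qed
    then show "t \<in> dom l \<omega> x \<and> skew \<sigma> (cubic a l) t (\<omega>, x) \<in> ?K"
      using inv_dom[OF iM p(1)] inv_S[OF iM p(1), of t] by (simp add: skew_def)
  qed
  show ?thesis
  proof (cases "?K = {}")
    case False
    then have KM: "?K = M" using minimal_subset_eq[OF M False cK iK] by simp
    have "continuous_on M snd" by (intro continuous_intros)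
    then obtain p where p: "p \<in> M" "\<And>q. q \<in> M \<Longrightarrow> snd p \<le> snd q" using continuous_attains_inf[OF cM nM] by blast
    have "p \<in> ?K" using p(1) KM by simp
    then have "0 \<le> snd p" by (cases p) auto
    then have "0 < snd p" using nz[of "fst p" "snd p"] p(1) by simp
    then show ?thesis using p(2) by (auto simp: pos_set_def)
  next
    case True
    have "continuous_on M snd" by (intro continuous_intros)
    then obtain p where p: "p \<in> M" "\<And>q. q \<in> M \<Longrightarrow> snd q \<le> snd p" using continuous_attains_sup[OF cM nM] by blast
    have "snd p < 0" using True p(1) by (cases p) (auto simp: not_le)
    then show ?thesis using p(2) by (intro disjI2 exI[of _ "- snd p"]) auto
  qed
qed

lemma pos_minimal_persistent:
  assumes M: "minimal_set \<sigma> (cubic a l) M" and "pos_set M" shows "l \<in> persistent"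
proof -
  obtain d where d: "0 < d" "\<And>p. p \<in> M \<Longrightarrow> d \<le> snd p" using assms(2) by (auto simp: pos_set_def)
  have cM: "compact M" and iM: "invariant_set \<sigma> (cubic a l) M" and nM: "M \<noteq> {}"
    using M by (auto simp: minimal_set_def)
  have "d \<le> \<beta> l \<omega>" for \<omega>
  proof -
    have "\<omega> \<in> fst ` M" using inv_fst_UNIV[OF nM cM iM] by simp
    then obtain x where x: "(\<omega>, x) \<in> M" by force
    then show ?thesis using inv_subset_attr[OF cM iM x] d(2)[OF x] by (simp add: mem_band)
  qed
  then show ?thesis using d(1) by (auto simp: persistent_def)
qed

lemma pos_graph: "0 < d \<Longrightarrow> (\<And>\<omega>. d \<le> b \<omega>) \<Longrightarrow> pos_set (graph_of b)"
  by (auto simp: pos_set_def graph_of_def)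

end

text \<open>A solution of the minimal set above \<open>\<kappa>\<close> converges to the graph of \<open>b\<close>, so the two minimal
  sets meet.\<close>

lemma (in separated_pair) pos_minimal:
  assumes M: "minimal_set \<sigma> (cubic a l) M" and pos: "pos_set M"
    and above: "(\<omega>, x) \<in> M" "\<kappa> \<omega> < x"
  shows "M = graph_of b"
proof -
  obtain d where d: "0 < d" "\<And>p. p \<in> M \<Longrightarrow> d \<le> snd p" using pos by (auto simp: pos_set_def)
  have cM: "compact M" and iM: "invariant_set \<sigma> (cubic a l) M" using M by (auto simp: minimal_set_def)
  define X where "X = max x (absorbing_level l)"
  define C where "C = (w2 * R * X / (\<epsilon> * (x - \<kappa> \<omega>) * w1)) * \<bar>x - b \<omega>\<bar>"
  let ?u = "\<lambda>t. S l t \<omega> x"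
  have inM: "(\<sigma> t \<omega>, ?u t) \<in> M" for t by (rule inv_S[OF iM above(1)])
  have near: "\<bar>?u n - b (\<sigma> n \<omega>)\<bar> \<le> C * exp (- (d * \<epsilon>) * real n)" for n :: nat
    unfolding C_def by (rule forward_convergence) (use above d d(2)[OF inM] in \<open>auto simp: X_def\<close>)
  obtain p r where p: "p \<in> M" "strict_mono r" "((\<lambda>n. (\<sigma> (real n) \<omega>, ?u n)) \<circ> r) \<longlonglongrightarrow> p"
    using cM[unfolded compact_def, rule_format, of "\<lambda>n. (\<sigma> (real n) \<omega>, ?u n)"] inM by blast
  have 1: "(\<lambda>n. \<sigma> (real (r n)) \<omega>) \<longlonglongrightarrow> fst p" using tendsto_fst[OF p(3)] by (simp add: o_def)
  have 2: "(\<lambda>n. ?u (real (r n))) \<longlonglongrightarrow> snd p" using tendsto_snd[OF p(3)] by (simp add: o_def)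
  have "isCont b (fst p)" using b_continuous by (simp add: continuous_on_eq_continuous_at)
  then have 3: "(\<lambda>n. b (\<sigma> (real (r n)) \<omega>)) \<longlonglongrightarrow> b (fst p)" using 1 by (rule isCont_tendsto_compose)
  have "(\<lambda>n. C * exp (- (d * \<epsilon>) * real n)) \<longlonglongrightarrow> 0" by (rule exp_decay_sequentially) (use d eps in simp)
  then have 4: "(\<lambda>n. C * exp (- (d * \<epsilon>) * real (r n))) \<longlonglongrightarrow> 0"
    using LIMSEQ_subseq_LIMSEQ[OF _ p(2)] by (force simp: o_def)
  have "(\<lambda>n. \<bar>?u (real (r n)) - b (\<sigma> (real (r n)) \<omega>)\<bar>) \<longlonglongrightarrow> \<bar>snd p - b (fst p)\<bar>" by (intro tendsto_intros 2 3)
  then have "\<bar>snd p - b (fst p)\<bar> \<le> 0" by (rule LIMSEQ_le[OF _ 4]) (use near in auto)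
  then have "p = (fst p, b (fst p))" by (simp add: prod_eq_iff)
  then have "p \<in> graph_of b" unfolding graph_of_def by blast
  then show ?thesis using p(1) by (intro minimal_meet_eq[OF M graph_minimal[OF b b_continuous]]) blast
qed

context cubic_family
begin

lemma graph_eqI:
  assumes "fst ` M = UNIV" "\<And>\<omega> x. (\<omega>, x) \<in> M \<Longrightarrow> x = b \<omega>" shows "M = graph_of b"
proof (intro subset_antisym subsetI)
  fix p assume "p \<in> graph_of b"
  then obtain \<omega> where p: "p = (\<omega>, b \<omega>)" by (auto simp: graph_of_def)
  have "\<omega> \<in> fst ` M" using assms(1) by simp
  then show "p \<in> M" using assms(2) p by force
qed (use assms(2) in \<open>force simp: graph_of_def\<close>)

text \<open>For \<open>l \<ge> 0\<close> the pair consists of \<open>0\<close> and \<open>\<beta> l\<close>.\<close>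

lemma upper_nonneg:
  assumes l: "0 \<le> l" "l \<in> persistent"
  shows "continuous_on UNIV (\<beta> l)" "att_near l (\<beta> l)"
    and "{M. minimal_set \<sigma> (cubic a l) M \<and> pos_set M} = {graph_of (\<beta> l)}"
proof -
  obtain \<epsilon> R where "separated_pair \<sigma> a \<alpha> \<beta> l (\<lambda>_. 0) (\<beta> l) (\<lambda>_. 1) l \<epsilon> R 1 1"
    using pair_nonneg[OF l] by blast
  then interpret sp: separated_pair \<sigma> a \<alpha> \<beta> l "\<lambda>_. 0" "\<beta> l" "\<lambda>_. 1" l \<epsilon> R 1 1 .
  show c: "continuous_on UNIV (\<beta> l)" by (rule sp.b_continuous)
  show "att_near l (\<beta> l)" by (rule sp.b_attractive)
  have "M = graph_of (\<beta> l)" if M: "minimal_set \<sigma> (cubic a l) M" "pos_set M" for M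
  proof -
    obtain \<omega> x where "(\<omega>, x) \<in> M" using M(1) by (auto simp: minimal_set_def)
    then show ?thesis using M(2) by (intro sp.pos_minimal[OF M]) (auto simp: pos_set_def)
  qed
  moreover have "minimal_set \<sigma> (cubic a l) (graph_of (\<beta> l))" by (rule graph_minimal[OF eqm_beta c])
  moreover have "pos_set (graph_of (\<beta> l))" by (rule pos_graph[OF sp.eps sp.b_ge])
  ultimately show "{M. minimal_set \<sigma> (cubic a l) M \<and> pos_set M} = {graph_of (\<beta> l)}" by blast
qed

lemma pos_minimal_survivors:
  assumes l: "l < 0" and M: "minimal_set \<sigma> (cubic a l) M" "pos_set M"
  shows "M \<subseteq> survivors l"
proof
  fix p assume p: "p \<in> M"
  have cM: "compact M" and iM: "invariant_set \<sigma> (cubic a l) M" using M by (auto simp: minimal_set_def)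
  obtain \<omega> x where px: "p = (\<omega>, x)" by (cases p)
  obtain d where d: "0 < d" "\<And>p. p \<in> M \<Longrightarrow> d \<le> snd p" using M(2) by (auto simp: pos_set_def)
  obtain R where R: "0 < R" "\<And>\<omega> x. (\<omega>, x) \<in> M \<Longrightarrow> \<bar>x\<bar> \<le> R" using compact_snd_bound[OF cM] by blast
  have px': "(\<omega>, x) \<in> M" using p px by simp
  have "(\<omega>, S l 0 \<omega> x) \<in> survivors l"
  proof (rule survivors_entire[OF l pos_minimal_persistent[OF M] inv_sol_on[OF iM px'] d(1)])
    show "d \<le> S l t \<omega> x" for t using d(2)[OF inv_S[OF iM px']] by simp
    show "S l t \<omega> x \<le> R" for t using R(2)[OF inv_S[OF iM px', of t]] by simp
  qed
  then show "p \<in> survivors l" by (simp add: px)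
qed

text \<open>For negative \<open>l\<close> above a persistent parameter the pair consists of \<open>kappa l\<close> and \<open>\<beta> l\<close>.\<close>

lemma upper_neg:
  assumes p: "p \<in> persistent" "p < l" "l < 0"
  shows "continuous_on UNIV (\<beta> l)" "att_near l (\<beta> l)" "continuous_on UNIV (kappa l)" "rep_near l (kappa l)"
    and "\<exists>e>0. \<forall>\<omega>. kappa l \<omega> + e \<le> \<beta> l \<omega>"
    and "{M. minimal_set \<sigma> (cubic a l) M \<and> pos_set M} = {graph_of (\<beta> l), graph_of (kappa l)}"
proof -
  obtain e R where "separated_pair_pos \<sigma> a \<alpha> \<beta> l (kappa l) (\<beta> l) (kappa l) 0 e R (decay_radius l) R (decay_radius l)"
    using pair_neg[OF p] by blast
  then interpret sp: separated_pair_pos \<sigma> a \<alpha> \<beta> l "kappa l" "\<beta> l" "kappa l" 0 e R "decay_radius l" R "decay_radius l" .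
  have lp: "l \<in> persistent" using persistent_upward p by (meson less_imp_le)
  show c: "continuous_on UNIV (\<beta> l)" by (rule sp.b_continuous)
  show "att_near l (\<beta> l)" by (rule sp.b_attractive)
  show ck: "continuous_on UNIV (kappa l)" by (rule sp.kappa_continuous)
  show "rep_near l (kappa l)" by (rule sp.kappa_repulsive)
  show "\<exists>e>0. \<forall>\<omega>. kappa l \<omega> + e \<le> \<beta> l \<omega>" using sp.eps sp.gap by blast
  have "M = graph_of (\<beta> l) \<or> M = graph_of (kappa l)" if M: "minimal_set \<sigma> (cubic a l) M" "pos_set M" for M
  proof (cases "\<exists>\<omega> x. (\<omega>, x) \<in> M \<and> kappa l \<omega> < x")
    case True
    then show ?thesis using sp.pos_minimal[OF M] by blast
  next
    case False
    have "kappa l \<omega> \<le> x" if "(\<omega>, x) \<in> M" for \<omega> x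
      using pos_minimal_survivors[OF p(3) M] kappa_le[OF p(3) lp] that by blast
    then have "x = kappa l \<omega>" if "(\<omega>, x) \<in> M" for \<omega> x using False that by (meson antisym not_le)
    moreover have "fst ` M = UNIV" using M(1) inv_fst_UNIV[of M l] by (auto simp: minimal_set_def)
    ultimately show ?thesis using graph_eqI by blast
  qed
  moreover have "minimal_set \<sigma> (cubic a l) (graph_of (\<beta> l))" by (rule graph_minimal[OF eqm_beta c])
  moreover have "minimal_set \<sigma> (cubic a l) (graph_of (kappa l))" by (rule graph_minimal[OF sp.kappa ck])
  moreover have "pos_set (graph_of (\<beta> l))" by (rule pos_graph[OF sp.eps sp.b_ge])
  moreover have "pos_set (graph_of (kappa l))" by (rule pos_graph[OF sp.kappa0])
  ultimately show "{M. minimal_set \<sigma> (cubic a l) M \<and> pos_set M} = {graph_of (\<beta> l), graph_of (kappa l)}" by blast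
qed

section \<open>Collisions in the upper half\<close>

lemma isCont_beta_flow: "isCont (\<beta> l) \<omega> \<Longrightarrow> isCont (\<beta> l) (\<sigma> t \<omega>)"
  by (rule eqm_isCont_flow[OF eqm_beta beta_ge_0 order_refl])

text \<open>Positivity of \<open>\<beta> 0\<close> at a continuity point would spread over the base and make \<open>0\<close> persistent.\<close>

lemma collision_beta_zero:
  assumes "0 \<notin> persistent"
  shows "collision \<sigma> (cubic a) 0 (at_right 0) \<beta> (\<lambda>_ _. 0) (\<beta> 0) (\<lambda>_. 0) {\<omega>. isCont (\<beta> 0) \<omega>}"
  unfolding collision_def
proof (intro conjI allI ballI)
  show "((\<lambda>l. \<beta> l \<omega>) \<longlongrightarrow> \<beta> 0 \<omega>) (at_right 0)" for \<omega> by (rule beta_right_continuous)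
  show "semicontinuous (\<beta> 0)" by (rule semicontinuous_superlevel[OF beta_superlevel])
  show "semicontinuous (\<lambda>_::'w. 0)" by (rule semicontinuous_superlevel) simp
  show "equilibrium \<sigma> (cubic a 0) (\<beta> 0)" by (rule eqm_equilibrium[OF eqm_beta])
  show "equilibrium \<sigma> (cubic a 0) (\<lambda>_. 0)" by (rule eqm_equilibrium[OF eqm_zero])
  show "residual {\<omega>. isCont (\<beta> 0) \<omega>}" by (rule residual_continuity_points[OF beta_superlevel])
  fix \<omega> assume \<omega>: "\<omega> \<in> {\<omega>. isCont (\<beta> 0) \<omega>}"
  show "\<sigma> t \<omega> \<in> {\<omega>. isCont (\<beta> 0) \<omega>}" for t using \<omega> isCont_beta_flow by simp
  obtain R where R: "\<And>\<omega>. \<beta> 0 \<omega> \<le> R" using beta_bounded by metis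
  have "\<not> 0 < \<beta> 0 \<omega>"
    using eqm_gap_dichotomy[OF eqm_zero eqm_beta _ beta_ge_0 R, of \<omega>] assms \<omega> by (auto simp: persistent_def)
  then show "\<beta> 0 \<omega> = 0" using beta_ge_0[of 0 \<omega>] by simp
qed (use assms in auto)

lemma kappa_antimono:
  assumes "p \<in> persistent" "p \<le> l" "l \<le> l'" "l' < 0" shows "kappa l' \<omega> \<le> kappa l \<omega>"
proof (cases "l = l'")
  case False
  have lp: "l \<in> persistent" using persistent_upward[OF assms(1,2)] .
  have "l < 0" "l < l'" using assms False by auto
  then obtain e where e: "0 < e" "\<And>\<omega>. kappa l' \<omega> + e \<le> kappa l \<omega>" using kappa_drop[OF _ lp _ assms(4)] by blast
  then show ?thesis using e(2)[of \<omega>] by linarith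
qed simp

text \<open>The limit of \<open>kappa\<close> at \<open>0\<close> is strictly below \<open>\<beta> 0\<close>. If it were positive at a continuity point, it would be
  bounded away from zero, but \<open>\<beta> 0\<close> is the only equilibrium with this property.\<close>

lemma collide_kappa_zero:
  assumes "0 \<in> persistent" shows "collide \<sigma> (cubic a) 0 (at_left 0) kappa (\<lambda>_ _. 0)"
proof -
  obtain \<mu> where mu: "\<mu> < 0" "\<And>l. l \<in> persistent \<longleftrightarrow> \<mu> \<le> l" using threshold[OF assms] by blast
  have p: "\<mu> \<in> persistent" using mu by simp
  have pl: "l \<in> persistent" if "\<mu> < l" for l using mu that by simp
  have kappa0: "0 \<le> kappa l \<omega>" if "\<mu> < l" "l < 0" for l \<omega>
    using decay_radius_le_kappa[OF that(2) pl[OF that(1)], of \<omega>] decay_radius_pos[OF that(2)] by linarith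
  have anti: "kappa y \<omega> \<le> kappa x \<omega>" if "\<mu> < x" "x \<le> y" "y < 0" for x y \<omega>
    using kappa_antimono[OF p] that by simp
  define g where "g \<omega> = (INF l\<in>{\<mu><..<0}. kappa l \<omega>)" for \<omega>
  have lim: "((\<lambda>l. kappa l \<omega>) \<longlongrightarrow> g \<omega>) (at_left 0)" for \<omega>
    unfolding g_def by (rule antimono_tendsto_at_left[OF mu(1) anti kappa0])
  have bdd: "bdd_below ((\<lambda>l. kappa l \<omega>) ` {\<mu><..<0})" for \<omega> using kappa0 by (intro bdd_belowI[of _ 0]) auto
  have ne: "{\<mu><..<0} \<noteq> {}" using mu(1) by simp
  have g0: "0 \<le> g \<omega>" for \<omega> unfolding g_def using ne kappa0 by (intro cINF_greatest) auto
  have gle: "g \<omega> \<le> kappa l \<omega>" if "\<mu> < l" "l < 0" for l \<omega>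
    unfolding g_def using that by (intro cINF_lower[OF bdd]) simp
  have ev: "\<forall>\<^sub>F l in at_left 0. l \<in> {\<mu><..<0}" by (rule eventually_at_left_real[OF mu(1)])
  have g: "eqm 0 g"
  proof (rule eqm_limit[OF _ lim])
    show "\<forall>\<^sub>F l in at_left 0. eqm l (kappa l)" using ev by eventually_elim (use kappa_eqm pl in auto)
    show "(id \<longlongrightarrow> 0) (at_left (0::real))" unfolding id_def by (rule tendsto_ident_at)
    show "\<forall>\<^sub>F l in at_left 0. \<forall>\<omega>. 0 \<le> kappa l \<omega>" using ev by eventually_elim (use kappa0 in auto)
  qed simp
  have usc: "closed {\<omega>. y \<le> g \<omega>}" for y
  proof -
    have "{\<omega>. y \<le> g \<omega>} = (\<Inter>l\<in>{\<mu><..<0}. {\<omega>. y \<le> kappa l \<omega>})"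
      using ne gle by (auto simp: g_def intro: cINF_greatest order_trans)
    moreover have "closed {\<omega>. y \<le> kappa l \<omega>}" if "l \<in> {\<mu><..<0}" for l
      using upper_neg(3)[OF p] that by (intro closed_Collect_le continuous_on_const) auto
    ultimately show ?thesis by auto
  qed
  define l1 where "l1 = \<mu> / 2"
  have l1: "\<mu> < l1" "l1 < 0" using mu(1) by (auto simp: l1_def)
  obtain e where e: "0 < e" "\<And>\<omega>. \<beta> l1 \<omega> + e \<le> \<beta> 0 \<omega>" using persistent_gain[OF pl[OF l1(1)] l1(2)] by blast
  have gb: "g \<omega> + e \<le> \<beta> 0 \<omega>" for \<omega>
    using gle[OF l1, of \<omega>] kappa_le_beta[OF l1(2) pl[OF l1(1)], of \<omega>] e(2)[of \<omega>] by linarith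
  have gb': "g \<omega> \<le> \<beta> 0 \<omega>" for \<omega> using gb[of \<omega>] e(1) by linarith
  obtain R where R: "\<And>\<omega>. \<beta> 0 \<omega> \<le> R" using beta_bounded by metis
  have gR: "g \<omega> \<le> R" for \<omega> using gb'[of \<omega>] R[of \<omega>] by linarith
  obtain \<epsilon> R' where "separated_pair \<sigma> a \<alpha> \<beta> 0 (\<lambda>_. 0) (\<beta> 0) (\<lambda>_. 1) 0 \<epsilon> R' 1 1"
    using pair_nonneg[OF order_refl assms] by blast
  then interpret sp: separated_pair \<sigma> a \<alpha> \<beta> 0 "\<lambda>_. 0" "\<beta> 0" "\<lambda>_. 1" 0 \<epsilon> R' 1 1 .
  have g_zero: "g \<omega> = 0" if c: "isCont g \<omega>" for \<omega>
  proof (rule ccontr)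
    assume "g \<omega> \<noteq> 0"
    then have "0 < g \<omega>" using g0[of \<omega>] by simp
    then obtain d where d: "0 < d" "\<And>\<omega>. d \<le> g \<omega>"
      using eqm_gap_dichotomy[OF eqm_zero g _ g0 gR, of \<omega>] c by auto
    have "g (\<sigma> 0 \<omega>) = \<beta> 0 \<omega>"
      by (rule sp.entire_eq_b[OF eqm_sol_on[OF g], of d \<omega> R]) (use d gR in auto)
    then show False using gb[of \<omega>] e(1) by simp
  qed
  have "collision \<sigma> (cubic a) 0 (at_left 0) kappa (\<lambda>_ _. 0) g (\<lambda>_. 0) {\<omega>. isCont g \<omega>}"
    unfolding collision_def
  proof (intro conjI allI ballI)
    show "semicontinuous g" by (rule semicontinuous_superlevel[OF usc])
    show "semicontinuous (\<lambda>_::'w. 0)" by (rule semicontinuous_superlevel) simp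
    show "equilibrium \<sigma> (cubic a 0) g" by (rule eqm_equilibrium[OF g])
    show "equilibrium \<sigma> (cubic a 0) (\<lambda>_. 0)" by (rule eqm_equilibrium[OF eqm_zero])
    show "residual {\<omega>. isCont g \<omega>}" by (rule residual_continuity_points[OF usc])
    show "\<sigma> t \<omega> \<in> {\<omega>. isCont g \<omega>}" if "\<omega> \<in> {\<omega>. isCont g \<omega>}" for \<omega> t
      using that eqm_isCont_flow[OF g g0 gb'] by simp
  qed (use lim g_zero in auto)
  then show ?thesis unfolding collide_def by blast
qed

end

locale at_threshold = cubic_family \<sigma> a \<alpha> \<beta>
  for \<sigma> :: "real \<Rightarrow> 'w::metric_space \<Rightarrow> 'w" and a :: "'w \<Rightarrow> real" and \<alpha> \<beta> :: "real \<Rightarrow> 'w \<Rightarrow> real" +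
  fixes \<mu> :: real
  assumes mu_neg: "\<mu> < 0" and persistent_iff: "\<And>l. l \<in> persistent \<longleftrightarrow> \<mu> \<le> l"
begin

text \<open>The residual set over which \<open>\<beta> \<mu>\<close> and \<open>kappa \<mu>\<close> coincide.\<close>

definition core :: "'w set" where "core = {\<omega>. isCont (\<beta> \<mu>) \<omega> \<and> isCont (kappa \<mu>) \<omega>}"

text \<open>The closure of the orbit of a point of the common graph. By \<open>orbit_closure\<close> and \<open>minimal_survivors_eq\<close>
  the chosen point of the core does not matter.\<close>

definition threshold_set :: "('w \<times> real) set" where
  "threshold_set = closure (range (\<lambda>t. skew \<sigma> (cubic a \<mu>) t (SOME \<omega>. \<omega> \<in> core, \<beta> \<mu> (SOME \<omega>. \<omega> \<in> core))))"

lemma mu_persistent: "\<mu> \<in> persistent" by (simp add: persistent_iff)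

lemmas kappa_facts = kappa_eqm[OF mu_neg mu_persistent] kappa_le_beta[OF mu_neg mu_persistent] decay_radius_le_kappa[OF mu_neg mu_persistent]
  kappa_survivors[OF mu_neg mu_persistent]

lemma kappa_mu_nonneg: "0 \<le> kappa \<mu> \<omega>"
  using kappa_facts(3)[of \<omega>] decay_radius_pos[OF mu_neg] by linarith

lemma core_residual: "residual core"
proof -
  have "closed {\<omega>. y \<le> - kappa \<mu> \<omega>}" for y
    using kappa_sublevel[OF mu_neg mu_persistent, of "- y"] by (simp add: le_minus_iff)
  then have "residual {\<omega>. isCont (\<lambda>\<omega>. - kappa \<mu> \<omega>) \<omega>}" by (rule residual_continuity_points)
  then have "residual {\<omega>. isCont (kappa \<mu>) \<omega>}" by (simp add: isCont_def tendsto_minus_cancel_left)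
  from residual_Int[OF residual_continuity_points[OF beta_superlevel[of _ \<mu>]] this]
  show ?thesis by (simp add: core_def Int_def)
qed

lemma core_invariant: "\<omega> \<in> core \<Longrightarrow> \<sigma> t \<omega> \<in> core"
  using isCont_beta_flow[where l = \<mu>] eqm_isCont_flow[OF kappa_facts(1) kappa_mu_nonneg kappa_facts(2)] by (simp add: core_def)

lemma core_eq: assumes "\<omega> \<in> core" shows "kappa \<mu> \<omega> = \<beta> \<mu> \<omega>"
proof (rule ccontr)
  assume "kappa \<mu> \<omega> \<noteq> \<beta> \<mu> \<omega>"
  then have less: "kappa \<mu> \<omega> < \<beta> \<mu> \<omega>" using kappa_facts(2)[of \<omega>] by simp
  obtain R where R: "\<And>\<omega>. \<beta> \<mu> \<omega> \<le> R" using beta_bounded by metis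
  obtain d where "0 < d" "\<And>\<omega>. kappa \<mu> \<omega> + d \<le> \<beta> \<mu> \<omega>"
    using eqm_gap_dichotomy[OF kappa_facts(1) eqm_beta kappa_mu_nonneg kappa_facts(2) R, of \<omega>] assms less by (auto simp: core_def)
  moreover obtain \<eta> where "\<beta> \<mu> \<eta> < kappa \<mu> \<eta> + d" using no_gap_at_threshold[OF mu_neg persistent_iff] calculation(1) by blast
  ultimately show False by (meson not_le)
qed

lemma core_nonempty: "core \<noteq> {}"
  using residual_nonempty[OF compact_base core_residual] .

lemma survivors_core: "\<omega> \<in> core \<Longrightarrow> (\<omega>, x) \<in> survivors \<mu> \<Longrightarrow> x = \<beta> \<mu> \<omega>"
  using kappa_le[OF mu_neg mu_persistent, of \<omega> x] core_eq[of \<omega>] by (simp add: mem_survivors)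

text \<open>Over the core there is only one survivor, so every compact invariant set of survivors contains it.\<close>

lemma inv_in_survivors_contains:
  assumes "K \<noteq> {}" "compact K" "invariant_set \<sigma> (cubic a \<mu>) K" "K \<subseteq> survivors \<mu>" "\<omega> \<in> core"
  shows "(\<omega>, \<beta> \<mu> \<omega>) \<in> K"
proof -
  have "\<omega> \<in> fst ` K" using inv_fst_UNIV[OF assms(1-3)] by simp
  then obtain x where "(\<omega>, x) \<in> K" by force
  then show ?thesis using survivors_core[OF assms(5)] assms(4) by blast
qed

lemma orbit_closure:
  assumes "\<omega> \<in> core"
  defines "C \<equiv> closure (range (\<lambda>t. skew \<sigma> (cubic a \<mu>) t (\<omega>, \<beta> \<mu> \<omega>)))"
  shows "minimal_set \<sigma> (cubic a \<mu>) C" "C \<subseteq> survivors \<mu>" "(\<omega>, \<beta> \<mu> \<omega>) \<in> C"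
proof -
  let ?O = "range (\<lambda>t. skew \<sigma> (cubic a \<mu>) t (\<omega>, \<beta> \<mu> \<omega>))"
  have O: "?O = range (\<lambda>t. (\<sigma> t \<omega>, \<beta> \<mu> (\<sigma> t \<omega>)))" by (simp add: skew_def beta_flow)
  have Os: "?O \<subseteq> survivors \<mu>" unfolding O using beta_survivors[OF mu_neg mu_persistent] by auto
  then show CS: "C \<subseteq> survivors \<mu>" unfolding C_def by (intro closure_minimal compact_imp_closed survivors_compact)
  have survivorsA: "survivors \<mu> \<subseteq> attr_upper \<mu>" by (auto simp: mem_survivors mem_attr_upper)
  have closedC: "closed C" by (simp add: C_def)
  have "compact (survivors \<mu> \<inter> C)" by (intro compact_Int_closed survivors_compact closedC)
  then have compC: "compact C" using CS by (simp add: Int_absorb1)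
  show mem: "(\<omega>, \<beta> \<mu> \<omega>) \<in> C" unfolding C_def by (rule closure_subset[THEN subsetD]) (auto simp: O intro!: image_eqI[of _ _ 0])
  have inv: "invariant_set \<sigma> (cubic a \<mu>) C"
    unfolding invariant_set_def
  proof clarify
    fix \<eta> x t assume p: "(\<eta>, x) \<in> C"
    let ?F = "\<lambda>p. (\<sigma> t (fst p), S \<mu> t (fst p) (snd p))"
    have "continuous_on (attr_upper \<mu>) ?F" by (intro continuous_intros S_continuous_on_attr_upper)
    then have "continuous_on C ?F" using CS survivorsA by (blast intro: continuous_on_subset)
    moreover have "?F ` ?O \<subseteq> C"
    proof (rule image_subsetI, elim rangeE)
      fix p s assume "p = skew \<sigma> (cubic a \<mu>) s (\<omega>, \<beta> \<mu> \<omega>)"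
      then have "?F p = skew \<sigma> (cubic a \<mu>) (t + s) (\<omega>, \<beta> \<mu> \<omega>)"
        by (simp add: skew_def beta_flow)
      then show "?F p \<in> C"
        unfolding C_def by (metis closure_subset rangeI subsetD)
    qed
    ultimately have "?F ` closure ?O \<subseteq> C" by (intro image_closure_subset closedC) (auto simp: C_def)
    then have "?F (\<eta>, x) \<in> C" using p unfolding C_def by blast
    moreover have "t \<in> dom \<mu> \<eta> x" using p CS survivorsA attr_dom attr_upper_attr by blast
    ultimately show "t \<in> dom \<mu> \<eta> x \<and> skew \<sigma> (cubic a \<mu>) t (\<eta>, x) \<in> C" by (simp add: skew_def)
  qed
  show "minimal_set \<sigma> (cubic a \<mu>) C"
    unfolding minimal_set_def
  proof (intro conjI allI impI)
    show "C \<noteq> {}" "compact C" "invariant_set \<sigma> (cubic a \<mu>) C" using mem compC inv by auto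
    fix K assume K: "K \<noteq> {} \<and> compact K \<and> invariant_set \<sigma> (cubic a \<mu>) K"
    show "\<not> K \<subset> C"
    proof
      assume KC: "K \<subset> C"
      have *: "(\<omega>, \<beta> \<mu> \<omega>) \<in> K" using K KC CS assms(1) by (intro inv_in_survivors_contains) auto
      have "?O \<subseteq> K"
        unfolding O using inv_S[of \<mu> K, OF _ *] K by (auto simp: beta_flow)
      then have "C \<subseteq> K" unfolding C_def using K by (intro closure_minimal compact_imp_closed) auto
      then show False using KC by blast
    qed
  qed
qed

lemma pos_survivors: "M \<subseteq> survivors \<mu> \<Longrightarrow> pos_set M"
  unfolding pos_set_def
proof (intro exI[of _ "decay_radius \<mu>"] conjI ballI decay_radius_pos[OF mu_neg])
  fix p assume "M \<subseteq> survivors \<mu>" "p \<in> M"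
  then have "(fst p, snd p) \<in> survivors \<mu>" by auto
  then have "decay_radius \<mu> \<le> S \<mu> 0 (fst p) (snd p)" unfolding mem_survivors by blast
  then show "decay_radius \<mu> \<le> snd p" by simp
qed

lemma minimal_survivors_eq:
  assumes "minimal_set \<sigma> (cubic a \<mu>) M" "M \<subseteq> survivors \<mu>" "minimal_set \<sigma> (cubic a \<mu>) N" "N \<subseteq> survivors \<mu>"
  shows "M = N"
proof -
  obtain \<omega> where \<omega>: "\<omega> \<in> core" using core_nonempty by blast
  have "(\<omega>, \<beta> \<mu> \<omega>) \<in> M" "(\<omega>, \<beta> \<mu> \<omega>) \<in> N"
    using assms \<omega> by (auto simp: minimal_set_def intro!: inv_in_survivors_contains)
  then show ?thesis by (intro minimal_meet_eq[OF assms(1,3)]) blast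
qed

lemma threshold_set_minimal: "minimal_set \<sigma> (cubic a \<mu>) threshold_set" and threshold_set_survivors: "threshold_set \<subseteq> survivors \<mu>"
  using orbit_closure[of "SOME \<omega>. \<omega> \<in> core"] core_nonempty some_in_eq[of core] by (auto simp: threshold_set_def)

lemma upper_mu: "{M. minimal_set \<sigma> (cubic a \<mu>) M \<and> pos_set M} = {threshold_set}"
  using threshold_set_minimal threshold_set_survivors pos_survivors minimal_survivors_eq pos_minimal_survivors[OF mu_neg] by blast

lemma threshold_set_core: assumes "\<omega> \<in> core" shows "(\<omega>, \<beta> \<mu> \<omega>) \<in> threshold_set"
  using threshold_set_minimal threshold_set_survivors assms by (auto simp: minimal_set_def intro!: inv_in_survivors_contains)

lemma collision_minimal_mu: "collision_minimal_set \<sigma> (cubic a \<mu>) (\<beta> \<mu>) core threshold_set"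
  unfolding collision_minimal_set_def
  using orbit_closure(1,2) minimal_survivors_eq[OF threshold_set_minimal threshold_set_survivors] threshold_set_minimal by blast

lemma kappa_tendsto_mu: "((\<lambda>l. kappa l \<omega>) \<longlongrightarrow> kappa \<mu> \<omega>) (at_right \<mu>)"
proof -
  obtain R where R: "\<And>\<omega>. \<beta> \<mu> \<omega> \<le> R" using beta_bounded by metis
  have pl: "l \<in> persistent" if "\<mu> < l" for l using that by (simp add: persistent_iff)
  have le: "kappa l \<omega> \<le> kappa \<mu> \<omega>" if "\<mu> < l" "l < 0" for l \<omega> using kappa_antimono[OF mu_persistent, of \<mu> l] that by simp
  have anti: "kappa y \<omega> \<le> kappa x \<omega>" if "\<mu> < x" "x \<le> y" "y < 0" for x y \<omega>
    using kappa_antimono[OF mu_persistent] that by simp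
  define g where "g \<omega> = (SUP l\<in>{\<mu><..<0}. kappa l \<omega>)" for \<omega>
  have lim: "((\<lambda>l. kappa l \<omega>) \<longlongrightarrow> g \<omega>) (at_right \<mu>)" for \<omega>
    unfolding g_def by (rule antimono_tendsto_at_right[OF mu_neg anti le])
  have ne: "{\<mu><..<0} \<noteq> {}" using mu_neg by simp
  have bdd: "bdd_above ((\<lambda>l. kappa l \<omega>) ` {\<mu><..<0})" for \<omega> using le by (intro bdd_aboveI[of _ "kappa \<mu> \<omega>"]) auto
  have g_le: "g \<omega> \<le> kappa \<mu> \<omega>" for \<omega> unfolding g_def using ne le by (intro cSUP_least) auto
  define l1 where "l1 = \<mu> / 2"
  have l1: "\<mu> < l1" "l1 < 0" using mu_neg by (auto simp: l1_def)
  have g_ge: "decay_radius l1 \<le> g \<omega>" for \<omega>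
    using cSUP_upper[OF _ bdd, of l1 \<omega>] l1 decay_radius_le_kappa[OF l1(2) pl[OF l1(1)], of \<omega>] by (auto simp: g_def)
  have ev: "\<forall>\<^sub>F l in at_right \<mu>. l \<in> {\<mu><..<0}" by (rule eventually_at_right_real[OF mu_neg])
  have g: "eqm \<mu> g"
  proof (rule eqm_limit[OF _ lim])
    show "\<forall>\<^sub>F l in at_right \<mu>. eqm l (kappa l)" using ev by eventually_elim (use kappa_eqm pl in auto)
    show "(id \<longlongrightarrow> \<mu>) (at_right \<mu>)" unfolding id_def by (rule tendsto_ident_at)
    show "\<forall>\<^sub>F l in at_right \<mu>. \<forall>\<omega>. 0 \<le> kappa l \<omega>"
      using ev
    proof eventually_elim
      case (elim l)
      then show ?case using decay_radius_le_kappa[of l] pl decay_radius_pos[of l] by (auto intro: order_trans[OF less_imp_le])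
    qed
  qed simp
  have "(\<omega>, g (\<sigma> 0 \<omega>)) \<in> survivors \<mu>" for \<omega>
  proof (rule survivors_entire[OF mu_neg mu_persistent eqm_sol_on[OF g] decay_radius_pos[OF l1(2)]])
    show "decay_radius l1 \<le> g (\<sigma> t \<omega>)" for t by (rule g_ge)
    show "g (\<sigma> t \<omega>) \<le> R" for t using g_le[of "\<sigma> t \<omega>"] kappa_facts(2)[of "\<sigma> t \<omega>"] R[of "\<sigma> t \<omega>"] by linarith
  qed
  then have "kappa \<mu> \<omega> \<le> g \<omega>" using kappa_le[OF mu_neg mu_persistent] by fastforce
  then have "g \<omega> = kappa \<mu> \<omega>" using g_le[of \<omega>] by simp
  then show ?thesis using lim[of \<omega>] by simp
qed

lemma collision_mu: "collision \<sigma> (cubic a) \<mu> (at_right \<mu>) \<beta> kappa (\<beta> \<mu>) (kappa \<mu>) core"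
  unfolding collision_def
proof (intro conjI allI ballI)
  show "semicontinuous (\<beta> \<mu>)" by (rule semicontinuous_superlevel[OF beta_superlevel])
  have "closed {\<omega>. y \<le> - kappa \<mu> \<omega>}" for y
    using kappa_sublevel[OF mu_neg mu_persistent, of "- y"] by (simp add: le_minus_iff)
  from semicontinuous_uminus[OF semicontinuous_superlevel[OF this]]
  show "semicontinuous (kappa \<mu>)" by simp
  show "equilibrium \<sigma> (cubic a \<mu>) (\<beta> \<mu>)" "equilibrium \<sigma> (cubic a \<mu>) (kappa \<mu>)"
    by (intro eqm_equilibrium eqm_beta kappa_facts)+
qed (use beta_right_continuous kappa_tendsto_mu core_residual core_invariant core_eq in \<open>auto simp: core_def\<close>)

text \<open>Over the core, points slightly below the set are below \<open>kappa \<mu>\<close>. Their solutions decay to \<open>0\<close>, whereas those in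
  the set stay above \<open>decay_radius \<mu>\<close>.\<close>

lemma threshold_set_not_attractive: "\<not> hyp_attractive \<sigma> (cubic a \<mu>) threshold_set"
proof
  assume "hyp_attractive \<sigma> (cubic a \<mu>) threshold_set"
  then obtain \<delta> k \<gamma> where d: "0 < \<delta>" "1 \<le> k" "0 < \<gamma>" and
    dd: "\<And>\<omega> x y t. (\<omega>, x) \<in> threshold_set \<Longrightarrow> \<bar>y - x\<bar> < \<delta> \<Longrightarrow> 0 \<le> t \<Longrightarrow> \<bar>S \<mu> t \<omega> y - S \<mu> t \<omega> x\<bar> \<le> k * exp (- \<gamma> * \<bar>t\<bar>) * \<bar>y - x\<bar>"
    unfolding hyp_attractive_def by blast
  obtain \<omega> where \<omega>: "\<omega> \<in> core" using core_nonempty by blast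
  have r: "0 < decay_radius \<mu>" by (rule decay_radius_pos[OF mu_neg])
  define \<eta> where "\<eta> = min (\<delta> / 2) (decay_radius \<mu> / 2)"
  have \<eta>: "0 < \<eta>" "\<eta> < \<delta>" "\<eta> < decay_radius \<mu>" using d r by (auto simp: \<eta>_def)
  let ?x = "\<beta> \<mu> \<omega>" and ?y = "\<beta> \<mu> \<omega> - \<eta>"
  have y0: "0 \<le> ?y" "?y \<le> ?x" using \<eta> persistent_rad[OF mu_neg mu_persistent, of \<omega>] by auto
  have "(\<omega>, ?y) \<notin> survivors \<mu>" using survivors_core[OF \<omega>, of ?y] \<eta> by auto
  then obtain s where s: "0 \<le> s" "S \<mu> s \<omega> ?y < decay_radius \<mu>" using y0 by (auto simp: mem_survivors not_le)
  have "((\<lambda>t. S \<mu> t \<omega> ?y) \<longlongrightarrow> 0) at_top" by (rule S_below_rad_tendsto_0[OF mu_neg s(1) y0(1)]) (use s in simp)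
  then have 1: "\<forall>\<^sub>F t in at_top. S \<mu> t \<omega> ?y < decay_radius \<mu> / 2" by (rule order_tendstoD) (use r in simp)
  have "((\<lambda>t. k * \<eta> * exp (- \<gamma> * (t - 0))) \<longlongrightarrow> 0) at_top" by (rule exp_decay_at_top) (use d in simp)
  then have 2: "\<forall>\<^sub>F t in at_top. k * \<eta> * exp (- \<gamma> * (t - 0)) < decay_radius \<mu> / 2" by (rule order_tendstoD) (use r in simp)
  have "\<forall>\<^sub>F t in at_top. S \<mu> t \<omega> ?y < decay_radius \<mu> / 2 \<and> k * \<eta> * exp (- \<gamma> * (t - 0)) < decay_radius \<mu> / 2 \<and> 0 \<le> t"
    using 1 2 eventually_ge_at_top[of 0] by eventually_elim simp
  then obtain t where t: "S \<mu> t \<omega> ?y < decay_radius \<mu> / 2" "k * \<eta> * exp (- \<gamma> * (t - 0)) < decay_radius \<mu> / 2" "0 \<le> t"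
    by (auto simp: eventually_at_top_linorder)
  have "\<bar>S \<mu> t \<omega> ?y - S \<mu> t \<omega> ?x\<bar> \<le> k * exp (- \<gamma> * \<bar>t\<bar>) * \<bar>?y - ?x\<bar>"
    by (rule dd[OF threshold_set_core[OF \<omega>]]) (use \<eta> t in auto)
  then have "\<bar>S \<mu> t \<omega> ?y - \<beta> \<mu> (\<sigma> t \<omega>)\<bar> < decay_radius \<mu> / 2" using t \<eta> by (simp add: beta_flow mult_ac)
  then show False using t(1) persistent_rad[OF mu_neg mu_persistent, of "\<sigma> t \<omega>"] by linarith
qed

text \<open>Over the core, the set touches the top of the attractor. If it were repulsive, a point slightly above would have a
  bounded solution on the whole line, and hence belong to the attractor.\<close>

lemma threshold_set_not_repulsive: "\<not> hyp_repulsive \<sigma> (cubic a \<mu>) threshold_set"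
proof
  assume "hyp_repulsive \<sigma> (cubic a \<mu>) threshold_set"
  then obtain \<delta> k \<gamma> where d: "0 < \<delta>" "1 \<le> k" "0 < \<gamma>" and
    dd: "\<And>\<omega> x y t. (\<omega>, x) \<in> threshold_set \<Longrightarrow> \<bar>y - x\<bar> < \<delta> \<Longrightarrow> t \<le> 0 \<Longrightarrow> t \<in> dom \<mu> \<omega> y \<and> \<bar>S \<mu> t \<omega> y - S \<mu> t \<omega> x\<bar> \<le> k * exp (- \<gamma> * \<bar>t\<bar>) * \<bar>y - x\<bar>"
    unfolding hyp_repulsive_def by blast
  obtain \<omega> where \<omega>: "\<omega> \<in> core" using core_nonempty by blast
  obtain R where R: "0 < R" "\<And>\<omega>. \<beta> \<mu> \<omega> \<le> R" using beta_bounded by metis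
  let ?x = "\<beta> \<mu> \<omega>" and ?y = "\<beta> \<mu> \<omega> + \<delta> / 2"
  have *: "t \<in> dom \<mu> \<omega> ?y" "\<bar>S \<mu> t \<omega> ?y - \<beta> \<mu> (\<sigma> t \<omega>)\<bar> \<le> k * exp (- \<gamma> * \<bar>t\<bar>) * (\<delta> / 2)" if "t \<le> 0" for t
    using dd[OF threshold_set_core[OF \<omega>], of ?y t] that d by (auto simp: beta_flow)
  have "dom \<mu> \<omega> ?y = UNIV" using *(1) fwd_dom by (metis UNIV_eq_I linorder_linear)
  then have u: "sol_on \<mu> \<omega> UNIV (\<lambda>t. S \<mu> t \<omega> ?y)" using sol_on_sol[of \<mu> \<omega> ?y] by simp
  define B where "B = max (max (R + \<delta>) (absorbing_level \<mu>)) (R + k * \<delta>)"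
  have "\<bar>S \<mu> t \<omega> ?y\<bar> \<le> B" for t
  proof (cases "0 \<le> t")
    case True
    have "?y \<le> B" "absorbing_level \<mu> \<le> B" using R(2)[of \<omega>] d by (auto simp: B_def)
    then show ?thesis using True beta_ge_0[of \<mu> \<omega>] d by (intro S_abs_le) auto
  next
    case False
    have "k * exp (- \<gamma> * \<bar>t\<bar>) * (\<delta> / 2) \<le> k * 1 * (\<delta> / 2)" using d by (intro mult_right_mono mult_left_mono) auto
    also have "\<dots> \<le> k * \<delta>" using d by simp
    finally have "\<bar>S \<mu> t \<omega> ?y - \<beta> \<mu> (\<sigma> t \<omega>)\<bar> \<le> k * \<delta>" using *(2)[of t] False by simp
    then show ?thesis using R(2)[of "\<sigma> t \<omega>"] beta_ge_0[of \<mu> "\<sigma> t \<omega>"] by (simp add: B_def)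
  qed
  from entire_le_beta[OF u this, of 0] show False using d by simp
qed

end

section \<open>The trivial minimal set\<close>

context cubic_family
begin

text \<open>Moving a nearby point forwards for time \<open>t\<close> and back again would shrink its distance to the set by an exponentially
  small factor.\<close>

lemma not_attractive_and_repulsive:
  assumes "M \<noteq> {}" "invariant_set \<sigma> (cubic a l) M"
    "hyp_attractive \<sigma> (cubic a l) M" "hyp_repulsive \<sigma> (cubic a l) M"
  shows False
proof -
  obtain \<delta> k \<gamma> where d: "0 < \<delta>" "1 \<le> k" "0 < \<gamma>" and
    dd: "\<And>\<omega> x y t. (\<omega>, x) \<in> M \<Longrightarrow> \<bar>y - x\<bar> < \<delta> \<Longrightarrow> 0 \<le> t \<Longrightarrow> \<bar>S l t \<omega> y - S l t \<omega> x\<bar> \<le> k * exp (- \<gamma> * \<bar>t\<bar>) * \<bar>y - x\<bar>"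
    using assms(3) unfolding hyp_attractive_def by blast
  obtain \<delta>' k' \<gamma>' where e: "0 < \<delta>'" "1 \<le> k'" "0 < \<gamma>'" and
    ee: "\<And>\<omega> x y t. (\<omega>, x) \<in> M \<Longrightarrow> \<bar>y - x\<bar> < \<delta>' \<Longrightarrow> t \<le> 0 \<Longrightarrow> \<bar>S l t \<omega> y - S l t \<omega> x\<bar> \<le> k' * exp (- \<gamma>' * \<bar>t\<bar>) * \<bar>y - x\<bar>"
    using assms(4) unfolding hyp_repulsive_def by blast
  obtain \<omega> x where p: "(\<omega>, x) \<in> M" using assms(1) by auto
  define \<eta> where "\<eta> = min (\<delta> / 2) (\<delta>' / (2 * k))"
  have \<eta>: "0 < \<eta>" "\<eta> < \<delta>" using d e by (auto simp: \<eta>_def)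
  have "\<eta> \<le> \<delta>' / (2 * k)" by (simp add: \<eta>_def)
  then have k\<eta>: "k * \<eta> < \<delta>'" using d e by (simp add: field_simps)
  have "((\<lambda>t. k' * k * exp (- \<gamma> * (t - 0))) \<longlongrightarrow> 0) at_top" by (rule exp_decay_at_top) (use d in simp)
  then have "\<forall>\<^sub>F t in at_top. k' * k * exp (- \<gamma> * (t - 0)) < 1" by (rule order_tendstoD) simp
  then have "\<forall>\<^sub>F t in at_top. k' * k * exp (- \<gamma> * (t - 0)) < 1 \<and> 0 \<le> t" using eventually_ge_at_top[of 0] by eventually_elim simp
  then obtain t where t: "k' * k * exp (- \<gamma> * t) < 1" "0 \<le> t" by (auto simp: eventually_at_top_linorder)
  let ?y = "x + \<eta>"
  have 1: "\<bar>S l t \<omega> ?y - S l t \<omega> x\<bar> \<le> k * exp (- \<gamma> * t) * \<eta>" using dd[OF p, of ?y t] \<eta> t by simp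
  also have "\<dots> \<le> k * 1 * \<eta>" using d \<eta> t by (intro mult_right_mono mult_left_mono) auto
  finally have small: "\<bar>S l t \<omega> ?y - S l t \<omega> x\<bar> < \<delta>'" using k\<eta> by simp
  have flow_back: "S l (- t) (\<sigma> t \<omega>) (S l t \<omega> z) = z" for z
    using sol_flow(2)[of t l \<omega> z "- t"] fwd_dom[of t] fwd_dom[of 0] t by simp
  have "\<eta> = \<bar>S l (- t) (\<sigma> t \<omega>) (S l t \<omega> ?y) - S l (- t) (\<sigma> t \<omega>) (S l t \<omega> x)\<bar>"
    unfolding flow_back using \<eta> by simp
  also have "\<dots> \<le> k' * exp (- \<gamma>' * \<bar>- t\<bar>) * \<bar>S l t \<omega> ?y - S l t \<omega> x\<bar>"
    by (rule ee[OF inv_S[OF assms(2) p] small]) (use t in simp)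
  also have "\<dots> \<le> k' * 1 * (k * exp (- \<gamma> * t) * \<eta>)" using 1 t e by (intro mult_mono mult_left_mono) auto
  also have "\<dots> = (k' * k * exp (- \<gamma> * t)) * \<eta>" by simp
  also have "\<dots> < 1 * \<eta>" using t(1) \<eta>(1) by (rule mult_strict_right_mono)
  finally show False by simp
qed

lemma zero_repels:
  assumes "0 < l"
  obtains e where "0 < e" "\<And>\<omega> y t. 0 \<le> y \<Longrightarrow> y < e \<Longrightarrow> t \<le> 0 \<Longrightarrow> t \<in> dom l \<omega> y \<and> \<bar>S l t \<omega> y\<bar> \<le> exp (l / 2 * t) * y"
proof -
  obtain d where d: "0 < d" "\<And>\<omega>. d \<le> \<beta> l \<omega>" using persistent_pos[OF assms] by (auto simp: persistent_def)
  define e where "e = min (min 1 d) (l / (2 * (a_bound + 1)))"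
  have "e \<le> l / (2 * (a_bound + 1))" by (simp add: e_def)
  moreover have "0 < 2 * (a_bound + 1)" using a_bound_ge_1 by simp
  ultimately have "e * (2 * (a_bound + 1)) \<le> l" by (simp only: pos_le_divide_eq)
  then have e4: "e * (a_bound + 1) \<le> l / 2" by (simp add: algebra_simps)
  have e: "0 < e" "e \<le> 1" "e \<le> d" using assms a_bound_ge_1 d(1) by (auto simp: e_def)
  have growth: "l / 2 \<le> growth l \<omega> x" if "0 \<le> x" "x \<le> e" for \<omega> x
  proof -
    have "x\<^sup>2 \<le> e" using mult_mono[of x e x 1] that e by (simp add: power2_eq_square)
    moreover have "\<bar>a \<omega> * x\<bar> \<le> a_bound * e" unfolding abs_mult using abs_a_le[of \<omega>] that by (intro mult_mono) auto
    ultimately show ?thesis using e4 unfolding growth_def by (simp add: algebra_simps)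
  qed
  have main: "t \<in> dom l \<omega> y \<and> \<bar>S l t \<omega> y\<bar> \<le> exp (l / 2 * t) * y" if y: "0 \<le> y" "y < e" and t: "t \<le> 0" for \<omega> y t
  proof
    have A: "(\<omega>, y) \<in> attr_upper l" using y e d(2)[of \<omega>] by (simp add: mem_attr_upper)
    note dom = attr_dom[OF attr_upper_attr[OF A]]
    show "t \<in> dom l \<omega> y" by (simp add: dom)
    have der: "((\<lambda>t. S l t \<omega> y) has_real_derivative growth l (\<sigma> \<tau> \<omega>) (S l \<tau> \<omega> y) * S l \<tau> \<omega> y) (at \<tau>)" for \<tau>
      using sol_onD[OF attr_sol_on[OF attr_upper_attr[OF A]], of \<tau>] by (simp add: cubic_growth)
    have nn: "0 \<le> S l \<tau> \<omega> y" for \<tau> using attr_upper_S[OF A, of \<tau>] by (simp add: mem_attr_upper)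
    have le: "S l \<tau> \<omega> y \<le> e" if "\<tau> \<le> 0" for \<tau>
    proof (rule ccontr)
      assume *: "\<not> S l \<tau> \<omega> y \<le> e"
      have "e \<le> S l 0 \<omega> y"
      proof (rule barrier_ge[OF that der])
        show "e \<le> S l \<tau> \<omega> y" using * by simp
        fix r assume "S l r \<omega> y < e"
        then have "l / 2 \<le> growth l (\<sigma> r \<omega>) (S l r \<omega> y)" using nn by (intro growth) auto
        then show "0 \<le> growth l (\<sigma> r \<omega>) (S l r \<omega> y) * S l r \<omega> y" using nn assms by (intro mult_nonneg_nonneg) auto
      qed
      then show False using y by simp
    qed
    have "\<bar>S l t \<omega> y\<bar> * exp (l / 2 * (0 - t)) \<le> \<bar>S l 0 \<omega> y\<bar>"
    proof (rule growth_lower[OF t der])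
      fix \<tau> assume "t \<le> \<tau>" "\<tau> \<le> (0::real)"
      then have "l / 2 * (S l \<tau> \<omega> y)\<^sup>2 \<le> growth l (\<sigma> \<tau> \<omega>) (S l \<tau> \<omega> y) * (S l \<tau> \<omega> y)\<^sup>2"
        using nn le by (intro mult_right_mono growth) auto
      then show "l / 2 * (S l \<tau> \<omega> y)\<^sup>2 \<le> S l \<tau> \<omega> y * (growth l (\<sigma> \<tau> \<omega>) (S l \<tau> \<omega> y) * S l \<tau> \<omega> y)"
        by (simp add: power2_eq_square mult_ac)
    qed
    then have "\<bar>S l t \<omega> y\<bar> * exp (l / 2 * (0 - t)) * exp (l / 2 * t) \<le> \<bar>S l 0 \<omega> y\<bar> * exp (l / 2 * t)"
      by (intro mult_right_mono) auto
    moreover have "exp (l / 2 * (0 - t)) * exp (l / 2 * t) = 1" unfolding exp_add[symmetric] by simp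
    ultimately have "\<bar>S l t \<omega> y\<bar> * 1 \<le> \<bar>S l 0 \<omega> y\<bar> * exp (l / 2 * t)" by (simp only: mult.assoc)
    then show "\<bar>S l t \<omega> y\<bar> \<le> exp (l / 2 * t) * y" using y by (simp add: mult.commute)
  qed
  show ?thesis using that[OF e(1) main] .
qed

text \<open>For \<open>l = 0\<close> the growth rate vanishes at \<open>x = 0\<close>. If small solutions decayed exponentially, their growth rates
  would be integrable in time, and the solutions would not tend to \<open>0\<close>.\<close>

lemma M0_not_attractive_0: "\<not> hyp_attractive \<sigma> (cubic a 0) M0"
proof
  assume "hyp_attractive \<sigma> (cubic a 0) M0"
  then obtain \<delta> k \<gamma> where d: "0 < \<delta>" "1 \<le> k" "0 < \<gamma>" and
    H: "\<And>\<omega> x y t. (\<omega>, x) \<in> M0 \<Longrightarrow> \<bar>y - x\<bar> < \<delta> \<Longrightarrow> 0 \<le> t \<Longrightarrow> \<bar>S 0 t \<omega> y - S 0 t \<omega> x\<bar> \<le> k * exp (- \<gamma> * \<bar>t\<bar>) * \<bar>y - x\<bar>"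
    unfolding hyp_attractive_def by blast
  have dd: "\<bar>S 0 t \<omega> y\<bar> \<le> k * exp (- \<gamma> * t) * \<bar>y\<bar>" if "\<bar>y\<bar> < \<delta>" "0 \<le> t" for \<omega> y t
    using H[of \<omega> 0 y t] that by (simp add: graph_of_def)
  obtain \<omega> :: 'w where True by blast
  define y where "y = min (\<delta> / 2) (1 / k)"
  have y: "0 < y" "y < \<delta>" using d by (auto simp: y_def)
  have "y \<le> 1 / k" by (simp add: y_def)
  then have ky: "k * y \<le> 1" using d by (simp add: field_simps)
  let ?u = "\<lambda>t. S 0 t \<omega> y"
  have u0: "0 < ?u t" if "0 \<le> t" for t using that y by (simp add: S_pos)
  have u1: "?u t \<le> exp (- \<gamma> * t)" if "0 \<le> t" for t
  proof -
    have "?u t \<le> k * y * exp (- \<gamma> * t)" using dd[of y t \<omega>] y that u0[OF that] by (simp add: mult_ac)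
    also have "\<dots> \<le> 1 * exp (- \<gamma> * t)" using ky by (intro mult_right_mono) auto
    finally show ?thesis by simp
  qed
  \<comment> \<open>the logarithmic derivative of \<open>u\<close> is at least \<open>-C exp (- \<gamma> t)\<close>, which is integrable, so \<open>u\<close> cannot vanish in the limit\<close>
  define C where "C = a_bound + 1"
  have C: "0 < C" using a_bound_ge_1 by (simp add: C_def)
  have lower: "y * exp (- C / \<gamma>) \<le> ?u t" if t: "0 \<le> t" for t
  proof -
    have "- (?u t * exp (- (C / \<gamma>) * exp (- \<gamma> * t))) \<le> - (?u 0 * exp (- (C / \<gamma>) * exp (- \<gamma> * 0)))"
    proof (rule deriv_nonpos_imp_le[OF t, where u = "\<lambda>t. - (?u t * exp (- (C / \<gamma>) * exp (- \<gamma> * t)))"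
          and u' = "\<lambda>t. - ((growth 0 (\<sigma> t \<omega>) (?u t) + C * exp (- \<gamma> * t)) * ?u t * exp (- (C / \<gamma>) * exp (- \<gamma> * t)))"])
      fix \<tau> :: real assume \<tau>: "0 \<le> \<tau>"
      show "((\<lambda>t. - (?u t * exp (- (C / \<gamma>) * exp (- \<gamma> * t)))) has_real_derivative
          - ((growth 0 (\<sigma> \<tau> \<omega>) (?u \<tau>) + C * exp (- \<gamma> * \<tau>)) * ?u \<tau> * exp (- (C / \<gamma>) * exp (- \<gamma> * \<tau>)))) (at \<tau>)"
        using d(3) by (auto intro!: derivative_eq_intros S_deriv[OF \<tau>] simp: field_simps)
      have e1: "?u \<tau> \<le> 1" using u1[OF \<tau>] d \<tau> by (auto intro: order_trans)
      have "(?u \<tau>)\<^sup>2 \<le> ?u \<tau>" using mult_left_mono[OF e1, of "?u \<tau>"] u0[OF \<tau>] by (simp add: power2_eq_square)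
      moreover have "\<bar>a (\<sigma> \<tau> \<omega>) * ?u \<tau>\<bar> \<le> a_bound * ?u \<tau>"
        unfolding abs_mult using abs_a_le[of "\<sigma> \<tau> \<omega>"] u0[OF \<tau>] by (intro mult_mono) auto
      ultimately have "- C * ?u \<tau> \<le> growth 0 (\<sigma> \<tau> \<omega>) (?u \<tau>)" unfolding growth_def C_def by (simp add: algebra_simps abs_le_iff)
      moreover have "C * ?u \<tau> \<le> C * exp (- \<gamma> * \<tau>)" using u1[OF \<tau>] C by (intro mult_left_mono) auto
      ultimately have "0 \<le> growth 0 (\<sigma> \<tau> \<omega>) (?u \<tau>) + C * exp (- \<gamma> * \<tau>)" by linarith
      then show "- ((growth 0 (\<sigma> \<tau> \<omega>) (?u \<tau>) + C * exp (- \<gamma> * \<tau>)) * ?u \<tau> * exp (- (C / \<gamma>) * exp (- \<gamma> * \<tau>))) \<le> 0"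
        using u0[OF \<tau>] by simp
    qed
    then have "y * exp (- C / \<gamma>) \<le> ?u t * exp (- (C / \<gamma>) * exp (- \<gamma> * t))" by simp
    also have "\<dots> \<le> ?u t * 1" using u0[OF t] C d by (intro mult_left_mono) auto
    finally show ?thesis by simp
  qed
  have "((\<lambda>t. 1 * exp (- \<gamma> * (t - 0))) \<longlongrightarrow> 0) at_top" by (rule exp_decay_at_top) (use d in simp)
  then have "\<forall>\<^sub>F t in at_top. 1 * exp (- \<gamma> * (t - 0)) < y * exp (- C / \<gamma>)" by (rule order_tendstoD) (use y in simp)
  then have "\<forall>\<^sub>F t in at_top. 1 * exp (- \<gamma> * (t - 0)) < y * exp (- C / \<gamma>) \<and> 0 \<le> t" using eventually_ge_at_top[of 0] by eventually_elim simp
  then obtain t where "exp (- \<gamma> * t) < y * exp (- C / \<gamma>)" "0 \<le> t" by (auto simp: eventually_at_top_linorder)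
  then show False using u1[of t] lower[of t] by simp
qed

text \<open>If \<open>M0\<close> were repulsive, all small positive values would have bounded solutions on the whole line.\<close>

lemma M0_not_repulsive_0:
  assumes "0 \<notin> persistent" shows "\<not> hyp_repulsive \<sigma> (cubic a 0) M0"
proof
  assume "hyp_repulsive \<sigma> (cubic a 0) M0"
  then obtain \<delta> k \<gamma> where d: "0 < \<delta>" "1 \<le> k" "0 < \<gamma>" and
    H: "\<And>\<omega> x y t. (\<omega>, x) \<in> M0 \<Longrightarrow> \<bar>y - x\<bar> < \<delta> \<Longrightarrow> t \<le> 0 \<Longrightarrow> t \<in> dom 0 \<omega> y \<and> \<bar>S 0 t \<omega> y - S 0 t \<omega> x\<bar> \<le> k * exp (- \<gamma> * \<bar>t\<bar>) * \<bar>y - x\<bar>"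
    unfolding hyp_repulsive_def by blast
  have dd: "t \<in> dom 0 \<omega> y \<and> \<bar>S 0 t \<omega> y\<bar> \<le> k * exp (- \<gamma> * \<bar>t\<bar>) * \<bar>y\<bar>" if "\<bar>y\<bar> < \<delta>" "t \<le> 0" for \<omega> y t
    using H[of \<omega> 0 y t] that by (simp add: graph_of_def)
  have "\<delta> / 2 \<le> \<beta> 0 \<omega>" for \<omega>
  proof -
    let ?y = "\<delta> / 2"
    have *: "t \<in> dom 0 \<omega> ?y" "\<bar>S 0 t \<omega> ?y\<bar> \<le> k * exp (- \<gamma> * \<bar>t\<bar>) * ?y" if "t \<le> 0" for t
      using dd[of ?y t] that d by auto
    have "dom 0 \<omega> ?y = UNIV" using *(1) fwd_dom by (metis UNIV_eq_I linorder_linear)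
    then have u: "sol_on 0 \<omega> UNIV (\<lambda>t. S 0 t \<omega> ?y)" using sol_on_sol[of 0 \<omega> ?y] by simp
    have "\<bar>S 0 t \<omega> ?y\<bar> \<le> max (k * \<delta>) (absorbing_level 0)" for t
    proof (cases "0 \<le> t")
      case True
      have "?y \<le> k * \<delta>" using d mult_right_mono[of 1 k \<delta>] by simp
      then have "?y \<le> max (k * \<delta>) (absorbing_level 0)" by (rule max.coboundedI1)
      then show ?thesis by (rule S_abs_le[OF True, rotated]) (use d in auto)
    next
      case False
      have "k * exp (- \<gamma> * \<bar>t\<bar>) * ?y \<le> k * 1 * ?y" using d by (intro mult_right_mono mult_left_mono) auto
      also have "\<dots> \<le> k * \<delta>" using d by simp
      finally show ?thesis using *(2)[of t] False by simp
    qed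
    from entire_le_beta[OF u this, of 0] show ?thesis by simp
  qed
  then show False using assms d(1) unfolding persistent_def by (auto dest: spec[of _ "\<delta> / 2"])
qed

end

section \<open>Exponential dichotomy and persistence at \<open>0\<close>\<close>

context base_flow
begin

definition orbit_integral :: "'w \<Rightarrow> real \<Rightarrow> real" where "orbit_integral \<omega> t = (LBINT s=0..t. a (\<sigma> s \<omega>))"

lemma a_orbit_continuous: "continuous_on A (\<lambda>s. a (\<sigma> s \<omega>))"
  by (intro continuous_intros)

lemma orbit_integral_eq:
  assumes "\<And>t. (F has_real_derivative a (\<sigma> t \<omega>)) (at t)" shows "orbit_integral \<omega> t = F t - F 0"
proof -
  have "(LBINT s=ereal 0..ereal t. a (\<sigma> s \<omega>)) = F t - F 0"
    by (rule interval_integral_FTC_finite)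
      (auto intro!: a_orbit_continuous has_field_derivative_at_within assms simp: has_real_derivative_iff_has_vector_derivative[symmetric])
  then show ?thesis by (simp add: orbit_integral_def zero_ereal_def)
qed

lemma orbit_integral_deriv: "((\<lambda>t. orbit_integral \<omega> t) has_real_derivative a (\<sigma> t \<omega>)) (at t)"
proof -
  obtain F where F: "\<And>t. (F has_real_derivative a (\<sigma> t \<omega>)) (at t)"
  proof -
    have "\<exists>F. \<forall>x::real. -\<infinity> < ereal x \<longrightarrow> ereal x < \<infinity> \<longrightarrow> (F has_vector_derivative a (\<sigma> x \<omega>)) (at x)"
      using a_orbit_continuous[of UNIV \<omega>]
      by (intro einterval_antiderivative) (auto simp: continuous_on_eq_continuous_at)
    then show ?thesis using that by (auto simp: has_real_derivative_iff_has_vector_derivative)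
  qed
  have "orbit_integral \<omega> = (\<lambda>t. F t - F 0)" using orbit_integral_eq[OF F] by blast
  then show ?thesis using F[of t] by (auto intro!: derivative_eq_intros)
qed

lemma orbit_integral_0 [simp]: "orbit_integral \<omega> 0 = 0"
  using orbit_integral_eq[OF orbit_integral_deriv, of \<omega> 0] by simp

lemma orbit_integral_cocycle: "orbit_integral (\<sigma> s \<omega>) t = orbit_integral \<omega> (t + s) - orbit_integral \<omega> s"
proof -
  have "((\<lambda>t. orbit_integral \<omega> (t + s)) has_real_derivative a (\<sigma> t (\<sigma> s \<omega>))) (at t)" for t
    using orbit_integral_deriv[of \<omega> "t + s"] by (simp add: DERIV_shift)
  from orbit_integral_eq[OF this] show ?thesis by simp
qed

end

context cubic_family
begin

text \<open>For \<open>l = 0\<close> the derivative of \<open>1 / x\<close> along a solution is \<open>x - a\<close>, so the integral of \<open>a\<close> along an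
  orbit differs from that of \<open>\<beta> 0\<close> by a bounded quantity.\<close>

lemma persistent_0_growth:
  assumes "0 \<in> persistent"
  obtains d where "0 < d" "\<And>\<omega> t. t \<le> 0 \<Longrightarrow> orbit_integral \<omega> t \<le> 1 / d + d * t"
proof -
  obtain d where d: "0 < d" "\<And>\<omega>. d \<le> \<beta> 0 \<omega>" using assms by (auto simp: persistent_def)
  have "orbit_integral \<omega> t \<le> 1 / d + d * t" if t: "t \<le> 0" for \<omega> t
  proof -
    let ?x = "\<lambda>t. \<beta> 0 (\<sigma> t \<omega>)"
    have x: "0 < ?x t" for t using d(1) d(2)[of "\<sigma> t \<omega>"] by linarith
    have x': "(?x has_real_derivative growth 0 (\<sigma> \<tau> \<omega>) (?x \<tau>) * ?x \<tau>) (at \<tau>)" for \<tau>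
      using sol_onD[OF eqm_sol_on[OF eqm_beta[of 0], of \<omega> UNIV], of \<tau>] by (simp add: cubic_growth)
    have "d * 0 - (orbit_integral \<omega> 0 + inverse (?x 0)) \<le> d * t - (orbit_integral \<omega> t + inverse (?x t))"
    proof (rule deriv_nonpos_imp_le[OF t, where u = "\<lambda>t. d * t - (orbit_integral \<omega> t + inverse (?x t))" and u' = "\<lambda>t. d - ?x t"])
      fix \<tau>
      show "((\<lambda>t. d * t - (orbit_integral \<omega> t + inverse (?x t))) has_real_derivative d - ?x \<tau>) (at \<tau>)"
        using x[of \<tau>] by (auto intro!: derivative_eq_intros x' orbit_integral_deriv simp: growth_def field_simps power2_eq_square)
      show "d - ?x \<tau> \<le> 0" using d(2)[of "\<sigma> \<tau> \<omega>"] by simp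
    qed
    moreover have "0 < inverse (?x t)" using x by simp
    moreover have "inverse (?x 0) \<le> 1 / d" using d(1) d(2)[of \<omega>] by (simp add: inverse_eq_divide frac_le)
    ultimately show ?thesis unfolding orbit_integral_0 flow_0 mult_zero_right by linarith
  qed
  then show ?thesis using that d(1) by blast
qed

text \<open>Let \<open>y = 1 / x\<close>, so that \<open>y' = 1 / y - a\<close>. While \<open>y\<close> exceeds \<open>Y = 2 / d\<close>, the term \<open>1 / y\<close> is at most
  \<open>d / 2\<close>, half of the average size of \<open>a\<close>; so after its last time below \<open>Y\<close> the function \<open>y\<close> can
  grow by at most \<open>c\<close>.\<close>

lemma growth_persistent_0:
  assumes "0 < d" and growth: "\<And>\<omega> t. t \<le> 0 \<Longrightarrow> orbit_integral \<omega> t \<le> c + d * t"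
  shows "0 \<in> persistent"
proof -
  have c: "0 \<le> c" using growth[of 0 undefined] by simp
  define Y where "Y = 2 / d"
  have Y: "0 < Y" using assms by (simp add: Y_def)
  have key: "inverse (Y + c) \<le> S 0 t \<eta> (inverse Y)" if t: "0 \<le> t" for t \<eta>
  proof -
    let ?u = "\<lambda>t. S 0 t \<eta> (inverse Y)"
    let ?y = "\<lambda>t. inverse (?u t)"
    have u: "0 < ?u \<tau>" if "0 \<le> \<tau>" for \<tau> using that Y by (simp add: S_pos)
    have y': "((\<lambda>t. ?y t + orbit_integral \<eta> t) has_real_derivative ?u \<tau>) (at \<tau>)" if "0 \<le> \<tau>" for \<tau>
      using u[OF that] by (auto intro!: derivative_eq_intros S_deriv[OF that] orbit_integral_deriv simp: growth_def field_simps power2_eq_square)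
    have cu: "continuous_on {0..t} ?u" by (rule sol_on_continuous[OF fwd_sol_on'])
    have cy: "continuous_on {0..t} ?y" by (intro continuous_intros cu) (use u in force)
    have "?y t \<le> Y + c"
    proof (cases "?y t \<le> Y")
      case True
      then show ?thesis using c by simp
    next
      case False
      then obtain r where r: "0 \<le> r" "r \<le> t" "?y r \<le> Y" "\<And>\<tau>. r < \<tau> \<Longrightarrow> \<tau> \<le> t \<Longrightarrow> Y < ?y \<tau>"
        using last_exit[OF t cy, of Y] by auto
      have ud: "?u \<tau> \<le> d / 2" if "r < \<tau>" "\<tau> \<le> t" for \<tau>
      proof -
        have "inverse (?y \<tau>) \<le> inverse Y" using r(4)[OF that] Y by (intro le_imp_inverse_le) auto
        then show ?thesis by (simp add: Y_def)
      qed
      have "(?y t + orbit_integral \<eta> t) - (?y r + orbit_integral \<eta> r) \<le> d / 2 * (t - r)"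
      proof (cases "r = t")
        case False
        then have rt: "r < t" using r by simp
        have "\<exists>z>r. z < t \<and> (?y t + orbit_integral \<eta> t) - (?y r + orbit_integral \<eta> r) = (t - r) * ?u z"
          by (rule MVT2[OF rt, where f = "\<lambda>t. ?y t + orbit_integral \<eta> t"]) (use y' r in auto)
        then obtain z where "r < z" "z < t" "(?y t + orbit_integral \<eta> t) - (?y r + orbit_integral \<eta> r) = (t - r) * ?u z" by blast
        then show ?thesis using mult_left_mono[OF ud[of z], of "t - r"] rt by (simp add: mult.commute)
      qed simp
      moreover have "orbit_integral (\<sigma> t \<eta>) (r - t) \<le> c + d * (r - t)" using r by (intro growth) simp
      moreover have "orbit_integral (\<sigma> t \<eta>) (r - t) = orbit_integral \<eta> r - orbit_integral \<eta> t" by (simp add: orbit_integral_cocycle)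
      moreover have "0 \<le> d / 2 * (t - r)" using assms r by simp
      ultimately show ?thesis using r(3) by (simp add: algebra_simps)
    qed
    then have "inverse (Y + c) \<le> inverse (?y t)" using u[OF t] by (intro le_imp_inverse_le) auto
    then show ?thesis by simp
  qed
  have "inverse (Y + c) \<le> \<beta> 0 \<omega>" for \<omega>
    by (rule pullback_le[OF filterlim_real_sequentially, where x = "\<lambda>_. inverse Y" and R = "inverse Y"]) (use Y key in auto)
  moreover have "0 < inverse (Y + c)" using Y c by simp
  ultimately show ?thesis unfolding persistent_def by blast
qed

end

section \<open>Reflection\<close>

definition flip :: "'w \<times> real \<Rightarrow> 'w \<times> real" where "flip p = (fst p, - snd p)"

lemma flip_Pair [simp]: "flip (\<omega>, x) = (\<omega>, - x)" by (simp add: flip_def)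

lemma flip_flip [simp]: "flip (flip p) = p" by (simp add: flip_def)

lemma flip_image_flip [simp]: "flip ` flip ` K = K" by (simp add: image_image)

lemma mem_flip_image: "(\<omega>, x) \<in> flip ` K \<longleftrightarrow> (\<omega>, - x) \<in> K"
  by (metis (no_types, lifting) flip_Pair flip_flip image_iff minus_minus)

lemma dist_flip [simp]: "dist (flip p) (flip q) = dist p q"
  by (simp add: flip_def dist_prod_def dist_real_def abs_minus_commute)

lemma flip_continuous: "continuous_on A flip"
  unfolding flip_def by (intro continuous_intros)

lemma flip_compact_iff: "compact (flip ` K) \<longleftrightarrow> compact K"
  using compact_continuous_image[OF flip_continuous, of K] compact_continuous_image[OF flip_continuous, of "flip ` K"] by auto

lemma flip_image_eq_iff: "flip ` K = L \<longleftrightarrow> K = flip ` L"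
  by auto

lemma flip_graph: "flip ` graph_of b = graph_of (\<lambda>\<omega>. - b \<omega>)"
  by (simp add: graph_of_def image_image)

lemma flip_band: "flip ` band p q = band (\<lambda>\<omega>. - q \<omega>) (\<lambda>\<omega>. - p \<omega>)"
proof -
  have "P \<in> flip ` band p q \<longleftrightarrow> P \<in> band (\<lambda>\<omega>. - q \<omega>) (\<lambda>\<omega>. - p \<omega>)" for P
    by (cases P) (auto simp: mem_flip_image mem_band)
  then show ?thesis by blast
qed

lemma closure_flip:
  fixes A :: "('a::metric_space \<times> real) set"
  shows "closure (flip ` A) = flip ` closure A"
proof (rule subset_antisym)
  have *: "flip ` closure A \<subseteq> closure (flip ` A)" for A :: "('a \<times> real) set"
    by (rule image_closure_subset[OF flip_continuous closed_closure closure_subset])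
  show "flip ` closure A \<subseteq> closure (flip ` A)" by (rule *)
  have "flip ` flip ` closure (flip ` A) \<subseteq> flip ` closure (flip ` flip ` A)" using *[of "flip ` A"] by (rule image_mono)
  then show "closure (flip ` A) \<subseteq> flip ` closure A" by simp
qed

lemma hausdorff_semidist_flip: "hausdorff_semidist (flip ` A) (flip ` B) = hausdorff_semidist A B"
  by (simp add: hausdorff_semidist_def image_image)

lemma bounded_flip: "bounded C \<Longrightarrow> bounded (flip ` C)"
proof -
  assume "bounded C"
  then obtain x e where "\<forall>y\<in>C. dist x y \<le> e" by (auto simp: bounded_def)
  then have "\<forall>y\<in>flip ` C. dist (flip x) y \<le> e" by auto
  then show "bounded (flip ` C)" unfolding bounded_def by blast
qed

lemma reflect_cubic: "reflect (cubic a l) = cubic (\<lambda>\<omega>. - a \<omega>) l"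
  by (auto simp: reflect_def cubic_def fun_eq_iff)

text \<open>The coefficient \<open>a'\<close> is a parameter rather than an expression so that the relation is symmetric: every
  fact can also be used from \<open>a'\<close> to \<open>a\<close>.\<close>

locale mirror = base_flow \<sigma> a
  for \<sigma> :: "real \<Rightarrow> 'w::metric_space \<Rightarrow> 'w" and a :: "'w \<Rightarrow> real" +
  fixes a' :: "'w \<Rightarrow> real"
  assumes a': "\<And>\<omega>. a' \<omega> = - a \<omega>"

lemma (in mirror) mirror_sym: "mirror \<sigma> a' a"
proof -
  have eq: "a' = (\<lambda>\<omega>. - a \<omega>)" using a' by blast
  show ?thesis
    by unfold_locales (auto simp: eq compact_base flow minimal intro!: continuous_intros)
qed

context mirror
begin

lemma solves_neg: 
  assumes "solves \<sigma> (cubic a l) \<omega> x I u" shows "solves \<sigma> (cubic a' l) \<omega> (- x) I (\<lambda>t. - u t)"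
proof -
  have "((\<lambda>t. - u t) has_real_derivative cubic a' l (\<sigma> t \<omega>) (- u t)) (at t)" if "t \<in> I" for t
  proof -
    have "(u has_real_derivative cubic a l (\<sigma> t \<omega>) (u t)) (at t)" using assms that by (simp add: solves_def)
    from DERIV_minus[OF this] show ?thesis by (simp add: cubic_def a' algebra_simps)
  qed
  then show ?thesis using assms by (simp add: solves_def)
qed

lemma dom_neg: "sol_dom \<sigma> (cubic a' l) \<omega> (- x) = sol_dom \<sigma> (cubic a l) \<omega> x"
proof -
  interpret r: mirror \<sigma> a' a by (rule mirror_sym)
  have "(\<exists>u. solves \<sigma> (cubic a' l) \<omega> (- x) I u) \<longleftrightarrow> (\<exists>u. solves \<sigma> (cubic a l) \<omega> x I u)" for I
    using solves_neg[of l \<omega> x I] r.solves_neg[of l \<omega> "- x" I] by auto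
  then show ?thesis by (simp add: sol_dom_def)
qed

lemma sol_neg:
  assumes "t \<in> sol_dom \<sigma> (cubic a l) \<omega> x"
  shows "sol \<sigma> (cubic a' l) t \<omega> (- x) = - sol \<sigma> (cubic a l) t \<omega> x"
proof -
  interpret r: mirror \<sigma> a' a by (rule mirror_sym)
  obtain I u where I: "solves \<sigma> (cubic a l) \<omega> x I u" "t \<in> I" using assms by (auto simp: sol_dom_def)
  show ?thesis using sol_eq(2)[OF I] r.sol_eq(2)[OF solves_neg[OF I(1)] I(2)] by simp
qed

lemma skew_neg:
  assumes "t \<in> sol_dom \<sigma> (cubic a l) \<omega> x"
  shows "skew \<sigma> (cubic a' l) t (\<omega>, - x) = flip (skew \<sigma> (cubic a l) t (\<omega>, x))"
  by (simp add: skew_def sol_neg[OF assms])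

lemma invariant_flip_imp:
  assumes "invariant_set \<sigma> (cubic a l) K" shows "invariant_set \<sigma> (cubic a' l) (flip ` K)"
  unfolding invariant_set_def
proof (intro ballI allI, unfold split_paired_all prod.case, intro allI)
  fix \<omega> x t assume "(\<omega>, x) \<in> flip ` K"
  then have p: "(\<omega>, - x) \<in> K" by (simp add: mem_flip_image)
  have d: "t \<in> sol_dom \<sigma> (cubic a l) \<omega> (- x)" and s: "skew \<sigma> (cubic a l) t (\<omega>, - x) \<in> K"
    using assms p by (auto simp: invariant_set_def)
  show "t \<in> sol_dom \<sigma> (cubic a' l) \<omega> x \<and> skew \<sigma> (cubic a' l) t (\<omega>, x) \<in> flip ` K"
    using d s dom_neg[of l \<omega> "- x"] skew_neg[OF d] by simp
qed

lemma attractive_flip_imp: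
  assumes "hyp_attractive \<sigma> (cubic a l) M" shows "hyp_attractive \<sigma> (cubic a' l) (flip ` M)"
proof -
  obtain \<delta> k \<gamma> where d: "0 < \<delta>" "1 \<le> k" "0 < \<gamma>" and
    H: "\<And>\<omega> x y t. (\<omega>, x) \<in> M \<Longrightarrow> \<bar>y - x\<bar> < \<delta> \<Longrightarrow> (0::real) \<le> t \<Longrightarrow> t \<in> sol_dom \<sigma> (cubic a l) \<omega> y \<and>
      \<bar>sol \<sigma> (cubic a l) t \<omega> y - sol \<sigma> (cubic a l) t \<omega> x\<bar> \<le> k * exp (- \<gamma> * \<bar>t\<bar>) * \<bar>y - x\<bar>"
    using assms unfolding hyp_attractive_def by blast
  have "t \<in> sol_dom \<sigma> (cubic a' l) \<omega> y \<and>
      \<bar>sol \<sigma> (cubic a' l) t \<omega> y - sol \<sigma> (cubic a' l) t \<omega> x\<bar> \<le> k * exp (- \<gamma> * \<bar>t\<bar>) * \<bar>y - x\<bar>"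
    if p: "(\<omega>, x) \<in> flip ` M" "\<bar>y - x\<bar> < \<delta>" and t: "(0::real) \<le> t" for \<omega> x y t
  proof -
    have p': "(\<omega>, - x) \<in> M" "\<bar>- y - - x\<bar> < \<delta>" using p by (auto simp: mem_flip_image)
    have x: "t \<in> sol_dom \<sigma> (cubic a l) \<omega> (- x)" using H[OF p'(1) _ t, of "- x"] d by simp
    note y = H[OF p' t]
    have "t \<in> sol_dom \<sigma> (cubic a' l) \<omega> y" using y dom_neg[of l \<omega> "- y"] by simp
    moreover have "\<bar>sol \<sigma> (cubic a' l) t \<omega> y - sol \<sigma> (cubic a' l) t \<omega> x\<bar> \<le> k * exp (- \<gamma> * \<bar>t\<bar>) * \<bar>y - x\<bar>"
      using y sol_neg[OF conjunct1[OF y]] sol_neg[OF x] by (simp add: abs_minus_commute)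
    ultimately show ?thesis ..
  qed
  then show ?thesis unfolding hyp_attractive_def using d by blast
qed

lemma repulsive_flip_imp:
  assumes "hyp_repulsive \<sigma> (cubic a l) M" shows "hyp_repulsive \<sigma> (cubic a' l) (flip ` M)"
proof -
  obtain \<delta> k \<gamma> where d: "0 < \<delta>" "1 \<le> k" "0 < \<gamma>" and
    H: "\<And>\<omega> x y t. (\<omega>, x) \<in> M \<Longrightarrow> \<bar>y - x\<bar> < \<delta> \<Longrightarrow> t \<le> (0::real) \<Longrightarrow> t \<in> sol_dom \<sigma> (cubic a l) \<omega> y \<and>
      \<bar>sol \<sigma> (cubic a l) t \<omega> y - sol \<sigma> (cubic a l) t \<omega> x\<bar> \<le> k * exp (- \<gamma> * \<bar>t\<bar>) * \<bar>y - x\<bar>"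
    using assms unfolding hyp_repulsive_def by blast
  have "t \<in> sol_dom \<sigma> (cubic a' l) \<omega> y \<and>
      \<bar>sol \<sigma> (cubic a' l) t \<omega> y - sol \<sigma> (cubic a' l) t \<omega> x\<bar> \<le> k * exp (- \<gamma> * \<bar>t\<bar>) * \<bar>y - x\<bar>"
    if p: "(\<omega>, x) \<in> flip ` M" "\<bar>y - x\<bar> < \<delta>" and t: "t \<le> (0::real)" for \<omega> x y t
  proof -
    have p': "(\<omega>, - x) \<in> M" "\<bar>- y - - x\<bar> < \<delta>" using p by (auto simp: mem_flip_image)
    have x: "t \<in> sol_dom \<sigma> (cubic a l) \<omega> (- x)" using H[OF p'(1) _ t, of "- x"] d by simp
    note y = H[OF p' t]
    have "t \<in> sol_dom \<sigma> (cubic a' l) \<omega> y" using y dom_neg[of l \<omega> "- y"] by simp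
    moreover have "\<bar>sol \<sigma> (cubic a' l) t \<omega> y - sol \<sigma> (cubic a' l) t \<omega> x\<bar> \<le> k * exp (- \<gamma> * \<bar>t\<bar>) * \<bar>y - x\<bar>"
      using y sol_neg[OF conjunct1[OF y]] sol_neg[OF x] by (simp add: abs_minus_commute)
    ultimately show ?thesis ..
  qed
  then show ?thesis unfolding hyp_repulsive_def using d by blast
qed

lemma equilibrium_neg_imp:
  assumes "equilibrium \<sigma> (cubic a l) b" shows "equilibrium \<sigma> (cubic a' l) (\<lambda>\<omega>. - b \<omega>)"
  using assms dom_neg[of l _ "b _"] sol_neg[of _ l _ "b _"] by (simp add: equilibrium_def)

lemma minimal_flip_imp:
  assumes M: "minimal_set \<sigma> (cubic a l) M" shows "minimal_set \<sigma> (cubic a' l) (flip ` M)"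
proof -
  interpret r: mirror \<sigma> a' a by (rule mirror_sym)
  show ?thesis
    unfolding minimal_set_def
  proof (intro conjI allI impI notI)
    show "compact (flip ` M)" "invariant_set \<sigma> (cubic a' l) (flip ` M)"
      using M by (auto simp: minimal_set_def flip_compact_iff invariant_flip_imp)
    show False if "flip ` M = {}" using that M by (simp add: minimal_set_def)
    fix K assume K: "K \<noteq> {} \<and> compact K \<and> invariant_set \<sigma> (cubic a' l) K" "K \<subset> flip ` M"
    have "flip ` K \<noteq> {} \<and> compact (flip ` K) \<and> invariant_set \<sigma> (cubic a l) (flip ` K)"
      using K(1) r.invariant_flip_imp by (auto simp: flip_compact_iff)
    moreover have "flip ` K \<subseteq> flip ` flip ` M" using K(2) by (intro image_mono) auto
    moreover have "flip ` K \<noteq> M" using K(2) flip_image_eq_iff[of K M] by blast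
    moreover have "\<not> L \<subset> M" if "L \<noteq> {} \<and> compact L \<and> invariant_set \<sigma> (cubic a l) L" for L
      using M that unfolding minimal_set_def by (elim conjE allE[of _ L]) simp
    ultimately show False by (metis flip_image_flip psubsetI)
  qed
qed

text \<open>The reflection is an isometry that conjugates the two flows.\<close>

lemma attractor_neg:
  assumes att: "is_global_attractor \<sigma> (cubic a l) A" shows "is_global_attractor \<sigma> (cubic a' l) (flip ` A)"
  unfolding is_global_attractor_def
proof (intro conjI allI impI)
  show "compact (flip ` A)" "invariant_set \<sigma> (cubic a' l) (flip ` A)"
    using att by (auto simp: is_global_attractor_def flip_compact_iff invariant_flip_imp)
  fix C :: "('w \<times> real) set" assume C: "bounded C"
  let ?D = "flip ` C"
  have dom: "\<forall>(\<omega>, x)\<in>?D. \<forall>t\<ge>0. t \<in> sol_dom \<sigma> (cubic a l) \<omega> x"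
    and lim: "((\<lambda>t. hausdorff_semidist (skew \<sigma> (cubic a l) t ` ?D) A) \<longlongrightarrow> 0) at_top"
    using att bounded_flip[OF C] by (auto simp: is_global_attractor_def)
  have dom': "t \<in> sol_dom \<sigma> (cubic a l) \<omega> (- x)" if "(\<omega>, x) \<in> C" "0 \<le> t" for \<omega> x t
  proof -
    have "(\<omega>, - x) \<in> ?D" using that by (simp add: mem_flip_image)
    then show ?thesis using dom that(2) by blast
  qed
  have "t \<in> sol_dom \<sigma> (cubic a' l) \<omega> x" if "(\<omega>, x) \<in> C" "0 \<le> t" for \<omega> x t
    using dom'[OF that] dom_neg[of l \<omega> "- x"] by simp
  then show "\<forall>(\<omega>, x)\<in>C. \<forall>t\<ge>0. t \<in> sol_dom \<sigma> (cubic a' l) \<omega> x" by blast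
  have "\<forall>\<^sub>F t in at_top. hausdorff_semidist (skew \<sigma> (cubic a l) t ` ?D) A = hausdorff_semidist (skew \<sigma> (cubic a' l) t ` C) (flip ` A)"
    using eventually_ge_at_top[of 0]
  proof eventually_elim
    case (elim t)
    have "skew \<sigma> (cubic a' l) t p = flip (skew \<sigma> (cubic a l) t (flip p))" if "p \<in> C" for p
    proof -
      obtain \<omega> x where p: "p = (\<omega>, x)" by (cases p)
      show ?thesis using skew_neg[OF dom'[of \<omega> x t]] that elim by (simp add: p)
    qed
    then have "skew \<sigma> (cubic a' l) t ` C = flip ` skew \<sigma> (cubic a l) t ` ?D"
      unfolding image_image by (rule image_cong[OF refl])
    then show ?case by (simp add: hausdorff_semidist_flip)
  qed
  then show "((\<lambda>t. hausdorff_semidist (skew \<sigma> (cubic a' l) t ` C) (flip ` A)) \<longlongrightarrow> 0) at_top"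
    by (rule Lim_transform_eventually[OF lim])
qed

end

section \<open>The bifurcation diagrams\<close>

lemma mem_graph_of: "(\<omega>, x) \<in> graph_of b \<longleftrightarrow> x = b \<omega>"
  by (auto simp: graph_of_def)

lemma set_below_graph: "set_below (graph_of b1) (graph_of b2) \<longleftrightarrow> (\<forall>\<omega>. b1 \<omega> < b2 \<omega>)"
  by (simp add: set_below_def mem_graph_of)

lemma graph_neq:
  assumes "\<And>\<omega>. b1 \<omega> < b2 \<omega>" shows "graph_of b1 \<noteq> graph_of b2"
proof
  assume eq: "graph_of b1 = graph_of b2"
  have "(undefined, b1 undefined) \<in> graph_of b2" unfolding eq[symmetric] by (simp add: mem_graph_of)
  then show False using assms[of undefined] by (simp add: mem_graph_of)
qed

text \<open>The facts on the upper half hold for \<open>a\<close> and for \<open>a'\<close>; those for \<open>a'\<close>, with prefix \<open>neg\<close>, describe the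
  lower half for \<open>a\<close>.\<close>

locale cubic_pair = cubic_family \<sigma> a \<alpha> \<beta> + neg: cubic_family \<sigma> a' \<alpha>' \<beta>'
  for \<sigma> :: "real \<Rightarrow> 'w::metric_space \<Rightarrow> 'w" and a :: "'w \<Rightarrow> real" and \<alpha> \<beta> :: "real \<Rightarrow> 'w \<Rightarrow> real"
    and a' :: "'w \<Rightarrow> real" and \<alpha>' \<beta>' :: "real \<Rightarrow> 'w \<Rightarrow> real" +
  assumes a'_eq: "\<And>\<omega>. a' \<omega> = - a \<omega>" and alpha'_eq: "\<And>l \<omega>. \<alpha>' l \<omega> = - \<beta> l \<omega>" and beta'_eq: "\<And>l \<omega>. \<beta>' l \<omega> = - \<alpha> l \<omega>"
begin

lemma mirror1: "mirror \<sigma> a a'"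
  by unfold_locales (rule a'_eq)

lemma mirror2: "mirror \<sigma> a' a"
  by (rule mirror.mirror_sym[OF mirror1])

lemmas to_neg = mirror.minimal_flip_imp[OF mirror1]
lemmas minimal_of_neg = mirror.minimal_flip_imp[OF mirror2]
lemmas attractive_of_neg = mirror.attractive_flip_imp[OF mirror2]
lemmas repulsive_of_neg = mirror.repulsive_flip_imp[OF mirror2]
lemmas equilibrium_of_neg = mirror.equilibrium_neg_imp[OF mirror2]
lemmas sol_of_neg = mirror.sol_neg[OF mirror2]
lemmas dom_of_neg = mirror.dom_neg[OF mirror2]
lemmas skew_of_neg = mirror.skew_neg[OF mirror2]

lemma attractive_to_neg: "hyp_attractive \<sigma> (cubic a l) (flip ` M) \<Longrightarrow> hyp_attractive \<sigma> (cubic a' l) M"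
  using mirror.attractive_flip_imp[OF mirror1, of l "flip ` M"] by simp

lemma repulsive_to_neg: "hyp_repulsive \<sigma> (cubic a l) (flip ` M) \<Longrightarrow> hyp_repulsive \<sigma> (cubic a' l) M"
  using mirror.repulsive_flip_imp[OF mirror1, of l "flip ` M"] by simp

lemma alpha_eq: "\<alpha> l = (\<lambda>\<omega>. - \<beta>' l \<omega>)" by (simp add: beta'_eq)

lemma graph_alpha: "graph_of (\<alpha> l) = flip ` graph_of (\<beta>' l)"
  by (simp add: flip_graph alpha_eq)

lemma minimal_classification:
  "{M. minimal_set \<sigma> (cubic a l) M} = {M. minimal_set \<sigma> (cubic a l) M \<and> pos_set M} \<union> {M0}
     \<union> (`) flip ` {M. minimal_set \<sigma> (cubic a' l) M \<and> pos_set M}"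
proof (intro subset_antisym subsetI)
  fix M assume "M \<in> {M. minimal_set \<sigma> (cubic a l) M}"
  then have M: "minimal_set \<sigma> (cubic a l) M" by simp
  show "M \<in> {M. minimal_set \<sigma> (cubic a l) M \<and> pos_set M} \<union> {M0} \<union> (`) flip ` {M. minimal_set \<sigma> (cubic a' l) M \<and> pos_set M}"
  proof (cases "M = M0 \<or> pos_set M")
    case True
    then show ?thesis using M by blast
  next
    case False
    then obtain d where d: "0 < d" "\<forall>p\<in>M. d \<le> - snd p" using minimal_trichotomy[OF M] by blast
    then have "pos_set (flip ` M)" unfolding pos_set_def by (intro exI[of _ d]) (auto simp: flip_def)
    moreover have "M = flip ` flip ` M" by simp
    ultimately show ?thesis using to_neg[OF M] by blast
  qed
next
  fix M assume "M \<in> {M. minimal_set \<sigma> (cubic a l) M \<and> pos_set M} \<union> {M0} \<union> (`) flip ` {M. minimal_set \<sigma> (cubic a' l) M \<and> pos_set M}"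
  then show "M \<in> {M. minimal_set \<sigma> (cubic a l) M}" using M0_minimal minimal_of_neg by blast
qed

lemma no_pos_minimal: "l \<notin> persistent \<Longrightarrow> {M. minimal_set \<sigma> (cubic a l) M \<and> pos_set M} = {}"
  using pos_minimal_persistent by blast

lemma no_neg_minimal: "l \<notin> neg.persistent \<Longrightarrow> {M. minimal_set \<sigma> (cubic a' l) M \<and> pos_set M} = {}"
  using neg.pos_minimal_persistent by blast

lemma M0_attractive: assumes "l < 0" shows "hyp_attractive \<sigma> (cubic a l) M0"
proof -
  have pos: "0 < min (decay_radius l) (neg.decay_radius l)" using decay_radius_pos[OF assms] neg.decay_radius_pos[OF assms] by simp
  have main: "t \<in> dom l \<omega> y \<and> \<bar>S l t \<omega> y - S l t \<omega> x\<bar> \<le> 1 * exp (- (- l / 2) * \<bar>t\<bar>) * \<bar>y - x\<bar>"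
    if "(\<omega>, x) \<in> M0 \<and> \<bar>y - x\<bar> < min (decay_radius l) (neg.decay_radius l)" and t: "0 \<le> t" for \<omega> x y t
  proof
    have x: "x = 0" and y: "\<bar>y\<bar> < decay_radius l" "\<bar>y\<bar> < neg.decay_radius l" using that by (auto simp: mem_graph_of)
    show "t \<in> dom l \<omega> y" by (rule fwd_dom[OF t])
    have "\<bar>S l t \<omega> y\<bar> \<le> \<bar>y\<bar> * exp (l / 2 * t)"
    proof (cases "0 \<le> y")
      case True
      then show ?thesis using S_decay[OF assms t True, of \<omega>] y S_nonneg[OF t, of l \<omega> y] by simp
    next
      case False
      then show ?thesis
        using neg.S_decay[OF assms t, of "- y" \<omega>] y neg.S_nonneg[OF t, of l \<omega> "- y"] sol_of_neg[OF neg.fwd_dom[OF t], of l \<omega> "- y"] by simp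
    qed
    then show "\<bar>S l t \<omega> y - S l t \<omega> x\<bar> \<le> 1 * exp (- (- l / 2) * \<bar>t\<bar>) * \<bar>y - x\<bar>" using x t by (simp add: mult.commute)
  qed
  have "0 < - l / 2" using assms by simp
  then show ?thesis unfolding hyp_attractive_def using pos main order_refl[of "1 :: real"] by blast
qed

lemma M0_repulsive: assumes "0 < l" shows "hyp_repulsive \<sigma> (cubic a l) M0"
proof -
  obtain e where e: "0 < e" "\<And>\<omega> y t. 0 \<le> y \<Longrightarrow> y < e \<Longrightarrow> t \<le> 0 \<Longrightarrow> t \<in> dom l \<omega> y \<and> \<bar>S l t \<omega> y\<bar> \<le> exp (l / 2 * t) * y"
    using zero_repels[OF assms] by blast
  obtain e' where e': "0 < e'" "\<And>\<omega> y t. 0 \<le> y \<Longrightarrow> y < e' \<Longrightarrow> t \<le> 0 \<Longrightarrow> t \<in> neg.dom l \<omega> y \<and> \<bar>neg.S l t \<omega> y\<bar> \<le> exp (l / 2 * t) * y"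
    using neg.zero_repels[OF assms] by blast
  have main: "t \<in> dom l \<omega> y \<and> \<bar>S l t \<omega> y\<bar> \<le> exp (l / 2 * t) * \<bar>y\<bar>" if y: "\<bar>y\<bar> < min e e'" and t: "t \<le> 0" for \<omega> y t
  proof (cases "0 \<le> y")
    case True
    then show ?thesis using e(2)[OF True _ t, of \<omega>] y by simp
  next
    case False
    then have *: "t \<in> neg.dom l \<omega> (- y) \<and> \<bar>neg.S l t \<omega> (- y)\<bar> \<le> exp (l / 2 * t) * (- y)"
      using e'(2)[of "- y" t \<omega>] y t by simp
    then show ?thesis using sol_of_neg[OF conjunct1[OF *]] dom_of_neg[of l \<omega> "- y"] False by simp
  qed
  have main': "t \<in> dom l \<omega> y \<and> \<bar>S l t \<omega> y - S l t \<omega> x\<bar> \<le> 1 * exp (- (l / 2) * \<bar>t\<bar>) * \<bar>y - x\<bar>"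
    if "(\<omega>, x) \<in> M0 \<and> \<bar>y - x\<bar> < min e e'" and t: "t \<le> 0" for \<omega> x y t
  proof -
    have x: "x = 0" and y: "\<bar>y\<bar> < min e e'" using that by (auto simp: mem_graph_of)
    show ?thesis using main[OF y t, of \<omega>] x t by simp
  qed
  have "0 < l / 2" "0 < min e e'" using assms e(1) e'(1) by auto
  then show ?thesis unfolding hyp_repulsive_def using main' order_refl[of "1 :: real"] by blast
qed

lemma lower_nonneg:
  assumes l: "0 \<le> l" "l \<in> neg.persistent"
  shows "continuous_on UNIV (\<alpha> l)" "hyp_attractive \<sigma> (cubic a l) (graph_of (\<alpha> l))"
    and "(`) flip ` {M. minimal_set \<sigma> (cubic a' l) M \<and> pos_set M} = {graph_of (\<alpha> l)}"
proof -
  note u = neg.upper_nonneg[OF l]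
  show "continuous_on UNIV (\<alpha> l)" unfolding alpha_eq by (intro continuous_intros u(1))
  show "hyp_attractive \<sigma> (cubic a l) (graph_of (\<alpha> l))"
    unfolding graph_alpha by (rule attractive_of_neg[OF neg.att_near_hyp[OF neg.eqm_beta u(2)]])
  show "(`) flip ` {M. minimal_set \<sigma> (cubic a' l) M \<and> pos_set M} = {graph_of (\<alpha> l)}"
    unfolding graph_alpha u(3) by simp
qed

lemma alpha_below: "l \<in> neg.persistent \<Longrightarrow> \<exists>d>0. \<forall>\<omega>. \<alpha> l \<omega> \<le> - d"
  by (auto simp: neg.persistent_def beta'_eq minus_le_iff le_minus_iff)

lemma alpha_neg: "l \<in> neg.persistent \<Longrightarrow> \<alpha> l \<omega> < 0"
  using alpha_below[of l] by (meson neg_less_0_iff_less order_le_less_trans)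

lemma beta_pos: "l \<in> persistent \<Longrightarrow> 0 < \<beta> l \<omega>"
  unfolding persistent_def using less_le_trans by blast

text \<open>The situation at the parameters with three minimal sets: the middle one is repulsive, the other two are
  attractive.\<close>

definition three :: "real \<Rightarrow> ('w \<times> real) set \<Rightarrow> ('w \<times> real) set \<Rightarrow> ('w \<times> real) set \<Rightarrow> bool" where
  "three l A B C \<longleftrightarrow> {M. minimal_set \<sigma> (cubic a l) M} = {A, B, C} \<and> A \<noteq> B \<and> B \<noteq> C \<and> A \<noteq> C \<and>
     hyp_attractive \<sigma> (cubic a l) A \<and> hyp_repulsive \<sigma> (cubic a l) B \<and> hyp_attractive \<sigma> (cubic a l) C"

lemma minimal_exclusive:
  "minimal_set \<sigma> (cubic a l) M \<Longrightarrow> \<not> (hyp_attractive \<sigma> (cubic a l) M \<and> hyp_repulsive \<sigma> (cubic a l) M)"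
  using not_attractive_and_repulsive[of M l] by (auto simp: minimal_set_def)

text \<open>The bijection matches the sets by their position; as no minimal set is both attractive and repulsive,
  it preserves both types.\<close>

lemma three_same:
  assumes "three l A B C" "three l' A' B' C'"
  shows "same_minimal_structure \<sigma> (cubic a l) (cubic a l')"
proof -
  define \<phi> where "\<phi> M = (if M = A then A' else if M = B then B' else C')" for M
  have m: "{M. minimal_set \<sigma> (cubic a l) M} = {A, B, C}" "{M. minimal_set \<sigma> (cubic a l') M} = {A', B', C'}"
    and ne: "A \<noteq> B" "B \<noteq> C" "A \<noteq> C" "A' \<noteq> B'" "B' \<noteq> C'" "A' \<noteq> C'"
    and t: "hyp_attractive \<sigma> (cubic a l) A" "hyp_repulsive \<sigma> (cubic a l) B" "hyp_attractive \<sigma> (cubic a l) C"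
    "hyp_attractive \<sigma> (cubic a l') A'" "hyp_repulsive \<sigma> (cubic a l') B'" "hyp_attractive \<sigma> (cubic a l') C'"
    using assms by (auto simp: three_def)
  have mm: "minimal_set \<sigma> (cubic a l) A" "minimal_set \<sigma> (cubic a l) B" "minimal_set \<sigma> (cubic a l) C"
    "minimal_set \<sigma> (cubic a l') A'" "minimal_set \<sigma> (cubic a l') B'" "minimal_set \<sigma> (cubic a l') C'"
    using m by auto
  have f: "\<phi> A = A'" "\<phi> B = B'" "\<phi> C = C'" using ne by (auto simp: \<phi>_def)
  have "bij_betw \<phi> {A, B, C} {A', B', C'}" using ne f by (auto simp: bij_betw_def inj_on_def)
  moreover have "(hyp_attractive \<sigma> (cubic a l) M \<longleftrightarrow> hyp_attractive \<sigma> (cubic a l') (\<phi> M)) \<and>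
      (hyp_repulsive \<sigma> (cubic a l) M \<longleftrightarrow> hyp_repulsive \<sigma> (cubic a l') (\<phi> M))" if "minimal_set \<sigma> (cubic a l) M" for M
  proof -
    have "M = A \<or> M = B \<or> M = C" using that m(1) by blast
    then show ?thesis using f t mm minimal_exclusive by auto
  qed
  ultimately show ?thesis unfolding same_minimal_structure_def m by blast
qed

lemma three_pos: assumes "0 < l" shows "three l (graph_of (\<alpha> l)) M0 (graph_of (\<beta> l))"
proof -
  have p: "l \<in> persistent" "l \<in> neg.persistent" using persistent_pos[OF assms] neg.persistent_pos[OF assms] by auto
  have l: "0 \<le> l" using assms by simp
  have "{M. minimal_set \<sigma> (cubic a l) M} = {graph_of (\<alpha> l), M0, graph_of (\<beta> l)}"
    unfolding minimal_classification upper_nonneg(3)[OF l p(1)] lower_nonneg(3)[OF l p(2)] by auto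
  moreover have "graph_of (\<alpha> l) \<noteq> M0" by (intro graph_neq alpha_neg p)
  moreover have "M0 \<noteq> graph_of (\<beta> l)" by (intro graph_neq beta_pos p)
  moreover have "graph_of (\<alpha> l) \<noteq> graph_of (\<beta> l)"
    by (rule graph_neq, rule less_trans[OF alpha_neg[OF p(2)] beta_pos[OF p(1)]])
  moreover have "hyp_attractive \<sigma> (cubic a l) (graph_of (\<beta> l))"
    by (rule att_near_hyp[OF eqm_beta upper_nonneg(2)[OF l p(1)]])
  ultimately show ?thesis using lower_nonneg(2)[OF l p(2)] M0_repulsive[OF assms] by (simp add: three_def)
qed

lemma three_below: "three l A B C \<Longrightarrow> hyperbolic \<sigma> (cubic a l) A \<and> hyperbolic \<sigma> (cubic a l) B \<and> hyperbolic \<sigma> (cubic a l) C"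
  by (simp add: three_def hyperbolic_def)

lemma collision_of_neg:
  assumes "collision \<sigma> (cubic a') l F b1 b2 g1 g2 R"
  shows "collision \<sigma> (cubic a) l F (\<lambda>p \<omega>. - b1 p \<omega>) (\<lambda>p \<omega>. - b2 p \<omega>) (\<lambda>\<omega>. - g1 \<omega>) (\<lambda>\<omega>. - g2 \<omega>) R"
  using assms unfolding collision_def
  by (auto intro!: tendsto_minus semicontinuous_uminus equilibrium_of_neg continuous_minus)

lemma collision_minimal_of_neg:
  assumes c: "collision_minimal_set \<sigma> (cubic a' l) g R M" and g: "equilibrium \<sigma> (cubic a' l) g"
  shows "collision_minimal_set \<sigma> (cubic a l) (\<lambda>\<omega>. - g \<omega>) R (flip ` M)"
proof -
  have "skew \<sigma> (cubic a l) t (\<omega>, - g \<omega>) = flip (skew \<sigma> (cubic a' l) t (\<omega>, g \<omega>))" for t \<omega>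
    using g by (intro skew_of_neg) (simp add: equilibrium_def)
  then have "range (\<lambda>t. skew \<sigma> (cubic a l) t (\<omega>, - g \<omega>)) = flip ` range (\<lambda>t. skew \<sigma> (cubic a' l) t (\<omega>, g \<omega>))" for \<omega>
    by (simp add: image_image)
  then show ?thesis using c unfolding collision_minimal_set_def by (simp add: closure_flip minimal_of_neg)
qed

lemma band_zero: assumes "l < 0" "l \<notin> persistent" "l \<notin> neg.persistent" shows "band (\<alpha> l) (\<beta> l) = M0"
proof -
  have "\<alpha> l \<omega> = 0" "\<beta> l \<omega> = 0" for \<omega>
    using neg.beta_zero[OF assms(1,3), of \<omega>] beta_zero[OF assms(1,2), of \<omega>] by (auto simp: beta'_eq)
  then show ?thesis by (auto simp: band_def graph_of_def)
qed

theorem pitchfork: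
  assumes "0 \<notin> persistent" "0 \<notin> neg.persistent"
  shows "global_pitchfork_diagram \<sigma> (cubic a) \<alpha> \<beta>"
  unfolding global_pitchfork_diagram_def
proof (intro conjI allI impI)
  fix l :: real assume l: "0 < l"
  note t = three_pos[OF l]
  show "{M. minimal_set \<sigma> (cubic a l) M} = {graph_of (\<alpha> l), M0, graph_of (\<beta> l)}" using t by (simp add: three_def)
  show "set_below (graph_of (\<alpha> l)) M0" using alpha_neg[OF neg.persistent_pos[OF l]] by (simp add: set_below_graph)
  show "set_below M0 (graph_of (\<beta> l))" using beta_pos[OF persistent_pos[OF l]] by (simp add: set_below_graph)
  show "hyperbolic \<sigma> (cubic a l) (graph_of (\<alpha> l))" "hyperbolic \<sigma> (cubic a l) M0" "hyperbolic \<sigma> (cubic a l) (graph_of (\<beta> l))"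
    using three_below[OF t] by auto
next
  show "collide \<sigma> (cubic a) 0 (at_right 0) \<beta> (\<lambda>_ _. 0)" unfolding collide_def using collision_beta_zero[OF assms(1)] by blast
  from collision_of_neg[OF neg.collision_beta_zero[OF assms(2)]]
  have "collision \<sigma> (cubic a) 0 (at_right 0) \<alpha> (\<lambda>_ _. 0) (\<lambda>\<omega>. - \<beta>' 0 \<omega>) (\<lambda>_. 0) {\<omega>. isCont (\<beta>' 0) \<omega>}"
    by (simp add: beta'_eq)
  then show "collide \<sigma> (cubic a) 0 (at_right 0) \<alpha> (\<lambda>_ _. 0)" unfolding collide_def by blast
next
  fix l :: real assume "l \<le> 0"
  then have "l \<notin> persistent" "l \<notin> neg.persistent" using assms persistent_upward[of l 0] neg.persistent_upward[of l 0] by auto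
  then show "{M. minimal_set \<sigma> (cubic a l) M} = {M0}" 
    unfolding minimal_classification by (simp add: no_pos_minimal no_neg_minimal)
next
  fix l :: real assume l: "l < 0"
  then have "l \<notin> persistent" "l \<notin> neg.persistent" using assms persistent_upward[of l 0] neg.persistent_upward[of l 0] by auto
  then show "band (\<alpha> l) (\<beta> l) = M0" by (rule band_zero[OF l])
qed

end

text \<open>The case in which the saddle-node bifurcation takes place in the lower half: the parameter \<open>0\<close> is persistent
  there, but not in the upper half.\<close>

locale transcritical_pair = cubic_pair \<sigma> a \<alpha> \<beta> a' \<alpha>' \<beta>' + th: at_threshold \<sigma> a' \<alpha>' \<beta>' \<mu>
  for \<sigma> :: "real \<Rightarrow> 'w::metric_space \<Rightarrow> 'w" and a :: "'w \<Rightarrow> real" and \<alpha> \<beta> :: "real \<Rightarrow> 'w \<Rightarrow> real"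
    and a' :: "'w \<Rightarrow> real" and \<alpha>' \<beta>' :: "real \<Rightarrow> 'w \<Rightarrow> real" and \<mu> :: real +
  assumes zero_not_persistent: "0 \<notin> persistent"
begin

lemma not_persistent: "l \<le> 0 \<Longrightarrow> l \<notin> persistent"
  using zero_not_persistent persistent_upward by blast

lemma mu_lt: "\<mu> < 0" by (rule th.mu_neg)

lemma persistent'_iff: "l \<in> neg.persistent \<longleftrightarrow> \<mu> \<le> l" by (rule th.persistent_iff)

text \<open>The repulsive equilibrium and the minimal set at the threshold, reflected into the lower half.\<close>

definition kappa_lower :: "real \<Rightarrow> 'w \<Rightarrow> real" where "kappa_lower l \<omega> = - neg.kappa l \<omega>"

definition Ml :: "('w \<times> real) set" where "Ml = flip ` th.threshold_set"

lemma graph_kappa_lower: "graph_of (kappa_lower l) = flip ` graph_of (neg.kappa l)"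
  by (simp add: flip_graph kappa_lower_def[abs_def])

lemma zero_minimal: "{M. minimal_set \<sigma> (cubic a 0) M} = {graph_of (\<alpha> 0), M0}"
  unfolding minimal_classification no_pos_minimal[OF zero_not_persistent]
  using lower_nonneg(3)[of 0] mu_lt by (auto simp: persistent'_iff)

lemma mu_minimal: "{M. minimal_set \<sigma> (cubic a \<mu>) M} = {Ml, M0}"
  using mu_lt unfolding minimal_classification no_pos_minimal[OF not_persistent[OF less_imp_le[OF mu_lt]]] th.upper_mu
  by (auto simp: Ml_def)

lemma below_minimal:
  assumes "l < \<mu>" shows "{M. minimal_set \<sigma> (cubic a l) M} = {M0}"
proof -
  have n: "l \<notin> persistent" "l \<notin> neg.persistent" using assms mu_lt not_persistent[of l] by (auto simp: persistent'_iff)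
  show ?thesis unfolding minimal_classification no_pos_minimal[OF n(1)] no_neg_minimal[OF n(2)] by simp
qed

lemma middle:
  assumes l: "\<mu> < l" "l < 0"
  shows "continuous_on UNIV (\<alpha> l)" "continuous_on UNIV (kappa_lower l)"
    and "three l (graph_of (\<alpha> l)) (graph_of (kappa_lower l)) M0"
    and "\<alpha> l \<omega> < kappa_lower l \<omega>" "kappa_lower l \<omega> < 0"
proof -
  have mp: "\<mu> \<in> neg.persistent" "l \<in> neg.persistent" using l by (auto simp: persistent'_iff)
  note u = neg.upper_neg[OF mp(1) l]
  show "continuous_on UNIV (\<alpha> l)" using u(1) by (simp add: alpha_eq continuous_on_minus)
  show "continuous_on UNIV (kappa_lower l)" using u(3) by (simp add: kappa_lower_def[abs_def] continuous_on_minus)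
  show lt: "\<alpha> l \<omega> < kappa_lower l \<omega>" for \<omega>
  proof -
    obtain e where "0 < e" "\<And>\<omega>. neg.kappa l \<omega> + e \<le> \<beta>' l \<omega>" using u(5) by blast
    then show ?thesis by (metis add_less_cancel_left add.right_neutral alpha_eq kappa_lower_def less_le_trans neg_less_iff_less)
  qed
  show lt0: "kappa_lower l \<omega> < 0" for \<omega>
    using neg.decay_radius_le_kappa[OF l(2) mp(2), of \<omega>] neg.decay_radius_pos[OF l(2)] by (simp add: kappa_lower_def)
  have "{M. minimal_set \<sigma> (cubic a l) M} = {graph_of (\<alpha> l), graph_of (kappa_lower l), M0}"
    unfolding minimal_classification no_pos_minimal[OF not_persistent[OF less_imp_le[OF l(2)]]] u(6)
    by (auto simp: graph_alpha graph_kappa_lower)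
  moreover have "hyp_attractive \<sigma> (cubic a l) (graph_of (\<alpha> l))"
    unfolding graph_alpha by (intro attractive_of_neg neg.att_near_hyp neg.eqm_beta u(2))
  moreover have "hyp_repulsive \<sigma> (cubic a l) (graph_of (kappa_lower l))"
    unfolding graph_kappa_lower by (intro repulsive_of_neg neg.rep_near_hyp neg.kappa_eqm[OF l(2) mp(2)] u(4))
  moreover have "graph_of (\<alpha> l) \<noteq> graph_of (kappa_lower l)" using lt by (rule graph_neq)
  moreover have "graph_of (kappa_lower l) \<noteq> M0" using lt0 by (rule graph_neq)
  moreover have "graph_of (\<alpha> l) \<noteq> M0" by (intro graph_neq alpha_neg mp)
  ultimately show "three l (graph_of (\<alpha> l)) (graph_of (kappa_lower l)) M0" using M0_attractive[OF l(2)] by (simp add: three_def)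
qed

lemma collision_at_mu: "collision \<sigma> (cubic a) \<mu> (at_right \<mu>) \<alpha> kappa_lower (\<alpha> \<mu>) (\<lambda>\<omega>. - neg.kappa \<mu> \<omega>) th.core"
  using collision_of_neg[OF th.collision_mu] by (simp add: beta'_eq kappa_lower_def[abs_def])

lemma collision_minimal_at_mu: "collision_minimal_set \<sigma> (cubic a \<mu>) (\<alpha> \<mu>) th.core Ml"
  using collision_minimal_of_neg[OF th.collision_minimal_mu neg.eqm_equilibrium[OF neg.eqm_beta]]
  by (simp add: beta'_eq Ml_def)

lemma kappa_lower_collides_zero: "collide \<sigma> (cubic a) 0 (at_left 0) kappa_lower (\<lambda>_ _. 0)"
proof -
  have "0 \<in> neg.persistent" using mu_lt by (simp add: persistent'_iff)
  then obtain g1 g2 R where "collision \<sigma> (cubic a') 0 (at_left 0) neg.kappa (\<lambda>_ _. 0) g1 g2 R"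
    using neg.collide_kappa_zero unfolding collide_def by blast
  from collision_of_neg[OF this] show ?thesis unfolding collide_def kappa_lower_def[abs_def] by auto
qed

lemma Ml_not_hyperbolic: "\<not> hyperbolic \<sigma> (cubic a \<mu>) Ml"
  using th.threshold_set_not_attractive th.threshold_set_not_repulsive attractive_to_neg repulsive_to_neg
  unfolding hyperbolic_def Ml_def by blast

lemma Ml_below: "set_below Ml M0"
proof -
  have "x < 0" if "(\<omega>, x) \<in> Ml" for \<omega> x
  proof -
    have "(\<omega>, - x) \<in> th.threshold_set" using that by (simp add: Ml_def mem_flip_image)
    moreover have "pos_set th.threshold_set" using th.upper_mu by blast
    ultimately show ?thesis by (force simp: pos_set_def)
  qed
  then show ?thesis by (auto simp: set_below_def graph_of_def)
qed

lemma ev_middle_right: "\<forall>\<^sub>F l in at_right \<mu>. \<mu> < l \<and> l < 0"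
  using eventually_at_right_real[OF mu_lt] by simp

lemma ev_middle_left: "\<forall>\<^sub>F l in at_left 0. \<mu> < l \<and> l < 0"
  using eventually_at_left_real[OF mu_lt] by simp

text \<open>The open set can be the whole lower half, because below \<open>\<mu>\<close> the only minimal set is \<open>M0\<close>.\<close>

lemma saddle_node: "local_saddle_node \<sigma> (cubic a) \<mu> Ml"
  unfolding local_saddle_node_def
proof (rule bexI[of _ "(at_right \<mu>, at_left \<mu>)"], unfold prod.case, intro exI conjI)
  show "\<forall>\<^sub>F l in at_right \<mu>. continuous_on UNIV (\<alpha> l) \<and> minimal_set \<sigma> (cubic a l) (graph_of (\<alpha> l)) \<and>
      hyp_attractive \<sigma> (cubic a l) (graph_of (\<alpha> l)) \<and> continuous_on UNIV (kappa_lower l) \<and>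
      minimal_set \<sigma> (cubic a l) (graph_of (kappa_lower l)) \<and> hyp_repulsive \<sigma> (cubic a l) (graph_of (kappa_lower l))"
    using ev_middle_right
  proof eventually_elim
    case (elim l)
    then show ?case using middle(1-3)[of l] unfolding three_def by blast
  qed
  show "collision \<sigma> (cubic a) \<mu> (at_right \<mu>) \<alpha> kappa_lower (\<alpha> \<mu>) (\<lambda>\<omega>. - neg.kappa \<mu> \<omega>) th.core" by (rule collision_at_mu)
  show "collision_minimal_set \<sigma> (cubic a \<mu>) (\<alpha> \<mu>) th.core Ml" by (rule collision_minimal_at_mu)
  show "\<not> hyperbolic \<sigma> (cubic a \<mu>) Ml" by (rule Ml_not_hyperbolic)
  show "open (UNIV \<times> {..<0} :: ('w \<times> real) set)" by (intro open_Times) auto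
  have lt: "\<alpha> \<mu> \<omega> < 0" "- neg.kappa \<mu> \<omega> < 0" for \<omega>
    using alpha_neg[of \<mu> \<omega>] th.kappa_facts(3)[of \<omega>] neg.decay_radius_pos[OF mu_lt] by (auto simp: persistent'_iff)
  have "x < 0" if "(\<omega>, x) \<in> band (\<lambda>\<omega>. min (\<alpha> \<mu> \<omega>) (- neg.kappa \<mu> \<omega>)) (\<lambda>\<omega>. max (\<alpha> \<mu> \<omega>) (- neg.kappa \<mu> \<omega>))" for \<omega> x
    using that lt[of \<omega>] unfolding mem_band by linarith
  then show "band (\<lambda>\<omega>. min (\<alpha> \<mu> \<omega>) (- neg.kappa \<mu> \<omega>)) (\<lambda>\<omega>. max (\<alpha> \<mu> \<omega>) (- neg.kappa \<mu> \<omega>)) \<subseteq> UNIV \<times> {..<0}"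
    by auto
  have "\<forall>\<^sub>F l in at_left \<mu>. l < \<mu>" by (simp add: eventually_at_filter)
  then show "\<forall>\<^sub>F l in at_left \<mu>. \<forall>N. minimal_set \<sigma> (cubic a l) N \<longrightarrow> N \<inter> (UNIV \<times> {..<0}) = {}"
  proof eventually_elim
    case (elim l)
    have "N = M0" if "minimal_set \<sigma> (cubic a l) N" for N using below_minimal[OF elim] that by blast
    then show ?case by (auto simp: graph_of_def)
  qed
qed simp

text \<open>On the left of \<open>0\<close> the partner of \<open>M0\<close> is the graph of \<open>kappa_lower l\<close>, on the right it is the graph of
  \<open>\<beta> l\<close>.\<close>

lemma transcritical: "local_transcritical \<sigma> (cubic a) 0 (\<lambda>_. 0)"
  unfolding local_transcritical_def
proof (intro conjI ballI)
  fix F assume "F \<in> {at_left 0, at_right (0::real)}"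
  then consider "F = at_left 0" | "F = at_right 0" by blast
  then show "\<exists>b. (\<forall>\<^sub>F l in F. minimal_set \<sigma> (cubic a l) M0 \<and> hyperbolic \<sigma> (cubic a l) M0 \<and>
      continuous_on UNIV (b l) \<and> minimal_set \<sigma> (cubic a l) (graph_of (b l)) \<and>
      hyperbolic \<sigma> (cubic a l) (graph_of (b l)) \<and> graph_of (b l) \<noteq> M0) \<and> collide \<sigma> (cubic a) 0 F b (\<lambda>_ _. 0)"
  proof cases
    case 1
    show ?thesis
      unfolding 1
    proof (intro exI[of _ kappa_lower] conjI kappa_lower_collides_zero)
      show "\<forall>\<^sub>F l in at_left 0. minimal_set \<sigma> (cubic a l) M0 \<and> hyperbolic \<sigma> (cubic a l) M0 \<and>
          continuous_on UNIV (kappa_lower l) \<and> minimal_set \<sigma> (cubic a l) (graph_of (kappa_lower l)) \<and>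
          hyperbolic \<sigma> (cubic a l) (graph_of (kappa_lower l)) \<and> graph_of (kappa_lower l) \<noteq> M0"
        using ev_middle_left
      proof eventually_elim
        case (elim l)
        then show ?case using middle(2,3)[of l] unfolding three_def hyperbolic_def by blast
      qed
    qed
  next
    case 2
    show ?thesis
      unfolding 2
    proof (intro exI[of _ \<beta>] conjI)
      show "collide \<sigma> (cubic a) 0 (at_right 0) \<beta> (\<lambda>_ _. 0)"
        unfolding collide_def using collision_beta_zero[OF zero_not_persistent] by blast
      have "\<forall>\<^sub>F l in at_right 0. (0::real) < l" by (rule eventually_at_right_less)
      then show "\<forall>\<^sub>F l in at_right 0. minimal_set \<sigma> (cubic a l) M0 \<and> hyperbolic \<sigma> (cubic a l) M0 \<and>
          continuous_on UNIV (\<beta> l) \<and> minimal_set \<sigma> (cubic a l) (graph_of (\<beta> l)) \<and>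
          hyperbolic \<sigma> (cubic a l) (graph_of (\<beta> l)) \<and> graph_of (\<beta> l) \<noteq> M0"
      proof eventually_elim
        case (elim l)
        then show ?case using three_pos[of l] upper_nonneg(1)[of l] persistent_pos[of l] unfolding three_def hyperbolic_def by auto
      qed
    qed
  qed
next
  show "minimal_set \<sigma> (cubic a 0) M0" by (rule M0_minimal)
  show "\<not> hyperbolic \<sigma> (cubic a 0) M0"
    using M0_not_attractive_0 M0_not_repulsive_0[OF zero_not_persistent] by (simp add: hyperbolic_def)
  have "0 \<in> neg.persistent" using mu_lt by (simp add: persistent'_iff)
  then obtain d where d: "0 < d" "\<And>\<omega>. \<alpha> 0 \<omega> \<le> - d" using alpha_below by blast
  show "\<exists>U. open U \<and> M0 \<subseteq> U \<and> (\<forall>N. minimal_set \<sigma> (cubic a 0) N \<and> N \<inter> U \<noteq> {} \<longrightarrow> N = M0)"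
  proof (intro exI[of _ "UNIV \<times> {- d<..}"] conjI allI impI)
    show "open (UNIV \<times> {- d<..} :: ('w \<times> real) set)" by (intro open_Times) auto
    show "M0 \<subseteq> UNIV \<times> {- d<..}" using d by (auto simp: graph_of_def)
    fix N assume N: "minimal_set \<sigma> (cubic a 0) N \<and> N \<inter> UNIV \<times> {- d<..} \<noteq> {}"
    have "\<not> - d < \<alpha> 0 \<omega>" for \<omega> using d(2)[of \<omega>] by linarith
    then have "graph_of (\<alpha> 0) \<inter> UNIV \<times> {- d<..} = {}" by (auto simp: graph_of_def)
    then show "N = M0" using N zero_minimal by blast
  qed
qed

text \<open>At \<open>\<mu>\<close> the attractor contains the graph of \<open>\<alpha> \<mu>\<close>, which is bounded away from \<open>0\<close>, and below \<open>\<mu>\<close>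
  it is \<open>M0\<close>.\<close>

lemma discontinuous: "discontinuous_at (\<lambda>l. band (\<alpha> l) (\<beta> l)) \<mu>"
  unfolding discontinuous_at_def
proof
  assume lim: "((\<lambda>l. hausdorff_dist (band (\<alpha> l) (\<beta> l)) (band (\<alpha> \<mu>) (\<beta> \<mu>))) \<longlongrightarrow> 0) (at \<mu>)"
  have mp: "\<mu> \<in> neg.persistent" by (simp add: persistent'_iff)
  obtain d where d: "0 < d" "\<And>\<omega>. \<alpha> \<mu> \<omega> \<le> - d" using alpha_below[OF mp] by blast
  have "((\<lambda>l. hausdorff_dist (band (\<alpha> l) (\<beta> l)) (band (\<alpha> \<mu>) (\<beta> \<mu>))) \<longlongrightarrow> 0) (at_left \<mu>)"
    by (rule tendsto_mono[OF _ lim]) (simp add: at_le)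
  then have "\<forall>\<^sub>F l in at_left \<mu>. hausdorff_dist (band (\<alpha> l) (\<beta> l)) (band (\<alpha> \<mu>) (\<beta> \<mu>)) < ennreal d"
    by (rule order_tendstoD) (use d in simp)
  moreover have "\<forall>\<^sub>F l in at_left \<mu>. l < \<mu>" by (simp add: eventually_at_filter)
  ultimately have "\<forall>\<^sub>F l in at_left \<mu>. hausdorff_dist (band (\<alpha> l) (\<beta> l)) (band (\<alpha> \<mu>) (\<beta> \<mu>)) < ennreal d \<and> l < \<mu>"
    by eventually_elim simp
  from eventually_happens'[OF _ this] obtain l where
    l: "hausdorff_dist (band (\<alpha> l) (\<beta> l)) (band (\<alpha> \<mu>) (\<beta> \<mu>)) < ennreal d" "l < \<mu>"
    by (auto simp: trivial_limit_at_left_real)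
  have "band (\<alpha> l) (\<beta> l) = M0" using l(2) mu_lt not_persistent[of l] by (intro band_zero) (auto simp: persistent'_iff)
  then have *: "hausdorff_semidist (band (\<alpha> \<mu>) (\<beta> \<mu>)) M0 < ennreal d" using l(1) by (simp add: hausdorff_dist_def)
  obtain \<omega> :: 'w where True by blast
  have "(\<omega>, \<alpha> \<mu> \<omega>) \<in> band (\<alpha> \<mu>) (\<beta> \<mu>)" using alpha_le_0[of \<mu> \<omega>] beta_ge_0[of \<mu> \<omega>] by (simp add: mem_band)
  from hausdorff_semidist_lessD[OF * this] obtain q where q: "q \<in> M0" "dist (\<omega>, \<alpha> \<mu> \<omega>) q < d" by blast
  have "snd q = 0" using q(1) by (auto simp: graph_of_def)
  then have "\<bar>\<alpha> \<mu> \<omega>\<bar> < d" using q(2) dist_snd_le[of "(\<omega>, \<alpha> \<mu> \<omega>)" q] by (simp add: dist_real_def)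
  then show False using d(2)[of \<omega>] by linarith
qed

lemma same_structure_card:
  assumes "same_minimal_structure \<sigma> f1 f2"
  shows "card {M. minimal_set \<sigma> f1 M} = card {M. minimal_set \<sigma> f2 M}"
  using assms unfolding same_minimal_structure_def by (auto dest: bij_betw_same_card)

lemma card_three: "three l A B C \<Longrightarrow> card {M. minimal_set \<sigma> (cubic a l) M} = 3"
  unfolding three_def by simp

text \<open>At \<open>\<mu>\<close> there are two minimal sets, but one on the left; at \<open>0\<close> there are two, but three on
  the right. Elsewhere the structure is locally constant.\<close>

lemma bifurcation_points: "{l. bifurcation_point \<sigma> (cubic a) l} = {\<mu>, 0}"
proof -
  have bif_mu: "bifurcation_point \<sigma> (cubic a) \<mu>"
    unfolding bifurcation_point_def
  proof
    assume "\<forall>\<^sub>F l in nhds \<mu>. same_minimal_structure \<sigma> (cubic a \<mu>) (cubic a l)"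
    then have "\<forall>\<^sub>F l in at_left \<mu>. same_minimal_structure \<sigma> (cubic a \<mu>) (cubic a l) \<and> l < \<mu>"
      unfolding eventually_at_filter by eventually_elim simp
    from eventually_happens'[OF _ this] obtain l where l: "same_minimal_structure \<sigma> (cubic a \<mu>) (cubic a l)" "l < \<mu>"
      by (auto simp: trivial_limit_at_left_real)
    have "Ml \<noteq> M0"
    proof
      assume eq: "Ml = M0"
      show False using Ml_below unfolding eq set_below_graph by simp
    qed
    then show False using same_structure_card[OF l(1)] below_minimal[OF l(2)] mu_minimal by simp
  qed
  have bif_0: "bifurcation_point \<sigma> (cubic a) 0"
    unfolding bifurcation_point_def
  proof
    assume "\<forall>\<^sub>F l in nhds 0. same_minimal_structure \<sigma> (cubic a 0) (cubic a l)"
    then have "\<forall>\<^sub>F l in at_right 0. same_minimal_structure \<sigma> (cubic a 0) (cubic a l) \<and> 0 < l"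
      unfolding eventually_at_filter by eventually_elim simp
    from eventually_happens'[OF _ this] obtain l where l: "same_minimal_structure \<sigma> (cubic a 0) (cubic a l)" "0 < l"
      by (auto simp: trivial_limit_at_right_real)
    have "card {graph_of (\<alpha> 0), M0} \<le> 2" by (simp add: card_insert_if)
    then show False using same_structure_card[OF l(1)] card_three[OF three_pos[OF l(2)]] zero_minimal by simp
  qed
  have other: "\<not> bifurcation_point \<sigma> (cubic a) l0" if l0: "l0 \<noteq> \<mu>" "l0 \<noteq> 0" for l0
  proof -
    have "\<forall>\<^sub>F l in nhds l0. same_minimal_structure \<sigma> (cubic a l0) (cubic a l)"
    proof -
      consider "0 < l0" | "\<mu> < l0" "l0 < 0" | "l0 < \<mu>" using l0 by linarith
      then show ?thesis
      proof cases
        case 1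
        have "\<forall>\<^sub>F l in nhds l0. l \<in> {0<..}" using 1 by (intro eventually_nhds_in_open) auto
        then show ?thesis by eventually_elim (use three_same[OF three_pos[OF 1] three_pos] in simp)
      next
        case 2
        have "\<forall>\<^sub>F l in nhds l0. l \<in> {\<mu><..<0}" using 2 by (intro eventually_nhds_in_open) auto
        then show ?thesis by eventually_elim (use three_same[OF middle(3)[OF 2] middle(3)] in simp)
      next
        case 3
        have "\<forall>\<^sub>F l in nhds l0. l \<in> {..<\<mu>}" using 3 by (intro eventually_nhds_in_open) auto
        then show ?thesis
        proof eventually_elim
          case (elim l)
          have n: "l0 < 0" "l < 0" "l < \<mu>" using 3 elim mu_lt by auto
          note m = below_minimal[OF 3] below_minimal[OF n(3)]
          have eq: "hyp_attractive \<sigma> (cubic a l0) M0 \<longleftrightarrow> hyp_attractive \<sigma> (cubic a l) M0"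
            "hyp_repulsive \<sigma> (cubic a l0) M0 \<longleftrightarrow> hyp_repulsive \<sigma> (cubic a l) M0"
            using M0_attractive[OF n(1)] M0_attractive[OF n(2)] minimal_exclusive[OF M0_minimal] by blast+
          have types: "(hyp_attractive \<sigma> (cubic a l0) M \<longleftrightarrow> hyp_attractive \<sigma> (cubic a l) M) \<and>
              (hyp_repulsive \<sigma> (cubic a l0) M \<longleftrightarrow> hyp_repulsive \<sigma> (cubic a l) M)" if "minimal_set \<sigma> (cubic a l0) M" for M
          proof -
            have "M = M0" using that m(1) by blast
            then show ?thesis using eq by simp
          qed
          have "bij_betw (\<lambda>M. M) {M. minimal_set \<sigma> (cubic a l0) M} {M. minimal_set \<sigma> (cubic a l) M}"
            unfolding m by (simp add: bij_betw_def)
          then show ?case unfolding same_minimal_structure_def using types by blast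
        qed
      qed
    qed
    then show ?thesis by (simp add: bifurcation_point_def)
  qed
  show ?thesis using bif_mu bif_0 other by blast
qed

theorem diagram: "transcritical_saddle_node_diagram \<sigma> (cubic a) \<alpha> \<beta> \<mu>"
  unfolding transcritical_saddle_node_diagram_def
proof (intro conjI allI impI)
  fix l :: real assume l: "0 < l"
  note t = three_pos[OF l]
  show "{M. minimal_set \<sigma> (cubic a l) M} = {graph_of (\<alpha> l), M0, graph_of (\<beta> l)}" using t by (simp add: three_def)
  show "set_below (graph_of (\<alpha> l)) M0" using alpha_neg[OF neg.persistent_pos[OF l]] by (simp add: set_below_graph)
  show "set_below M0 (graph_of (\<beta> l))" using beta_pos[OF persistent_pos[OF l]] by (simp add: set_below_graph)
next
  show "collide \<sigma> (cubic a) 0 (at_right 0) \<beta> (\<lambda>_ _. 0)"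
    unfolding collide_def using collision_beta_zero[OF zero_not_persistent] by blast
next
  fix l :: real assume l: "\<mu> < l"
  have lp: "l \<in> neg.persistent" using l by (simp add: persistent'_iff)
  have "minimal_set \<sigma> (cubic a l) (graph_of (\<alpha> l)) \<and> hyp_attractive \<sigma> (cubic a l) (graph_of (\<alpha> l))"
  proof (cases "0 \<le> l")
    case True
    have "graph_of (\<alpha> l) \<in> {M. minimal_set \<sigma> (cubic a l) M}"
      unfolding minimal_classification lower_nonneg(3)[OF True lp] by blast
    then show ?thesis using lower_nonneg(2)[OF True lp] by simp
  next
    case False
    then show ?thesis using middle(3)[OF l] unfolding three_def by auto
  qed
  then show "minimal_set \<sigma> (cubic a l) (graph_of (\<alpha> l))" "hyperbolic \<sigma> (cubic a l) (graph_of (\<alpha> l))"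
    by (auto simp: hyperbolic_def)
  show "set_below (graph_of (\<alpha> l)) M0" using alpha_neg[OF lp] by (simp add: set_below_graph)
next
  show "{M. minimal_set \<sigma> (cubic a 0) M} = {graph_of (\<alpha> 0), M0}" by (rule zero_minimal)
next
  show "\<exists>\<kappa> Ml g1 g2 R.
        (\<forall>l\<in>{\<mu><..<0}.
           continuous_on UNIV (\<kappa> l) \<and>
           {M. minimal_set \<sigma> (cubic a l) M} = {graph_of (\<alpha> l), graph_of (\<kappa> l), M0} \<and>
           set_below (graph_of (\<alpha> l)) (graph_of (\<kappa> l)) \<and> set_below (graph_of (\<kappa> l)) M0 \<and>
           hyperbolic \<sigma> (cubic a l) (graph_of (\<alpha> l)) \<and> hyp_repulsive \<sigma> (cubic a l) (graph_of (\<kappa> l)) \<and>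
           hyperbolic \<sigma> (cubic a l) M0) \<and>
        (\<forall>l\<in>{\<mu><..<0}. \<forall>l'\<in>{\<mu><..<0}. l < l' \<longrightarrow> (\<forall>\<omega>. \<kappa> l \<omega> < \<kappa> l' \<omega>)) \<and>
        collide \<sigma> (cubic a) 0 (at_left 0) \<kappa> (\<lambda>_ _. 0) \<and>
        collision \<sigma> (cubic a) \<mu> (at_right \<mu>) \<alpha> \<kappa> g1 g2 R \<and>
        collision_minimal_set \<sigma> (cubic a \<mu>) g1 R Ml \<and>
        {M. minimal_set \<sigma> (cubic a \<mu>) M} = {Ml, M0} \<and> set_below Ml M0 \<and>
        \<not> hyperbolic \<sigma> (cubic a \<mu>) Ml \<and>
        local_saddle_node \<sigma> (cubic a) \<mu> Ml"
  proof (intro exI conjI ballI impI allI)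
    fix l assume "l \<in> {\<mu><..<0}"
    then have l: "\<mu> < l" "l < 0" by auto
    note m = middle[OF l]
    show "continuous_on UNIV (kappa_lower l)" by (rule m(2))
    show "{M. minimal_set \<sigma> (cubic a l) M} = {graph_of (\<alpha> l), graph_of (kappa_lower l), M0}"
      "hyp_repulsive \<sigma> (cubic a l) (graph_of (kappa_lower l))" using m(3) by (auto simp: three_def)
    show "set_below (graph_of (\<alpha> l)) (graph_of (kappa_lower l))" "set_below (graph_of (kappa_lower l)) M0"
      using m(4,5) by (auto simp: set_below_graph)
    show "hyperbolic \<sigma> (cubic a l) (graph_of (\<alpha> l))" "hyperbolic \<sigma> (cubic a l) M0"
      using three_below[OF m(3)] by auto
    fix l' \<omega> assume "l' \<in> {\<mu><..<0}" "l < l'"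
    then obtain e where "0 < e" "\<And>\<omega>. neg.kappa l' \<omega> + e \<le> neg.kappa l \<omega>"
      using neg.kappa_drop[of l l'] l by (auto simp: persistent'_iff)
    then have "neg.kappa l' \<omega> < neg.kappa l \<omega>" by (meson less_add_same_cancel1 less_le_trans)
    then show "kappa_lower l \<omega> < kappa_lower l' \<omega>" by (simp add: kappa_lower_def)
  next
    show "collide \<sigma> (cubic a) 0 (at_left 0) kappa_lower (\<lambda>_ _. 0)" by (rule kappa_lower_collides_zero)
    show "collision \<sigma> (cubic a) \<mu> (at_right \<mu>) \<alpha> kappa_lower (\<alpha> \<mu>) (\<lambda>\<omega>. - neg.kappa \<mu> \<omega>) th.core" by (rule collision_at_mu)
    show "collision_minimal_set \<sigma> (cubic a \<mu>) (\<alpha> \<mu>) th.core Ml" by (rule collision_minimal_at_mu)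
    show "{M. minimal_set \<sigma> (cubic a \<mu>) M} = {Ml, M0}" by (rule mu_minimal)
    show "set_below Ml M0" by (rule Ml_below)
    show "\<not> hyperbolic \<sigma> (cubic a \<mu>) Ml" by (rule Ml_not_hyperbolic)
    show "local_saddle_node \<sigma> (cubic a) \<mu> Ml" by (rule saddle_node)
  qed
next
  fix l assume "l < \<mu>"
  then show "band (\<alpha> l) (\<beta> l) = M0" using mu_lt not_persistent[of l] by (intro band_zero) (auto simp: persistent'_iff)
next
  show "{l. bifurcation_point \<sigma> (cubic a) l} = {\<mu>, 0}" by (rule bifurcation_points)
  show "discontinuous_at (\<lambda>l. band (\<alpha> l) (\<beta> l)) \<mu>" by (rule discontinuous)
  show "local_transcritical \<sigma> (cubic a) 0 (\<lambda>_. 0)" by (rule transcritical)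
qed

end

lemma (in cubic_pair) saddle_node_below:
  assumes "0 \<in> neg.persistent" "0 \<notin> persistent"
  shows "\<exists>\<mu><0. transcritical_saddle_node_diagram \<sigma> (cubic a) \<alpha> \<beta> \<mu>"
proof -
  obtain \<mu> where mu: "\<mu> < 0" "\<And>l. l \<in> neg.persistent \<longleftrightarrow> \<mu> \<le> l" using neg.threshold[OF assms(1)] by blast
  interpret transcritical_pair \<sigma> a \<alpha> \<beta> a' \<alpha>' \<beta>' \<mu>
    by unfold_locales (use mu assms(2) in auto)
  show ?thesis using mu(1) diagram by blast
qed

lemma (in cubic_pair) neg_orbit_integral: "neg.orbit_integral \<omega> t = - orbit_integral \<omega> t"
proof -
  have "((\<lambda>t. - orbit_integral \<omega> t) has_real_derivative a' (\<sigma> t \<omega>)) (at t)" for t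
    using DERIV_minus[OF orbit_integral_deriv[of \<omega> t]] by (simp add: a'_eq)
  from neg.orbit_integral_eq[OF this] show ?thesis by simp
qed

text \<open>The two kinds of exponential dichotomy for \<open>a\<close> correspond to each other under \<open>a \<mapsto> -a\<close> and reversal of the
  time of integration, and the second kind is persistence at \<open>0\<close>.\<close>

lemma (in cubic_pair) dichotomy_iff:
  "exponential_dichotomy \<sigma> a \<longleftrightarrow> 0 \<in> persistent \<or> 0 \<in> neg.persistent"
proof -
  have shift: "orbit_integral (\<sigma> t \<omega>) (- t) = - orbit_integral \<omega> t" for \<omega> t using orbit_integral_cocycle[of t \<omega> "- t"] by simp
  have ED: "exponential_dichotomy \<sigma> a \<longleftrightarrow> (\<exists>k\<ge>1. \<exists>\<delta>>0.
        (\<forall>\<omega>. \<forall>t\<ge>0. exp (orbit_integral \<omega> t) \<le> k * exp (- \<delta> * t)) \<or> (\<forall>\<omega>. \<forall>t\<le>0. exp (orbit_integral \<omega> t) \<le> k * exp (\<delta> * t)))"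
    by (simp add: exponential_dichotomy_def orbit_integral_def)
  have log: "x \<le> ln k + y" if "1 \<le> k" "exp x \<le> k * exp y" for x y k :: real
  proof -
    have "exp x \<le> exp (ln k + y)" using that by (simp add: exp_add)
    then show ?thesis by simp
  qed
  show ?thesis
  proof
    assume "exponential_dichotomy \<sigma> a"
    then obtain k \<delta> where k: "1 \<le> k" "0 < \<delta>" and
      "(\<forall>\<omega>. \<forall>t\<ge>0. exp (orbit_integral \<omega> t) \<le> k * exp (- \<delta> * t)) \<or> (\<forall>\<omega>. \<forall>t\<le>0. exp (orbit_integral \<omega> t) \<le> k * exp (\<delta> * t))"
      unfolding ED by blast
    then consider (1) "\<And>\<omega> t. 0 \<le> t \<Longrightarrow> exp (orbit_integral \<omega> t) \<le> k * exp (- \<delta> * t)" | (2) "\<And>\<omega> t. t \<le> 0 \<Longrightarrow> exp (orbit_integral \<omega> t) \<le> k * exp (\<delta> * t)" by blast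
    then show "0 \<in> persistent \<or> 0 \<in> neg.persistent"
    proof cases
      case 1
      have "neg.orbit_integral \<omega> t \<le> ln k + \<delta> * t" if "t \<le> 0" for \<omega> t
        using log[OF k(1) 1[of "- t" "\<sigma> t \<omega>"]] that by (simp add: neg_orbit_integral shift)
      then show ?thesis using neg.growth_persistent_0[OF k(2)] by blast
    next
      case 2
      have "orbit_integral \<omega> t \<le> ln k + \<delta> * t" if "t \<le> 0" for \<omega> t using log[OF k(1) 2[OF that, of \<omega>]] .
      then show ?thesis using growth_persistent_0[OF k(2)] by blast
    qed
  next
    have exp: "exp x \<le> exp (1 / d) * exp y" if "x \<le> 1 / d + y" for x d y :: real
      using that by (simp flip: exp_add)
    assume "0 \<in> persistent \<or> 0 \<in> neg.persistent"
    then show "exponential_dichotomy \<sigma> a"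
    proof
      assume "0 \<in> persistent"
      then obtain d where d: "0 < d" "\<And>\<omega> t. t \<le> 0 \<Longrightarrow> orbit_integral \<omega> t \<le> 1 / d + d * t" using persistent_0_growth by blast
      show ?thesis unfolding ED
        by (rule exI[of _ "exp (1 / d)"], rule conjI, use d(1) in simp, rule exI[of _ d]) (use d exp in blast)
    next
      assume "0 \<in> neg.persistent"
      then obtain d where d: "0 < d" "\<And>\<omega> t. t \<le> 0 \<Longrightarrow> neg.orbit_integral \<omega> t \<le> 1 / d + d * t" using neg.persistent_0_growth by blast
      have "orbit_integral \<omega> t \<le> 1 / d + - d * t" if "0 \<le> t" for \<omega> t
        using d(2)[of "- t" "\<sigma> t \<omega>"] that by (simp add: neg_orbit_integral shift)
      then show ?thesis unfolding ED
        by (intro exI[of _ "exp (1 / d)"] conjI exI[of _ d] disjI1 allI impI exp) (use d(1) in auto)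
    qed
  qed
qed

text \<open>Persistence at \<open>0\<close> makes the averages of the coefficient positive.\<close>

lemma (in cubic_pair) not_both_persistent: "\<not> (0 \<in> persistent \<and> 0 \<in> neg.persistent)"
proof
  assume *: "0 \<in> persistent \<and> 0 \<in> neg.persistent"
  obtain d where d: "0 < d" "\<And>\<omega> t. t \<le> 0 \<Longrightarrow> orbit_integral \<omega> t \<le> 1 / d + d * t" using persistent_0_growth * by blast
  obtain e where e: "0 < e" "\<And>\<omega> t. t \<le> 0 \<Longrightarrow> neg.orbit_integral \<omega> t \<le> 1 / e + e * t" using neg.persistent_0_growth * by blast
  obtain \<omega> :: 'w where True by blast
  define t where "t = - (1 / d + 1 / e + 1) / (d + e)"
  have pos: "0 < 1 / d + 1 / e + 1" using d(1) e(1) by (simp add: add_pos_pos)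
  have t: "t \<le> 0" "(d + e) * t = - (1 / d + 1 / e + 1)"
    using pos d(1) e(1) by (auto simp: t_def divide_nonpos_pos)
  have "0 \<le> 1 / d + 1 / e + (d + e) * t"
    using d(2)[OF t(1), of \<omega>] e(2)[OF t(1), of \<omega>] by (simp add: neg_orbit_integral algebra_simps)
  then show False using t(2) by simp
qed

theorem corollary6p7:
  fixes \<sigma> :: "real \<Rightarrow> 'w::metric_space \<Rightarrow> 'w"
    and a\<^sub>2 :: "'w \<Rightarrow> real"
    and \<xi>m \<xi>p :: real
    and \<alpha> \<beta> :: "real \<Rightarrow> 'w \<Rightarrow> real"
  assumes compact: "compact (UNIV :: 'w set)"
    and flow: "continuous_flow \<sigma>"
    and minimal: "minimal_flow \<sigma>"
    and cont: "continuous_on UNIV a\<^sub>2"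
    and le: "\<xi>m \<le> \<xi>p"
    and spectrum: "sacker_sell_spectrum \<sigma> a\<^sub>2 = {- \<xi>p..- \<xi>m}"
    and attractor: "\<And>l. is_global_attractor \<sigma> (cubic a\<^sub>2 l) (band (\<alpha> l) (\<beta> l))"
  shows "(0 \<in> {\<xi>m..\<xi>p} \<longrightarrow> global_pitchfork_diagram \<sigma> (cubic a\<^sub>2) \<alpha> \<beta>) \<and>
    (0 \<notin> {\<xi>m..\<xi>p} \<longrightarrow>
      (\<exists>\<mu><0.
        transcritical_saddle_node_diagram \<sigma> (cubic a\<^sub>2) \<alpha> \<beta> \<mu> \<or>
        transcritical_saddle_node_diagram \<sigma> (\<lambda>l. reflect (cubic a\<^sub>2 l))
          (\<lambda>l \<omega>. - \<beta> l \<omega>) (\<lambda>l \<omega>. - \<alpha> l \<omega>) \<mu>))"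
proof -
  let ?a' = "\<lambda>\<omega>. - a\<^sub>2 \<omega>" and ?\<alpha>' = "\<lambda>l \<omega>. - \<beta> l \<omega>" and ?\<beta>' = "\<lambda>l \<omega>. - \<alpha> l \<omega>"
  interpret m: mirror \<sigma> a\<^sub>2 ?a' by unfold_locales (use compact flow minimal cont in auto)
  interpret r: mirror \<sigma> ?a' a\<^sub>2 by (rule m.mirror_sym)
  have att': "is_global_attractor \<sigma> (cubic ?a' l) (band (?\<alpha>' l) (?\<beta>' l))" for l
    using m.attractor_neg[OF attractor[of l]] by (simp add: flip_band)
  interpret P: cubic_pair \<sigma> a\<^sub>2 \<alpha> \<beta> ?a' ?\<alpha>' ?\<beta>'
    by unfold_locales (use attractor att' in auto)
  interpret N: cubic_pair \<sigma> ?a' ?\<alpha>' ?\<beta>' a\<^sub>2 \<alpha> \<beta>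
    by unfold_locales auto
  have "0 \<in> {\<xi>m..\<xi>p} \<longleftrightarrow> 0 \<in> {- \<xi>p..- \<xi>m}" by auto
  also have "\<dots> \<longleftrightarrow> \<not> exponential_dichotomy \<sigma> a\<^sub>2"
    unfolding spectrum[symmetric] by (simp add: sacker_sell_spectrum_def)
  finally have zero: "0 \<in> {\<xi>m..\<xi>p} \<longleftrightarrow> 0 \<notin> P.persistent \<and> 0 \<notin> P.neg.persistent"
    by (simp add: P.dichotomy_iff)
  show ?thesis
  proof (intro conjI impI)
    assume "0 \<in> {\<xi>m..\<xi>p}"
    then show "global_pitchfork_diagram \<sigma> (cubic a\<^sub>2) \<alpha> \<beta>" using P.pitchfork zero by blast
  next
    assume "0 \<notin> {\<xi>m..\<xi>p}"
    then consider "0 \<in> P.neg.persistent" "0 \<notin> P.persistent" | "0 \<in> P.persistent" "0 \<notin> P.neg.persistent"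
      using zero P.not_both_persistent by blast
    then show "\<exists>\<mu><0. transcritical_saddle_node_diagram \<sigma> (cubic a\<^sub>2) \<alpha> \<beta> \<mu> \<or>
        transcritical_saddle_node_diagram \<sigma> (\<lambda>l. reflect (cubic a\<^sub>2 l)) (\<lambda>l \<omega>. - \<beta> l \<omega>) (\<lambda>l \<omega>. - \<alpha> l \<omega>) \<mu>"
    proof cases
      case 1
      then show ?thesis using P.saddle_node_below by blast
    next
      case 2
      have "(\<lambda>l. reflect (cubic a\<^sub>2 l)) = cubic ?a'" by (simp add: reflect_cubic fun_eq_iff)
      then show ?thesis using N.saddle_node_below 2 by auto
    qed
  qed
qed

end
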